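(* Let $(q_n)_n$ be a sequence of integers such that $\frac{\rho(q_n)}{\log\mathrm{rad}(q_n)}\to\infty$. Assume $\mathrm{GRH}$ and $\mathrm{ELI}_A(\mathcal{X}_{q_n})$ for some $A>1$, where $\mathcal{X}_{q_n}$ is the set of non-trivial quadratic Dirichlet characters modulo $q_n$. Then $$\log\log\log x_{q_n;R,NR}\ll_A\frac{\rho(q_n)}{\log\mathrm{rad}(q_n)}+\log\rho(q_n).$$
   Context: For an integer $q\ge3$: $\rho(q)$ is the number of $x\in(\mathbf{Z}/q\mathbf{Z})^\times$ with $x^2=1$; $\mathrm{rad}(q)$ is the product of the primes dividing $q$; $R_q=\{a^2:a\in(\mathbf{Z}/q\mathbf{Z})^\times\}$, $NR_q=(\mathbf{Z}/q\mathbf{Z})^\times\setminus R_q$; $\pi(x;q,a)$ is the number of primes $p\le x$ with $p\equiv a\pmod q$; and $$x_{q;R,NR}=\inf\Bigl\{x\ge2:\frac1{|R_q|}\sum_{a\in R_q}\pi(x;q,a)>\frac1{|NR_q|}\sum_{b\in NR_q}\pi(x;q,b)\Bigr\}.$$ Non-trivial quadratic characters are the $\chi\ne\chi_0$ with $\chi^2=\chi_0$, $\chi_0$ being the principal character. The conclusion is an asymptotic upper bound as $n\to\infty$: there is $K_A>0$ depending only on $A$ such that, for all sufficiently large $n$, $x_{q_n;R,NR}\le\exp\exp\exp(K_A(\rho(q_n)/\log\mathrm{rad}(q_n)+\log\rho(q_n)))$. GRH is the Generalized Riemann Hypothesis for Dirichlet $L$-functions modulo the $q_n$; the hypotheses are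 assumed for every $q_n$ with the same $A$. $\mathrm{ELI}_A(\mathcal{X}_q)$, for a set $\mathcal{X}_q$ of Dirichlet characters modulo $q$: let $(\gamma_j)_{j\ge1}$ be an enumeration in non-decreasing order of the positive imaginary parts of the non-trivial zeros ($0<\mathrm{Re}<1$), counted with multiplicities, of the $L(s,\chi)$ with $\chi\in\mathcal{X}_q$, and $N(T)=\#\{j:\gamma_j\le T\}$. Then for all $T$ sufficiently large, $$\Bigl|\sum_{j=1}^{N(T)}m_j\gamma_j\Bigr|\gg_A N(T)^{-N(T)^A}$$ for any integers $m_1,\dots,m_{N(T)}$, not all zero, with $|m_j|\le N(T)$. The implied constant here depends only on $A$, and "sufficiently large" means larger than an absolute constant. *)

theory Defs
  imports
    "HOL-Complex_Analysis.Complex_Analysis"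
    "HOL-Number_Theory.Number_Theory"
    "HOL-Library.Extended_Real"
begin

section \<open>The unit group modulo q, quadratic residues and prime counting\<close>

text \<open>
  The group $(\mathbf{Z}/q\mathbf{Z})^\times$ is represented by its set of representatives
  \<open>totatives q\<close> in $\{1,\dots,q\}$.
\<close>

definition rho :: "nat \<Rightarrow> nat" where
  "rho q = card {x \<in> totatives q. [x ^ 2 = 1] (mod q)}"

definition rad :: "nat \<Rightarrow> nat" where
  "rad q = \<Prod>(prime_factors q)"

definition quad_res :: "nat \<Rightarrow> nat set" where
  "quad_res q = {a \<in> totatives q. \<exists>x \<in> totatives q. [x ^ 2 = a] (mod q)}"

definition quad_nonres :: "nat \<Rightarrow> nat set" where
  "quad_nonres q = totatives q - quad_res q"

definition primes_count :: "real \<Rightarrow> nat \<Rightarrow> nat \<Rightarrow> nat" where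
  "primes_count x q a = card {p. prime p \<and> real p \<le> x \<and> [p = a] (mod q)}"

text \<open>
  The infimum is taken in the extended reals, so that it is \<open>\<infinity>\<close> if there is no such \<open>x\<close>
  (an infimum of the empty set in the type of reals would be an unspecified real number).
\<close>

definition x_first :: "nat \<Rightarrow> ereal" where
  "x_first q = Inf (ereal ` {x. x \<ge> 2 \<and>
     (1 / real (card (quad_res q))) * (\<Sum>a\<in>quad_res q. real (primes_count x q a))
     > (1 / real (card (quad_nonres q))) * (\<Sum>b\<in>quad_nonres q. real (primes_count x q b))})"

section \<open>Dirichlet characters and their L-functions\<close>

text \<open>
  A Dirichlet character modulo \<open>q\<close> is regarded as a \<open>q\<close>-periodic function on the naturals that
  vanishes off the units; \<open>\<psi> 1 = 1\<close> follows from \<open>\<psi> 1 \<noteq> 0\<close> and multiplicativity.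
\<close>

definition dirichlet_character :: "nat \<Rightarrow> (nat \<Rightarrow> complex) \<Rightarrow> bool" where
  "dirichlet_character q \<psi> \<longleftrightarrow>
     (\<forall>n. \<psi> (n + q) = \<psi> n) \<and>
     (\<forall>m n. \<psi> (m * n) = \<psi> m * \<psi> n) \<and>
     (\<forall>n. \<psi> n \<noteq> 0 \<longleftrightarrow> coprime n q)"

definition principal_character :: "nat \<Rightarrow> nat \<Rightarrow> complex" where
  "principal_character q n = (if coprime n q then 1 else 0)"

definition quadratic_characters :: "nat \<Rightarrow> (nat \<Rightarrow> complex) set" where
  "quadratic_characters q = {\<psi>. dirichlet_character q \<psi> \<and> \<psi> \<noteq> principal_character q \<and>
     (\<lambda>n. \<psi> n ^ 2) = principal_character q}"

text \<open>
  \<open>L(s,\<psi>)\<close> is the analytic continuation to $\mathbf{C}\setminus\{1\}$ of the Dirichlet series,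
  which converges for \<open>Re s > 1\<close>. By the identity theorem the continuation is unique off
  the point \<open>1\<close>, and its value at \<open>1\<close> plays no role for zeros with \<open>0 < Re s < 1\<close>.
\<close>

definition L_function :: "(nat \<Rightarrow> complex) \<Rightarrow> complex \<Rightarrow> complex" where
  "L_function \<psi> = (SOME f. f holomorphic_on (- {1}) \<and>
     (\<forall>s. Re s > 1 \<longrightarrow> (\<lambda>n. \<psi> (Suc n) / of_nat (Suc n) powr s) sums f s))"

definition nontrivial_zeros :: "(nat \<Rightarrow> complex) \<Rightarrow> complex set" where
  "nontrivial_zeros \<psi> = {s. 0 < Re s \<and> Re s < 1 \<and> L_function \<psi> s = 0}"

definition GRH_mod :: "nat \<Rightarrow> bool" where
  "GRH_mod q \<longleftrightarrow>
     (\<forall>\<psi>. dirichlet_character q \<psi> \<longrightarrow> (\<forall>s \<in> nontrivial_zeros \<psi>. Re s = 1 / 2))"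

section \<open>The effective linear independence hypothesis\<close>

text \<open>The number of times \<open>t\<close> occurs as the imaginary part of a non-trivial zero, with
  multiplicities, over all characters in \<open>X\<close>.\<close>

definition ordinate_mult :: "(nat \<Rightarrow> complex) set \<Rightarrow> real \<Rightarrow> nat" where
  "ordinate_mult X t =
     (\<Sum>\<psi>\<in>X. \<Sum>s\<in>{s \<in> nontrivial_zeros \<psi>. Im s = t}. nat (zorder (L_function \<psi>) s))"

text \<open>\<open>\<gamma> 1 \<le> \<gamma> 2 \<le> \<dots>\<close> lists the positive ordinates with multiplicities; the value \<open>\<gamma> 0\<close>
  is ignored. Finiteness of the fibres is required explicitly because \<open>card\<close> of an infinite
  set is \<open>0\<close>.\<close>

definition enumerates_ordinates :: "(nat \<Rightarrow> complex) set \<Rightarrow> (nat \<Rightarrow> real) \<Rightarrow> bool" where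
  "enumerates_ordinates X \<gamma> \<longleftrightarrow>
     mono_on {1..} \<gamma> \<and> (\<forall>j\<ge>1. \<gamma> j > 0) \<and>
     (\<forall>t>0. finite {j. j \<ge> 1 \<and> \<gamma> j = t} \<and> card {j. j \<ge> 1 \<and> \<gamma> j = t} = ordinate_mult X t)"

definition ordinate_count :: "(nat \<Rightarrow> real) \<Rightarrow> real \<Rightarrow> nat" where
  "ordinate_count \<gamma> T = card {j. j \<ge> 1 \<and> \<gamma> j \<le> T}"

text \<open>The constants are explicit: \<open>c\<close> is the implied constant of $\gg_A$ and \<open>T0\<close> is the bound
  beyond which \<open>T\<close> is sufficiently large.\<close>

definition ELI :: "real \<Rightarrow> real \<Rightarrow> real \<Rightarrow> (nat \<Rightarrow> complex) set \<Rightarrow> bool" where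
  "ELI A c T0 X \<longleftrightarrow>
     (\<forall>\<gamma>. enumerates_ordinates X \<gamma> \<longrightarrow>
       (\<forall>T>T0. \<forall>m :: nat \<Rightarrow> int.
         (\<exists>j\<in>{1..ordinate_count \<gamma> T}. m j \<noteq> 0) \<longrightarrow>
         (\<forall>j\<in>{1..ordinate_count \<gamma> T}. \<bar>m j\<bar> \<le> int (ordinate_count \<gamma> T)) \<longrightarrow>
         \<bar>\<Sum>j=1..ordinate_count \<gamma> T. real_of_int (m j) * \<gamma> j\<bar>
           \<ge> c * real (ordinate_count \<gamma> T) powr (- (real (ordinate_count \<gamma> T) powr A))))"

end

theory Submission
 imports Defs "HOL-Probability.Probability" "HOL-Real_Asymp.Real_Asymp"
begin

text \<open>
Write \<open>r = rho q\<close>. For the primitive character \<open>psi\<close> inducing a quadratic character modulo \<open>q\<close>, the sum of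
\<open>Re (1 / (s - z))\<close> over the zeros \<open>z = 1/2 + ig\<close> of its L-function is known for real \<open>s > 1\<close>. Uniqueness of Laplace
transforms turns this into an explicit formula for the sums of
\<open>mangoldt n * psi n * n powr (-alpha) * (1 - exp (-l * (y - ln n)))\<close> over \<open>ln n \<le> y\<close>, where \<open>alpha\<close> is about
\<open>1 / ln (rad q)\<close> and \<open>l = r ^ 40\<close>. Dirichlet's theorem on simultaneous approximation yields \<open>y \<le> exp (r ^ 92)\<close> such that
\<open>cis (g * y)\<close> is close to \<open>1\<close> for all zeros with \<open>\<bar>g\<bar> \<le> r ^ 44\<close>. At this \<open>y\<close> each of the \<open>r - 1\<close> sums exceeds about
\<open>20 * ln r * exp ((1/2 - alpha) * y)\<close>, while the prime squares, which carry the bias towards nonresidues, contribute only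
\<open>O(exp ((1/2 - alpha) * y))\<close> to each. Added over the characters, the prime parts are a weighted integral of the race, so
by partial summation the race cannot stay nonpositive up to \<open>exp y\<close>.
\<close>

section \<open>Dirichlet series\<close>

text \<open>The weight \<open>1 - exp (...)\<close> is chosen for its effect on a zero
  \<open>z\<close>: it produces \<open>l / (z * (z + l))\<close>, which is absolutely summable and
  has real part \<open>pker\<close> at \<open>beta\<close> minus \<open>pker\<close> at
  \<open>beta + l\<close>. With all phases near 1 the zeros contribute
  \<open>p (beta + l) - p beta\<close>; the conductor cancels in this difference, and the digamma
  term leaves \<open>ln l / 2 = 20 * ln r\<close>. The closed form of \<open>p\<close> belongs to
  abscissas beyond 1. Hence the damping by \<open>alpha\<close>: it brings in
  \<open>V (1 + alpha)\<close> in place of a value at 1, and \<open>alpha * ln m \<le> 1\<close>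
  keeps the passage from \<open>1/2 - alpha\<close> to \<open>1/2 + alpha\<close> cheap. The
  obstacle is \<open>V (1 + alpha)\<close>, bounded below for a single character only by about
  \<open>- 1 / alpha\<close>. Its sum over all characters behaves better: by orthogonality the units
  lose \<open>1 / alpha\<close> once, and the primes dividing \<open>q\<close>, where primitive
  characters need not vanish, lose about \<open>6 * ln r\<close> per character. So the exponent 40
  of \<open>l\<close> has to give a coefficient above 6; the exponent 44 of \<open>T\<close> makes
  the zeros beyond \<open>T\<close> negligible, and \<open>r ^ 92\<close> bounds the logarithm of
  \<open>T\<close> raised to the number of zeros.\<close>

definition dirichlet_series :: "(nat \<Rightarrow> complex) \<Rightarrow> complex \<Rightarrow> complex" where
 "dirichlet_series f s = (\<Sum>n. f n * of_nat n powr (- s))"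

definition mangoldt_series :: "(nat \<Rightarrow> complex) \<Rightarrow> complex \<Rightarrow> complex" where
 "mangoldt_series f s = (\<Sum>n. mangoldt n * f n * of_nat n powr (- s))"

lemma norm_nat_powr: "norm (of_nat n powr s :: complex) = real n powr Re s"
 by (cases "n = 0") (simp_all add: norm_powr_real_powr)

text \<open>The index 0 is harmless here and in all later series: \<open>0 powr z = 0\<close>, so
  its term vanishes whatever \<open>f 0\<close> is.\<close>

lemma dirichlet_term_bound:
 assumes "norm (f n) \<le> 1" "Re s \<ge> sig"
 shows "norm (f n * of_nat n powr (- s)) \<le> real n powr (- sig)"
proof (cases "n = 0")
 case False
 have "norm (f n * of_nat n powr (- s)) \<le> 1 * real n powr (- Re s)"
  unfolding norm_mult norm_nat_powr using assms by (intro mult_mono) auto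
 also have "... \<le> real n powr (- sig)" using assms False by (simp add: powr_mono)
 finally show ?thesis .
qed simp

text \<open>Half of the excess \<open>sig - 1\<close> of the exponent absorbs the logarithm, and the
  exponent that remains is still below -1.\<close>

lemma ln_powr_le: "ln (real n) * real n powr (- sig) \<le> 2 / (sig - 1) * real n powr (- (sig + 1) / 2)" if "sig > 1"
proof (cases "n = 0")
 case False
 have "ln (real n) \<le> real n powr ((sig - 1) / 2) / ((sig - 1) / 2)" by (rule ln_powr_bound) (use False that in auto)
 hence "ln (real n) * real n powr (- sig) \<le> real n powr ((sig - 1) / 2) / ((sig - 1) / 2) * real n powr (- sig)"
  by (rule mult_right_mono) simp
 also have "... = 2 / (sig - 1) * (real n powr ((sig - 1) / 2) * real n powr (- sig))" by simp
 also have "real n powr ((sig - 1) / 2) * real n powr (- sig) = real n powr (- (sig + 1) / 2)"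
  by (simp add: powr_add[symmetric] field_simps)
 finally show ?thesis .
qed simp

lemma summable_ln_powr: "summable (\<lambda>n. ln (real n) * real n powr (- sig))" if "sig > 1"
proof (rule summable_comparison_test')
 show "summable (\<lambda>n. 2 / (sig - 1) * real n powr (- (sig + 1) / 2))"
  using that by (intro summable_mult) (simp add: summable_real_powr_iff)
 show "norm (ln (real n) * real n powr (- sig)) \<le> 2 / (sig - 1) * real n powr (- (sig + 1) / 2)" if "n \<ge> 1" for n
  using ln_powr_le[OF \<open>sig > 1\<close>, of n] that by simp
qed

lemma mangoldt_le_ln: "(mangoldt n :: real) \<le> ln (real n)" if "n > 0"
 using mangoldt_le[of n] that by simp

lemma mangoldt_term_bound:
 assumes "norm (f n) \<le> 1" "Re s \<ge> sig"
 shows "norm (mangoldt n * f n * of_nat n powr (- s)) \<le> ln (real n) * real n powr (- sig)"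
proof (cases "n = 0")
 case False
 have "norm (mangoldt n * f n * of_nat n powr (- s)) = mangoldt n * norm (f n * of_nat n powr (- s))"
  by (simp add: norm_mult)
 also have "... \<le> ln (real n) * real n powr (- sig)"
  using assms False by (intro mult_mono mangoldt_le_ln dirichlet_term_bound) auto
 finally show ?thesis .
qed simp

lemma summable_dirichlet:
 assumes "\<And>n. norm (f n) \<le> 1" "Re s > 1"
 shows "summable (\<lambda>n. norm (f n * of_nat n powr (- s)))"
  "summable (\<lambda>n. norm (mangoldt n * f n * of_nat n powr (- s)))"
proof -
 show "summable (\<lambda>n. norm (f n * of_nat n powr (- s)))"
 proof (rule summable_comparison_test')
  show "summable (\<lambda>n. real n powr (- Re s))" using assms by (simp add: summable_real_powr_iff)
  show "norm (norm (f n * of_nat n powr (- s))) \<le> real n powr (- Re s)" for n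
   unfolding real_norm_def abs_norm_cancel by (rule dirichlet_term_bound) (use assms in auto)
 qed
 show "summable (\<lambda>n. norm (mangoldt n * f n * of_nat n powr (- s)))"
 proof (rule summable_comparison_test'[OF summable_ln_powr[OF assms(2)]])
  show "norm (norm (mangoldt n * f n * of_nat n powr (- s))) \<le> ln (real n) * real n powr (- Re s)" for n
   unfolding real_norm_def abs_norm_cancel by (rule mangoldt_term_bound) (use assms in auto)
 qed
qed

lemma has_field_derivative_nat_powr:
 fixes f :: complex
 shows "((\<lambda>s. f * of_nat n powr (- s)) has_field_derivative - (of_real (ln (real n)) * f * of_nat n powr (- s))) (at s)"
proof (cases "n = 0")
 case False
 have "((\<lambda>s. of_nat n powr (- s)) has_field_derivative Ln (of_nat n) * of_nat n powr (- s) * - 1) (at s)"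
  by (rule DERIV_chain2[OF has_field_derivative_powr_right DERIV_minus[OF DERIV_ident]]) (use False in simp)
 from DERIV_cmult[OF this, of f]
 have "((\<lambda>s. f * of_nat n powr (- s)) has_field_derivative f * (Ln (of_nat n) * of_nat n powr (- s) * - 1)) (at s)" .
 thus ?thesis using False Ln_of_nat[of n] by (simp add: mult_ac)
qed simp

lemma dirichlet_series_derivative:
 assumes "\<And>n. norm (f n) \<le> 1" "Re s > 1"
 shows "(\<lambda>n. - (of_real (ln (real n)) * f n * of_nat n powr (- s))) sums deriv (dirichlet_series f) s"
  "(dirichlet_series f has_field_derivative deriv (dirichlet_series f) s) (at s)"
proof -
 \<comment> \<open>Half way between 1 and \<open>Re s\<close>: the terms are dominated uniformly on
   an open half plane that still contains \<open>s\<close>.\<close>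
 define sig where "sig = (Re s + 1) / 2"
 have sig: "1 < sig" "sig < Re s" using assms by (auto simp: sig_def)
 define S where "S = {s. Re s > sig}"
 have S: "open S" "s \<in> S" using sig by (auto simp: S_def open_halfspace_Re_gt)
 obtain g g' where g: "\<forall>x\<in>S. ((\<lambda>n. f n * of_nat n powr (- x)) sums g x) \<and>
   ((\<lambda>n. - (of_real (ln (real n)) * f n * of_nat n powr (- x))) sums g' x) \<and> (g has_field_derivative g' x) (at x)"
 proof (rule series_and_derivative_comparison[OF S(1)])
  show "summable (\<lambda>n. real n powr (- sig))" using sig by (simp add: summable_real_powr_iff)
  show "\<forall>\<^sub>F n in sequentially. \<forall>x\<in>S. norm (f n * of_nat n powr (- x)) \<le> real n powr (- sig)"
   using assms(1) by (intro always_eventually allI ballI dirichlet_term_bound) (auto simp: S_def)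
  show "((\<lambda>s. f n * of_nat n powr (- s)) has_field_derivative - (of_real (ln (real n)) * f n * of_nat n powr (- x))) (at x)"
   if "x \<in> S" for n x by (rule has_field_derivative_nat_powr)
 qed (rule that)
 have eq: "g x = dirichlet_series f x" if "x \<in> S" for x using g that by (simp add: dirichlet_series_def sums_iff)
 have "(g has_field_derivative g' s) (at s)" using g S(2) by blast
 hence d: "(dirichlet_series f has_field_derivative g' s) (at s)"
  by (rule has_field_derivative_transform_within_open[OF _ S eq])
 thus "(dirichlet_series f has_field_derivative deriv (dirichlet_series f) s) (at s)" by (simp add: DERIV_imp_deriv)
 show "(\<lambda>n. - (of_real (ln (real n)) * f n * of_nat n powr (- s))) sums deriv (dirichlet_series f) s"
  using g S d by (simp add: DERIV_imp_deriv)
qed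

lemma dirichlet_series_holomorphic:
 assumes "\<And>n. norm (f n) \<le> 1"
 shows "dirichlet_series f holomorphic_on {s. Re s > 1}"
proof -
 have "\<exists>d. (dirichlet_series f has_field_derivative d) (at s)" if "Re s > 1" for s
  using dirichlet_series_derivative(2)[of f, OF assms that] by blast
 thus ?thesis using open_halfspace_Re_gt[of 1] by (auto simp: holomorphic_on_open)
qed

lemma has_sum_product_banach:
 fixes x :: "'a \<Rightarrow> 'c :: {real_normed_field, banach}" and y :: "'b \<Rightarrow> 'c"
 assumes "(x has_sum a) A" "(y has_sum b) B" "(\<lambda>i. norm (x i)) summable_on A" "(\<lambda>i. norm (y i)) summable_on B"
 shows "((\<lambda>(i, j). x i * y j) has_sum (a * b)) (A \<times> B)"
proof -
 define D where "D = (\<Sum>\<^sub>\<infinity>j\<in>B. norm (y j))"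
 have "(\<lambda>(i, j). norm (x i) * norm (y j)) summable_on A \<times> B"
 proof (rule summable_on_SigmaI)
  show "((\<lambda>j. case (i, j) of (i, j) \<Rightarrow> norm (x i) * norm (y j)) has_sum norm (x i) * D) B" for i
   unfolding D_def using assms(4) by (simp add: has_sum_cmult_right)
  show "(\<lambda>i. norm (x i) * D) summable_on A" by (intro summable_on_cmult_left assms)
 qed auto
 hence "(\<lambda>p. norm (case p of (i, j) \<Rightarrow> x i * y j)) summable_on A \<times> B"
  by (simp add: case_prod_unfold norm_mult)
 hence summ: "(\<lambda>(i, j). x i * y j) summable_on A \<times> B" by (rule abs_summable_summable)
 have "(\<Sum>\<^sub>\<infinity>(i,j)\<in>A \<times> B. x i * y j) = (\<Sum>\<^sub>\<infinity>i\<in>A. \<Sum>\<^sub>\<infinity>j\<in>B. x i * y j)"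
  using infsum_Sigma'_banach[of "\<lambda>i j. x i * y j" A "\<lambda>_. B"] summ by simp
 also have "... = a * b"
  using infsumI[OF assms(1)] infsumI[OF assms(2)] by (simp add: infsum_cmult_right' infsum_cmult_left')
 finally show ?thesis using summ by (simp add: has_sum_iff)
qed

text \<open>Pairs are sorted by their product, \<open>(i, j)\<close> becoming
  \<open>(i * j, i)\<close>; this is what turns a product of two Dirichlet series into one.\<close>

lemma has_sum_divisors:
 fixes F :: "nat \<Rightarrow> nat \<Rightarrow> 'c :: {real_normed_field, banach}"
 assumes "((\<lambda>(i, j). F i j) has_sum S) ({0<..} \<times> {0<..})"
 shows "((\<lambda>n. \<Sum>d | d dvd n. F d (n div d)) has_sum S) {0<..}"
proof -
 define P where "P = {0::nat<..}"
 define Q where "Q = Sigma P (\<lambda>n. {d. d dvd n})"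
 have "((\<lambda>(n, d). F d (n div d)) has_sum S) Q"
 proof (rule has_sum_reindex_bij_witness[where i = "\<lambda>(i, j). (i * j, i)" and j = "\<lambda>(n, d). (d, n div d)", THEN iffD2, OF _ _ _ _ _ refl])
  show "((\<lambda>(i, j). F i j) has_sum S) (P \<times> P)" using assms by (simp add: P_def)
 qed (auto simp: Q_def P_def dvd_pos_nat dvd_div_eq_0_iff intro!: Nat.gr0I)
 moreover have "((\<lambda>d. case (n, d) of (n, d) \<Rightarrow> F d (n div d)) has_sum (\<Sum>d | d dvd n. F d (n div d))) {d. d dvd n}"
  if "n \<in> P" for n
  using has_sum_finite[of "{d. d dvd n}" "\<lambda>d. F d (n div d)"] that by (simp add: P_def)
 ultimately show ?thesis unfolding Q_def P_def[symmetric] by (rule has_sum_SigmaD)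
qed

lemma dirichlet_convolution_sums:
 fixes A B :: "nat \<Rightarrow> complex"
 assumes A: "summable (\<lambda>n. norm (A n))" "A 0 = 0" and B: "summable (\<lambda>n. norm (B n))" "B 0 = 0"
 shows "(\<lambda>n. \<Sum>d | d dvd n. A d * B (n div d)) sums (suminf A * suminf B)"
proof -
 have hs: "(g has_sum suminf g) {0<..}" "(\<lambda>n. norm (g n)) summable_on {0<..}"
  if "summable (\<lambda>n. norm (g n))" "g 0 = 0" for g :: "nat \<Rightarrow> complex"
 proof -
  have "(g has_sum suminf g) UNIV"
   using norm_summable_imp_has_sum[OF that(1) summable_sums[OF summable_norm_cancel[OF that(1)]]] .
  thus "(g has_sum suminf g) {0<..}" by (rule has_sum_cong_neutral[THEN iffD2, rotated 3]) (use that(2) in auto)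
  show "(\<lambda>n. norm (g n)) summable_on {0<..}"
   by (rule summable_on_subset_banach[OF norm_summable_imp_summable_on]) (use that(1) in auto)
 qed
 have "((\<lambda>n. \<Sum>d | d dvd n. A d * B (n div d)) has_sum (suminf A * suminf B)) {0<..}"
  by (intro has_sum_divisors has_sum_product_banach hs A B)
 hence "((\<lambda>n. \<Sum>d | d dvd n. A d * B (n div d)) has_sum (suminf A * suminf B)) UNIV"
  by (rule has_sum_cong_neutral[THEN iffD2, rotated 3]) (use B in auto)
 thus ?thesis by (rule has_sum_imp_sums)
qed

lemma nat_powr_dvd: "d dvd n ==> of_nat d powr s * of_nat (n div d) powr s = (of_nat n powr s :: complex)"
 by (elim dvdE) (cases "d = 0"; simp add: powr_times_real)

text \<open>Complete multiplicativity carries \<open>f\<close> through the identity that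
  \<open>mangoldt\<close> summed over divisors is \<open>ln\<close>. The product form is deliberate:
  a quotient would presuppose that the series does not vanish, which is deduced from this
  equation.\<close>

lemma mangoldt_convolution:
 assumes f1: "\<And>n. norm (f n) \<le> 1" and mult: "\<And>m n. f (m * n) = f m * f n" and s: "Re s > 1"
 shows "deriv (dirichlet_series f) s = - mangoldt_series f s * dirichlet_series f s"
proof -
 define A where "A = (\<lambda>n. mangoldt n * f n * of_nat n powr (- s))"
 define B where "B = (\<lambda>n. f n * of_nat n powr (- s))"
 have "(\<lambda>n. \<Sum>d | d dvd n. A d * B (n div d)) sums (mangoldt_series f s * dirichlet_series f s)"
  unfolding mangoldt_series_def dirichlet_series_def A_def[symmetric] B_def[symmetric]
  by (rule dirichlet_convolution_sums) (use summable_dirichlet[of f, OF f1 s] in \<open>auto simp: A_def B_def\<close>)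
 moreover have "(\<Sum>d | d dvd n. A d * B (n div d)) = of_real (ln (real n)) * f n * of_nat n powr (- s)" for n
 proof (cases "n = 0")
  case False
  have "A d * B (n div d) = mangoldt d * (f n * of_nat n powr (- s))" if d: "d dvd n" for d
   using nat_powr_dvd[OF d, of "- s"] mult[of d "n div d"] d by (simp add: A_def B_def mult_ac)
  hence "(\<Sum>d | d dvd n. A d * B (n div d)) = (\<Sum>d | d dvd n. mangoldt d) * (f n * of_nat n powr (- s))"
   by (simp add: sum_distrib_right)
  thus ?thesis using False by (simp add: mangoldt_sum mult_ac)
 qed simp
 ultimately have "(\<lambda>n. of_real (ln (real n)) * f n * of_nat n powr (- s)) sums (mangoldt_series f s * dirichlet_series f s)"
  by (simp only:)
 from sums_unique2[OF sums_minus[OF this] dirichlet_series_derivative(1)[of f, OF f1 s]] show ?thesis by simp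
qed

text \<open>A point where the first term visibly dominates: the tail at 4 is compared with one
  eighth of the telescoping series of \<open>1 / ((n + 1) * (n + 2))\<close>.\<close>

lemma dirichlet_series_near_one:
 assumes f1: "\<And>n. norm (f n) \<le> 1" and one: "f 1 = 1"
 shows "dirichlet_series f 4 \<noteq> 0"
proof
 assume 0: "dirichlet_series f 4 = 0"
 have s: "summable (\<lambda>n. norm (f n * of_nat n powr (- 4)))" by (rule summable_dirichlet(1)[OF f1]) simp
 have split: "dirichlet_series f 4 = (\<Sum>n. f (n + 2) * of_nat (n + 2) powr (- 4)) + 1"
  unfolding dirichlet_series_def
  using suminf_split_initial_segment[OF summable_norm_cancel[OF s], of 2] one by (simp add: numeral_2_eq_2)
 have "norm (\<Sum>n. f (n + 2) * of_nat (n + 2) powr (- 4)) \<le> (\<Sum>n. 1 / 2 ^ 3 * (1 / real ((n + 1) * (n + 2))))"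
 proof (rule norm_suminf_le)
  show "norm (f (n + 2) * of_nat (n + 2) powr (- 4)) \<le> 1 / 2 ^ 3 * (1 / real ((n + 1) * (n + 2)))" for n
  proof -
   have "norm (f (n + 2) * of_nat (n + 2) powr (- 4)) \<le> real (n + 2) powr (- 4)"
    by (rule dirichlet_term_bound[OF f1]) simp
   also have "... = 1 / real (n + 2) ^ 4" by (simp add: powr_minus_divide)
   also have "... \<le> 1 / (2 ^ 3 * real ((n + 1) * (n + 2)))"
   proof (rule divide_left_mono)
    have "real ((n + 1) * (n + 2)) * 2 ^ 2 \<le> real (n + 2) ^ 2 * real (n + 2) ^ 2"
     by (intro mult_mono power_mono) (auto simp: power2_eq_square algebra_simps)
    moreover have "2 ^ 3 * real ((n + 1) * (n + 2)) \<le> real (n + 2) ^ 4"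
     by (simp add: power4_eq_xxxx algebra_simps)
    ultimately show "2 ^ 3 * real ((n + 1) * (n + 2)) \<le> real (n + 2) ^ 4" by simp
    show "0 < real (n + 2) ^ 4 * (2 ^ 3 * real ((n + 1) * (n + 2)))"
    proof -
     have "0 < (n + 1) * (n + 2)" by simp
     hence "0 < real ((n + 1) * (n + 2))" by (simp only: of_nat_0_less_iff)
     thus ?thesis by (intro mult_pos_pos zero_less_power) auto
    qed
   qed auto
   finally show ?thesis by simp
  qed
  have "summable (\<lambda>n. 1 / real ((n + 1) * (n + 2)))"
  proof (rule summable_comparison_test')
   show "summable (\<lambda>n. inverse (real (Suc n) ^ 2))"
    using inverse_power_summable[of 2, where ?'a = real] by (subst summable_Suc_iff) simp
   show "norm (1 / real ((n + 1) * (n + 2))) \<le> inverse (real (Suc n) ^ 2)" for n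
   proof -
    have "(Suc n)^2 \<le> (n + 1) * (n + 2)" by (simp add: power2_eq_square)
    hence "real (Suc n) ^ 2 \<le> real ((n + 1) * (n + 2))" by (metis of_nat_le_iff of_nat_power)
    hence "1 / real ((n + 1) * (n + 2)) \<le> 1 / real (Suc n) ^ 2" by (intro frac_le) auto
    thus ?thesis by (simp add: inverse_eq_divide)
   qed
  qed
  thus "summable (\<lambda>n. 1 / 2 ^ 3 * (1 / real ((n + 1) * (n + 2))))" by (rule summable_mult)
 qed
 also have "... = 1 / 2 ^ 3 * 1"
 proof -
  have "(\<lambda>n. 1 / real (n + 1) - 1 / real (Suc n + 1)) sums (1 / real (0 + 1) - 0)"
   by (rule telescope_sums') real_asymp
  moreover have "1 / real (n + 1) - 1 / real (Suc n + 1) = 1 / real ((n + 1) * (n + 2))" for n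
   by (simp add: field_simps)
  ultimately have "(\<lambda>n. 1 / real ((n + 1) * (n + 2))) sums 1" by simp
  from sums_unique[OF sums_mult[OF this, of "1 / 2 ^ 3"]] show ?thesis by simp
 qed
 finally have "norm (\<Sum>n. f (n + 2) * of_nat (n + 2) powr (- 4)) < 1" by simp
 moreover have "(\<Sum>n. f (n + 2) * of_nat (n + 2) powr (- 4)) = - 1" using 0 split by (simp add: add_eq_0_iff2)
 ultimately show False by simp
qed

lemma mangoldt_series_holomorphic:
 assumes "\<And>n. norm (f n) \<le> 1"
 shows "mangoldt_series f holomorphic_on {s. Re s > 1}"
proof -
 have "\<exists>d. (mangoldt_series f has_field_derivative d) (at s)" if s: "Re s > 1" for s
 proof -
  define sig where "sig = (Re s + 1) / 2"
  have sig: "1 < sig" "sig < Re s" using s by (auto simp: sig_def)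
  define S where "S = {s. Re s > sig}"
  have S: "open S" "s \<in> S" using sig by (auto simp: S_def open_halfspace_Re_gt)
  obtain g g' where g: "\<forall>x\<in>S. ((\<lambda>n. (mangoldt n * f n) * of_nat n powr (- x)) sums g x) \<and>
    ((\<lambda>n. - (of_real (ln (real n)) * (mangoldt n * f n) * of_nat n powr (- x))) sums g' x) \<and> (g has_field_derivative g' x) (at x)"
  proof (rule series_and_derivative_comparison[OF S(1) summable_ln_powr[OF sig(1)]])
   show "\<forall>\<^sub>F n in sequentially. \<forall>x\<in>S. norm ((mangoldt n * f n) * of_nat n powr (- x)) \<le> ln (real n) * real n powr (- sig)"
    using assms(1) by (intro always_eventually allI ballI mangoldt_term_bound) (auto simp: S_def)
   show "((\<lambda>s. (mangoldt n * f n) * of_nat n powr (- s)) has_field_derivative - (of_real (ln (real n)) * (mangoldt n * f n) * of_nat n powr (- x))) (at x)"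
    if "x \<in> S" for n x by (rule has_field_derivative_nat_powr)
  qed (rule that)
  have eq: "g x = mangoldt_series f x" if "x \<in> S" for x using g that by (simp add: mangoldt_series_def sums_iff)
  have "(g has_field_derivative g' s) (at s)" using g S(2) by blast
  hence "(mangoldt_series f has_field_derivative g' s) (at s)"
   by (rule has_field_derivative_transform_within_open[OF _ S eq])
  thus ?thesis by blast
 qed
 thus ?thesis using open_halfspace_Re_gt[of 1] by (auto simp: holomorphic_on_open)
qed

text \<open>The relation \<open>D' = -V D\<close> is a linear differential equation, so \<open>D\<close> vanishes everywhere or nowhere.\<close>

lemma dirichlet_series_nonzero:
 assumes f1: "\<And>n. norm (f n) \<le> 1" and mult: "\<And>m n. f (m * n) = f m * f n" and one: "f 1 = 1" and s: "Re s > 1"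
 shows "dirichlet_series f s \<noteq> 0"
proof -
 define H where "H = {s. Re s > 1}"
 have H: "open H" "convex H" unfolding H_def by (rule open_halfspace_Re_gt, rule convex_halfspace_Re_gt)
 have hol: "mangoldt_series f holomorphic_on H" unfolding H_def by (rule mangoldt_series_holomorphic[OF f1])
 obtain W where W': "\<And>z. z \<in> H ==> (W has_field_derivative mangoldt_series f z) (at z within H)"
  by (rule holomorphic_convex_primitive'[OF H(2,1) hol]) blast
 have W: "(W has_field_derivative mangoldt_series f z) (at z)" if "z \<in> H" for z
  using W'[OF that] at_within_open[OF that H(1)] by simp
 \<comment> \<open>\<open>exp (W z)\<close> is the integrating factor, so \<open>E\<close> is
   constant; the value at 4 shows that the constant is nonzero.\<close>
 define E where "E = (\<lambda>z. dirichlet_series f z * exp (W z))"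
 have "(E has_field_derivative 0) (at z within H)" if z: "z \<in> H" for z
 proof -
  have d: "(dirichlet_series f has_field_derivative deriv (dirichlet_series f) z) (at z)"
   using z by (intro dirichlet_series_derivative(2) f1) (simp add: H_def)
  have conv: "deriv (dirichlet_series f) z = - mangoldt_series f z * dirichlet_series f z"
   using z by (intro mangoldt_convolution f1 mult) (simp add: H_def)
  have "(E has_field_derivative (deriv (dirichlet_series f) z * exp (W z) + exp (W z) * mangoldt_series f z * dirichlet_series f z)) (at z)"
   unfolding E_def by (rule DERIV_mult[OF d DERIV_chain2[OF DERIV_exp W[OF z]]])
  thus ?thesis unfolding conv by (simp add: has_field_derivative_at_within mult_ac)
 qed
 then obtain c where c: "\<And>z. z \<in> H ==> E z = c"
  using has_field_derivative_zero_constant[OF H(2)] by blast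
 have "E 4 \<noteq> 0" using dirichlet_series_near_one[of f, OF f1 one] by (simp add: E_def)
 hence "E s \<noteq> 0" using c[of 4] c[of s] s by (simp add: H_def)
 thus ?thesis by (auto simp: E_def)
qed

lemma dirichlet_series_log_deriv:
 assumes "\<And>n. norm (f n) \<le> 1" and "\<And>m n. f (m * n) = f m * f n" and "f 1 = 1" and "Re s > 1"
 shows "deriv (dirichlet_series f) s / dirichlet_series f s = - mangoldt_series f s"
 using mangoldt_convolution[of f s] dirichlet_series_nonzero[of f s] assms by simp

section \<open>The zeta function and nonvanishing on the line of abscissa 1\<close>

text \<open>This is \<open>s - 1\<close> times the difference between \<open>n powr (- s)\<close>
  and the integral of \<open>x powr (- s)\<close> over \<open>[n, n + 1]\<close>; the factor keeps
  the term regular at \<open>s = 1\<close>.\<close>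

definition zeta_term :: "nat \<Rightarrow> complex \<Rightarrow> complex" where
 "zeta_term n s = (s - 1) * of_nat n powr (- s) + of_nat (n + 1) powr (1 - s) - of_nat n powr (1 - s)"

text \<open>This is \<open>(s - 1)\<zeta>(s)\<close>, continued to the half plane \<open>Re s > 0\<close> by comparing sum and integral.\<close>

definition zeta_reg :: "complex \<Rightarrow> complex" where
 "zeta_reg s = 1 + (\<Sum>n. zeta_term (Suc n) s)"

text \<open>The term is an increment of a function \<open>phi\<close> whose derivative is itself an
  increment of \<open>z powr (- s)\<close>. The mean value inequality is applied to both; the inner
  application gains the factor \<open>1 / n\<close> that brings convergence down to
  \<open>Re s > 0\<close>.\<close>

lemma zeta_term_bound:
 assumes n: "n > 0" and s: "Re s > 0"
 shows "norm (zeta_term n s) \<le> norm (s - 1) * norm s * real n powr (- Re s - 1)"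
proof -
 define S where "S = (of_real ` {real n..real n + 1} :: complex set)"
 have cvx: "convex S" unfolding S_def
  by (rule convex_linear_image) (auto intro: bounded_linear.linear bounded_linear_of_real)
 have S: "\<exists>x. z = of_real x \<and> real n \<le> x \<and> x \<le> real n + 1" if "z \<in> S" for z using that by (auto simp: S_def)
 have nS: "of_nat n \<in> S" "of_nat (n + 1) \<in> S" unfolding S_def by (auto simp: image_iff intro: bexI[of _ "real n"] bexI[of _ "real n + 1"])
 have dp: "((\<lambda>z. z powr w) has_field_derivative w * z powr (w - 1)) (at z within S)" if zS: "z \<in> S" for z w
 proof -
  obtain x where x: "z = of_real x" "real n \<le> x" using S[OF zS] by auto
  hence "z \<notin> \<real>\<^sub>\<le>\<^sub>0" using n x(2) by (auto simp: x(1) complex_nonpos_Reals_iff)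
  thus ?thesis by (rule has_field_derivative_at_within[OF has_field_derivative_powr])
 qed
 have 1: "norm (z powr (- s) - of_nat n powr (- s)) \<le> norm s * real n powr (- Re s - 1) * norm (z - of_nat n)" if z: "z \<in> S" for z
 proof (rule field_differentiable_bound[OF cvx dp])
  fix u assume u: "u \<in> S"
  obtain x where x: "u = of_real x" "real n \<le> x" using S[OF u] by auto
  have "norm (- s * u powr (- s - 1)) = norm s * x powr (- Re s - 1)" using x n by (simp add: norm_mult norm_powr_real_powr)
  also have "... \<le> norm s * real n powr (- Re s - 1)" using x n s by (intro mult_left_mono powr_mono2') auto
  finally show "norm (- s * u powr (- s - 1)) \<le> norm s * real n powr (- Re s - 1)" .
 qed (use z nS in auto)
 define phi where "phi = (\<lambda>z. (s - 1) * of_nat n powr (- s) * z + z powr (1 - s))"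
 have "norm (phi (of_nat (n + 1)) - phi (of_nat n)) \<le> norm (s - 1) * norm s * real n powr (- Re s - 1) * norm (of_nat (n + 1) - of_nat n :: complex)"
 proof (rule field_differentiable_bound[OF cvx])
  fix z assume z: "z \<in> S"
  show "(phi has_field_derivative (s - 1) * of_nat n powr (- s) + (1 - s) * z powr (1 - s - 1)) (at z within S)"
   unfolding phi_def by (intro DERIV_add dp[OF z]) (auto intro!: derivative_eq_intros)
  have "(s - 1) * of_nat n powr (- s) + (1 - s) * z powr (1 - s - 1) = (1 - s) * (z powr (- s) - of_nat n powr (- s))"
   by (simp add: algebra_simps)
  also have "norm ... \<le> norm (1 - s) * (norm s * real n powr (- Re s - 1) * norm (z - of_nat n))"
   unfolding norm_mult by (intro mult_left_mono 1 z) auto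
  also have "... \<le> norm (1 - s) * (norm s * real n powr (- Re s - 1) * 1)"
  proof -
   obtain x where x: "z = of_real x" "real n \<le> x" "x \<le> real n + 1" using S[OF z] by auto
   have "z - of_nat n = of_real (x - real n)" by (simp add: x)
   hence "norm (z - of_nat n) = \<bar>x - real n\<bar>" by (simp only: norm_of_real)
   thus ?thesis using x by (intro mult_left_mono) auto
  qed
  finally show "norm ((s - 1) * of_nat n powr (- s) + (1 - s) * z powr (1 - s - 1)) \<le> norm (s - 1) * norm s * real n powr (- Re s - 1)"
   by (simp add: norm_minus_commute mult.assoc)
 qed (rule nS)+
 moreover have "phi (of_nat (n + 1)) - phi (of_nat n) = zeta_term n s" by (simp add: phi_def zeta_term_def algebra_simps)
 ultimately show ?thesis by simp
qed

lemma zeta_term_holomorphic: "zeta_term n holomorphic_on UNIV" if "n > 0"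
 unfolding zeta_term_def using that by (auto intro!: holomorphic_intros)

lemma zeta_reg_holomorphic: "zeta_reg holomorphic_on {s. Re s > 0}"
 and zeta_reg_summable: "Re s > 0 ==> summable (\<lambda>n. zeta_term (Suc n) s)"
proof -
 define H where "H = {s. Re s > 0}"
 have H: "open H" unfolding H_def by (rule open_halfspace_Re_gt)
 have ex: "\<exists>g g'. \<forall>x\<in>H. ((\<lambda>n. zeta_term (Suc n) x) sums g x) \<and> ((\<lambda>n. deriv (zeta_term (Suc n)) x) sums g' x) \<and> (g has_field_derivative g' x) (at x)"
 proof (rule series_and_derivative_comparison_local[OF H])
  show "(zeta_term (Suc n) has_field_derivative deriv (zeta_term (Suc n)) x) (at x)" for n x
   by (rule holomorphic_derivI[OF zeta_term_holomorphic]) auto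
  fix x assume "x \<in> H"
  hence x: "Re x > 0" by (simp add: H_def)
  define sig where "sig = Re x / 2"
  define C where "C = (norm x + sig + 1) * (norm x + sig)"
  have sig: "sig > 0" using x by (simp add: sig_def)
  show "\<exists>d h. 0 < d \<and> summable h \<and> (\<forall>\<^sub>F n in sequentially. \<forall>y\<in>ball x d \<inter> H. norm (zeta_term (Suc n) y) \<le> h n)"
  proof (intro exI[of _ sig] exI[of _ "\<lambda>n. C * real (Suc n) powr (- sig - 1)"] conjI always_eventually allI ballI)
   show "sig > 0" by (rule sig)
   have "summable (\<lambda>n. real n powr (- sig - 1))" using sig by (simp add: summable_real_powr_iff)
   thus "summable (\<lambda>n. C * real (Suc n) powr (- sig - 1))" by (intro summable_mult) (rule summable_Suc_iff[THEN iffD2])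
   fix n y assume y: "y \<in> ball x sig \<inter> H"
   have ny: "norm (y - x) < sig" using y by (simp add: dist_norm norm_minus_commute)
   have "Re x - Re y \<le> norm (y - x)" using abs_Re_le_cmod[of "y - x"] by simp
   hence Rey: "Re y \<ge> sig" using ny by (simp add: sig_def)
   have ny2: "norm y \<le> norm x + sig" using norm_triangle_ineq[of x "y - x"] ny by simp
   have "norm (y - 1) \<le> norm y + 1" using norm_triangle_ineq4[of y 1] by simp
   hence ny3: "norm (y - 1) \<le> norm x + sig + 1" using ny2 by simp
   have "norm (zeta_term (Suc n) y) \<le> norm (y - 1) * norm y * real (Suc n) powr (- Re y - 1)"
    by (rule zeta_term_bound) (use Rey sig in auto)
   also have "... \<le> C * real (Suc n) powr (- sig - 1)"
    unfolding C_def using ny2 ny3 Rey sig by (intro mult_mono powr_mono) auto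
   finally show "norm (zeta_term (Suc n) y) \<le> C * real (Suc n) powr (- sig - 1)" .
  qed
 qed
 then obtain g g' where g: "\<And>x. x \<in> H ==> (\<lambda>n. zeta_term (Suc n) x) sums g x" "\<And>x. x \<in> H ==> (g has_field_derivative g' x) (at x)"
  by blast
 have "g holomorphic_on H" using g(2) H by (auto simp: holomorphic_on_open)
 hence "(\<lambda>s. 1 + g s) holomorphic_on H" by (intro holomorphic_intros)
 moreover have "1 + g s = zeta_reg s" if "s \<in> H" for s using g(1)[OF that] by (simp add: zeta_reg_def sums_iff)
 ultimately show "zeta_reg holomorphic_on {s. Re s > 0}" unfolding H_def[symmetric] by (rule holomorphic_transform)
 show "Re s > 0 ==> summable (\<lambda>n. zeta_term (Suc n) s)" using g(1)[of s] by (simp add: H_def sums_iff)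
qed

lemma zeta_reg_eq: "zeta_reg s = (s - 1) * dirichlet_series (\<lambda>_. 1) s" if s: "Re s > 1"
proof -
 \<comment> \<open>Telescoping leaves \<open>- 1\<close>, which the leading 1 of
   \<open>zeta_reg\<close> cancels.\<close>
 have part: "(\<Sum>n<N. zeta_term (Suc n) s) = (s - 1) * (\<Sum>n<Suc N. 1 * of_nat n powr (- s)) + of_nat (Suc N) powr (1 - s) - 1" for N
  by (induction N) (auto simp: zeta_term_def algebra_simps)
 have "(\<lambda>N. \<Sum>n<N. 1 * of_nat n powr (- s)) \<longlonglongrightarrow> dirichlet_series (\<lambda>_. 1) s"
  unfolding dirichlet_series_def
  using summable_dirichlet(1)[of "\<lambda>_. 1" s] s by (intro summable_LIMSEQ) (auto dest: summable_norm_cancel)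
 from LIMSEQ_Suc[OF this] have 1: "(\<lambda>N. \<Sum>n<Suc N. 1 * of_nat n powr (- s)) \<longlonglongrightarrow> dirichlet_series (\<lambda>_. 1) s" .
 have "(\<lambda>N. real N powr (1 - Re s)) \<longlonglongrightarrow> 0"
  by (rule tendsto_neg_powr) (use s filterlim_real_sequentially in auto)
 hence "(\<lambda>N. norm (of_nat (Suc N) powr (1 - s) :: complex)) \<longlonglongrightarrow> 0"
  unfolding norm_nat_powr by (drule_tac LIMSEQ_Suc) simp
 hence 2: "(\<lambda>N. of_nat (Suc N) powr (1 - s) :: complex) \<longlonglongrightarrow> 0" by (rule tendsto_norm_zero_cancel)
 have "(\<lambda>N. (s - 1) * (\<Sum>n<Suc N. 1 * of_nat n powr (- s)) + of_nat (Suc N) powr (1 - s) - 1) \<longlonglongrightarrow> (s - 1) * dirichlet_series (\<lambda>_. 1) s + 0 - 1"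
  by (intro tendsto_intros 1 2)
 hence "(\<lambda>n. zeta_term (Suc n) s) sums ((s - 1) * dirichlet_series (\<lambda>_. 1) s + 0 - 1)"
  unfolding sums_def part .
 thus ?thesis by (simp add: zeta_reg_def sums_iff)
qed

lemma zeta_reg_one: "zeta_reg 1 = 1"
proof -
 have "zeta_term (Suc n) 1 = 0" for n by (simp add: zeta_term_def del: of_nat_Suc of_nat_add)
 thus ?thesis by (simp add: zeta_reg_def)
qed

locale completely_multiplicative_sign =
 fixes psi :: "nat \<Rightarrow> real"
 assumes psi_mult: "\<And>m n. psi (m * n) = psi m * psi n"
  and psi_values: "\<And>n. psi n = 0 \<or> psi n = 1 \<or> psi n = -1"
  and psi_one: "psi 1 = 1"
begin

text \<open>The Dirichlet coefficients of the product of the zeta function and the L-function of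
  \<open>psi\<close>.\<close>

definition divisor_psi :: "nat \<Rightarrow> real" where "divisor_psi n = (\<Sum>d | d dvd n. psi d)"

lemma psi_power: "psi (p ^ i) = psi p ^ i"
proof (induction i)
 case 0 thus ?case using psi_one by simp
qed (simp add: psi_mult)

text \<open>As \<open>p\<close> is prime to \<open>M\<close>, every divisor is uniquely a power of
  \<open>p\<close> times a divisor of \<open>M\<close>. The inductions below peel off one prime with
  its full exponent in this way.\<close>

lemma divisor_psi_prime_power_mult:
 assumes p: "prime p" and M: "\<not> p dvd M"
 shows "divisor_psi (p ^ k * M) = (\<Sum>i\<le>k. psi p ^ i) * divisor_psi M"
proof -
 have cop: "coprime (p ^ i) d" if "d dvd M" for i d
 proof -
  have "\<not> p dvd d" using M that by (meson dvd_trans)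
  thus ?thesis using p by (simp add: prime_imp_coprime coprime_power_left_iff)
 qed
 have inj: "inj_on (\<lambda>(i, d). p ^ i * d) ({..k} \<times> {d. d dvd M})"
 proof (rule inj_onI, clarify)
  fix i j d e assume d: "d dvd M" and e: "e dvd M" and eq: "p ^ i * d = p ^ j * e"
  have "p ^ i dvd p ^ j" using eq cop[OF e, of i] by (metis coprime_dvd_mult_left_iff dvd_triv_left)
  moreover have "p ^ j dvd p ^ i" using eq cop[OF d, of j] by (metis coprime_dvd_mult_left_iff dvd_triv_left)
  ultimately have "p ^ i = p ^ j" by (rule dvd_antisym)
  moreover have "p > 1" using p prime_gt_1_nat by blast
  ultimately show "i = j \<and> d = e" using eq by (auto dest: power_inject_exp[THEN iffD1])
 qed
 have img: "{d. d dvd p ^ k * M} = (\<lambda>(i, d). p ^ i * d) ` ({..k} \<times> {d. d dvd M})"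
 proof safe
  fix x assume "x dvd p ^ k * M"
  then obtain a d where ad: "x = a * d" "a dvd p ^ k" "d dvd M" using division_decomp by blast
  then obtain i where "i \<le> k" "a = p ^ i" using p divides_primepow_nat by blast
  thus "x \<in> (\<lambda>(i, d). p ^ i * d) ` ({..k} \<times> {d. d dvd M})" using ad by auto
 qed (auto intro: mult_dvd_mono le_imp_power_dvd)
 have "divisor_psi (p ^ k * M) = (\<Sum>(i, d)\<in>{..k} \<times> {d. d dvd M}. psi (p ^ i * d))"
  unfolding divisor_psi_def img by (subst sum.reindex[OF inj]) (simp add: case_prod_unfold)
 also have "... = (\<Sum>i\<le>k. \<Sum>d | d dvd M. psi p ^ i * psi d)"
  by (subst sum.cartesian_product[symmetric]) (simp add: psi_mult psi_power)
 finally show ?thesis by (simp add: divisor_psi_def sum_product)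
qed

text \<open>The critical value is \<open>psi p = -1\<close>, where the sum alternates; an even
  \<open>k\<close> means an odd number of terms, so the last 1 survives.\<close>

lemma geometric_sign_nonneg: "(\<Sum>i\<le>k. psi p ^ i) \<ge> 0" "even k ==> (\<Sum>i\<le>k. psi p ^ i) \<ge> 1"
proof -
 have *: "(\<Sum>i\<le>k. (-1) ^ i :: real) = (if even k then 1 else 0)" by (induction k) auto
 consider "psi p = 0" | "psi p = 1" | "psi p = -1" using psi_values by blast
 thus "(\<Sum>i\<le>k. psi p ^ i) \<ge> 0" "even k ==> (\<Sum>i\<le>k. psi p ^ i) \<ge> 1"
  by (cases; simp add: * sum_nonneg power_0_left sum.delta)+
qed

lemma divisor_psi_nonneg: "n > 0 ==> divisor_psi n \<ge> 0"
proof (induction n rule: less_induct)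
 case (less n)
 show ?case
 proof (cases "n = 1")
  case True thus ?thesis using psi_one by (simp add: divisor_psi_def)
 next
  case False
  then obtain p where p: "prime p" "p dvd n" using prime_factor_nat by blast
  obtain M where M: "n = p ^ multiplicity p n * M" "\<not> p dvd M"
   by (rule multiplicity_decompose'[of n p]) (use less.prems p in auto)
  have "multiplicity p n > 0" using p less.prems by (simp add: prime_multiplicity_gt_zero_iff)
  hence "M < n" using M less.prems p prime_gt_1_nat[OF p(1)]
   by (metis One_nat_def mult.commute n_less_m_mult_n nat_0_less_mult_iff one_less_power)
  moreover have "M > 0" using M less.prems by (auto intro: Nat.gr0I)
  ultimately have "divisor_psi M \<ge> 0" using less.IH by blast
  thus ?thesis using geometric_sign_nonneg(1) divisor_psi_prime_power_mult[OF p(1) M(2), of "multiplicity p n"]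
   by (subst M(1)) simp
 qed
qed

lemma divisor_psi_square: "n > 0 ==> divisor_psi (n^2) \<ge> 1"
proof (induction n rule: less_induct)
 case (less n)
 show ?case
 proof (cases "n = 1")
  case True thus ?thesis using psi_one by (simp add: divisor_psi_def)
 next
  case False
  then obtain p where p: "prime p" "p dvd n" using prime_factor_nat by blast
  define k where "k = multiplicity p n"
  obtain M where M: "n = p ^ k * M" "\<not> p dvd M"
   unfolding k_def by (rule multiplicity_decompose'[of n p]) (use less.prems p in auto)
  have "k > 0" using p less.prems by (simp add: k_def prime_multiplicity_gt_zero_iff)
  hence "M < n" using M less.prems p prime_gt_1_nat[OF p(1)]
   by (metis One_nat_def mult.commute n_less_m_mult_n nat_0_less_mult_iff one_less_power)
  moreover have "M > 0" using M less.prems by (auto intro: Nat.gr0I)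
  ultimately have IH: "divisor_psi (M^2) \<ge> 1" using less.IH by blast
  have "n^2 = p ^ (2 * k) * M^2" by (subst M(1)) (simp add: power_mult_distrib power_mult[symmetric] mult.commute)
  moreover have "\<not> p dvd M\<^sup>2" using M(2) p by (simp add: prime_dvd_power_iff)
  ultimately have "divisor_psi (n^2) = (\<Sum>i\<le>2 * k. psi p ^ i) * divisor_psi (M^2)"
   using divisor_psi_prime_power_mult[OF p(1)] by simp
  moreover have "(\<Sum>i\<le>2 * k. psi p ^ i) \<ge> 1" by (rule geometric_sign_nonneg(2)) simp
  ultimately show ?thesis using IH mult_mono[of 1 "\<Sum>i\<le>2 * k. psi p ^ i" 1 "divisor_psi (M^2)"] by simp
 qed
qed

abbreviation "psi_c \<equiv> (\<lambda>n. complex_of_real (psi n))"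

lemma divisor_psi_series:
 assumes s: "Re s > 1"
 shows "(\<lambda>n. of_real (divisor_psi n) * of_nat n powr (- s)) sums (dirichlet_series psi_c s * dirichlet_series (\<lambda>_. 1) s)"
proof -
 define A where "A = (\<lambda>n. psi_c n * of_nat n powr (- s))"
 define B where "B = (\<lambda>n. 1 * of_nat n powr (- s) :: complex)"
 have n1: "norm (psi_c n) \<le> 1" for n using psi_values[of n] by auto
 have "(\<lambda>n. \<Sum>d | d dvd n. A d * B (n div d)) sums (dirichlet_series psi_c s * dirichlet_series (\<lambda>_. 1) s)"
  unfolding dirichlet_series_def A_def[symmetric] B_def[symmetric]
  by (rule dirichlet_convolution_sums)
   (use summable_dirichlet(1)[of psi_c, OF n1 s] summable_dirichlet(1)[of "\<lambda>_. 1", OF _ s] in \<open>auto simp: A_def B_def\<close>)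
 moreover have "(\<Sum>d | d dvd n. A d * B (n div d)) = of_real (divisor_psi n) * of_nat n powr (- s)" for n
 proof -
  have "A d * B (n div d) = psi_c d * of_nat n powr (- s)" if "d dvd n" for d
   using nat_powr_dvd[OF that, of "- s"] by (simp add: A_def B_def mult.assoc)
  thus ?thesis by (simp add: divisor_psi_def sum_distrib_right)
 qed
 ultimately show ?thesis by (simp only:)
qed

text \<open>Landau's argument: if \<open>L(1) = 0\<close>, then \<open>\<zeta>(s)L(s)\<close> is holomorphic for \<open>Re s > 0\<close>; its Dirichlet
 coefficients are nonnegative, so the Taylor series at \<open>2\<close> has coefficients of constant sign
 even after removing finitely many terms, and the Dirichlet series has bounded partial sums at
 \<open>s = 1/2\<close>. There the squares contribute the harmonic series.\<close>

lemma L_one_nonzero: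
 assumes holL: "L holomorphic_on UNIV" and L: "\<And>s. Re s > 1 ==> L s = dirichlet_series psi_c s"
 shows "L 1 \<noteq> 0"
proof
 assume L1: "L 1 = 0"
 define M where "M = (\<lambda>s. if s = 1 then deriv L 1 else L s / (s - 1))"
 define f where "f = (\<lambda>s. zeta_reg s * M s)"
 \<comment> \<open>In the variable \<open>w = 2 - s\<close> the terms become multiples of
   \<open>exp (w * ln n)\<close>, whose derivatives at 0 are nonnegative. The disc of radius 2
   corresponds to the one about \<open>s = 2\<close> that reaches \<open>Re s = 0\<close>, so it
   contains \<open>w = 3/2\<close>, where the series is not yet known to converge.\<close>
 define F where "F = (\<lambda>w. f (2 - w))"
 have "M holomorphic_on UNIV" by (rule pole_theorem_0[OF holL, of 1]) (use L1 in \<open>auto simp: M_def\<close>)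
 hence holf: "f holomorphic_on {s. Re s > 0}"
  unfolding f_def by (intro holomorphic_intros zeta_reg_holomorphic) (auto intro: holomorphic_on_subset)
 have Re2: "Re (2 - w) > 2 - r" if "w \<in> ball 0 r" for w r using complex_Re_le_cmod[of w] that by simp
 have holF: "F holomorphic_on ball 0 2"
  unfolding F_def by (rule holomorphic_on_compose_gen[OF _ holf, unfolded o_def])
   (use Re2[of _ 2] in \<open>auto intro!: holomorphic_intros\<close>)
 define l where "l = (\<lambda>n. ln (real n))"
 define c where "c = (\<lambda>n. divisor_psi n * real n powr (- 2))"
 define g where "g = (\<lambda>n (w::complex). of_real (c n) * exp (w * of_real (l n)))"
 have c0: "c n \<ge> 0" for n using divisor_psi_nonneg[of n] by (cases "n = 0") (auto simp: c_def)
 have l0: "l n \<ge> 0" for n by (cases "n = 0") (auto simp: l_def)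
 have g_eq: "g n w = of_real (divisor_psi n) * of_nat n powr (- (2 - w))" for n and w :: complex
 proof (cases "n = 0")
  case False
  have "real n powr (- 2) = exp (- 2 * l n)" using False by (simp add: powr_def l_def)
  moreover have "of_nat n powr (- (2 - w)) = exp (- 2 * of_real (l n) + w * of_real (l n))"
   using False by (simp add: powr_def l_def Ln_of_nat algebra_simps)
  ultimately show ?thesis by (simp add: g_def c_def exp_of_real[symmetric] exp_diff exp_minus divide_inverse mult.commute)
 qed (simp add: g_def c_def)
 have g_sums: "(\<lambda>n. g n w) sums F w" if w: "w \<in> ball 0 1" for w
 proof -
  have s: "Re (2 - w) > 1" using Re2[OF w] by simp
  hence ne: "2 - w \<noteq> 1" by auto
  show ?thesis using divisor_psi_series[OF s] ne zeta_reg_eq[OF s] L[OF s]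
   by (simp add: g_eq F_def f_def M_def mult.commute)
 qed
 define b where "b = (\<lambda>n. c n * exp (l n / 2))"
 have "summable (\<lambda>n. Re (g n (1/2)))" using sums_Re[OF g_sums[of "1/2"]] by (simp add: sums_iff)
 moreover have "Re (g n (1/2)) = b n" for n by (simp add: g_def b_def Re_exp)
 ultimately have sb: "summable b" by simp
 have "uniform_limit (ball 0 (1/2)) (\<lambda>M w. \<Sum>n<M. g n w) (\<lambda>w. \<Sum>n. g n w) sequentially"
 proof (rule Weierstrass_m_test[OF _ sb])
  fix n w assume w: "w \<in> ball (0::complex) (1/2)"
  have "Re w * l n \<le> 1/2 * l n" using w complex_Re_le_cmod[of w] l0[of n] by (intro mult_right_mono) auto
  thus "norm (g n w) \<le> b n" using c0[of n] by (auto simp: g_def b_def norm_mult intro!: mult_left_mono)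
 qed
 moreover have "(\<Sum>n. g n w) = F w" if "w \<in> ball 0 (1/2)" for w using g_sums[of w] that by (simp add: sums_iff)
 ultimately have ul: "uniform_limit (ball 0 (1/2)) (\<lambda>M w. \<Sum>n<M. g n w) F sequentially"
  using uniform_limit_cong'[of "ball 0 (1/2)" _ _ "\<lambda>w. \<Sum>n. g n w" F sequentially] by blast
 have dg: "(deriv ^^ k) (\<lambda>w. \<Sum>n\<in>A. g n w) = (\<lambda>w. \<Sum>n\<in>A. of_real (c n * l n ^ k) * exp (w * of_real (l n)))" if "finite A" for k A
 proof (induction k)
  case (Suc k)
  have "((\<lambda>w. \<Sum>n\<in>A. of_real (c n * l n ^ k) * exp (w * of_real (l n))) has_field_derivative
    (\<Sum>n\<in>A. of_real (c n * l n ^ Suc k) * exp (w * of_real (l n)))) (at w)" for w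
   by (intro DERIV_sum) (auto intro!: derivative_eq_intros)
  thus ?case unfolding funpow.simps o_def Suc by (intro ext DERIV_imp_deriv)
 qed (simp add: g_def)
 have bound: "(\<Sum>n<N. c n * exp (3/2 * l n)) \<le> Re (F (3/2))" for N
 proof -
  define H where "H = (\<lambda>w. F w - (\<Sum>n<N. g n w))"
  have holg: "(\<lambda>w. \<Sum>n\<in>A. g n w) holomorphic_on B" for A B unfolding g_def by (intro holomorphic_intros)
  have holH: "H holomorphic_on ball 0 2" unfolding H_def by (intro holomorphic_intros holF holg)
  have "uniform_limit (ball 0 (1/2)) (\<lambda>M w. (\<Sum>n<M + N. g n w) - (\<Sum>n<N. g n w)) H sequentially"
   unfolding H_def
   by (intro uniform_limit_intros filterlim_compose[OF ul, unfolded o_def] filterlim_add_const_nat_at_top)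
  moreover have "(\<Sum>n<M + N. g n w) - (\<Sum>n<N. g n w) = (\<Sum>n\<in>{N..<M + N}. g n w)" for M w
   using sum_diff_nat_ivl[of 0 N "M + N" "\<lambda>n. g n w"] by (simp add: atLeast0LessThan)
  ultimately have ulH: "uniform_limit (ball 0 (1/2)) (\<lambda>M w. \<Sum>n\<in>{N..<M + N}. g n w) H sequentially" by simp
  \<comment> \<open>Uniform convergence near 0 passes to derivatives, and every finite block of
    terms has nonnegative ones at 0.\<close>
  have coeff: "Re ((deriv ^^ k) H 0) \<ge> 0" for k
  proof (rule tendsto_lowerbound)
   show "(\<lambda>M. Re ((deriv ^^ k) (\<lambda>w. \<Sum>n\<in>{N..<M + N}. g n w) 0)) \<longlonglongrightarrow> Re ((deriv ^^ k) H 0)"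
    by (intro tendsto_Re higher_deriv_complex_uniform_limit[OF ulH] always_eventually allI holg) auto
   show "\<forall>\<^sub>F M in sequentially. 0 \<le> Re ((deriv ^^ k) (\<lambda>w. \<Sum>n\<in>{N..<M + N}. g n w) 0)"
    by (intro always_eventually allI) (auto simp: dg c0 l0 intro!: sum_nonneg)
  qed simp
  have "(\<lambda>k. Re ((deriv ^^ k) H 0 / fact k * (3/2 - 0) ^ k)) sums Re (H (3/2))"
   by (intro sums_Re holomorphic_power_series[OF holH]) (simp add: norm_divide)
  moreover have "Re ((deriv ^^ k) H 0 / fact k * (3/2 - 0) ^ k) = Re ((deriv ^^ k) H 0) * ((3/2) ^ k / fact k)" for k
  proof -
   have "(deriv ^^ k) H 0 / fact k * (3/2 - 0) ^ k = of_real ((3/2) ^ k / fact k) * (deriv ^^ k) H 0" by simp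
   thus ?thesis by (simp only: complex_scaleR scaleR_conv_of_real[symmetric]) simp
  qed
  ultimately have "(\<lambda>k. Re ((deriv ^^ k) H 0) * ((3/2) ^ k / fact k)) sums Re (H (3/2))" by (simp only:)
  hence "Re (H (3/2)) \<ge> 0" by (rule sums_le[OF _ sums_zero, rotated]) (use coeff in auto)
  moreover have "Re (\<Sum>n<N. g n (3/2)) = (\<Sum>n<N. c n * exp (3/2 * l n))" by (simp add: g_def Re_exp)
  ultimately show ?thesis by (simp add: H_def)
 qed
 have harm: "harm K \<le> Re (F (3/2))" for K
 proof -
  have "harm K \<le> (\<Sum>k\<in>{1..K}. c (k^2) * exp (3/2 * l (k^2)))"
   unfolding harm_def
  proof (rule sum_mono)
   fix k assume "k \<in> {1..K}"
   hence k: "k > 0" by simp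
   have "inverse (real k) = exp (- l k)" using k by (simp add: l_def exp_minus)
   also have "... = exp (- 2 * l (k^2) + 3/2 * l (k^2))" using k by (simp add: l_def ln_realpow)
   also have "... = real (k^2) powr (- 2) * exp (3/2 * l (k^2))" using k by (simp add: powr_def l_def mult_exp_exp)
   also have "... \<le> c (k^2) * exp (3/2 * l (k^2))"
    unfolding c_def using divisor_psi_square[OF k] by (intro mult_right_mono) (auto simp: mult_le_cancel_right1)
   finally show "inverse (of_nat k) \<le> c (k^2) * exp (3/2 * l (k^2))" by simp
  qed
  also have "... = (\<Sum>n\<in>(\<lambda>k. k\<^sup>2) ` {1..K}. c n * exp (3/2 * l n))" by (subst sum.reindex) (auto simp: inj_on_def)
  also have "... \<le> (\<Sum>n<Suc (K^2). c n * exp (3/2 * l n))"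
   by (rule sum_mono2) (auto simp: c0 less_Suc_eq_le power_mono)
  also note bound
  finally show ?thesis .
 qed
 obtain K :: nat where "harm K > Re (F (3/2))"
  using harm_at_top unfolding filterlim_at_top_dense by (metis eventually_sequentially le_refl)
 with harm[of K] show False by simp
qed

end

lemma mangoldt_series_one:
 assumes s: "Re s > 1"
 shows "mangoldt_series (\<lambda>_. 1) s = 1 / (s - 1) - deriv zeta_reg s / zeta_reg s"
  "zeta_reg s \<noteq> 0"
proof -
 define D where "D = dirichlet_series (\<lambda>_. 1)"
 have s1: "s \<noteq> 1" using s by auto
 have D0: "D s \<noteq> 0" unfolding D_def by (rule dirichlet_series_nonzero) (use s in auto)
 show "zeta_reg s \<noteq> 0" using zeta_reg_eq[OF s] D0 s1 by (simp add: D_def)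
 have "(D has_field_derivative deriv D s) (at s)" unfolding D_def by (rule dirichlet_series_derivative(2)) (use s in auto)
 hence "((\<lambda>s. (s - 1) * D s) has_field_derivative (D s + deriv D s * (s - 1))) (at s)"
  by (auto intro!: derivative_eq_intros)
 hence "(zeta_reg has_field_derivative (D s + deriv D s * (s - 1))) (at s)"
  by (rule has_field_derivative_transform_within_open[OF _ open_halfspace_Re_gt[of 1]]) (use s in \<open>auto simp: zeta_reg_eq D_def\<close>)
 hence "deriv zeta_reg s = D s + deriv D s * (s - 1)" by (rule DERIV_imp_deriv)
 moreover have "deriv D s / D s = - mangoldt_series (\<lambda>_. 1) s"
  unfolding D_def by (rule dirichlet_series_log_deriv) (use s in auto)
 hence "deriv D s = - mangoldt_series (\<lambda>_. 1) s * D s" using D0 by (simp add: field_simps)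
 ultimately have dz: "deriv zeta_reg s = D s - mangoldt_series (\<lambda>_. 1) s * D s * (s - 1)" by simp
 have zr: "zeta_reg s = (s - 1) * D s" using zeta_reg_eq[OF s] by (simp add: D_def)
 define u where "u = s - 1"
 have "u \<noteq> 0" using s1 by (simp add: u_def)
 thus "mangoldt_series (\<lambda>_. 1) s = 1 / (s - 1) - deriv zeta_reg s / zeta_reg s"
  unfolding dz zr u_def[symmetric] using D0 by (simp add: field_simps)
qed

text \<open>Write \<open>f\<close> as a power of \<open>w - z\<close> times a nonvanishing function:
  the logarithmic derivative is \<open>n / (w - z)\<close> plus a bounded term. One statement covers
  zeros, where \<open>n \<ge> 1\<close>, and other points, where only boundedness from below
  matters.\<close>

lemma log_deriv_near_zero:
 assumes hol: "f holomorphic_on S" and S: "open S" "connected S" "z \<in> S" and nz: "w \<in> S" "f w \<noteq> 0"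
 obtains C d where "d > 0" "\<And>delta. 0 < delta ==> delta < d ==> Re (deriv f (z + of_real delta) / f (z + of_real delta)) \<ge> (if f z = 0 then 1 / delta else 0) - C"
proof -
 define n where "n = nat (zorder f z)"
 define g where "g = zor_poly f z"
 have "\<exists>w\<in>S. f w \<noteq> 0" using nz by blast
 note zorder_exist_zero[OF hol S this]
 hence *: "if f z = 0 then 0 < zorder f z else zorder f z = 0"
  "\<exists>r>0. cball z r \<subseteq> S \<and> g holomorphic_on cball z r \<and> (\<forall>w\<in>cball z r. f w = g w * (w - z) ^ n \<and> g w \<noteq> 0)"
  unfolding g_def n_def by blast+
 then obtain r where r: "r > 0" "cball z r \<subseteq> S" "g holomorphic_on cball z r" "\<And>w. w \<in> cball z r ==> f w = g w * (w - z) ^ n"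
  "\<And>w. w \<in> cball z r ==> g w \<noteq> 0" by metis
 have n: "f z = 0 ==> n \<ge> 1" using *(1) by (auto simp: n_def split: if_splits)
 have holg: "g holomorphic_on ball z r" by (rule holomorphic_on_subset[OF r(3)]) auto
 have "continuous_on (cball z (r/2)) (\<lambda>w. deriv g w / g w)"
 proof (intro holomorphic_on_imp_continuous_on holomorphic_on_divide)
  show "deriv g holomorphic_on cball z (r/2)"
   by (rule holomorphic_on_subset[OF holomorphic_deriv[OF holg]]) (use r in auto)
  show "g holomorphic_on cball z (r/2)" by (rule holomorphic_on_subset[OF holg]) (use r in auto)
  show "g w \<noteq> 0" if "w \<in> cball z (r/2)" for w using r(5)[of w] that r(1) by auto
 qed
 hence "bounded ((\<lambda>w. deriv g w / g w) ` cball z (r/2))" by (intro compact_imp_bounded compact_continuous_image) auto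
 then obtain C where C': "\<forall>w\<in>cball z (r/2). norm (deriv g w / g w) \<le> C" by (auto simp: bounded_iff)
 have C: "norm (deriv g w / g w) \<le> C" if "w \<in> cball z (r/2)" for w using C' that by blast
 show ?thesis
 proof (rule that[of "r/2" C])
  fix delta :: real assume delta: "0 < delta" "delta < r/2"
  define u where "u = z + of_real delta"
  have u: "u \<in> cball z (r/2)" "u \<in> ball z r" using delta by (auto simp: u_def dist_norm)
  have uz: "u - z = of_real delta" by (simp add: u_def)
  have gu: "g u \<noteq> 0" using r(5)[of u] u by auto
  have dg: "(g has_field_derivative deriv g u) (at u)" by (rule holomorphic_derivI[OF holg]) (use u in auto)
  have "((\<lambda>w. (w - z) ^ n) has_field_derivative of_nat n * (u - z) ^ (n - 1)) (at u)"
   by (auto intro!: derivative_eq_intros)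
  from DERIV_mult[OF dg this] have "((\<lambda>w. g w * (w - z) ^ n) has_field_derivative
    (deriv g u * (u - z) ^ n + of_nat n * (u - z) ^ (n - 1) * g u)) (at u)" by simp
  hence "(f has_field_derivative (deriv g u * (u - z) ^ n + of_nat n * (u - z) ^ (n - 1) * g u)) (at u)"
   by (rule has_field_derivative_transform_within_open[OF _ open_ball u(2)]) (use r(4) in auto)
  hence d: "deriv f u = deriv g u * (u - z) ^ n + of_nat n * (u - z) ^ (n - 1) * g u" by (rule DERIV_imp_deriv)
  have "deriv f u / f u = deriv g u / g u + of_nat n / (u - z)"
   using gu delta r(4)[of u] u unfolding d by (cases n) (auto simp: uz field_simps)
  hence "Re (deriv f u / f u) = Re (deriv g u / g u) + real n / delta" by (simp add: uz)
  moreover have "Re (deriv g u / g u) \<ge> - C" using C[OF u(1)] abs_Re_le_cmod[of "deriv g u / g u"] by linarith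
  moreover have "real n / delta \<ge> (if f z = 0 then 1 / delta else 0)" using n delta by (auto intro!: divide_right_mono)
  ultimately show "Re (deriv f (z + of_real delta) / f (z + of_real delta)) \<ge> (if f z = 0 then 1 / delta else 0) - C"
   unfolding u_def[symmetric] by linarith
 qed (use r in auto)
qed

lemma Re_nat_powr: "Re (of_nat n powr (- Complex sig t)) = real n powr (- sig) * cos (t * ln (real n))" if "n > 0"
proof -
 have "of_nat n powr (- Complex sig t) = exp (Complex (- sig * ln (real n)) (- t * ln (real n)))"
  using that Ln_of_nat[of n] by (simp add: powr_def complex_eq_iff Re_exp Im_exp)
 thus ?thesis using that by (simp add: Re_exp powr_def)
qed

text \<open>For a coefficient \<open>c\<close> equal to 1 or -1 the bracket is
  \<open>2 * (1 + c * cos theta) ^ 2\<close>, and for \<open>c = 0\<close> it is positive too. Since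
  the values of \<open>f\<close> are signs or 0, the trivial coefficient 1 can stand where the
  square of \<open>f\<close> is usual, and the third series is that of zeta.\<close>

lemma three_four_one:
 assumes f: "\<And>n. f n = 0 \<or> f n = 1 \<or> f n = (-1 :: complex)" and sig: "sig > 1"
 shows "3 * Re (mangoldt_series (\<lambda>_. 1) (Complex sig 0)) + 4 * Re (mangoldt_series f (Complex sig t))
  + Re (mangoldt_series (\<lambda>_. 1) (Complex sig (2 * t))) \<ge> 0"
proof -
 have f1: "norm (f n) \<le> 1" for n using f[of n] by auto
 define T where "T = (\<lambda>n. 3 * Re (mangoldt n * 1 * of_nat n powr (- Complex sig 0)) + 4 * Re (mangoldt n * f n * of_nat n powr (- Complex sig t))
  + Re (mangoldt n * 1 * of_nat n powr (- Complex sig (2 * t))))"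
 have sums: "(\<lambda>n. Re (mangoldt n * h n * of_nat n powr (- s))) sums Re (mangoldt_series h s)"
  if "\<And>n. norm (h n) \<le> 1" "Re s > 1" for h s
  unfolding mangoldt_series_def
  by (rule sums_Re, rule summable_sums, rule summable_norm_cancel, rule summable_dirichlet(2)) (use that in auto)
 have "T sums (3 * Re (mangoldt_series (\<lambda>_. 1) (Complex sig 0)) + 4 * Re (mangoldt_series f (Complex sig t))
  + Re (mangoldt_series (\<lambda>_. 1) (Complex sig (2 * t))))"
  unfolding T_def by (intro sums_add sums_mult sums) (use f1 sig in auto)
 moreover have "T n \<ge> 0" for n
 proof (cases "n = 0")
  case False
  define theta where "theta = t * ln (real n)"
  define c where "c = Re (f n)"
  have fc: "f n = of_real c" "c = 0 \<or> c = 1 \<or> c = -1" using f[of n] by (auto simp: c_def)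
  have m: "(mangoldt n :: complex) = of_real (mangoldt n)" by simp
  have "T n = mangoldt n * (real n powr (- sig) * (3 + 4 * c * cos theta + cos (2 * theta)))"
   using False unfolding T_def fc(1) m
   by (simp add: Re_nat_powr theta_def algebra_simps del: of_real_mangoldt)
  also have "... \<ge> 0"
  proof (intro mult_nonneg_nonneg mangoldt_nonneg)
   have "3 + 4 * c * cos theta + cos (2 * theta) = 2 + 4 * c * cos theta + 2 * cos theta ^ 2" by (simp add: cos_double_cos)
   also have "... \<ge> 0"
   proof -
    have "2 * (1 + cos theta)^2 \<ge> 0" "2 * (1 - cos theta)^2 \<ge> 0" by auto
    thus ?thesis using fc(2) by (auto simp: power2_eq_square algebra_simps)
   qed
   finally show "0 \<le> 3 + 4 * c * cos theta + cos (2 * theta)" .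
  qed simp
  finally show ?thesis .
 qed (simp add: T_def)
 ultimately show ?thesis using suminf_nonneg[of T] by (simp add: sums_iff)
qed

text \<open>A zero at \<open>1 + it\<close> would contribute \<open>- 4 / delta\<close> or less,
  against \<open>3 / delta\<close> from the pole at 1. The series at \<open>2t\<close> stays bounded
  above because \<open>t \<noteq> 0\<close> keeps it away from that pole.\<close>

lemma nonvanishing_line_one:
 assumes f: "\<And>n. f n = 0 \<or> f n = 1 \<or> f n = (-1 :: complex)" and mult: "\<And>m n. f (m * n) = f m * f n" and one: "f 1 = 1"
  and hol: "L holomorphic_on UNIV" and L: "\<And>s. Re s > 1 ==> L s = dirichlet_series f s" and t: "t \<noteq> 0"
 shows "L (Complex 1 t) \<noteq> 0"
proof
 assume zero: "L (Complex 1 t) = 0"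
 have f1: "norm (f n) \<le> 1" for n using f[of n] by auto
 define H where "H = {s. Re s > 0}"
 have H: "open H" "connected H" unfolding H_def by (auto intro: open_halfspace_Re_gt convex_connected convex_halfspace_Re_gt)
 have hz: "zeta_reg holomorphic_on H" unfolding H_def by (rule zeta_reg_holomorphic)
 have z2: "zeta_reg 2 \<noteq> 0" by (rule mangoldt_series_one(2)) simp
 have L2: "L 2 \<noteq> 0" using L[of 2] dirichlet_series_nonzero[of f 2, OF f1 mult one] by simp
 obtain C1 d1 where C1: "d1 > 0" "\<And>delta. 0 < delta ==> delta < d1 ==> Re (deriv zeta_reg (1 + of_real delta) / zeta_reg (1 + of_real delta)) \<ge> (if zeta_reg 1 = 0 then 1 / delta else 0) - C1"
  by (rule log_deriv_near_zero[OF hz H _ _ z2, of 1]) (auto simp: H_def)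
 obtain C2 d2 where C2: "d2 > 0" "\<And>delta. 0 < delta ==> delta < d2 ==> Re (deriv zeta_reg (Complex 1 (2 * t) + of_real delta) / zeta_reg (Complex 1 (2 * t) + of_real delta)) \<ge> (if zeta_reg (Complex 1 (2 * t)) = 0 then 1 / delta else 0) - C2"
  by (rule log_deriv_near_zero[OF hz H _ _ z2, of "Complex 1 (2 * t)"]) (auto simp: H_def)
 obtain C3 d3 where C3: "d3 > 0" "\<And>delta. 0 < delta ==> delta < d3 ==> Re (deriv L (Complex 1 t + of_real delta) / L (Complex 1 t + of_real delta)) \<ge> (if L (Complex 1 t) = 0 then 1 / delta else 0) - C3"
  by (rule log_deriv_near_zero[OF hol open_UNIV connected_UNIV _ _ L2, of "Complex 1 t"]) auto
 define E where "E = 3 * C1 + 4 * C3 + C2 + 1 / (2 * \<bar>t\<bar>)"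
 \<comment> \<open>Besides lying in all three ranges, \<open>delta\<close> satisfies
   \<open>1 / delta \<ge> \<bar>E\<bar> + 1\<close>, whereas the inequality would force
   \<open>1 / delta \<le> E\<close>.\<close>
 define delta where "delta = min (min (d1/2) (d2/2)) (min (d3/2) (1 / (\<bar>E\<bar> + 1)))"
 have delta: "delta > 0" "delta < d1" "delta < d2" "delta < d3" "delta \<le> 1 / (\<bar>E\<bar> + 1)"
  using C1(1) C2(1) C3(1) by (auto simp: delta_def min_def)
 define sig where "sig = 1 + delta"
 have sig: "sig > 1" using delta by (simp add: sig_def)
 have e1: "1 + of_real delta = Complex sig 0" "Complex 1 (2 * t) + of_real delta = Complex sig (2 * t)" "Complex 1 t + of_real delta = Complex sig t"
  by (auto simp: sig_def complex_eq_iff)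
 have V1: "Re (mangoldt_series (\<lambda>_. 1) (Complex sig 0)) \<le> 1 / delta + C1"
 proof -
  have "Re (deriv zeta_reg (Complex sig 0) / zeta_reg (Complex sig 0)) \<ge> - C1" using C1(2)[OF delta(1,2)] unfolding e1 zeta_reg_one by simp
  moreover have "Complex sig 0 - 1 = of_real delta" by (simp add: sig_def complex_eq_iff)
  ultimately show ?thesis using mangoldt_series_one(1)[of "Complex sig 0"] sig by simp
 qed
 have V2: "Re (mangoldt_series (\<lambda>_. 1) (Complex sig (2 * t))) \<le> 1 / (2 * \<bar>t\<bar>) + C2"
 proof -
  have "Re (deriv zeta_reg (Complex sig (2 * t)) / zeta_reg (Complex sig (2 * t))) \<ge> - C2"
   using C2(2)[OF delta(1,3)] delta(1) unfolding e1 by (auto split: if_splits intro: order_trans[rotated])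
  moreover have "Re (1 / (Complex sig (2 * t) - 1)) \<le> 1 / (2 * \<bar>t\<bar>)"
  proof -
   have "\<bar>2 * t\<bar> \<le> norm (Complex sig (2 * t) - 1)" using abs_Im_le_cmod[of "Complex sig (2 * t) - 1"] by simp
   hence "norm (1 / (Complex sig (2 * t) - 1)) \<le> 1 / (2 * \<bar>t\<bar>)" using t by (auto simp: norm_divide intro!: frac_le)
   thus ?thesis using complex_Re_le_cmod order_trans by blast
  qed
  ultimately show ?thesis using mangoldt_series_one(1)[of "Complex sig (2 * t)"] sig by simp
 qed
 have V3: "Re (mangoldt_series f (Complex sig t)) \<le> - (1 / delta) + C3"
 proof -
  have s: "Re (Complex sig t) > 1" using sig by simp
  have "deriv L (Complex sig t) = deriv (dirichlet_series f) (Complex sig t)"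
  proof (rule deriv_cong_ev[OF _ refl])
   have "\<forall>\<^sub>F z in nhds (Complex sig t). z \<in> {s. Re s > 1}"
    by (rule eventually_nhds_in_open[OF open_halfspace_Re_gt]) (use s in simp)
   thus "\<forall>\<^sub>F z in nhds (Complex sig t). L z = dirichlet_series f z" by eventually_elim (simp add: L)
  qed
  hence "deriv L (Complex sig t) / L (Complex sig t) = - mangoldt_series f (Complex sig t)"
   using dirichlet_series_log_deriv[of f, OF f1 mult one s] L[OF s] by simp
  thus ?thesis using C3(2)[OF delta(1,4)] zero unfolding e1 by simp
 qed
 have "0 \<le> 3 * (1 / delta + C1) + 4 * (- (1 / delta) + C3) + (1 / (2 * \<bar>t\<bar>) + C2)"
  by (rule order_trans[OF three_four_one[of f sig t, OF f sig]]) (intro add_mono mult_left_mono V1 V2 V3; simp)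
 hence "1 / delta \<le> E" by (simp add: E_def)
 moreover have "\<bar>E\<bar> + 1 \<le> 1 / delta" using delta(1,5) by (simp add: field_simps)
 ultimately show False by linarith
qed

section \<open>Poisson summation\<close>

lemma integral_cis_int:
 "integral {0..1} (\<lambda>x. cis (2 * pi * of_int k * x)) = (if k = 0 then 1 else 0)"
proof (cases "k = 0")
 case False
 define c where "c = \<i> * of_real (2 * pi * of_int k)"
 have c0: "c \<noteq> 0" using False by (simp add: c_def)
 have "((\<lambda>x::real. exp (c * of_real x)) has_integral (exp (c * of_real 1) / c - exp (c * of_real 0) / c)) {0..1}"
  by (rule fundamental_theorem_of_calculus[of 0 1 "\<lambda>x. exp (c * of_real x) / c"])
   (use c0 in \<open>auto intro!: derivative_eq_intros simp: has_vector_derivative_complex_iff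
    has_real_derivative_iff_has_vector_derivative[symmetric] exp_of_real
    intro!: has_vector_derivative_real_field\<close>)
 moreover have "exp (c * of_real 1) = 1"
 proof -
  have "exp (c * of_real 1) = exp (of_int k * (of_real (2 * pi) * \<i>))" by (simp add: c_def mult_ac)
  thus ?thesis using exp_integer_2pi[of "of_int k"] by (simp add: mult_ac)
 qed
 moreover have "exp (c * of_real x) = cis (2 * pi * of_int k * x)" for x
  by (simp add: c_def cis_conv_exp mult_ac)
 ultimately have "((\<lambda>x. cis (2 * pi * of_int k * x)) has_integral 0) {0..1}" by simp
 thus ?thesis using False by (simp add: integral_unique)
qed (simp add: cis_zero)

text \<open>Stone-Weierstrass takes the place of a square integrable theory: \<open>g\<close> is
  orthogonal to every polynomial on the circle, and such polynomials approximate
  \<open>cnj g\<close>, so the integral of \<open>(cmod (g x))^2\<close> is zero.\<close>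

lemma fourier_uniqueness:
 fixes g :: "real \<Rightarrow> complex"
 assumes cont: "continuous_on UNIV g" and per: "\<And>x. g (x + 1) = g x"
  and coef: "\<And>k::int. integral {0..1} (\<lambda>x. g x * cis (- (2 * pi * of_int k * x))) = 0"
 shows "g x = 0"
proof -
 have contg: "continuous_on A g" for A using cont continuous_on_subset by blast
 \<comment> \<open>\<open>V f\<close> says that all Fourier coefficients of \<open>f\<close> vanish.
   Multiplying by one exponential only shifts the coefficients, so \<open>V\<close> survives
   multiplication by the real and imaginary parts of \<open>cis\<close>, hence by polynomials in
   them.\<close>
 define V where "V = (\<lambda>f. \<forall>k::int. ((\<lambda>x. f x * cis (- (2 * pi * of_int k * x))) has_integral 0) {0..1})"
 have Vadd: "V (\<lambda>x. f x + h x)" if "V f" "V h" for f h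
  unfolding V_def
 proof
  fix k show "((\<lambda>x. (f x + h x) * cis (- (2 * pi * of_int k * x))) has_integral 0) {0..1}"
   using has_integral_add[OF that[unfolded V_def, rule_format, of k]] by (simp add: ring_distribs)
 qed
 have Vmul: "V (\<lambda>x. f x * (c * cis (2 * pi * of_int j * x)))" if "V f" for f c and j :: int
  unfolding V_def
 proof
  fix k :: int
  have "((\<lambda>x. c * (f x * cis (- (2 * pi * of_int (k - j) * x)))) has_integral c * 0) {0..1}"
   using that unfolding V_def by (intro has_integral_mult_right) blast
  moreover have "c * (f x * cis (- (2 * pi * of_int (k - j) * x)))
    = f x * (c * cis (2 * pi * of_int j * x)) * cis (- (2 * pi * of_int k * x))" for x
  proof -
   have "cis (- (2 * pi * of_int (k - j) * x)) = cis (2 * pi * of_int j * x) * cis (- (2 * pi * of_int k * x))"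
    by (simp add: cis_mult algebra_simps)
   thus ?thesis by (simp only: mult_ac)
  qed
  ultimately show "((\<lambda>x. f x * (c * cis (2 * pi * of_int j * x)) * cis (- (2 * pi * of_int k * x))) has_integral 0) {0..1}"
   by (simp only: mult_zero_right)
 qed
 have Vpoly: "V (\<lambda>x. f x * of_real (p (cis (2 * pi * x))))" if "real_polynomial_function p" "V f" for p f
  using that
 proof (induction arbitrary: f rule: real_polynomial_function.induct)
  case (linear p)
  have p: "p z = Re z * p 1 + Im z * p \<i>" for z
  proof -
   have "p (Re z *\<^sub>R 1 + Im z *\<^sub>R \<i>) = Re z * p 1 + Im z * p \<i>"
    using linear.hyps by (simp add: linear_simps)
   moreover have "Re z *\<^sub>R 1 + Im z *\<^sub>R \<i> = z" by (simp add: complex_eq_iff)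
   ultimately show ?thesis by simp
  qed
  have "f x * of_real (p (cis (2 * pi * x))) = f x * (Complex (p 1 / 2) (- p \<i> / 2) * cis (2 * pi * of_int 1 * x))
    + f x * (Complex (p 1 / 2) (p \<i> / 2) * cis (2 * pi * of_int (- 1) * x))" for x
   unfolding distrib_left[symmetric] by (subst p) (simp add: complex_eq_iff)
  thus ?case using Vadd[OF Vmul[OF linear.prems] Vmul[OF linear.prems]] by (simp only:)
 next
  case (const c)
  thus ?case using Vmul[of f "of_real c" 0] by (simp add: cis_zero)
 next
  case (add p r)
  thus ?case using Vadd by (simp add: ring_distribs)
 next
  case (mult p r)
  show ?case using mult.IH(2)[OF mult.IH(1)[OF mult.prems]] by (simp add: mult.assoc)
 qed
 have Vg: "V g" unfolding V_def
 proof
  fix k show "((\<lambda>x. g x * cis (- (2 * pi * of_int k * x))) has_integral 0) {0..1}"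
   unfolding coef[of k, symmetric]
   by (intro integrable_integral integrable_continuous_real continuous_intros contg)
 qed
 define G where "G = (\<lambda>z. cnj (g (Arg2pi z / (2 * pi))))"
 have G: "G (cis (2 * pi * x)) = cnj (g x)" if x: "x \<in> {0..1}" for x
 proof (cases "x = 1")
  case False
  have "Arg2pi (cis (2 * pi * x)) = 2 * pi * x"
   by (rule Arg2pi_unique[of 1]) (use x False in \<open>auto simp: cis_conv_exp mult_ac\<close>)
  thus ?thesis by (simp add: G_def)
 qed (use per[of 0] in \<open>simp add: G_def Arg2pi_of_real[of 1, simplified]\<close>)
 \<comment> \<open>Continuity of the induced function on the circle, in particular at the base
   point, is read off from the correspondence between loops and circle maps, applied to the trivial
   homotopy of \<open>g\<close> with itself.\<close>
 have "homotopic_loops UNIV g g"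
  unfolding homotopic_loops_refl using contg per[of 0] by (simp add: path_def pathfinish_def pathstart_def)
 hence "continuous_on (sphere 0 1) (\<lambda>z. g (Arg2pi z / (2 * pi)))"
  using homotopic_with_imp_continuous[OF homotopic_loops_imp_homotopic_circlemaps, of UNIV g g] by (simp add: o_def)
 hence contG: "continuous_on (sphere 0 1) G" unfolding G_def by (rule continuous_on_cnj)
 define I where "I = integral {0..1} (\<lambda>x. g x * cnj (g x))"
 have I: "((\<lambda>x. g x * cnj (g x)) has_integral I) {0..1}"
  unfolding I_def by (intro integrable_integral integrable_continuous_real continuous_intros contg)
 obtain M where M: "\<And>x. x \<in> {0..1} ==> norm (g x) \<le> M" "M > 0"
  using compact_imp_bounded[OF compact_continuous_image[OF contg[of "{0..1}"]]] unfolding bounded_pos by (metis compact_Icc imageI)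
 have "norm I \<le> e * M" if e: "e > 0" for e
 proof -
  obtain p where p: "polynomial_function p" "\<And>z. z \<in> sphere 0 1 ==> norm (G z - p z) < e"
   using Stone_Weierstrass_polynomial_function[OF _ contG e] by auto
  have "V (\<lambda>x. g x * of_real (Re (p (cis (2 * pi * x)))) + g x * of_real (Im (p (cis (2 * pi * x)))) * (\<i> * cis (2 * pi * of_int 0 * x)))"
   using p(1) bounded_linear_Re bounded_linear_Im unfolding polynomial_function_def o_def
   by (intro Vadd Vmul Vpoly[of "\<lambda>z. Re (p z)"] Vpoly[of "\<lambda>z. Im (p z)"] Vg) blast+
  moreover have "g x * of_real (Re z) + g x * of_real (Im z) * (\<i> * cis (2 * pi * of_int 0 * x)) = g x * z" for x z
   by (simp add: complex_eq_iff algebra_simps)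
  ultimately have "((\<lambda>x. g x * p (cis (2 * pi * x))) has_integral 0) {0..1}"
   unfolding V_def by (auto dest: spec[of _ 0])
  hence "((\<lambda>x. g x * cnj (g x) - g x * p (cis (2 * pi * x))) has_integral (I - 0)) {0..1}" by (intro has_integral_diff I)
  hence "norm (I - 0) \<le> e * M * measure lborel {0..1::real}"
  proof (rule has_integral_bound_real[where S = "{}", rotated 2])
   fix x :: real assume "x \<in> {0..1} - {}"
   hence x: "x \<in> {0..1}" by simp
   have "norm (cnj (g x) - p (cis (2 * pi * x))) \<le> e" using p(2)[of "cis (2 * pi * x)"] G[OF x] by simp
   hence "norm (g x) * norm (cnj (g x) - p (cis (2 * pi * x))) \<le> M * e" using M x by (intro mult_mono) auto
   thus "norm (g x * cnj (g x) - g x * p (cis (2 * pi * x))) \<le> e * M"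
    by (simp add: right_diff_distrib[symmetric] norm_mult mult.commute)
  qed (use e M in auto)
  thus ?thesis by simp
 qed
 from this[of "norm I / (2 * M)"] have "I = 0" using M(2) by (cases "I = 0") auto
 hence "((\<lambda>x. (cmod (g x))\<^sup>2) has_integral 0) {0..1}"
  using has_integral_linear[OF I bounded_linear_Re] by (simp add: o_def cmod_power2 power2_eq_square[symmetric])
 moreover have "continuous_on {0..1} (\<lambda>x. (cmod (g x))\<^sup>2)" by (intro continuous_intros contg)
 ultimately have "g x = 0" if "x \<in> {0..1}" for x
  using integral_eq_0_iff[of 0 1 "\<lambda>x. (cmod (g x))\<^sup>2"] that by (simp add: integral_unique)
 moreover have "g (y + of_int i) = g y" for y i
  by (induction i rule: int_induct[where k = 0])
   (use per[of "y + of_int _"] per[of "y + of_int _ - 1"] in \<open>auto simp: algebra_simps\<close>)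
 from this[of "frac x" "\<lfloor>x\<rfloor>"] have "g x = g (frac x)" by (simp add: frac_def)
 ultimately show ?thesis using frac_ge_0[of x] frac_lt_1[of x] by simp
qed

lemma summable_on_int_inverse_square: "(\<lambda>j::int. 1 / (1 + real_of_int j ^ 2)) summable_on UNIV"
proof -
 have nat: "(\<lambda>n::nat. 1 / (1 + real n ^ 2)) summable_on UNIV"
 proof -
  have "summable (\<lambda>n::nat. 1 / (1 + real n ^ 2))"
  proof (rule summable_comparison_test_ev)
   show "summable (\<lambda>n::nat. inverse (real n ^ 2))" by (rule inverse_power_summable) simp
   show "\<forall>\<^sub>F n in sequentially. norm (1 / (1 + real n ^ 2)) \<le> inverse (real n ^ 2)"
    using eventually_gt_at_top[of 0] by eventually_elim (auto simp: inverse_eq_divide intro!: divide_left_mono mult_pos_pos add_pos_nonneg)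
  qed
  thus ?thesis by (subst summable_on_UNIV_nonneg_real_iff) auto
 qed
 have 1: "(\<lambda>j::int. 1 / (1 + real_of_int j ^ 2)) summable_on range int"
  by (subst summable_on_reindex) (use nat in \<open>auto simp: o_def\<close>)
 have 2: "(\<lambda>j::int. 1 / (1 + real_of_int j ^ 2)) summable_on range (\<lambda>n. - int n)"
  by (subst summable_on_reindex) (use nat in \<open>auto simp: o_def inj_on_def\<close>)
 have "(\<lambda>j::int. 1 / (1 + real_of_int j ^ 2)) summable_on range int \<union> range (\<lambda>n. - int n)"
  by (rule summable_on_union[OF 1 2])
 moreover have "range int \<union> range (\<lambda>n. - int n) = UNIV"
 proof -
  have "x \<in> range int \<union> range (\<lambda>n. - int n)" for x by (cases x rule: int_cases2) auto
  thus ?thesis by blast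
 qed
 ultimately show ?thesis by simp
qed

lemma translate_bound:
 fixes h :: "real \<Rightarrow> complex"
 assumes bound: "\<And>x. norm (h x) \<le> C / (1 + x^2)" and x: "\<bar>x\<bar> \<le> R"
 shows "norm (h (x + of_int j)) \<le> C * (2 + 2 * R^2) * (1 / (1 + real_of_int j ^ 2))"
proof -
 have C: "C \<ge> 0" using order_trans[OF norm_ge_zero bound[of 0]] by simp
 have R: "x^2 \<le> R^2" using x by (metis abs_ge_zero order_trans power2_abs power_mono)
 have "(real_of_int j)^2 \<le> 2 * (x + of_int j)^2 + 2 * x^2"
  using zero_le_power2[of "2 * x + of_int j"] by (simp add: power2_eq_square algebra_simps)
 moreover have p: "0 \<le> R^2 * (x + of_int j)^2" by simp
 moreover have "(2 + 2 * R^2) * (1 + (x + of_int j)^2) = 2 + 2 * (x + of_int j)^2 + 2 * R^2 + 2 * (R^2 * (x + of_int j)^2)"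
  by (simp add: ring_distribs)
 ultimately have "1 + (real_of_int j)^2 \<le> (2 + 2 * R^2) * (1 + (x + of_int j)^2)"
  using R by linarith
 moreover have "1 + (x + of_int j)^2 > 0" "1 + (real_of_int j)^2 > 0" by (auto intro: add_pos_nonneg)
 ultimately have "1 / (1 + (x + of_int j)^2) \<le> (2 + 2 * R^2) * (1 / (1 + real_of_int j ^ 2))"
  by (simp add: divide_simps mult.commute)
 from mult_left_mono[OF this C] bound[of "x + of_int j"] show ?thesis by (simp add: mult.assoc)
qed

lemma isCont_infsum_M_test:
 fixes f :: "'a \<Rightarrow> real \<Rightarrow> complex"
 assumes cont: "\<And>j. continuous_on UNIV (f j)"
  and le: "\<And>j y. \<bar>y\<bar> < R ==> norm (f j y) \<le> M j" and M: "M summable_on UNIV" and x: "\<bar>x\<bar> < R"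
 shows "isCont (\<lambda>x. \<Sum>\<^sub>\<infinity>j. f j x) x"
proof -
 have "uniform_limit {-R<..<R} (\<lambda>X y. \<Sum>j\<in>X. f j y) (\<lambda>y. \<Sum>\<^sub>\<infinity>j. f j y) (finite_subsets_at_top UNIV)"
  by (rule Weierstrass_m_test_general[OF _ M]) (use le in auto)
 moreover have "continuous_on {-R<..<R} (\<lambda>y. \<Sum>j\<in>X. f j y)" for X
  by (intro continuous_intros continuous_on_subset[OF cont]) auto
 ultimately have "continuous_on {-R<..<R} (\<lambda>y. \<Sum>\<^sub>\<infinity>j. f j y)"
  by (intro uniform_limit_theorem[where F = "finite_subsets_at_top UNIV"]) auto
 thus ?thesis using x by (simp add: continuous_on_eq_continuous_at abs_less_iff)
qed

lemma sum_unit_intervals: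
 fixes f :: "real \<Rightarrow> complex"
 assumes "continuous_on UNIV f"
 shows "(\<Sum>j\<in>{-int N..<int N}. integral {of_int j..of_int j + 1} f) = integral {-real N..real N} f"
proof (induction N)
 case (Suc N)
 have int: "f integrable_on {a..b}" for a b
  by (rule integrable_continuous_real) (use assms continuous_on_subset in blast)
 have "{-int (Suc N)..<int (Suc N)} = insert (-int N - 1) (insert (int N) {-int N..<int N})" by auto
 hence "(\<Sum>j\<in>{-int (Suc N)..<int (Suc N)}. integral {of_int j..of_int j + 1} f) =
  integral {-real N - 1..-real N} f + integral {real N..real N + 1} f + integral {-real N..real N} f"
  using Suc by simp
 also have "... = (integral {-real N - 1..-real N} f + integral {-real N..real N} f) + integral {real N..real N + 1} f" by simp
 also have "integral {-real N - 1..-real N} f + integral {-real N..real N} f = integral {-real N - 1..real N} f"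
  by (rule Henstock_Kurzweil_Integration.integral_combine) (use int in auto)
 also have "... + integral {real N..real N + 1} f = integral {-real N - 1..real N + 1} f"
  by (rule Henstock_Kurzweil_Integration.integral_combine) (use int in auto)
 finally have *: "(\<Sum>j\<in>{-int (Suc N)..<int (Suc N)}. integral {of_int j..of_int j + 1} f) = integral {-real N - 1..real N + 1} f" .
 have "- real (Suc N) = - real N - 1" "real (Suc N) = real N + 1" by simp_all
 with * show ?case by (simp only:)
qed simp

text \<open>Serves both sides of Poisson's formula: once for the translates of \<open>h\<close>,
  once for the Fourier series itself.\<close>

lemma infsum_fourier_coefficient:
 fixes f :: "'a \<Rightarrow> real \<Rightarrow> complex"
 assumes cont: "\<And>j. continuous_on {0..1} (f j)" and e: "continuous_on {0..1} e"
  and le: "\<And>j x. \<bar>x\<bar> \<le> 1 ==> norm (f j x) \<le> M j" and M: "M summable_on UNIV"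
 shows "(\<lambda>x. (\<Sum>\<^sub>\<infinity>j. f j x) * e x) integrable_on {0..1}"
  "((\<lambda>j. integral {0..1} (\<lambda>x. f j x * e x)) has_sum integral {0..1} (\<lambda>x. (\<Sum>\<^sub>\<infinity>j. f j x) * e x)) UNIV"
proof -
 define g where "g = (\<lambda>x. \<Sum>\<^sub>\<infinity>j. f j x)"
 have ul: "uniform_limit {0..1} (\<lambda>X x. \<Sum>j\<in>X. f j x) g (finite_subsets_at_top UNIV)"
  unfolding g_def by (rule Weierstrass_m_test_general[OF le M]) auto
 have contg: "continuous_on {0..1} g"
  by (rule uniform_limit_theorem[OF _ ul]) (auto intro!: continuous_intros cont)
 have "uniform_limit {0..1} (\<lambda>X x. (\<Sum>j\<in>X. f j x) * e x) (\<lambda>x. g x * e x) (finite_subsets_at_top UNIV)"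
  by (rule uniform_lim_mult[OF ul uniform_limit_const])
   (intro compact_imp_bounded compact_continuous_image contg e compact_Icc)+
 then obtain I J where IJ: "\<And>X. ((\<lambda>x. (\<Sum>j\<in>X. f j x) * e x) has_integral I X) {0..1}"
  "((\<lambda>x. g x * e x) has_integral J) {0..1}" "(I \<longlongrightarrow> J) (finite_subsets_at_top UNIV)"
  by (rule uniform_limit_integral) (auto intro!: continuous_intros cont e)
 have "I = sum (\<lambda>j. integral {0..1} (\<lambda>x. f j x * e x))"
 proof (intro ext has_integral_unique[OF IJ(1)])
  fix X
  have "((\<lambda>x. \<Sum>j\<in>X. f j x * e x) has_integral (\<Sum>j\<in>X. integral {0..1} (\<lambda>x. f j x * e x))) {0..1}"
  proof (cases "finite X")
   case True
   thus ?thesis by (intro has_integral_sum integrable_integral integrable_continuous_real continuous_intros cont e)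
  qed simp
  thus "((\<lambda>x. (\<Sum>j\<in>X. f j x) * e x) has_integral (\<Sum>j\<in>X. integral {0..1} (\<lambda>x. f j x * e x))) {0..1}"
   by (simp only: sum_distrib_right)
 qed
 thus "((\<lambda>j. integral {0..1} (\<lambda>x. f j x * e x)) has_sum integral {0..1} (\<lambda>x. (\<Sum>\<^sub>\<infinity>j. f j x) * e x)) UNIV"
  "(\<lambda>x. (\<Sum>\<^sub>\<infinity>j. f j x) * e x) integrable_on {0..1}"
  using IJ(2,3) unfolding has_sum_def g_def by (auto simp: has_integral_iff)
qed

text \<open>Both sides are continuous, have period 1 and the same Fourier coefficients. The
  transform at \<open>k\<close> is required only as a limit over \<open>[-N, N]\<close>: this is
  what summing over unit intervals produces, and for the odd Gaussian it is accessible to the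
  fundamental theorem of calculus.\<close>

lemma poisson_summation:
 fixes h :: "real \<Rightarrow> complex" and c :: "int \<Rightarrow> complex"
 assumes cont: "continuous_on UNIV h" and bound: "\<And>x. norm (h x) \<le> C / (1 + x^2)"
  and coef: "\<And>k. (\<lambda>N. integral {-real N..real N} (\<lambda>x. h x * cis (-(2 * pi * of_int k * x)))) \<longlonglongrightarrow> c k"
  and summ: "(\<lambda>k. norm (c k)) summable_on UNIV"
 shows "(\<Sum>\<^sub>\<infinity>j. h (x + of_int j)) = (\<Sum>\<^sub>\<infinity>k. c k * cis (2 * pi * of_int k * x))"
proof -
 define P where "P = (\<lambda>x. \<Sum>\<^sub>\<infinity>j. h (x + of_int j))"
 define Q where "Q = (\<lambda>x. \<Sum>\<^sub>\<infinity>k. c k * cis (2 * pi * of_int k * x))"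
 have P_x: "P x = (\<Sum>\<^sub>\<infinity>j. h (x + of_int j))" and Q_x: "Q x = (\<Sum>\<^sub>\<infinity>k. c k * cis (2 * pi * of_int k * x))" for x
  by (simp_all add: P_def Q_def)
 have conth: "continuous_on A (\<lambda>x. h (x + a))" for A a
  by (intro continuous_on_compose2[OF cont] continuous_intros) auto
 have summM: "(\<lambda>j::int. K * (1 / (1 + real_of_int j ^ 2))) summable_on UNIV" for K
  by (intro summable_on_cmult_right summable_on_int_inverse_square)
 have P: "isCont P x" for x unfolding P_def
  by (rule isCont_infsum_M_test[where R = "\<bar>x\<bar> + 1" and M = "\<lambda>j. C * (2 + 2 * (\<bar>x\<bar> + 1)^2) * (1 / (1 + real_of_int j ^ 2))"])
   (use translate_bound[OF bound] summM conth in auto)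
 have Q: "isCont Q x" for x unfolding Q_def
  by (rule isCont_infsum_M_test[where R = "\<bar>x\<bar> + 1" and M = "\<lambda>k. norm (c k)"])
   (auto simp: norm_mult intro!: summ continuous_intros)
 have perP: "P (x + 1) = P x" for x
  unfolding P_def
  by (rule infsum_reindex_bij_witness[where i = "\<lambda>j. j + 1" and j = "\<lambda>j. j - 1", symmetric]) (auto simp: algebra_simps)
 have perQ: "Q (x + 1) = Q x" for x
 proof -
  have "cis (2 * pi * of_int k * (x + 1)) = cis (2 * pi * of_int k * x)" for k
  proof -
   have "cis (2 * pi * of_int k * (x + 1)) = cis (2 * pi * of_int k * x) * cis (2 * pi * of_int k)"
    by (simp add: cis_mult algebra_simps)
   thus ?thesis using cis_multiple_2pi[of "of_int k"] by simp
  qed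
  thus ?thesis by (simp add: Q_def)
 qed
 have coefP: "integral {0..1} (\<lambda>x. P x * cis (-(2 * pi * of_int k * x))) = c k"
  "(\<lambda>x. P x * cis (-(2 * pi * of_int k * x))) integrable_on {0..1}" for k
 proof -
  define e where "e = (\<lambda>x::real. cis (-(2 * pi * of_int k * x)))"
  have e_shift: "e (x + of_int j) = e x" for x j
  proof -
   have "e (x + of_int j) = e x * cis (2 * pi * of_int (- k * j))" by (simp add: e_def cis_mult algebra_simps)
   thus ?thesis using cis_multiple_2pi[of "of_int (- k * j)"] by (metis Ints_of_int mult.right_neutral)
  qed
  have conte: "continuous_on A e" for A unfolding e_def by (intro continuous_intros)
  note * = infsum_fourier_coefficient[OF conth conte translate_bound[OF bound, where R = 1] summM, folded P_x]
  have "integral {0..1} (\<lambda>x. h (x + of_int j) * e x) = integral {of_int j..of_int j + 1} (\<lambda>u. h u * e u)" for j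
   using integral_shift_real_ivl[of "of_int j" "of_int j" "of_int j + 1" "\<lambda>u. h u * e u"]
   by (simp add: add.commute e_shift)
  hence "((\<lambda>j. integral {of_int j..of_int j + 1} (\<lambda>u. h u * e u)) has_sum integral {0..1} (\<lambda>x. P x * e x)) UNIV"
   using *(2) by simp
  moreover have "filterlim (\<lambda>N. {-int N..<int N}) (finite_subsets_at_top UNIV) sequentially"
   unfolding filterlim_finite_subsets_at_top
  proof safe
   fix X :: "int set" assume X: "finite X"
   then obtain B where B: "\<And>x. x \<in> X ==> \<bar>x\<bar> \<le> B"
    by (metis Max_ge finite_imageI image_eqI)
   show "\<forall>\<^sub>F N in sequentially. finite {-int N..<int N} \<and> X \<subseteq> {-int N..<int N} \<and> {-int N..<int N} \<subseteq> UNIV"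
    using eventually_gt_at_top[of "nat B"]
    by eventually_elim (use B in \<open>force simp: abs_le_iff\<close>)
  qed
  ultimately have "(\<lambda>N. \<Sum>j\<in>{-int N..<int N}. integral {of_int j..of_int j + 1} (\<lambda>u. h u * e u)) \<longlonglongrightarrow> integral {0..1} (\<lambda>x. P x * e x)"
   unfolding has_sum_def by (rule filterlim_compose)
  hence "(\<lambda>N. integral {-real N..real N} (\<lambda>u. h u * e u)) \<longlonglongrightarrow> integral {0..1} (\<lambda>x. P x * e x)"
   by (subst (asm) sum_unit_intervals) (intro continuous_intros conte cont)
  with coef[of k] show "integral {0..1} (\<lambda>x. P x * cis (-(2 * pi * of_int k * x))) = c k"
   unfolding e_def by (rule LIMSEQ_unique[THEN sym])
  show "(\<lambda>x. P x * cis (-(2 * pi * of_int k * x))) integrable_on {0..1}" using *(1) by (simp add: e_def)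
 qed
 have coefQ: "integral {0..1} (\<lambda>x. Q x * cis (-(2 * pi * of_int l * x))) = c l"
  "(\<lambda>x. Q x * cis (-(2 * pi * of_int l * x))) integrable_on {0..1}" for l
 proof -
  define e where "e = (\<lambda>x::real. cis (-(2 * pi * of_int l * x)))"
  have *: "(\<lambda>x. Q x * e x) integrable_on {0..1}"
   "((\<lambda>k. integral {0..1} (\<lambda>x. c k * cis (2 * pi * of_int k * x) * e x)) has_sum integral {0..1} (\<lambda>x. Q x * e x)) UNIV"
   unfolding Q_x by (rule infsum_fourier_coefficient[OF _ _ _ summ]; auto simp: norm_mult e_def intro!: continuous_intros)+
  have eq: "c k * cis (2 * pi * of_int k * x) * e x = c k * cis (2 * pi * of_int (k - l) * x)" for k x
   by (simp add: e_def mult.assoc cis_mult) (simp add: algebra_simps)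
  have "integral {0..1} (\<lambda>x. c k * cis (2 * pi * of_int k * x) * e x) = c k * (if k - l = 0 then 1 else 0)" for k
   unfolding integral_cis_int[symmetric] eq by simp
  hence "((\<lambda>k. c k * (if k - l = 0 then 1 else 0)) has_sum integral {0..1} (\<lambda>x. Q x * e x)) UNIV"
   using *(2) by simp
  moreover have "((\<lambda>k. c k * (if k - l = 0 then 1 else 0)) has_sum c l) UNIV"
   by (rule has_sum_finite_neutralI[of "{l}"]) auto
  ultimately show "integral {0..1} (\<lambda>x. Q x * cis (-(2 * pi * of_int l * x))) = c l"
   unfolding e_def by (rule has_sum_unique)
  show "(\<lambda>x. Q x * cis (-(2 * pi * of_int l * x))) integrable_on {0..1}"
   using *(1) by (simp add: e_def)
 qed
 have "P x - Q x = 0"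
 proof (rule fourier_uniqueness)
  show "continuous_on UNIV (\<lambda>x. P x - Q x)"
   by (intro continuous_at_imp_continuous_on ballI continuous_diff P Q)
  show "P (x + 1) - Q (x + 1) = P x - Q x" for x by (simp add: perP perQ)
  show "integral {0..1} (\<lambda>x. (P x - Q x) * cis (- (2 * pi * of_int k * x))) = 0" for k
   unfolding left_diff_distrib by (subst integral_diff) (use coefP coefQ in auto)
 qed
 thus ?thesis by (simp add: P_def Q_def)
qed

text \<open>The characteristic function of the standard normal distribution, rescaled by
  \<open>c\<close> so that \<open>(c * u)^2 / 2 = pi * T * u^2\<close>.\<close>

lemma gaussian_fourier:
 assumes T: "T > 0"
 shows "integrable lborel (\<lambda>u. of_real (exp (- pi * T * u^2)) * cis (- (2 * pi * k * u)))"
  "(LINT u|lborel. of_real (exp (- pi * T * u^2)) * cis (- (2 * pi * k * u))) = of_real (exp (- pi * k^2 / T) / sqrt T)"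
proof -
 define c where "c = sqrt (2 * pi * T)"
 have c: "c > 0" "c^2 = 2 * pi * T" using T by (auto simp: c_def)
 define t where "t = - (2 * pi * k) / c"
 define f where "f = (\<lambda>x. std_normal_density x *\<^sub>R iexp (t * x))"
 have int_sn: "integrable lborel std_normal_density"
  using integrable_std_normal_moment[of 0] by simp
 have intf: "integrable lborel f"
  unfolding f_def
  by (rule Bochner_Integration.integrable_bound[OF int_sn]) (auto simp: norm_mult)
 have "char std_normal_distribution t = (LINT x|lborel. f x)"
  unfolding char_def f_def by (subst integral_density) (auto simp: normal_density_nonneg)
 hence val: "(LINT x|lborel. f x) = of_real (exp (- t\<^sup>2 / 2))"
  by (simp add: char_std_normal_distribution)
 have fc: "f (0 + c * u) = of_real (1 / sqrt (2 * pi)) * (of_real (exp (- pi * T * u^2)) * cis (- (2 * pi * k * u)))" for u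
 proof -
  have "std_normal_density (c * u) = 1 / sqrt (2 * pi) * exp (- pi * T * u^2)"
   by (simp add: std_normal_density_def power_mult_distrib c(2))
  moreover have "iexp (t * (c * u)) = cis (- (2 * pi * k * u))"
   using c(1) by (simp add: cis_conv_exp t_def mult.assoc)
  ultimately show ?thesis by (simp add: f_def scaleR_conv_of_real mult.assoc)
 qed
 have "integrable lborel (\<lambda>u. f (0 + c * u))"
  using intf c(1) by (subst lborel_integrable_real_affine_iff) auto
 hence "integrable lborel (\<lambda>u. of_real (sqrt (2 * pi)) * f (0 + c * u))" by (rule integrable_mult_right)
 thus "integrable lborel (\<lambda>u. of_real (exp (- pi * T * u^2)) * cis (- (2 * pi * k * u)))"
 proof -
  have "of_real (sqrt (2 * pi)) * f (0 + c * u) = of_real (exp (- pi * T * u^2)) * cis (- (2 * pi * k * u))" for u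
   unfolding fc by simp
  with \<open>integrable lborel (\<lambda>u. of_real (sqrt (2 * pi)) * f (0 + c * u))\<close> show ?thesis by simp
 qed
 have "(LINT x|lborel. f x) = \<bar>c\<bar> *\<^sub>R (LINT u|lborel. f (0 + c * u))"
  by (rule lborel_integral_real_affine) (use c in auto)
 also have "... = of_real (c / sqrt (2 * pi)) * (LINT u|lborel. of_real (exp (- pi * T * u^2)) * cis (- (2 * pi * k * u)))"
  unfolding fc using c by (simp add: scaleR_conv_of_real)
 also have "c / sqrt (2 * pi) = sqrt T" by (simp add: c_def real_sqrt_mult)
 finally have "of_real (sqrt T) * (LINT u|lborel. of_real (exp (- pi * T * u^2)) * cis (- (2 * pi * k * u))) = of_real (exp (- t\<^sup>2 / 2))"
  using val by simp
 moreover have "t^2 / 2 = pi * k^2 / T"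
  using T by (simp add: t_def power_divide c(2) power_mult_distrib) (simp add: power2_eq_square field_simps)
 ultimately show "(LINT u|lborel. of_real (exp (- pi * T * u^2)) * cis (- (2 * pi * k * u))) = of_real (exp (- pi * k^2 / T) / sqrt T)"
  using T by (simp add: field_simps)
qed

lemma tendsto_integral_symmetric:
 fixes f :: "real \<Rightarrow> complex"
 assumes int: "integrable lborel f"
 shows "(\<lambda>N. integral {-real N..real N} f) \<longlonglongrightarrow> (LINT x|lborel. f x)"
proof -
 have "(\<lambda>N. LINT x|lborel. indicator {-real N..real N} x *\<^sub>R f x) \<longlonglongrightarrow> (LINT x|lborel. f x)"
 proof (rule integral_dominated_convergence[where w = "\<lambda>x. norm (f x)"])
  show "AE x in lborel. (\<lambda>N. indicator {-real N..real N} x *\<^sub>R f x) \<longlonglongrightarrow> f x"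
  proof (rule AE_I2)
   fix x :: real
   have "\<forall>\<^sub>F N in sequentially. indicator {-real N..real N} x *\<^sub>R f x = f x"
    using eventually_ge_at_top[of "nat \<lceil>\<bar>x\<bar>\<rceil>"]
    by eventually_elim (auto simp: indicator_def nat_ceiling_le_eq abs_le_iff)
   thus "(\<lambda>N. indicator {-real N..real N} x *\<^sub>R f x) \<longlonglongrightarrow> f x" by (rule tendsto_eventually)
  qed
 qed (use int in \<open>auto simp: indicator_def\<close>)
 moreover have "(LINT x|lborel. indicator {-real N..real N} x *\<^sub>R f x) = integral {-real N..real N} f" for N
  using set_borel_integral_eq_integral(2)[of "{-real N..real N}" f] int
  by (simp add: set_lebesgue_integral_def set_integrable_def integrable_mult_indicator)
 ultimately show ?thesis by simp
qed

lemma gaussian_coef: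
 assumes T: "T > 0"
 shows "(\<lambda>N. integral {-real N..real N} (\<lambda>u. of_real (exp (- pi * T * u^2)) * cis (- (2 * pi * k * u))))
  \<longlonglongrightarrow> of_real (exp (- pi * k^2 / T) / sqrt T)"
 using tendsto_integral_symmetric[OF gaussian_fourier(1)[OF T, of k]] gaussian_fourier(2)[OF T, of k] by simp

text \<open>Integrating the derivative of \<open>E\<close> over \<open>[-N, N]\<close> leaves
  boundary terms that vanish in the limit, so the odd coefficient is a multiple of the even
  one.\<close>

lemma gaussian_odd_coef:
 assumes T: "T > 0"
 shows "(\<lambda>N. integral {-real N..real N} (\<lambda>u. of_real (u * exp (- pi * T * u^2)) * cis (- (2 * pi * k * u))))
  \<longlonglongrightarrow> - \<i> * of_real (k / T * (exp (- pi * k^2 / T) / sqrt T))"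
proof -
 define E where "E = (\<lambda>u. complex_of_real (exp (- pi * T * u^2)) * cis (- (2 * pi * k * u)))"
 define J where "J = (\<lambda>N. integral {-real N..real N} E)"
 define I where "I = (\<lambda>N. integral {-real N..real N} (\<lambda>u. of_real u * E u))"
 have contE: "continuous_on A E" for A unfolding E_def by (intro continuous_intros)
 have Eder: "(E has_vector_derivative (of_real (- 2 * pi * T) * (of_real u * E u) - 2 * pi * k * \<i> * E u)) (at u within S)" for u S
 proof -
  define c where "c = - (\<i> * of_real (2 * pi * k))"
  have cis: "cis (- (2 * pi * k * u)) = exp (c * of_real u)" for u
   by (simp add: c_def cis_conv_exp mult_ac)
  have 1: "((\<lambda>u. exp (c * of_real u)) has_vector_derivative c * exp (c * of_real u)) (at u within S)"
   by (rule has_vector_derivative_real_field) (auto intro!: derivative_eq_intros)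
  have "((\<lambda>u. exp (- pi * T * u^2)) has_real_derivative exp (- pi * T * u^2) * (- 2 * pi * T * u)) (at u within S)"
   by (auto intro!: derivative_eq_intros)
  hence 2: "((\<lambda>u. complex_of_real (exp (- pi * T * u^2))) has_vector_derivative
    of_real (exp (- pi * T * u^2) * (- 2 * pi * T * u))) (at u within S)"
   by (intro has_vector_derivative_of_real) (simp add: has_real_derivative_iff_has_vector_derivative)
  have "(E has_vector_derivative (complex_of_real (exp (- pi * T * u^2)) * (c * exp (c * of_real u))
    + of_real (exp (- pi * T * u^2) * (- 2 * pi * T * u)) * exp (c * of_real u))) (at u within S)"
   unfolding E_def cis by (rule has_vector_derivative_mult[OF 2 1])
  hence "(E has_vector_derivative (complex_of_real (exp (- pi * T * u^2)) * (c * cis (- (2 * pi * k * u)))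
    + of_real (exp (- pi * T * u^2) * (- 2 * pi * T * u)) * cis (- (2 * pi * k * u)))) (at u within S)"
   unfolding cis .
  moreover have "complex_of_real (exp (- pi * T * u^2)) * (c * cis (- (2 * pi * k * u)))
    + of_real (exp (- pi * T * u^2) * (- 2 * pi * T * u)) * cis (- (2 * pi * k * u))
   = of_real (- 2 * pi * T) * (of_real u * E u) - 2 * pi * k * \<i> * E u"
   by (simp add: E_def c_def algebra_simps)
  ultimately show ?thesis by simp
 qed
 have FTC: "of_real (- 2 * pi * T) * I N - 2 * pi * k * \<i> * J N = E (real N) - E (- real N)" for N
 proof -
  have "((\<lambda>u. of_real (- 2 * pi * T) * (of_real u * E u) - 2 * pi * k * \<i> * E u) has_integral (E (real N) - E (- real N))) {-real N..real N}"
   by (rule fundamental_theorem_of_calculus) (use Eder in auto)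
  moreover have "((\<lambda>u. of_real (- 2 * pi * T) * (of_real u * E u) - 2 * pi * k * \<i> * E u) has_integral
    (of_real (- 2 * pi * T) * I N - 2 * pi * k * \<i> * J N)) {-real N..real N}"
   unfolding I_def J_def
   by (intro has_integral_diff has_integral_mult_right integrable_integral integrable_continuous_real continuous_intros contE)
  ultimately show ?thesis using has_integral_unique by blast
 qed
 have E0: "(\<lambda>N. E (real N)) \<longlonglongrightarrow> 0" "(\<lambda>N. E (- real N)) \<longlonglongrightarrow> 0"
 proof -
  have lim: "(\<lambda>N. exp (- pi * T * (real N)^2)) \<longlonglongrightarrow> 0" using T by real_asymp
  show "(\<lambda>N. E (real N)) \<longlonglongrightarrow> 0"
   by (rule Lim_null_comparison[OF always_eventually lim]) (simp add: E_def norm_mult)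
  show "(\<lambda>N. E (- real N)) \<longlonglongrightarrow> 0"
   by (rule Lim_null_comparison[OF always_eventually lim]) (simp add: E_def norm_mult)
 qed
 have "J \<longlonglongrightarrow> of_real (exp (- pi * k^2 / T) / sqrt T)"
  unfolding J_def E_def by (rule gaussian_coef[OF T])
 hence "(\<lambda>N. (E (real N) - E (- real N) + 2 * pi * k * \<i> * J N) / of_real (- 2 * pi * T)) \<longlonglongrightarrow>
  (0 - 0 + 2 * pi * k * \<i> * of_real (exp (- pi * k^2 / T) / sqrt T)) / of_real (- 2 * pi * T)"
  by (intro tendsto_intros E0) (use T in auto)
 moreover have "(E (real N) - E (- real N) + 2 * pi * k * \<i> * J N) / of_real (- 2 * pi * T) = I N" for N
  unfolding FTC[symmetric] using T by simp
 moreover have "(0 - 0 + 2 * pi * k * \<i> * of_real (exp (- pi * k^2 / T) / sqrt T)) / of_real (- 2 * pi * T)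
  = - \<i> * of_real (k / T * (exp (- pi * k^2 / T) / sqrt T))"
  using T by (simp add: field_simps)
 ultimately have "I \<longlonglongrightarrow> - \<i> * of_real (k / T * (exp (- pi * k^2 / T) / sqrt T))" by simp
 thus ?thesis by (simp add: I_def E_def mult.assoc)
qed

section \<open>Theta functions of real characters\<close>

lemma has_sum_finite_sum:
 fixes f :: "'b \<Rightarrow> 'a \<Rightarrow> complex"
 assumes "finite B" "\<And>b. b \<in> B ==> (f b has_sum S b) A"
 shows "((\<lambda>k. \<Sum>b\<in>B. f b k) has_sum (\<Sum>b\<in>B. S b)) A"
 using assms by (induction B rule: finite_induct) (auto intro!: has_sum_add)

text \<open>\<open>a\<close> is 0 for an even and 1 for an odd character, and \<open>tau\<close> is
  its Gauss sum. Primitivity enters through \<open>gauss\<close>, which is assumed also for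
  \<open>k\<close> not prime to \<open>m\<close>, and through \<open>norm_tau\<close>.\<close>

locale real_primitive_character =
 fixes m :: nat and psi :: "nat \<Rightarrow> real" and a :: nat and tau :: complex
 assumes m: "m > 1" and period: "\<And>n. psi (n + m) = psi n"
  and chi_mult: "\<And>k n. psi (k * n) = psi k * psi n"
  and chi_zero: "\<And>n. psi n = 0 \<longleftrightarrow> \<not> coprime n m"
  and chi_sign: "\<And>n. psi n \<noteq> 0 ==> psi n = 1 \<or> psi n = -1"
  and a01: "a = 0 \<or> a = 1"
  and parity: "\<And>n. n \<le> m ==> psi (m - n) = (-1) ^ a * psi n"
  and gauss: "\<And>k. (\<Sum>b<m. of_real (psi b) * cis (2 * pi * real k * real b / real m)) = tau * of_real (psi k)"
  and norm_tau: "norm tau = sqrt (real m)"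
begin

definition X :: "int \<Rightarrow> real" where "X k = psi (nat (k mod int m))"

text \<open>Half of the theta series over all integers: the parity \<open>a\<close> makes the terms
  at \<open>n\<close> and \<open>- n\<close> equal.\<close>

definition omega :: "real \<Rightarrow> real" where
 "omega t = (\<Sum>n. psi n * real n ^ a * exp (- pi * (real n)^2 * t / m))"

text \<open>The root number. Conjugating the Gauss sum shows the quotient to be real, and its
  absolute value is 1, so it is a sign.\<close>

definition kappa :: real where "kappa = Re ((- \<i>) ^ a * tau / sqrt m)"

lemma m_pos: "m > 0" "real m > 0" using m by auto

lemma chi_0: "psi 0 = 0" using m by (simp add: chi_zero)

lemma chi_1: "psi 1 = 1"
 using chi_mult[of 1 1] chi_sign[of 1] by (simp add: chi_zero)

lemma abs_chi_le: "\<bar>psi n\<bar> \<le> 1"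
 using chi_sign[of n] by (cases "psi n = 0") auto

lemma chi_add_mult: "psi (n + m * k) = psi n"
proof (induction k)
 case (Suc k)
 have "psi (n + m * Suc k) = psi ((n + m * k) + m)" by (simp add: algebra_simps)
 thus ?case using period Suc by simp
qed simp

lemma chi_mod: "psi (n mod m) = psi n"
 using chi_add_mult[of "n mod m" "n div m"] by (simp add: mod_mult_div_eq)

lemma X_nat: "X (int n) = psi n"
 by (simp add: X_def zmod_int[symmetric] chi_mod)

lemma X_bn: "b < m ==> X (int m * j + int b) = psi b"
 by (simp add: X_def)

lemma abs_X_le: "\<bar>X k\<bar> \<le> 1" by (simp add: X_def abs_chi_le)

lemma X_uminus: "X (- k) = (-1) ^ a * X k"
proof -
 define b where "b = nat (k mod int m)"
 have b: "int b = k mod int m" "b < m" using m by (auto simp: b_def nat_less_iff)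
 show ?thesis
 proof (cases "b = 0")
  case True
  hence "k mod int m = 0" "(- k) mod int m = 0" using b by (auto simp: mod_0_imp_dvd)
  thus ?thesis by (simp add: X_def chi_0)
 next
  case False
  hence "(- k) mod int m = int m - k mod int m" using b by (simp add: zmod_zminus1_eq_if)
  hence "nat ((- k) mod int m) = m - b" using b by (simp add: nat_diff_distrib b_def)
  thus ?thesis using parity[of b] b by (simp add: X_def b_def)
 qed
qed

lemma gauss_int: "(\<Sum>b<m. of_real (psi b) * cis (2 * pi * of_int k * (real b / real m))) = tau * of_real (X k)"
proof -
 define r where "r = nat (k mod int m)"
 have r: "k = int m * (k div int m) + int r" using m by (simp add: r_def)
 have "cis (2 * pi * of_int k * (real b / real m)) = cis (2 * pi * real r * real b / real m)" for b
 proof -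
  have "real_of_int k = real m * of_int (k div int m) + real r"
   by (subst r) simp
  hence "2 * pi * of_int k * (real b / real m) = 2 * pi * real r * real b / real m + 2 * pi * of_int (k div int m * int b)"
   using m_pos by (simp add: field_simps)
  hence "cis (2 * pi * of_int k * (real b / real m)) = cis (2 * pi * real r * real b / real m) * cis (2 * pi * of_int (k div int m * int b))"
   by (simp only: cis_mult)
  moreover have "cis (2 * pi * of_int (k div int m * int b)) = 1" by (rule cis_multiple_2pi) (rule Ints_of_int)
  ultimately show ?thesis by simp
 qed
 thus ?thesis using gauss[of r] by (simp add: X_def r_def)
qed

lemma tau_conj: "cnj tau = (-1) ^ a * tau"
proof -
 have t: "tau = (\<Sum>b<m. of_real (psi b) * cis (2 * pi * of_int 1 * (real b / real m)))"
  by (subst gauss_int) (use X_nat[of 1] chi_1 in simp)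
 have "cnj tau = (\<Sum>b<m. of_real (psi b) * cis (2 * pi * of_int (- 1) * (real b / real m)))"
  by (subst t) (simp add: cis_cnj)
 also have "... = tau * of_real (X (- 1))" by (rule gauss_int)
 also have "X (- 1) = (-1) ^ a" using X_uminus[of 1] X_nat[of 1] chi_1 by simp
 finally show ?thesis by (simp add: mult.commute)
qed

lemma kappa: "(- \<i>) ^ a * tau / sqrt m = of_real kappa" "kappa = 1 \<or> kappa = -1"
proof -
 define z where "z = (- \<i>) ^ a * tau / sqrt m"
 have "cnj z = z" using a01 tau_conj by (auto simp: z_def)
 hence z: "z = of_real kappa" by (simp add: kappa_def z_def[symmetric] complex_eq_iff)
 thus "(- \<i>) ^ a * tau / sqrt m = of_real kappa" by (simp add: z_def)
 have "norm z = 1" using m_pos by (simp add: z_def norm_mult norm_divide norm_power norm_tau)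
 thus "kappa = 1 \<or> kappa = -1" by (simp add: z abs_if split: if_splits)
qed

text \<open>Decay like \<open>1 / (1 + u^2)\<close> is all that Poisson summation asks for, so the
  quadratic Taylor bound for \<open>exp\<close> suffices. The constant comes from
  \<open>2 + 2 * x^2 \<le> (2 + 4 / c^2) * (1 + c^2 * x^2 / 2)\<close>.\<close>

lemma gaussian_bound:
 assumes "T > 0"
 shows "\<bar>u ^ a * exp (- pi * T * u^2)\<bar> \<le> (2 + 4 / (pi * T)^2) / (1 + u^2)"
proof -
 define c x where "c = pi * T" and "x = u^2"
 have c: "c > 0" and x: "x \<ge> 0" using assms by (auto simp: c_def x_def)
 have ua: "\<bar>u ^ a\<bar> \<le> 1 + x"
 proof -
  have "2 * \<bar>u\<bar> \<le> 1 + x" using zero_le_power2[of "\<bar>u\<bar> - 1"] by (simp add: x_def power2_eq_square algebra_simps)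
  thus ?thesis using a01 x by auto
 qed
 have "1 + (c * x) + (c * x)^2 / 2 \<le> exp (c * x)" by (rule exp_lower_Taylor_quadratic) (use c x in auto)
 hence e: "1 + c^2 * x^2 / 2 \<le> exp (c * x)" using c x by (simp add: power_mult_distrib) (smt (verit) mult_nonneg_nonneg)
 have "(1 + x)^2 \<le> 2 + 2 * x^2" using zero_le_power2[of "1 - x"] by (simp add: power2_eq_square algebra_simps)
 also have "... \<le> (2 + 4 / c^2) * (1 + c^2 * x^2 / 2)" using c by (simp add: field_simps)
 also have "... \<le> (2 + 4 / c^2) * exp (c * x)" by (rule mult_left_mono[OF e]) simp
 finally have A: "(1 + x)^2 * exp (- (c * x)) \<le> 2 + 4 / c^2" by (simp add: exp_minus field_simps)
 have "\<bar>u ^ a\<bar> * exp (- (c * x)) \<le> (1 + x) * exp (- (c * x))" by (rule mult_right_mono[OF ua]) simp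
 hence "\<bar>u ^ a\<bar> * exp (- (c * x)) * (1 + x) \<le> (1 + x) * exp (- (c * x)) * (1 + x)"
  by (rule mult_right_mono) (use x in simp)
 also have "(1 + x) * exp (- (c * x)) * (1 + x) = (1 + x)^2 * exp (- (c * x))" by (simp add: power2_eq_square)
 also note A
 finally have "\<bar>u ^ a\<bar> * exp (- (c * x)) * (1 + x) \<le> 2 + 4 / c^2" .
 moreover have "0 < 1 + u^2" by (intro add_pos_nonneg) auto
 moreover have "\<bar>u ^ a * exp (- pi * T * u^2)\<bar> = \<bar>u ^ a\<bar> * exp (- (c * x))" by (simp add: abs_mult c_def x_def)
 ultimately show ?thesis by (simp only: pos_le_divide_eq c_def x_def)
qed

lemma theta_abs_summable:
 assumes "t > 0"
 shows "(\<lambda>k::int. norm (X k * of_int k ^ a * exp (- pi * (of_int k)^2 * t))) summable_on UNIV"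
proof (rule summable_on_comparison_test)
 show "(\<lambda>k::int. (2 + 4 / (pi * t)^2) * (1 / (1 + real_of_int k ^ 2))) summable_on UNIV"
  by (intro summable_on_cmult_right summable_on_int_inverse_square)
 fix k :: int
 have "norm (X k * of_int k ^ a * exp (- pi * (of_int k)^2 * t)) \<le> 1 * \<bar>of_int k ^ a * exp (- pi * t * (of_int k)^2)\<bar>"
  unfolding real_norm_def abs_mult mult.assoc by (intro mult_mono abs_X_le) (auto simp: mult_ac)
 also have "... \<le> (2 + 4 / (pi * t)^2) * (1 / (1 + real_of_int k ^ 2))"
  using gaussian_bound[OF assms, of "of_int k"] by simp
 finally show "norm (X k * of_int k ^ a * exp (- pi * (of_int k)^2 * t)) \<le> (2 + 4 / (pi * t)^2) * (1 / (1 + real_of_int k ^ 2))" .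
qed simp

lemma theta_int_eq_nat:
 assumes t: "t > 0"
 shows "(\<Sum>\<^sub>\<infinity>k. X k * of_int k ^ a * exp (- pi * (of_int k)^2 * t / m)) = 2 * omega t"
  "summable (\<lambda>n. \<bar>psi n * real n ^ a * exp (- pi * (real n)^2 * t / m)\<bar>)"
proof -
 define f where "f = (\<lambda>k::int. X k * of_int k ^ a * exp (- pi * (of_int k)^2 * t / m))"
 have abs: "(\<lambda>x. norm (f x)) summable_on UNIV"
  using theta_abs_summable[of "t / m"] t m_pos by (simp add: f_def)
 have f_nat: "f (int n) = psi n * real n ^ a * exp (- pi * (real n)^2 * t / m)" for n by (simp add: f_def X_nat)
 have f_neg: "f (- k) = f k" for k using a01 by (auto simp: f_def X_uminus)
 have f0: "f 0 = 0" using X_nat[of 0] by (simp add: f_def chi_0)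
 have absn: "(\<lambda>n::nat. norm (f (int n))) summable_on UNIV"
 proof -
  have "(\<lambda>x. norm (f x)) summable_on range int" using abs by (rule summable_on_subset_banach) simp
  thus ?thesis by (subst (asm) summable_on_reindex) (auto simp: o_def)
 qed
 have hs: "((\<lambda>n::nat. f (int n)) has_sum omega t) UNIV"
 proof -
  have "(\<lambda>n::nat. f (int n)) summable_on UNIV" using absn by (rule abs_summable_summable)
  then obtain S where S: "((\<lambda>n::nat. f (int n)) has_sum S) UNIV" by (auto simp: summable_on_def)
  from has_sum_imp_sums[OF this] have "S = omega t" by (simp add: omega_def f_nat sums_iff)
  thus ?thesis using S by simp
 qed
 show "summable (\<lambda>n. \<bar>psi n * real n ^ a * exp (- pi * (real n)^2 * t / m)\<bar>)"
  using summable_on_imp_summable[OF absn] by (simp add: f_nat)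
 have 1: "(f has_sum omega t) (range int)"
  by (subst has_sum_reindex) (use hs in \<open>auto simp: o_def\<close>)
 have 2: "(f has_sum omega t) (range (\<lambda>n. - int n))"
  by (subst has_sum_reindex) (use hs in \<open>auto simp: o_def f_neg inj_on_def\<close>)
 have 3: "(f has_sum omega t) (range (\<lambda>n. - int n) - {0})"
  by (rule has_sum_cong_neutral[THEN iffD2, OF _ _ _ 2]) (use f0 in auto)
 have "(f has_sum (omega t + omega t)) (range int \<union> (range (\<lambda>n. - int n) - {0}))"
  by (rule has_sum_Un_disjoint[OF 1 3]) auto
 moreover have "range int \<union> (range (\<lambda>n. - int n) - {0}) = UNIV"
 proof -
  have "x \<in> range int \<union> (range (\<lambda>n. - int n) - {0})" for x
  proof (cases "x \<ge> 0")
   case True thus ?thesis by (intro UnI1 image_eqI[of _ _ "nat x"]) auto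
  next
   case False
   hence "x \<in> range (\<lambda>n. - int n)" by (intro image_eqI[of _ _ "nat (- x)"]) auto
   thus ?thesis using False by auto
  qed
  thus ?thesis by blast
 qed
 ultimately show "(\<Sum>\<^sub>\<infinity>k. X k * of_int k ^ a * exp (- pi * (of_int k)^2 * t / m)) = 2 * omega t"
  unfolding f_def[symmetric] by (simp add: infsumI)
qed

text \<open>The integers are sorted by residue modulo \<open>m\<close> and Poisson's formula is
  applied to each class. Summing the resulting phases against \<open>psi\<close> gives the Gauss sum
  \<open>tau * psi k\<close>, so the dual series is the same theta series at
  \<open>1 / t\<close>.\<close>

lemma theta_functional_equation:
 assumes t: "t > 0"
 shows "omega t = kappa * t powr (- real a - 1/2) * omega (1 / t)"
proof -
 \<comment> \<open>With this scale the Gaussian at \<open>n / m\<close> has exponent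
   \<open>- pi * n^2 * t / m\<close>, the one occurring in \<open>omega\<close>.\<close>
 define T where "T = t * m"
 have T: "T > 0" using t m_pos by (simp add: T_def)
 define h where "h = (\<lambda>u. complex_of_real (u ^ a * exp (- pi * T * u^2)))"
 define c where "c = (\<lambda>k::int. (- \<i>) ^ a * of_real ((of_int k / T) ^ a * (exp (- pi * (of_int k)^2 / T) / sqrt T)))"
 define C where "C = 2 + 4 / (pi * T)^2"
 have hb: "norm (h u) \<le> C / (1 + u^2)" for u
  using gaussian_bound[OF T, of u] by (simp add: h_def C_def del: of_real_mult of_real_power)
 have summc: "(\<lambda>k. norm (c k)) summable_on UNIV"
 proof (rule summable_on_comparison_test)
  define K where "K = 1 / T ^ a / sqrt T"
  have K: "K \<ge> 0" using T by (simp add: K_def)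
  define D where "D = 2 + 4 / (pi * (1 / T))^2"
  show "(\<lambda>k::int. K * D * (1 / (1 + real_of_int k ^ 2))) summable_on UNIV"
   by (intro summable_on_cmult_right summable_on_int_inverse_square)
  fix k :: int
  have "norm (c k) = K * \<bar>of_int k ^ a * exp (- pi * (1 / T) * (of_int k)^2)\<bar>"
   using T by (simp add: c_def K_def norm_mult norm_power norm_divide power_divide abs_mult del: of_real_mult of_real_power)
  also have "... \<le> K * (D / (1 + real_of_int k ^ 2))"
   unfolding D_def by (intro mult_left_mono gaussian_bound K) (use T in auto)
  finally show "norm (c k) \<le> K * D * (1 / (1 + real_of_int k ^ 2))" by simp
 qed simp
 have coef: "(\<lambda>N. integral {-real N..real N} (\<lambda>x. h x * cis (-(2 * pi * of_int k * x)))) \<longlonglongrightarrow> c k" for k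
  using a01 gaussian_coef[OF T, of "of_int k"] gaussian_odd_coef[OF T, of "of_int k"]
  by (auto simp: h_def c_def)
 have poisson: "(\<Sum>\<^sub>\<infinity>j. h (x + of_int j)) = (\<Sum>\<^sub>\<infinity>k. c k * cis (2 * pi * of_int k * x))" for x
  by (rule poisson_summation[OF _ hb coef summc]) (auto simp: h_def intro!: continuous_intros)
 define F where "F = (\<lambda>n::int. of_real (X n) * h (of_int n / m))"
 define W where "W = (\<lambda>t. \<Sum>\<^sub>\<infinity>k. X k * of_int k ^ a * exp (- pi * (of_int k)^2 * t / m))"
 have F_eq: "of_nat m ^ a * F n = of_real (X n * of_int n ^ a * exp (- pi * (of_int n)^2 * t / m))" for n
  using m_pos by (simp add: F_def h_def T_def power_divide power2_eq_square)
 have hsW: "((\<lambda>k. X k * of_int k ^ a * exp (- pi * (of_int k)^2 * t / m)) has_sum W t) UNIV" if "t > 0" for t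
 proof -
  have "(\<lambda>k. X k * of_int k ^ a * exp (- pi * (of_int k)^2 * t / m)) summable_on UNIV"
   using abs_summable_summable[OF theta_abs_summable[of "t / m"]] that m_pos by simp
  thus ?thesis unfolding W_def by simp
 qed
 have hsF: "(F has_sum (of_real (W t) / of_nat m ^ a)) UNIV"
 proof -
  have "((\<lambda>n. of_nat m ^ a * F n) has_sum of_real (W t)) UNIV"
   unfolding F_eq by (rule has_sum_of_real[OF hsW[OF t]])
  from has_sum_cmult_right[OF this, of "1 / of_nat m ^ a"] show ?thesis using m_pos by simp
 qed
 have bij: "bij_betw (\<lambda>(b, j). int m * j + int b) ({..<m} \<times> UNIV) UNIV"
 proof (rule bij_betwI[where g = "\<lambda>n. (nat (n mod int m), n div int m)"])
  show "(\<lambda>n. (nat (n mod int m), n div int m)) \<in> UNIV \<rightarrow> {..<m} \<times> UNIV"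
   using m by (auto simp: nat_less_iff)
 qed (use m in \<open>auto simp: div_add1_eq\<close>)
 have hsp: "((\<lambda>(b, j). F (int m * j + int b)) has_sum (of_real (W t) / of_nat m ^ a)) ({..<m} \<times> UNIV)"
  using has_sum_reindex_bij_betw[OF bij, of F] hsF by (simp add: case_prod_unfold)
 have Fh: "F (int m * j + int b) = of_real (psi b) * h (real b / m + of_int j)" if "b < m" for b j
 proof -
  have "real_of_int (int m * j + int b) / m = real b / m + of_int j" using m_pos by (simp add: field_simps)
  thus ?thesis using X_bn[OF that] by (simp add: F_def)
 qed
 have hsc: "((\<lambda>k. c k * cis (2 * pi * of_int k * x)) has_sum (\<Sum>\<^sub>\<infinity>k. c k * cis (2 * pi * of_int k * x))) UNIV" for x
  by (rule has_sum_infsum, rule abs_summable_summable) (simp add: norm_mult summc)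
 have "of_real (W t) / of_nat m ^ a = (\<Sum>b<m. \<Sum>\<^sub>\<infinity>j. F (int m * j + int b))"
  using infsumI[OF hsp] infsum_Sigma'_banach[of "\<lambda>b j. F (int m * j + int b)" "{..<m}" "\<lambda>_. UNIV"] hsp
  by (simp add: summable_on_def infsum_finite) (metis infsum_finite finite_lessThan)
 also have "... = (\<Sum>b<m. of_real (psi b) * (\<Sum>\<^sub>\<infinity>k. c k * cis (2 * pi * of_int k * (real b / m))))"
 proof (rule sum.cong[OF refl])
  fix b assume "b \<in> {..<m}"
  hence b: "b < m" by simp
  show "(\<Sum>\<^sub>\<infinity>j. F (int m * j + int b)) = of_real (psi b) * (\<Sum>\<^sub>\<infinity>k. c k * cis (2 * pi * of_int k * (real b / m)))"
   unfolding Fh[OF b] poisson[symmetric] by (rule infsum_cmult_right')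
 qed
 finally have W1: "of_real (W t) / of_nat m ^ a = ..." .
 have "((\<lambda>k. \<Sum>b<m. of_real (psi b) * (c k * cis (2 * pi * of_int k * (real b / m)))) has_sum ...) UNIV"
  by (intro has_sum_finite_sum has_sum_cmult_right hsc) auto
 moreover have "(\<Sum>b<m. of_real (psi b) * (c k * cis (2 * pi * of_int k * (real b / m)))) = c k * (tau * of_real (X k))" for k
  unfolding gauss_int[symmetric] sum_distrib_left by (intro sum.cong refl) (simp add: mult_ac)
 ultimately have hs1: "((\<lambda>k. c k * (tau * of_real (X k))) has_sum (of_real (W t) / of_nat m ^ a)) UNIV" using W1 by simp
 have ck: "c k * (tau * of_real (X k)) = (- \<i>) ^ a * tau / (of_real (T ^ a * sqrt T)) *
   of_real (X k * of_int k ^ a * exp (- pi * (of_int k)^2 * (1 / t) / m))" for k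
  using T by (simp add: c_def power_divide T_def)
 have "((\<lambda>k. c k * (tau * of_real (X k))) has_sum ((- \<i>) ^ a * tau / (of_real (T ^ a * sqrt T)) * of_real (W (1 / t)))) UNIV"
  unfolding ck by (intro has_sum_cmult_right has_sum_of_real hsW) (use t in auto)
 with hs1 have "of_real (W t) / of_nat m ^ a = (- \<i>) ^ a * tau / (of_real (T ^ a * sqrt T)) * of_real (W (1 / t))"
  by (rule has_sum_unique)
 also have "(- \<i>) ^ a * tau = of_real kappa * of_real (sqrt m)"
  using kappa(1) m_pos by (simp add: field_simps)
 finally have "complex_of_real (W t) = of_real (kappa * (real m ^ a * sqrt m / (T ^ a * sqrt T)) * W (1 / t))"
  using m_pos T by (simp add: field_simps)
 hence "W t = kappa * (real m ^ a * sqrt m / (T ^ a * sqrt T)) * W (1 / t)" by (simp only: of_real_eq_iff)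
 also have "real m ^ a * sqrt m / (T ^ a * sqrt T) = 1 / (t ^ a * sqrt t)"
  using m_pos t by (simp add: T_def real_sqrt_mult power_mult_distrib)
 also have "... = t powr (- real a - 1/2)"
 proof -
  have "t powr (- real a - 1/2) = t powr (- (real a + 1/2))" by simp
  also have "... = inverse (t powr real a * t powr (1/2))" by (simp only: powr_minus powr_add)
  also have "... = 1 / (t ^ a * sqrt t)" using t by (simp only: powr_realpow powr_half_sqrt less_imp_le inverse_eq_divide)
  finally show ?thesis by (rule sym)
 qed
 also have "W t = 2 * omega t" unfolding W_def by (rule theta_int_eq_nat(1)[OF t])
 also have "W (1 / t) = 2 * omega (1 / t)" unfolding W_def by (rule theta_int_eq_nat(1)) (use t in simp)
 finally show ?thesis by simp
qed

end

section \<open>The completed L-function as a Mellin transform\<close>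

text \<open>Euler's integral in the variable \<open>v\<close>, where \<open>b * exp v\<close> is the
  usual one. On the whole real line the reflection of \<open>t\<close> to \<open>1 / t\<close> in
  the theta function becomes that of \<open>v\<close> to \<open>- v\<close>.\<close>

lemma integral_exp_exp_Gamma:
 assumes sig: "sig > (0::real)" and b: "b > 0"
 shows "integrable lborel (\<lambda>v. exp (sig * v - b * exp v))"
  "(LINT v|lborel. exp (sig * v - b * exp v)) = Gamma sig * b powr (- sig)"
proof -
 define f where "f = (\<lambda>t::real. t powr (sig - 1) / exp t)"
 define g where "g = (\<lambda>v. exp (sig * v - exp v))"
 have "(f has_integral Gamma sig) {0..}" unfolding f_def by (rule Gamma_integral_real[OF sig])
 hence hi: "(f has_integral Gamma sig) {0<..}"
 proof -
  have "((\<lambda>t. if t \<in> {0<..} then f t else 0) has_integral Gamma sig) {0..}"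
   by (rule has_integral_spike[of "{0}", rotated 2]) (use \<open>(f has_integral Gamma sig) {0..}\<close> in auto)
  thus ?thesis by (subst (asm) has_integral_restrict) auto
 qed
 have "f absolutely_integrable_on {0<..}"
  by (rule nonnegative_absolutely_integrable_1) (use hi in \<open>auto simp: f_def\<close>)
 moreover have "range exp = {0::real<..}"
  using exp_gt_zero exp_ln by (auto simp: image_iff) (metis exp_ln)
 ultimately have *: "f absolutely_integrable_on (exp ` UNIV) \<and> integral (exp ` UNIV) f = Gamma sig"
  using hi by (auto simp: integral_unique)
 have "(\<lambda>x. \<bar>exp x\<bar> * f (exp x)) absolutely_integrable_on UNIV \<and> integral UNIV (\<lambda>x. \<bar>exp x\<bar> * f (exp x)) = Gamma sig"
  by (rule has_absolute_integral_change_of_variables_1'[THEN iffD2, OF _ _ _ *]) (auto intro!: derivative_eq_intros simp: inj_on_def)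
 moreover have "\<bar>exp v\<bar> * f (exp v) = g v" for v
  by (simp add: f_def g_def exp_powr_real exp_diff exp_add[symmetric] algebra_simps)
   (simp add: exp_add[symmetric] exp_diff[symmetric] algebra_simps)
 ultimately have ai: "g absolutely_integrable_on UNIV" and ig: "integral UNIV g = Gamma sig" by auto
 have meas: "g \<in> borel_measurable lborel" unfolding g_def by measurable
 have intg: "integrable lborel g"
  using ai meas by (simp add: set_integrable_def integrable_completion)
 have Ig: "(LINT v|lborel. g v) = Gamma sig" using integral_lborel[OF intg] ig by simp
 have shift: "exp (sig * v - b * exp v) = b powr (- sig) * g (ln b + 1 * v)" for v
  using b by (simp add: g_def powr_def exp_add exp_add[symmetric] algebra_simps)
 have "integrable lborel (\<lambda>v. g (ln b + 1 * v))"
  using intg by (subst lborel_integrable_real_affine_iff) auto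
 thus "integrable lborel (\<lambda>v. exp (sig * v - b * exp v))" unfolding shift by simp
 have "(LINT v|lborel. g v) = \<bar>1\<bar> *\<^sub>R (LINT v|lborel. g (ln b + 1 * v))"
  by (rule lborel_integral_real_affine) simp
 thus "(LINT v|lborel. exp (sig * v - b * exp v)) = Gamma sig * b powr (- sig)"
  unfolding shift using Ig by simp
qed

text \<open>The maximum over \<open>w\<close> lies at \<open>ln (x / c)\<close>; the term
  \<open>- x\<close> of its value is dropped.\<close>

lemma linear_minus_exp_le:
 fixes x c w :: real
 assumes "x > 0" "c > 0"
 shows "x * w - c * exp w \<le> x * ln (x / c)"
proof -
 define d where "d = w - ln (x / c)"
 have "c * exp w = x * exp d" using assms by (simp add: d_def exp_diff)
 moreover have "x * (1 + d) \<le> x * exp d" using assms by (intro mult_left_mono exp_ge_add_one_self) auto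
 ultimately show ?thesis using assms by (simp add: d_def algebra_simps)
qed

lemma integrable_inverse_one_plus_square: "integrable lborel (\<lambda>x::real. inverse (1 + x^2))"
 using integrable_inverse_1_plus_square by (simp add: set_integrable_def einterval_def)

context real_primitive_character
begin

text \<open>In the variable \<open>t = exp v\<close> the exponential factor divides the weight
  \<open>a + 1/2\<close> of the functional equation evenly between \<open>t\<close> and
  \<open>1 / t\<close>, which turns the equation into a parity.\<close>

definition Theta :: "real \<Rightarrow> real" where
 "Theta v = omega (exp v) * exp (v * (real a + 1/2) / 2)"

lemma Theta_symmetric: "Theta (- v) = kappa * Theta v"
proof -
 have "omega (exp (- v)) = kappa * exp (- v) powr (- real a - 1/2) * omega (1 / exp (- v))"
  by (rule theta_functional_equation) simp
 also have "1 / exp (- v) = exp v" by (simp add: exp_minus divide_inverse)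
 also have "exp (- v) powr (- real a - 1/2) = exp (v * (real a + 1/2))" by (simp add: exp_powr_real algebra_simps)
 finally show ?thesis by (simp add: Theta_def exp_add[symmetric] field_simps)
qed

lemma omega_measurable [measurable]: "omega \<in> borel_measurable borel"
 unfolding omega_def by measurable

lemma Theta_measurable [measurable]: "Theta \<in> borel_measurable borel"
 unfolding Theta_def by measurable

lemma omega_bound: obtains C where "C > 0" "\<And>t. t \<ge> 1 ==> \<bar>omega t\<bar> \<le> C * exp (- (pi / m) * t)"
proof -
 define c where "c = pi / m"
 define g where "g = (\<lambda>n. case n of 0 \<Rightarrow> 0 | Suc k \<Rightarrow> real (Suc k) * exp (- c) ^ k)"
 have c: "c > 0" using m_pos by (simp add: c_def)
 have "summable (\<lambda>k. g (Suc k))"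
  unfolding g_def using geometric_deriv_sums[of "exp (- c)"] c by (simp add: sums_iff)
 hence sg: "summable g" by (rule summable_Suc_iff[THEN iffD1])
 have g0: "g n \<ge> 0" for n by (auto simp: g_def split: nat.splits)
 show ?thesis
 proof (rule that[of "suminf g + 1"])
  show "suminf g + 1 > 0" using suminf_nonneg[OF sg g0] by simp
  fix t :: real assume t: "t \<ge> 1"
  define F where "F = (\<lambda>n. psi n * real n ^ a * exp (- pi * (real n)^2 * t / m))"
  have F: "\<bar>F n\<bar> \<le> g n * exp (- c * t)" for n
  proof (cases n)
   case (Suc k)
   have "\<bar>psi n * real n ^ a\<bar> \<le> 1 * real n"
    unfolding abs_mult by (intro mult_mono abs_chi_le) (use a01 Suc in auto)
   moreover have "exp (- pi * (real n)^2 * t / m) \<le> exp (- c) ^ k * exp (- c * t)"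
   proof -
    have "real k * 1 \<le> ((real n)^2 - 1) * t"
     by (intro mult_mono) (use t Suc in \<open>auto simp: power2_eq_square algebra_simps\<close>)
    hence "c * (real k + t) \<le> c * ((real n)^2 * t)" using c by (intro mult_left_mono) (auto simp: algebra_simps)
    hence "exp (- pi * (real n)^2 * t / m) \<le> exp (- (c * real k) + - c * t)" by (simp add: c_def algebra_simps add_divide_distrib)
    also have "... = exp (- c) ^ k * exp (- c * t)" by (simp only: exp_add) (simp add: exp_of_nat_mult[symmetric] mult.commute)
    finally show ?thesis .
   qed
   ultimately have "\<bar>F n\<bar> \<le> 1 * real n * (exp (- c) ^ k * exp (- c * t))"
    unfolding F_def abs_mult[of "psi n * real n ^ a"] abs_exp_cancel by (intro mult_mono) auto
   thus ?thesis by (simp add: g_def Suc)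
  qed (simp add: F_def g_def chi_0)
  have sF: "summable (\<lambda>n. \<bar>F n\<bar>)" unfolding F_def using theta_int_eq_nat(2)[of t] t by simp
  have "\<bar>omega t\<bar> \<le> (\<Sum>n. \<bar>F n\<bar>)" unfolding omega_def F_def[symmetric] by (rule summable_rabs[OF sF])
  also have "... \<le> (\<Sum>n. g n * exp (- c * t))" by (rule suminf_le[OF F sF]) (intro summable_mult2 sg)
  also have "... = suminf g * exp (- c * t)" by (rule suminf_mult2[OF sg, symmetric])
  also have "... \<le> (suminf g + 1) * exp (- c * t)" by (intro mult_right_mono) auto
  finally show "\<bar>omega t\<bar> \<le> (suminf g + 1) * exp (- (pi / m) * t)" by (simp add: c_def)
 qed
qed

text \<open>\<open>R\<close> stays explicit because the growth of the completed L-function is read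
  off from it. For \<open>v \<ge> 0\<close> the 2 in \<open>R + 2\<close> pays once for the
  exponential factor of \<open>Theta\<close> and once for \<open>1 + v^2 \<le> 2 * exp v\<close>;
  negative \<open>v\<close> follow by parity.\<close>

lemma Theta_bound:
 obtains C where "C > 0" "\<And>v R. R \<ge> 0 ==> \<bar>Theta v\<bar> * exp (R * \<bar>v\<bar>) \<le> C * exp ((R + 2) * ln ((R + 2) / (pi / m))) * inverse (1 + v^2)"
proof -
 obtain C where C: "C > 0" "\<And>t. t \<ge> 1 ==> \<bar>omega t\<bar> \<le> C * exp (- (pi / m) * t)" by (rule omega_bound) blast
 define c where "c = pi / m"
 have c: "c > 0" using m_pos by (simp add: c_def)
 have pos: "\<bar>Theta w\<bar> * exp (R * w) \<le> 2 * C * exp ((R + 2) * ln ((R + 2) / c)) * inverse (1 + w^2)"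
  if w: "w \<ge> 0" and R: "R \<ge> 0" for w R
 proof -
  have "\<bar>Theta w\<bar> = \<bar>omega (exp w)\<bar> * exp (w * (real a + 1/2) / 2)" by (simp add: Theta_def abs_mult)
  also have "... \<le> (C * exp (- c * exp w)) * exp w"
  proof (rule mult_mono)
   show "\<bar>omega (exp w)\<bar> \<le> C * exp (- c * exp w)" unfolding c_def by (rule C(2)) (use w in simp)
   show "exp (w * (real a + 1/2) / 2) \<le> exp w" using a01 w by auto
  qed (use C in auto)
  finally have 1: "\<bar>Theta w\<bar> * exp (R * w) \<le> (C * exp (- c * exp w)) * exp w * exp (R * w)" by (rule mult_right_mono) simp
  have "1 + w + w^2 / 2 \<le> exp w" by (rule exp_lower_Taylor_quadratic[OF w])
  hence 2: "1 + w^2 \<le> 2 * exp w" using w by simp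
  have wpos: "1 + w^2 > 0" by (intro add_pos_nonneg) auto
  have "\<bar>Theta w\<bar> * exp (R * w) * (1 + w^2) \<le> (C * exp (- c * exp w)) * exp w * exp (R * w) * (2 * exp w)"
   using 1 2 C(1) by (intro mult_mono) auto
  also have "... = 2 * C * exp ((R + 2) * w - c * exp w)"
   by (simp add: exp_add[symmetric] exp_diff algebra_simps mult_exp_exp)
  also have "... \<le> 2 * C * exp ((R + 2) * ln ((R + 2) / c))"
   using linear_minus_exp_le[of "R + 2" c w] R c C(1) by (intro mult_left_mono) auto
  finally show ?thesis using wpos by (simp add: field_simps)
 qed
 have "\<bar>Theta v\<bar> * exp (R * \<bar>v\<bar>) \<le> 2 * C * exp ((R + 2) * ln ((R + 2) / c)) * inverse (1 + v^2)" if R: "R \<ge> 0" for v R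
 proof (cases "v \<ge> 0")
  case True thus ?thesis using pos[OF True R] by simp
 next
  case False
  have "\<bar>Theta v\<bar> = \<bar>Theta (- v)\<bar>" using kappa(2) by (auto simp: Theta_symmetric)
  thus ?thesis using pos[of "- v" R] R False by simp
 qed
 thus ?thesis using that[of "2 * C"] C(1) unfolding c_def by auto
qed

definition mu :: "nat \<Rightarrow> real" where "mu k = (LINT v|lborel. Theta v * v ^ k)"

lemma Theta_exp_integrable: "integrable lborel (\<lambda>v. \<bar>Theta v\<bar> * exp (R * \<bar>v\<bar>))" if "R \<ge> 0"
proof -
 obtain C where C: "C > 0" "\<And>v R. R \<ge> 0 ==> \<bar>Theta v\<bar> * exp (R * \<bar>v\<bar>) \<le> C * exp ((R + 2) * ln ((R + 2) / (pi / m))) * inverse (1 + v^2)"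
  by (rule Theta_bound) blast
 show ?thesis
  by (rule Bochner_Integration.integrable_bound[where f = "\<lambda>v. C * exp ((R + 2) * ln ((R + 2) / (pi / m))) * inverse (1 + v^2)"])
   (use C(2)[OF that] in \<open>auto intro!: integrable_inverse_one_plus_square simp: abs_mult abs_of_pos[OF C(1)]\<close>)
qed

lemma power_le_fact_exp: "x ^ k \<le> fact k * exp x" if "x \<ge> (0::real)"
proof -
 have "(\<lambda>n. x ^ n /\<^sub>R fact n) sums exp x" by (rule exp_converges)
 hence "sum (\<lambda>n. x ^ n /\<^sub>R fact n) {k} \<le> exp x"
  using that by (intro sum_le_suminf[where I = "{k}", THEN order_trans]) (auto simp: sums_iff)
 thus ?thesis by (simp add: field_simps)
qed

lemma moment_bound:
 obtains K where "\<And>R. R \<ge> 1 ==> K * exp ((R + 2) * ln ((R + 2) / (pi / m))) > 0"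
  "\<And>k. integrable lborel (\<lambda>v. Theta v * v ^ k)"
  "\<And>R k. R > 0 ==> \<bar>mu k\<bar> / fact k * R ^ k \<le> K * exp ((R + 2) * ln ((R + 2) / (pi / m)))"
proof -
 obtain C where C: "C > 0" "\<And>v R. R \<ge> 0 ==> \<bar>Theta v\<bar> * exp (R * \<bar>v\<bar>) \<le> C * exp ((R + 2) * ln ((R + 2) / (pi / m))) * inverse (1 + v^2)"
  by (rule Theta_bound) blast
 define I where "I = (LINT v|lborel. inverse (1 + v^2 :: real))"
 have I: "I \<ge> 0" unfolding I_def by (intro integral_nonneg_AE) auto
 have le: "\<bar>Theta v * v ^ k\<bar> * R ^ k \<le> fact k * (\<bar>Theta v\<bar> * exp (R * \<bar>v\<bar>))" if "R \<ge> 0" for v R k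
 proof -
  have "\<bar>Theta v * v ^ k\<bar> * R ^ k = \<bar>Theta v\<bar> * (R * \<bar>v\<bar>) ^ k" by (simp add: abs_mult power_abs power_mult_distrib)
  also have "... \<le> \<bar>Theta v\<bar> * (fact k * exp (R * \<bar>v\<bar>))" using that by (intro mult_left_mono power_le_fact_exp) auto
  finally show ?thesis by (simp add: mult_ac)
 qed
 have int: "integrable lborel (\<lambda>v. Theta v * v ^ k)" for k
  by (rule Bochner_Integration.integrable_bound[OF integrable_mult_right[OF Theta_exp_integrable[of 1], of "fact k"]])
   (use le[of 1] in auto)
 show ?thesis
 proof (rule that[of "C * (I + 1)"])
  show "C * (I + 1) * exp ((R + 2) * ln ((R + 2) / (pi / m))) > 0" for R using C(1) I by simp
  show "integrable lborel (\<lambda>v. Theta v * v ^ k)" for k by (rule int)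
  fix R :: real and k assume R: "R > 0"
  define E where "E = exp ((R + 2) * ln ((R + 2) / (pi / m)))"
  have "\<bar>mu k\<bar> * R ^ k \<le> (LINT v|lborel. \<bar>Theta v * v ^ k\<bar>) * R ^ k"
   unfolding mu_def using R by (intro mult_right_mono integral_abs_bound) auto
  also have "... = (LINT v|lborel. \<bar>Theta v * v ^ k\<bar> * R ^ k)" by simp
  also have "... \<le> (LINT v|lborel. fact k * (C * E * inverse (1 + v^2)))"
  proof (rule integral_mono)
   show "\<bar>Theta v * v ^ k\<bar> * R ^ k \<le> fact k * (C * E * inverse (1 + v^2))" for v
    by (rule order_trans[OF le[of R] mult_left_mono[OF C(2)[of R v, folded E_def]]]) (use R in auto)
  qed (use int[of k] in \<open>auto intro!: integrable_inverse_one_plus_square\<close>)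
  also have "... = fact k * (C * E * I)" by (simp add: I_def)
  also have "... \<le> fact k * (C * (I + 1) * E)" using C(1) by (intro mult_left_mono) (auto simp: E_def algebra_simps)
  finally show "\<bar>mu k\<bar> / fact k * R ^ k \<le> C * (I + 1) * exp ((R + 2) * ln ((R + 2) / (pi / m)))"
   unfolding E_def by (simp add: field_simps)
 qed
qed

text \<open>The integral of \<open>Theta v * exp (z * v)\<close> over \<open>v\<close>, expanded in
  moments: as a power series it is easily seen to be entire, and the identification with the
  integral is made for real \<open>z\<close> only.\<close>

definition xi0 :: "complex \<Rightarrow> complex" where "xi0 z = (\<Sum>k. of_real (mu k / fact k) * z ^ k)"

lemma xi0_summable: "summable (\<lambda>k. norm (of_real (mu k / fact k) * z ^ k :: complex))"
 and xi0_growth: "\<exists>K>0. \<forall>R\<ge>1. \<forall>z. norm z \<le> R \<longrightarrow> norm (xi0 z) \<le> K * exp ((2 * R + 2) * ln ((2 * R + 2) / (pi / m)))"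
proof -
 obtain K where K: "\<And>R. R \<ge> 1 ==> K * exp ((R + 2) * ln ((R + 2) / (pi / m))) > 0"
  "\<And>R k. R > 0 ==> \<bar>mu k\<bar> / fact k * R ^ k \<le> K * exp ((R + 2) * ln ((R + 2) / (pi / m)))"
  by (rule moment_bound) blast
 have K0: "K > 0" using K(1)[of 1] by (simp add: zero_less_mult_iff)
 \<comment> \<open>The moment bound is used with radius \<open>2 * R\<close>, which leaves a
   geometric factor \<open>(1/2) ^ k\<close>.\<close>
 have trm: "norm (of_real (mu k / fact k) * z ^ k :: complex) \<le> K * exp ((2 * R + 2) * ln ((2 * R + 2) / (pi / m))) * (1/2) ^ k"
  if "norm z \<le> R" "R > 0" for z k R
 proof -
  have "norm (of_real (mu k / fact k) * z ^ k :: complex) = \<bar>mu k\<bar> / fact k * norm z ^ k"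
   by (simp add: norm_mult norm_power norm_divide abs_divide)
  also have "... \<le> \<bar>mu k\<bar> / fact k * R ^ k" using that by (intro mult_left_mono power_mono) auto
  also have "... = \<bar>mu k\<bar> / fact k * (2 * R) ^ k * (1/2) ^ k" by (simp add: power_mult_distrib power_one_over)
  also have "... \<le> K * exp ((2 * R + 2) * ln ((2 * R + 2) / (pi / m))) * (1/2) ^ k"
   using that by (intro mult_right_mono K(2)) auto
  finally show ?thesis .
 qed
 have geo: "summable (\<lambda>k. D * (1/2) ^ k :: real)" "(\<Sum>k. D * (1/2) ^ k :: real) = 2 * D" for D
  by (auto intro!: summable_mult simp: suminf_mult suminf_geometric)
 have summ: "summable (\<lambda>k. norm (of_real (mu k / fact k) * z ^ k :: complex))" for z
 proof (rule summable_comparison_test'[OF geo(1)])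
  fix k :: nat
  show "norm (norm (of_real (mu k / fact k) * z ^ k :: complex))
   \<le> K * exp ((2 * (norm z + 1) + 2) * ln ((2 * (norm z + 1) + 2) / (pi / m))) * (1/2) ^ k"
   unfolding real_norm_def abs_norm_cancel by (rule trm) (auto intro: add_nonneg_pos)
 qed
 show "summable (\<lambda>k. norm (of_real (mu k / fact k) * z ^ k :: complex))" by (rule summ)
 show "\<exists>K>0. \<forall>R\<ge>1. \<forall>z. norm z \<le> R \<longrightarrow> norm (xi0 z) \<le> K * exp ((2 * R + 2) * ln ((2 * R + 2) / (pi / m)))"
 proof (intro exI[of _ "2 * K"] conjI allI impI)
  fix R :: real and z :: complex assume R: "R \<ge> 1" "norm z \<le> R"
  have "norm (xi0 z) \<le> (\<Sum>k. norm (of_real (mu k / fact k) * z ^ k :: complex))"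
   unfolding xi0_def by (rule summable_norm[OF summ])
  also have "... \<le> (\<Sum>k. K * exp ((2 * R + 2) * ln ((2 * R + 2) / (pi / m))) * (1/2) ^ k)"
   by (rule suminf_le[OF trm summ geo(1)]) (use R in auto)
  also have "... = 2 * K * exp ((2 * R + 2) * ln ((2 * R + 2) / (pi / m)))" by (simp add: geo(2))
  finally show "norm (xi0 z) \<le> 2 * K * exp ((2 * R + 2) * ln ((2 * R + 2) / (pi / m)))" .
 qed (use K0 in auto)
qed

lemma xi0_holomorphic: "xi0 holomorphic_on UNIV"
proof -
 have "xi0 holomorphic_on ball 0 r" for r
  by (rule power_series_holomorphic[where a = "\<lambda>k. of_real (mu k / fact k)"])
   (use summable_norm_cancel[OF xi0_summable] in \<open>auto simp: xi0_def summable_sums\<close>)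
 hence "xi0 field_differentiable at z" for z
  by (rule holomorphic_on_imp_differentiable_at[of _ "ball 0 (norm z + 1)"]) auto
 thus ?thesis by (simp add: holomorphic_on_def field_differentiable_at_within)
qed

lemma xi0_symmetric: "xi0 (- z) = of_real kappa * xi0 z"
proof -
 have "(-1) ^ k * mu k = kappa * mu k" for k
 proof -
  have "mu k = \<bar>-1\<bar> *\<^sub>R (LINT v|lborel. Theta (0 + -1 * v) * (0 + -1 * v) ^ k)"
   unfolding mu_def by (rule lborel_integral_real_affine) simp
  also have "... = (LINT v|lborel. (kappa * (-1) ^ k) * (Theta v * v ^ k))"
  proof -
   have "Theta (0 + -1 * v) * (0 + -1 * v) ^ k = (kappa * (-1) ^ k) * (Theta v * v ^ k)" for v
   proof -
    have "(0 + -1 * v) ^ k = (-1) ^ k * v ^ k" by (simp only: add_0 power_mult_distrib)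
    moreover have "Theta (0 + -1 * v) = kappa * Theta v" using Theta_symmetric[of v] by simp
    ultimately show ?thesis by (simp only: mult_ac)
   qed
   thus ?thesis by simp
  qed
  also have "... = kappa * (-1) ^ k * mu k" unfolding mu_def by (rule integral_mult_right_zero)
  finally have "mu k = kappa * (-1) ^ k * mu k" .
  hence "(-1) ^ k * mu k = (-1) ^ k * (kappa * (-1) ^ k * mu k)" by simp
  also have "... = ((-1) ^ k * (-1) ^ k) * (kappa * mu k)" by (simp only: mult_ac)
  finally have "(-1) ^ k * mu k = ((-1) ^ k * (-1) ^ k) * (kappa * mu k)" .
  thus ?thesis by (simp add: power_mult_distrib[symmetric])
 qed
 hence "of_real (mu k / fact k) * (- z) ^ k = of_real kappa * (of_real (mu k / fact k) * z ^ k)" for k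
 proof -
  have "of_real (mu k / fact k) * (- z) ^ k = of_real ((-1) ^ k * mu k / fact k) * z ^ k"
   by (simp add: power_minus[of z k])
  thus ?thesis by (simp add: \<open>\<And>k. (-1) ^ k * mu k = kappa * mu k\<close>)
 qed
 thus ?thesis unfolding xi0_def
  by (simp only: suminf_mult[OF summable_norm_cancel[OF xi0_summable]])
qed

lemma xi0_real: "xi0 (of_real x) = of_real (LINT v|lborel. Theta v * exp (x * v))"
proof -
 have int: "integrable lborel (\<lambda>v. Theta v * v ^ k)" for k by (rule moment_bound) blast
 define S where "S = (\<lambda>N v. \<Sum>k<N. Theta v * v ^ k * (x ^ k / fact k))"
 have "(\<lambda>N. LINT v|lborel. S N v) \<longlonglongrightarrow> (LINT v|lborel. Theta v * exp (x * v))"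
 proof (rule integral_dominated_convergence[where w = "\<lambda>v. \<bar>Theta v\<bar> * exp (\<bar>x\<bar> * \<bar>v\<bar>)"])
  show "AE v in lborel. (\<lambda>N. S N v) \<longlonglongrightarrow> Theta v * exp (x * v)"
  proof (rule AE_I2)
   fix v :: real
   have "(\<lambda>k. (x * v) ^ k /\<^sub>R fact k) sums exp (x * v)" by (rule exp_converges)
   hence "(\<lambda>k. Theta v * ((x * v) ^ k /\<^sub>R fact k)) sums (Theta v * exp (x * v))" by (rule sums_mult)
   thus "(\<lambda>N. S N v) \<longlonglongrightarrow> Theta v * exp (x * v)"
    unfolding sums_def S_def by (simp add: power_mult_distrib divide_inverse mult_ac)
  qed
  show "AE v in lborel. norm (S N v) \<le> \<bar>Theta v\<bar> * exp (\<bar>x\<bar> * \<bar>v\<bar>)" for N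
  proof (rule AE_I2)
   fix v :: real
   have "norm (S N v) \<le> (\<Sum>k<N. \<bar>Theta v\<bar> * ((\<bar>x\<bar> * \<bar>v\<bar>) ^ k /\<^sub>R fact k))"
    unfolding S_def by (rule sum_norm_le) (simp add: abs_mult power_abs power_mult_distrib divide_inverse mult_ac)
   also have "... = \<bar>Theta v\<bar> * (\<Sum>k<N. (\<bar>x\<bar> * \<bar>v\<bar>) ^ k /\<^sub>R fact k)" by (simp add: sum_distrib_left)
   also have "... \<le> \<bar>Theta v\<bar> * exp (\<bar>x\<bar> * \<bar>v\<bar>)"
   proof (intro mult_left_mono)
    note sums = exp_converges[of "\<bar>x\<bar> * \<bar>v\<bar>"]
    have "(\<Sum>k<N. (\<bar>x\<bar> * \<bar>v\<bar>) ^ k /\<^sub>R fact k) \<le> (\<Sum>k. (\<bar>x\<bar> * \<bar>v\<bar>) ^ k /\<^sub>R fact k)"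
     by (rule sum_le_suminf[OF sums_summable[OF sums]]) auto
    thus "(\<Sum>k<N. (\<bar>x\<bar> * \<bar>v\<bar>) ^ k /\<^sub>R fact k) \<le> exp (\<bar>x\<bar> * \<bar>v\<bar>)" using sums_unique[OF sums] by simp
   qed auto
   finally show "norm (S N v) \<le> \<bar>Theta v\<bar> * exp (\<bar>x\<bar> * \<bar>v\<bar>)" .
  qed
 qed (auto simp: S_def intro!: Theta_exp_integrable)
 moreover have "(LINT v|lborel. S N v) = (\<Sum>k<N. mu k * (x ^ k / fact k))" for N
  unfolding S_def by (subst Bochner_Integration.integral_sum) (use int in \<open>auto simp: mu_def simp del: times_divide_eq_right\<close>)
 ultimately have "(\<lambda>k. mu k * (x ^ k / fact k)) sums (LINT v|lborel. Theta v * exp (x * v))" by (simp add: sums_def)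
 hence "(\<lambda>k. of_real (mu k * (x ^ k / fact k))) sums complex_of_real (LINT v|lborel. Theta v * exp (x * v))" by (rule sums_of_real)
 thus ?thesis unfolding xi0_def by (simp add: sums_iff)
qed

text \<open>The weight \<open>(a + 1/2) / 2\<close> inside \<open>Theta\<close> and the exponent
  \<open>(s - 1/2) / 2\<close> add up to \<open>(s + a) / 2\<close>. Termwise integration for real
  \<open>s\<close> is enough, since the identity theorem later extends the result to complex
  \<open>s\<close>.\<close>

lemma Mellin_theta:
 fixes s :: real
 assumes s: "s > 1"
 shows "(LINT v|lborel. Theta v * exp ((s - 1/2) / 2 * v)) =
  (m / pi) powr ((s + a) / 2) * Gamma ((s + a) / 2) * (\<Sum>n. psi n * real n powr (- s))"
  "summable (\<lambda>n. \<bar>psi n * real n powr (- s)\<bar>)"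
proof -
 define sig where "sig = (s + real a) / 2"
 have sig: "sig > 0" using s by (simp add: sig_def)
 define b where "b = (\<lambda>n::nat. pi * (real n)^2 / m)"
 define f where "f = (\<lambda>n v. psi n * real n ^ a * exp (sig * v - b n * exp v))"
 define D where "D = (m / pi) powr sig * Gamma sig"
 have D: "D > 0" using m_pos sig by (simp add: D_def Gamma_real_pos)
 have powr: "real n ^ a * (Gamma sig * b n powr (- sig)) = D * real n powr (- s)" if "n > 0" for n
 proof -
  have "b n powr (- sig) = (m / pi) powr sig * (real n)\<^sup>2 powr (- sig)"
  proof -
   have "b n = (real n)^2 / (m / pi)" by (simp add: b_def)
   hence "b n powr (- sig) = (real n)\<^sup>2 powr (- sig) / (m / pi) powr (- sig)" by (simp only: powr_divide)
   thus ?thesis by (simp add: powr_minus divide_inverse)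
  qed
  also have "(real n)\<^sup>2 powr (- sig) = real n powr (- s - real a)"
  proof -
   have "(real n)^2 = real n powr 2" using that powr_realpow[of "real n" 2] by simp
   hence "(real n)\<^sup>2 powr (- sig) = real n powr (2 * - sig)" by (simp only: powr_powr)
   also have "2 * - sig = - s - real a" by (simp add: sig_def field_simps)
   finally show ?thesis .
  qed
  finally have "real n ^ a * (Gamma sig * b n powr (- sig)) = D * (real n powr (real a) * real n powr (- s - real a))"
   using that by (simp add: D_def powr_realpow)
  thus ?thesis by (simp add: powr_add[symmetric])
 qed
 have intf: "integrable lborel (f n)" for n
 proof (cases "n = 0")
  case False
  hence "b n > 0" using m_pos by (simp add: b_def)
  thus ?thesis unfolding f_def by (intro integrable_mult_right integral_exp_exp_Gamma(1) sig)
 qed (simp add: f_def chi_0)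
 have If: "(LINT v|lborel. f n v) = D * (psi n * real n powr (- s))"
  "(LINT v|lborel. norm (f n v)) = D * \<bar>psi n * real n powr (- s)\<bar>" for n
 proof -
  show "(LINT v|lborel. f n v) = D * (psi n * real n powr (- s))"
  proof (cases "n = 0")
   case False
   hence "b n > 0" using m_pos by (simp add: b_def)
   thus ?thesis using powr[of n] False by (simp add: f_def integral_exp_exp_Gamma(2)[OF sig])
  qed (simp add: f_def chi_0)
  show "(LINT v|lborel. norm (f n v)) = D * \<bar>psi n * real n powr (- s)\<bar>"
  proof (cases "n = 0")
   case False
   hence "b n > 0" using m_pos by (simp add: b_def)
   thus ?thesis using powr[of n] False by (simp add: f_def abs_mult integral_exp_exp_Gamma(2)[OF sig])
  qed (simp add: f_def chi_0)
 qed
 show summ: "summable (\<lambda>n. \<bar>psi n * real n powr (- s)\<bar>)"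
 proof (rule summable_comparison_test')
  show "summable (\<lambda>n. real n powr (- s))" using s by (simp add: summable_real_powr_iff)
  show "norm \<bar>psi n * real n powr (- s)\<bar> \<le> real n powr (- s)" for n
   using abs_chi_le[of n] by (simp add: abs_mult mult_left_le_one_le)
 qed
 have eq: "(\<Sum>n. f n v) = Theta v * exp ((s - 1/2) / 2 * v)" "summable (\<lambda>n. norm (f n v))" for v
 proof -
  have fv: "f n v = (psi n * real n ^ a * exp (- pi * (real n)^2 * exp v / m)) * exp (sig * v)" for n
   by (simp add: f_def b_def exp_diff exp_minus divide_inverse)
  have summ': "summable (\<lambda>n. \<bar>psi n * real n ^ a * exp (- pi * (real n)^2 * exp v / m)\<bar>)"
   using theta_int_eq_nat(2)[of "exp v"] by simp
  show "summable (\<lambda>n. norm (f n v))" unfolding fv norm_mult using summable_mult2[OF summ', of "exp (sig * v)"] by (simp add: abs_mult)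
  have "(\<Sum>n. f n v) = omega (exp v) * exp (sig * v)"
   unfolding fv omega_def by (rule suminf_mult2[symmetric]) (rule summable_rabs_cancel[OF summ'])
  also have "exp (sig * v) = exp (v * (real a + 1/2) / 2) * exp ((s - 1/2) / 2 * v)"
   by (simp add: exp_add[symmetric] sig_def field_simps)
  finally show "(\<Sum>n. f n v) = Theta v * exp ((s - 1/2) / 2 * v)" by (simp add: Theta_def mult.assoc)
 qed
 have "(LINT v|lborel. (\<Sum>n. f n v)) = (\<Sum>n. LINT v|lborel. f n v)"
 proof (rule integral_suminf[OF intf])
  show "summable (\<lambda>n. LINT v|lborel. norm (f n v))" unfolding If(2) by (rule summable_mult[OF summ])
 qed (use eq(2) in auto)
 also have "... = D * (\<Sum>n. psi n * real n powr (- s))"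
  unfolding If by (rule suminf_mult) (rule summable_rabs_cancel[OF summ])
 finally show "(LINT v|lborel. Theta v * exp ((s - 1/2) / 2 * v)) =
  (m / pi) powr ((s + a) / 2) * Gamma ((s + a) / 2) * (\<Sum>n. psi n * real n powr (- s))"
  unfolding eq(1) by (simp add: D_def sig_def)
qed

end

section \<open>Partial fractions of a logarithmic derivative\<close>

text \<open>With \<open>Re phi < B\<close> the quotient \<open>phi / (2 * B - phi)\<close> maps the
  disc into the unit disc, so Schwarz's lemma bounds \<open>phi\<close> by \<open>2 * B\<close> on
  half the radius, and Cauchy's inequality on discs of radius \<open>R / 4\<close> follows. The
  \<open>+ 1\<close> keeps \<open>B\<close> positive. The second derivative is taken for its factor
  \<open>1 / R^2\<close>: a single power of \<open>R\<close> would not beat a growth like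
  \<open>R * ln R\<close>.\<close>

lemma borel_caratheodory_second_deriv:
 assumes holh: "h holomorphic_on ball 0 R" and R: "R > 0"
  and Re: "\<And>w. w \<in> ball 0 R ==> Re (h w) \<le> A" and w: "norm w \<le> R / 4"
 shows "norm ((deriv ^^ 2) h w) \<le> 64 * (A - Re (h 0) + 1) / R^2"
proof -
 define B where "B = A - Re (h 0) + 1"
 define phi where "phi = (\<lambda>w. h w - h 0)"
 define psi where "psi = (\<lambda>w. phi w / (of_real (2 * B) - phi w))"
 have B1: "B \<ge> 1" using Re[of 0] R by (simp add: B_def)
 have Rephi: "Re (phi z) < B" if "norm z < R" for z
  using Re[of z] that by (simp add: phi_def B_def)
 have nz: "of_real (2 * B) - phi z \<noteq> 0" if "norm z < R" for z
 proof
  assume "of_real (2 * B) - phi z = 0"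
  hence "Re (of_real (2 * B) - phi z) = 0" by (metis zero_complex.simps(1))
  with Rephi[OF that] B1 show False by simp
 qed
 have less: "norm (phi z) < norm (of_real (2 * B) - phi z)" if "norm z < R" for z
 proof -
  have "norm (of_real (2 * B) - phi z)^2 - norm (phi z)^2 = 4 * B * (B - Re (phi z))"
   unfolding cmod_power2 by (simp add: power2_eq_square algebra_simps)
  also have "... > 0" using Rephi[OF that] B1 by simp
  finally have "norm (phi z)^2 < norm (of_real (2 * B) - phi z)^2" by simp
  thus ?thesis by (rule power2_less_imp_less) simp
 qed
 have holphi: "phi holomorphic_on ball 0 R"
  unfolding phi_def by (intro holomorphic_intros holh)
 have holpsi: "psi holomorphic_on ball 0 R"
  unfolding psi_def by (intro holomorphic_intros holphi) (use nz in auto)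
 have small: "norm (psi z) \<le> norm z / R" if z: "norm z < R" for z
 proof -
  have "norm ((psi \<circ> (\<lambda>u. of_real R * u)) (z / of_real R)) \<le> norm (z / of_real R)"
  proof (rule Schwarz_Lemma)
   show "psi \<circ> (*) (of_real R) holomorphic_on ball 0 1"
    by (rule holomorphic_on_compose_gen[OF _ holpsi])
     (use R in \<open>auto intro!: holomorphic_intros simp: norm_mult\<close>)
   show "(psi \<circ> (*) (complex_of_real R)) 0 = 0" by (simp add: psi_def phi_def)
   show "cmod ((psi \<circ> (*) (complex_of_real R)) u) < 1" if "cmod u < 1" for u
   proof -
    have "norm (of_real R * u) < R" using that R by (simp add: norm_mult)
    from less[OF this] show ?thesis by (simp add: psi_def norm_divide divide_simps)
   qed
   show "cmod (z / complex_of_real R) < 1" using z R by (simp add: norm_divide)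
  qed
  thus ?thesis using R by (simp add: norm_divide)
 qed
 have bd: "norm (phi z) \<le> 2 * B" if z: "norm z \<le> R / 2" for z
 proof -
  have zR: "norm z < R" using z R by simp
  have "norm z / R \<le> 1/2" using z R by (simp add: field_simps)
  hence "norm (psi z) \<le> 1/2" using small[OF zR] by linarith
  hence "norm (phi z) \<le> 1/2 * norm (of_real (2 * B) - phi z)"
   using nz[OF zR] by (simp add: psi_def norm_divide field_simps)
  also have "... \<le> 1/2 * (2 * B + norm (phi z))"
   using norm_triangle_ineq4[of "of_real (2 * B)" "phi z"] B1 by simp
  finally show ?thesis by simp
 qed
 have sub: "cball w (R/4) \<subseteq> ball 0 R" "\<And>z. dist w z \<le> R/4 ==> norm z \<le> R/2"
 proof -
  have *: "norm z \<le> R/2" if "dist w z \<le> R/4" for z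
   using that w norm_triangle_ineq3[of w z] by (auto simp: dist_norm)
  thus "\<And>z. dist w z \<le> R/4 ==> norm z \<le> R/2" by blast
  show "cball w (R/4) \<subseteq> ball 0 R" using * R by force
 qed
 have holh': "h holomorphic_on ball w (R/4)" "continuous_on (cball w (R/4)) (\<lambda>z. h z - h 0)"
  by (rule holomorphic_on_subset[OF holh], use sub(1) in auto)
   (intro holomorphic_on_imp_continuous_on holomorphic_intros holomorphic_on_subset[OF holh sub(1)])
 have "norm ((deriv ^^ 2) phi w) \<le> fact 2 * (2 * B) / (R/4)^2"
 proof (rule Cauchy_inequality)
  show "phi holomorphic_on ball w (R / 4)"
   unfolding phi_def by (intro holomorphic_intros holh')
  show "continuous_on (cball w (R / 4)) phi" unfolding phi_def by (rule holh')
  show "cmod (phi x) \<le> 2 * B" if "cmod (w - x) = R / 4" for x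
   using bd sub(2)[of x] that by (simp add: dist_norm)
 qed (use R in auto)
 moreover have "(deriv ^^ 2) phi w = (deriv ^^ 2) h w"
 proof -
  have wR: "w \<in> ball 0 R" using w R by simp
  have "(deriv ^^ 2) (\<lambda>w. h w - h 0) w = (deriv ^^ 2) h w - (deriv ^^ 2) (\<lambda>_. h 0) w"
   by (rule higher_deriv_diff[OF holh]) (use wR in \<open>auto intro!: holomorphic_intros\<close>)
  thus ?thesis by (simp add: phi_def)
 qed
 ultimately show ?thesis using R by (simp add: B_def power2_eq_square field_simps)
qed

lemma borel_caratheodory_deriv_diff:
 assumes holh: "h holomorphic_on ball 0 R" and R: "R > 0"
  and Re: "\<And>w. w \<in> ball 0 R ==> Re (h w) \<le> A" and s: "norm s \<le> R / 4"
 shows "norm (deriv h s - deriv h 0) \<le> 64 * (A - Re (h 0) + 1) / R^2 * norm s"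
proof -
 have "norm (deriv h s - deriv h 0) \<le> 64 * (A - Re (h 0) + 1) / R^2 * norm (s - 0)"
 proof (rule field_differentiable_bound[of "cball 0 (R/4)"])
  show "(deriv h has_field_derivative (deriv ^^ 2) h z) (at z within cball 0 (R / 4))"
   if "z \<in> cball 0 (R/4)" for z
  proof -
   have "z \<in> ball 0 R" using that R by auto
   hence "(deriv h has_field_derivative deriv (deriv h) z) (at z)"
    by (intro holomorphic_derivI[of _ "ball 0 R"] holomorphic_deriv holh) auto
   thus ?thesis by (simp add: numeral_2_eq_2 has_field_derivative_at_within)
  qed
  show "norm ((deriv ^^ 2) h z) \<le> 64 * (A - Re (h 0) + 1) / R^2" if "z \<in> cball 0 (R/4)" for z
   by (rule borel_caratheodory_second_deriv[OF holh R Re]) (use that in auto)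
 qed (use s R in auto)
 thus ?thesis by simp
qed

definition mult :: "(complex \<Rightarrow> complex) \<Rightarrow> complex \<Rightarrow> nat" where
 "mult f z = nat (zorder f z)"

lemma entire_zero_factor:
 assumes "f holomorphic_on UNIV" "f w0 \<noteq> 0"
 obtains r where "r > 0" "zor_poly f z holomorphic_on cball z r"
  "\<And>w. w \<in> cball z r ==> f w = zor_poly f z w * (w - z) ^ mult f z \<and> zor_poly f z w \<noteq> 0"
  "f z = 0 \<longleftrightarrow> mult f z > 0"
proof -
 have "\<exists>w\<in>UNIV. f w \<noteq> 0" using assms by blast
 note zorder_exist_zero[OF assms(1) open_UNIV connected_UNIV UNIV_I this, of z]
 hence *: "if f z = 0 then 0 < zorder f z else zorder f z = 0"
  "\<exists>r>0. cball z r \<subseteq> UNIV \<and> zor_poly f z holomorphic_on cball z r \<and>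
   (\<forall>w\<in>cball z r. f w = zor_poly f z w * (w - z) ^ nat (zorder f z) \<and> zor_poly f z w \<noteq> 0)"
  by blast+
 from *(2) obtain r where r: "r > 0" "zor_poly f z holomorphic_on cball z r"
   "\<forall>w\<in>cball z r. f w = zor_poly f z w * (w - z) ^ nat (zorder f z) \<and> zor_poly f z w \<noteq> 0"
  by metis
 have m: "f z = 0 \<longleftrightarrow> mult f z > 0"
 proof (cases "f z = 0")
  case True
  thus ?thesis using *(1) by (simp add: mult_def)
 next
  case False
  thus ?thesis using *(1) by (simp add: mult_def)
 qed
 show ?thesis
 proof (rule that[OF r(1,2) _ m])
  fix w assume "w \<in> cball z r"
  thus "f w = zor_poly f z w * (w - z) ^ mult f z \<and> zor_poly f z w \<noteq> 0"
   using r(3) unfolding mult_def by (rule_tac bspec)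
 qed
qed

lemma entire_finite_zero_factor:
 assumes hol: "f holomorphic_on UNIV" and nz: "f w0 \<noteq> 0" and fin: "finite S"
 obtains g where "g holomorphic_on UNIV" "\<And>w. f w = (\<Prod>z\<in>S. (w - z) ^ mult f z) * g w"
  "\<And>z. z \<in> S ==> g z \<noteq> 0"
proof -
 define P where "P = (\<lambda>w. \<Prod>z\<in>S. (w - z) ^ mult f z)"
 define Q where "Q = (\<lambda>z w. \<Prod>u\<in>S-{z}. (w - u) ^ mult f u)"
 \<comment> \<open>On \<open>S\<close> the quotient \<open>f w / P w\<close> may read
   \<open>0 / 0\<close>, so its limit is put in by hand through \<open>zor_poly\<close>.\<close>
 define g where "g = (\<lambda>w. if w \<in> S then zor_poly f w w / Q w w else f w / P w)"
 have PQ: "P w = (w - z) ^ mult f z * Q z w" if "z \<in> S" for z w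
  unfolding P_def Q_def using fin that by (simp add: prod.remove)
 have P0: "P w \<noteq> 0" if "w \<notin> S" for w using that fin by (auto simp: P_def)
 have Q0: "Q z w \<noteq> 0" if "w \<notin> S - {z}" for z w using that fin by (auto simp: Q_def)
 have near: "\<exists>e>0. \<forall>w\<in>ball z e. g w = zor_poly f z w / Q z w \<and> w \<notin> S - {z}" if z: "z \<in> S" for z
 proof -
  obtain r where r: "r > 0" "zor_poly f z holomorphic_on cball z r"
   "\<And>w. w \<in> cball z r ==> f w = zor_poly f z w * (w - z) ^ mult f z \<and> zor_poly f z w \<noteq> 0"
   using entire_zero_factor[OF hol nz] by metis
  obtain d where d: "d > 0" "\<And>w. w \<in> S ==> w \<noteq> z ==> d \<le> dist z w"
   using finite_set_avoid[OF fin, of z] by auto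
  show ?thesis
  proof (intro exI[of _ "min r d"] conjI ballI)
   fix w assume w: "w \<in> ball z (min r d)"
   show "w \<notin> S - {z}" using d(2)[of w] w by force
   show "g w = zor_poly f z w / Q z w"
   proof (cases "w = z")
    case False
    hence "w \<notin> S" using d(2)[of w] w by force
    thus ?thesis using r(3)[of w] w False P0 PQ[OF z] by (auto simp: g_def)
   qed (use z in \<open>simp add: g_def\<close>)
  qed (use r d in auto)
 qed
 have "g field_differentiable at w" for w
 proof (cases "w \<in> S")
  case True
  obtain r where r: "r > 0" "zor_poly f w holomorphic_on cball w r"
   using entire_zero_factor[OF hol nz] by metis
  obtain e where e: "e > 0" "\<forall>u\<in>ball w e. g u = zor_poly f w u / Q w u \<and> u \<notin> S - {w}"
   using near[OF True] by auto
  have "(\<lambda>u. zor_poly f w u / Q w u) holomorphic_on ball w (min r e)"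
  proof (intro holomorphic_intros)
   show "zor_poly f w holomorphic_on ball w (min r e)" by (rule holomorphic_on_subset[OF r(2)]) auto
   show "Q w holomorphic_on ball w (min r e)" unfolding Q_def by (intro holomorphic_intros)
  qed (use e Q0 in auto)
  hence "g holomorphic_on ball w (min r e)"
   by (rule holomorphic_transform) (use e in auto)
  thus ?thesis using r e by (intro holomorphic_on_imp_differentiable_at[of _ "ball w (min r e)"]) auto
 next
  case False
  have "open (- S)" using fin by (simp add: finite_imp_closed open_Compl)
  have "(\<lambda>u. f u / P u) holomorphic_on - S"
   by (intro holomorphic_intros holomorphic_on_subset[OF hol]) (auto simp: P_def P0 intro!: holomorphic_intros, use P0 P_def in auto)
  hence "g holomorphic_on - S" by (rule holomorphic_transform) (auto simp: g_def)
  thus ?thesis using False \<open>open (- S)\<close> by (intro holomorphic_on_imp_differentiable_at[of _ "- S"]) auto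
 qed
 hence "g holomorphic_on UNIV" by (simp add: holomorphic_on_def field_differentiable_at_within)
 moreover have "f w = P w * g w" for w
 proof (cases "w \<in> S")
  case True
  obtain r where r: "r > 0"
   "\<And>u. u \<in> cball w r ==> f u = zor_poly f w u * (u - w) ^ mult f w \<and> zor_poly f w u \<noteq> 0"
   using entire_zero_factor[OF hol nz] by metis
  show ?thesis using r(2)[of w] r(1) True Q0 PQ[OF True, of w] by (simp add: g_def)
 qed (simp add: g_def P0)
 moreover have "g z \<noteq> 0" if "z \<in> S" for z
 proof -
  obtain r where r: "r > 0"
   "\<And>u. u \<in> cball z r ==> f u = zor_poly f z u * (u - z) ^ mult f z \<and> zor_poly f z u \<noteq> 0"
   using entire_zero_factor[OF hol nz] by metis
  show ?thesis using r(2)[of z] r(1) that Q0 by (simp add: g_def)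
 qed
 ultimately show ?thesis using that unfolding P_def by blast
qed

lemma has_field_derivative_prod_power:
 fixes u :: "'a \<Rightarrow> complex \<Rightarrow> complex"
 assumes "finite S" "\<And>z. z \<in> S ==> (u z has_field_derivative d z) (at w)"
  "\<And>z. z \<in> S ==> u z w \<noteq> 0"
 shows "((\<lambda>w. \<Prod>z\<in>S. u z w ^ n z) has_field_derivative
  (\<Prod>z\<in>S. u z w ^ n z) * (\<Sum>z\<in>S. of_nat (n z) * (d z / u z w))) (at w)"
 using assms
proof (induction S rule: finite_induct)
 case (insert x S)
 have "((\<lambda>w. u x w ^ n x) has_field_derivative u x w ^ n x * (of_nat (n x) * (d x / u x w))) (at w)"
 proof (cases "n x")
  case (Suc k)
  have "((\<lambda>w. u x w ^ n x) has_field_derivative of_nat (n x) * (d x * u x w ^ (n x - Suc 0))) (at w)"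
   by (rule DERIV_power) (use insert.prems in simp)
  moreover have "of_nat (n x) * (d x * u x w ^ (n x - Suc 0)) = u x w ^ n x * (of_nat (n x) * (d x / u x w))"
   using insert.prems(2)[of x] by (simp add: Suc)
  ultimately show ?thesis by simp
 qed simp
 from DERIV_mult[OF this insert.IH] insert show ?case
  by (simp add: algebra_simps)
qed simp

text \<open>Each factor \<open>w - z\<close> is exchanged for the Blaschke factor
  \<open>v z w\<close>, which has the same modulus on the circle and no zero inside. The new
  function keeps the bound \<open>exp A\<close> inside and has a logarithm \<open>h\<close>.
  \<open>Re (h 0)\<close> gives Jensen's formula, and the derivative of \<open>h\<close> shows the
  zeros next to their reflections in the circle.\<close>

lemma blaschke_log:
 assumes hol: "f holomorphic_on UNIV" and f0: "f 0 \<noteq> 0" and R: "R > 0"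
  and bd: "\<And>w. norm w = R ==> norm (f w) \<le> exp A"
 defines "S \<equiv> {z. norm z < R \<and> f z = 0}"
 obtains h where "h holomorphic_on ball 0 R" "\<And>w. w \<in> ball 0 R ==> Re (h w) \<le> A"
  "Re (h 0) = ln (norm (f 0)) + (\<Sum>z\<in>S. mult f z * ln (R / norm z))"
  "\<And>w. w \<in> ball 0 R ==> f w \<noteq> 0 ==> deriv h w = deriv f w / f w
    - (\<Sum>z\<in>S. of_nat (mult f z) * (1 / (w - z)))
    - (\<Sum>z\<in>S. of_nat (mult f z) * (cnj z / (of_real (R^2) - cnj z * w)))"
  "finite S"
proof -
 have nconst: "\<not> f constant_on UNIV" if "f z = 0" for z
  using that f0 unfolding constant_on_def by (metis UNIV_I)
 have fin: "finite S"
 proof (cases "\<exists>z. f z = 0")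
  case True
  have "finite {z \<in> cball 0 R. f z = 0}"
   by (rule holomorphic_compact_finite_zeros[OF hol]) (use True nconst in auto)
  thus ?thesis by (rule rev_finite_subset) (auto simp: S_def)
 qed (auto simp: S_def)
 obtain g where g: "g holomorphic_on UNIV" "\<And>w. f w = (\<Prod>z\<in>S. (w - z) ^ mult f z) * g w"
  "\<And>z. z \<in> S ==> g z \<noteq> 0"
  using entire_finite_zero_factor[OF hol f0 fin] by blast
 define v where "v = (\<lambda>z w. (of_real (R^2) - cnj z * w) / of_real R)"
 define F where "F = (\<lambda>w. g w * (\<Prod>z\<in>S. v z w ^ mult f z))"
 have v0: "v z w \<noteq> 0" if "z \<in> S" "norm w < R" for z w
 proof -
  have "norm (cnj z * w) < R * R" using that unfolding norm_mult S_def
   by (intro mult_strict_mono') auto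
  hence "cnj z * w \<noteq> of_real (R^2)" using R by (metis norm_of_real abs_of_nonneg less_irrefl power2_eq_square zero_le_power2)
  thus ?thesis using R by (auto simp: v_def)
 qed
 have g0: "g w \<noteq> 0" if "norm w < R" for w
  using g(2)[of w] g(3)[of w] that by (cases "w \<in> S") (auto simp: S_def)
 have holF: "F holomorphic_on A" for A
  unfolding F_def v_def using R by (intro holomorphic_intros holomorphic_on_subset[OF g(1)]) auto
 have F0: "F w \<noteq> 0" if "norm w < R" for w
  using g0[OF that] v0 that fin by (auto simp: F_def)
 have vR: "norm (v z w) = norm (w - z)" if "norm w = R" for z w
 proof -
  have "of_real (R^2) = w * cnj w" using that by (metis complex_norm_square of_real_power)
  hence "v z w = w * cnj (w - z) / of_real R" by (simp add: v_def algebra_simps)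
  thus ?thesis using R that by (simp add: norm_mult norm_divide del: complex_cnj_diff)
 qed
 have FR: "norm (F w) \<le> exp A" if "norm w = R" for w
 proof -
  have "norm (F w) = norm (f w)"
   by (subst g(2)) (simp add: F_def vR[OF that] mult.commute norm_mult norm_power prod_norm[symmetric])
  thus ?thesis using bd[OF that] by simp
 qed
 have Fle: "norm (F w) \<le> exp A" if "norm w < R" for w
 proof (rule maximum_modulus_frontier[of F "ball 0 R"])
  show "continuous_on (closure (ball 0 R)) F" by (intro holomorphic_on_imp_continuous_on holF)
 qed (use that R FR in \<open>auto intro: holF\<close>)
 obtain h where h: "h holomorphic_on ball 0 R" "\<And>x. x \<in> ball 0 R ==> exp (h x) = F x"
  by (rule holomorphic_logarithm_exists[of "ball 0 R" F 0]) (use R F0 holF in auto)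
 have Reh: "Re (h w) = ln (norm (F w))" if "norm w < R" for w
  using h(2)[of w] that by (metis dist_0_norm ln_exp mem_ball norm_exp_eq_Re)
 show ?thesis
 proof
  show "h holomorphic_on ball 0 R" by fact
  show "finite S" by fact
  show "Re (h w) \<le> A" if "w \<in> ball 0 R" for w
  proof -
   have "ln (norm (F w)) \<le> ln (exp A)" using Fle[of w] F0[of w] that
    by (intro ln_mono) auto
   thus ?thesis using Reh[of w] that by simp
  qed
  have S0: "z \<noteq> 0" if "z \<in> S" for z using that f0 by (auto simp: S_def)
  have "norm (F 0) = norm (f 0) * (\<Prod>z\<in>S. (R / norm z) ^ mult f z)"
  proof -
   have "norm (F 0) = norm (g 0) * (\<Prod>z\<in>S. R ^ mult f z)"
    using R by (simp add: F_def v_def norm_mult prod_norm[symmetric] norm_power norm_divide power2_eq_square)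
   moreover have "norm (f 0) = norm (g 0) * (\<Prod>z\<in>S. norm z ^ mult f z)"
    by (subst g(2)) (simp add: norm_mult prod_norm[symmetric] norm_power)
   moreover have "(\<Prod>z\<in>S. norm z ^ mult f z) \<noteq> 0" using fin S0 by auto
   ultimately show ?thesis by (simp add: power_divide prod_dividef)
  qed
  moreover have "(\<Prod>z\<in>S. (R / norm z) ^ mult f z) > 0" using R S0 by (intro prod_pos) auto
  moreover have "ln (\<Prod>z\<in>S. (R / norm z) ^ mult f z) = (\<Sum>z\<in>S. mult f z * ln (R / norm z))"
   using R S0 fin by (subst ln_prod) (auto simp: ln_realpow)
  ultimately show "Re (h 0) = ln (norm (f 0)) + (\<Sum>z\<in>S. mult f z * ln (R / norm z))"
   using Reh[of 0] R f0 by (simp add: ln_mult)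
  show "deriv h w = deriv f w / f w - (\<Sum>z\<in>S. of_nat (mult f z) * (1 / (w - z)))
    - (\<Sum>z\<in>S. of_nat (mult f z) * (cnj z / (of_real (R^2) - cnj z * w)))"
   if w: "w \<in> ball 0 R" and fw: "f w \<noteq> 0" for w
  proof -
   have wS: "w - z \<noteq> 0" if "z \<in> S" for z using that fw by (auto simp: S_def)
   have gw: "g w \<noteq> 0" using g0 w by auto
   have dg: "(g has_field_derivative deriv g w) (at w)"
    using g(1) by (intro holomorphic_derivI[of g UNIV]) auto
   have pder: "((\<lambda>w. \<Prod>z\<in>S. (w - z) ^ mult f z) has_field_derivative
     (\<Prod>z\<in>S. (w - z) ^ mult f z) * (\<Sum>z\<in>S. of_nat (mult f z) * (1 / (w - z)))) (at w)"
    by (rule has_field_derivative_prod_power[OF fin]) (use wS in \<open>auto intro!: derivative_eq_intros\<close>)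
   have vder: "((\<lambda>w. \<Prod>z\<in>S. v z w ^ mult f z) has_field_derivative
     (\<Prod>z\<in>S. v z w ^ mult f z) * (\<Sum>z\<in>S. of_nat (mult f z) * ((- cnj z / of_real R) / v z w))) (at w)"
    by (rule has_field_derivative_prod_power[OF fin])
     (use v0 w R in \<open>auto simp: v_def intro!: derivative_eq_intros\<close>)
   have "(f has_field_derivative f w * ((\<Sum>z\<in>S. of_nat (mult f z) * (1 / (w - z))) + deriv g w / g w)) (at w)"
   proof -
    have feq: "(\<lambda>x. (\<Prod>z\<in>S. (x - z) ^ mult f z) * g x) = f" by (rule ext) (rule g(2)[symmetric])
    have val: "(\<Prod>z\<in>S. (w - z) ^ mult f z) * (\<Sum>z\<in>S. of_nat (mult f z) * (1 / (w - z))) * g w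
      + deriv g w * (\<Prod>z\<in>S. (w - z) ^ mult f z)
     = ((\<Prod>z\<in>S. (w - z) ^ mult f z) * g w) * ((\<Sum>z\<in>S. of_nat (mult f z) * (1 / (w - z))) + deriv g w / g w)"
     using gw by (simp add: field_simps)
    show ?thesis using DERIV_mult[OF pder dg] unfolding val feq g(2)[of w, symmetric] .
   qed
   hence f': "deriv f w / f w = (\<Sum>z\<in>S. of_nat (mult f z) * (1 / (w - z))) + deriv g w / g w"
    using fw by (simp add: DERIV_imp_deriv)
   have "(F has_field_derivative F w * (deriv g w / g w +
     (\<Sum>z\<in>S. of_nat (mult f z) * ((- cnj z / of_real R) / v z w)))) (at w)"
   proof -
    have val: "deriv g w * (\<Prod>z\<in>S. v z w ^ mult f z) +
      (\<Prod>z\<in>S. v z w ^ mult f z) * (\<Sum>z\<in>S. of_nat (mult f z) * ((- cnj z / of_real R) / v z w)) * g w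
     = F w * (deriv g w / g w + (\<Sum>z\<in>S. of_nat (mult f z) * ((- cnj z / of_real R) / v z w)))"
     using gw by (simp add: F_def field_simps del: sum_negf)
    show ?thesis using DERIV_mult[OF dg vder] unfolding val by (simp add: F_def[abs_def])
   qed
   hence F': "deriv F w = F w * (deriv g w / g w +
     (\<Sum>z\<in>S. of_nat (mult f z) * ((- cnj z / of_real R) / v z w)))"
    by (rule DERIV_imp_deriv)
   have "(h has_field_derivative deriv h w) (at w)"
    using h(1) w by (intro holomorphic_derivI[of h "ball 0 R"]) auto
   from DERIV_chain2[OF DERIV_exp this]
   have "((\<lambda>w. exp (h w)) has_field_derivative exp (h w) * deriv h w) (at w)" .
   hence "(F has_field_derivative exp (h w) * deriv h w) (at w)"
    by (rule has_field_derivative_transform_within_open[of _ _ _ "ball 0 R"]) (use h(2) w in auto)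
   hence "deriv F w = F w * deriv h w" using h(2) w by (simp add: DERIV_imp_deriv)
   hence "deriv h w = deriv g w / g w + (\<Sum>z\<in>S. of_nat (mult f z) * ((- cnj z / of_real R) / v z w))"
    using F' F0[of w] w by simp
   also have "(\<Sum>z\<in>S. of_nat (mult f z) * ((- cnj z / of_real R) / v z w)) =
     - (\<Sum>z\<in>S. of_nat (mult f z) * (cnj z / (of_real (R^2) - cnj z * w)))"
    unfolding sum_negf[symmetric] using R by (intro sum.cong refl) (simp add: v_def)
   finally show ?thesis using f' by (simp add: algebra_simps)
  qed
 qed
qed

text \<open>Partial fractions without a product formula. Between 0 and \<open>s\<close> the
  derivative of the logarithm from \<open>blaschke_log\<close> changes by \<open>o(1)\<close>, and
  so does the sum over the reflected zeros, because \<open>B R\<close> is \<open>o(R^2)\<close>.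
  Subtracting the values at 0 is what makes this growth condition sufficient.\<close>

theorem partial_fraction_limit:
 assumes hol: "f holomorphic_on UNIV" and f0: "f 0 \<noteq> 0" and fs: "f s \<noteq> 0"
  and growth: "\<And>R w. R \<ge> 1 ==> norm w \<le> R ==> norm (f w) \<le> exp (B R)"
  and lim: "((\<lambda>R. B R / R^2) \<longlongrightarrow> 0) at_top"
 shows "((\<lambda>R::real. \<Sum>z | norm z < R \<and> f z = 0. of_nat (mult f z) * (1 / (s - z) + 1 / z)) \<longlongrightarrow>
  deriv f s / f s - deriv f 0 / f 0) at_top"
proof -
 define S where "S = (\<lambda>R::real. {z. norm z < R \<and> f z = 0})"
 define c where "c = ln (norm (f 0))"
 have S_eq: "{z. norm z < R \<and> f z = 0} = S R" for R by (simp add: S_def)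
 have fin: "finite (S R)" if "R > 0" for R
 proof -
  have bd: "\<And>w. norm w = R ==> norm (f w) \<le> exp (B (max 1 R))" using growth[of "max 1 R"] by simp
  show ?thesis by (rule blaschke_log[OF hol f0 \<open>R > 0\<close> bd, unfolded S_eq])
 qed
 have S0: "z \<noteq> 0" if "z \<in> S R" for z R using that f0 by (auto simp: S_def)
 \<comment> \<open>Jensen's formula in radius \<open>3 * R\<close>: as \<open>exp 1 \<le> 3\<close>,
   each zero of modulus below \<open>R\<close> counts at least 1.\<close>
 have cnt: "(\<Sum>z\<in>S R. real (mult f z)) \<le> B (3 * R) - c" if R: "R \<ge> 1" for R
 proof -
  have R3: "3 * R > 0" using R by simp
  have bd: "\<And>w. norm w = 3 * R ==> norm (f w) \<le> exp (B (3 * R))" using growth[of "3*R"] R by simp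
  obtain h where h: "h holomorphic_on ball 0 (3*R)" "\<And>w. w \<in> ball 0 (3*R) ==> Re (h w) \<le> B (3*R)"
   "Re (h 0) = ln (norm (f 0)) + (\<Sum>z\<in>S (3*R). mult f z * ln (3*R / norm z))"
   "\<And>w. w \<in> ball 0 (3*R) ==> f w \<noteq> 0 ==> deriv h w = deriv f w / f w
    - (\<Sum>z\<in>S (3*R). of_nat (mult f z) * (1 / (w - z)))
    - (\<Sum>z\<in>S (3*R). of_nat (mult f z) * (cnj z / (of_real ((3*R)^2) - cnj z * w)))" "finite (S (3*R))"
  proof -
   show thesis by (rule blaschke_log[OF hol f0 R3 bd, unfolded S_eq], assumption, rule that)
  qed
  have "(\<Sum>z\<in>S R. real (mult f z)) \<le> (\<Sum>z\<in>S R. mult f z * ln (3*R / norm z))"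
  proof (rule sum_mono)
   fix z assume z: "z \<in> S R"
   have "3 \<le> 3 * R / norm z" using z S0[OF z] by (auto simp: S_def field_simps)
   moreover have "exp 1 \<le> (3::real)" using exp_le by simp
   ultimately have "ln (exp 1) \<le> ln (3 * R / norm z)" by (intro ln_mono) auto
   hence "1 \<le> ln (3 * R / norm z)" by simp
   from mult_left_mono[OF this, of "real (mult f z)"]
   show "real (mult f z) \<le> mult f z * ln (3*R / norm z)" by simp
  qed
  also have "... \<le> (\<Sum>z\<in>S (3*R). mult f z * ln (3*R / norm z))"
  proof (rule sum_mono2)
   show "finite (S (3*R))" using fin R3 by blast
   show "S R \<subseteq> S (3*R)" using R by (auto simp: S_def)
   show "0 \<le> mult f z * ln (3*R / norm z)" if "z \<in> S (3*R) - S R" for z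
   proof -
    have "1 \<le> 3 * R / norm z" using that S0[of z "3*R"] by (auto simp: S_def field_simps)
    thus ?thesis by simp
   qed
  qed
  also have "... \<le> B (3 * R) - c" using h(2)[of 0] h(3) R by (simp add: c_def)
  finally show ?thesis .
 qed
 define E where "E = (\<lambda>R::real. 64 * (B R - c + 1) / R^2 * norm s + 2 * norm s * (B (3 * R) - c) / R^2)"
 have main: "norm ((\<Sum>z\<in>S R. of_nat (mult f z) * (1 / (s - z) + 1 / z)) - (deriv f s / f s - deriv f 0 / f 0)) \<le> E R"
  if R1: "R \<ge> 1" and Rs: "R \<ge> 4 * norm s" for R
 proof -
  have R: "R > 0" using R1 by simp
  have sR: "norm s < R" using Rs R by (cases "norm s = 0") auto
  have bd: "\<And>w. norm w = R ==> norm (f w) \<le> exp (B R)" using growth[of R] R1 by simp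
  obtain h where h: "h holomorphic_on ball 0 (R)" "\<And>w. w \<in> ball 0 (R) ==> Re (h w) \<le> B (R)"
   "Re (h 0) = ln (norm (f 0)) + (\<Sum>z\<in>S (R). mult f z * ln (R / norm z))"
   "\<And>w. w \<in> ball 0 (R) ==> f w \<noteq> 0 ==> deriv h w = deriv f w / f w
    - (\<Sum>z\<in>S (R). of_nat (mult f z) * (1 / (w - z)))
    - (\<Sum>z\<in>S (R). of_nat (mult f z) * (cnj z / (of_real ((R)^2) - cnj z * w)))" "finite (S (R))"
  proof -
   show thesis by (rule blaschke_log[OF hol f0 R bd, unfolded S_eq], assumption, rule that)
  qed
  have "(\<Sum>z\<in>S R. mult f z * ln (R / norm z)) \<ge> 0"
  proof (rule sum_nonneg)
   fix z assume z: "z \<in> S R"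
   have "1 \<le> R / norm z" using z S0[OF z] by (auto simp: S_def field_simps)
   thus "0 \<le> mult f z * ln (R / norm z)" by simp
  qed
  hence h0: "Re (h 0) \<ge> c" using h(3) by (simp add: c_def)
  have "norm (deriv h s - deriv h 0) \<le> 64 * (B R - Re (h 0) + 1) / R^2 * norm s"
   by (rule borel_caratheodory_deriv_diff[OF h(1) R h(2)]) (use Rs in auto)
  also have "... \<le> 64 * (B R - c + 1) / R^2 * norm s"
   using h0 by (intro mult_right_mono divide_right_mono) auto
  finally have 1: "norm (deriv h s - deriv h 0) \<le> 64 * (B R - c + 1) / R^2 * norm s" .
  define T where "T = (\<Sum>z\<in>S R. of_nat (mult f z) * (cnj z / (of_real (R^2) - cnj z * s)))
   - (\<Sum>z\<in>S R. of_nat (mult f z) * (cnj z / of_real (R^2)))"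
  have hs: "deriv h s = deriv f s / f s
    - (\<Sum>z\<in>S R. of_nat (mult f z) * (1 / (s - z)))
    - (\<Sum>z\<in>S R. of_nat (mult f z) * (cnj z / (of_real (R^2) - cnj z * s)))"
   using h(4)[of s] fs sR by simp
  have hz: "deriv h 0 = deriv f 0 / f 0
    + (\<Sum>z\<in>S R. of_nat (mult f z) * (1 / z))
    - (\<Sum>z\<in>S R. of_nat (mult f z) * (cnj z / of_real (R^2)))"
   using h(4)[of 0] f0 R by (simp add: sum_negf)
  have "(\<Sum>z\<in>S R. of_nat (mult f z) * (1 / (s - z) + 1 / z)) =
    (\<Sum>z\<in>S R. of_nat (mult f z) * (1 / (s - z))) + (\<Sum>z\<in>S R. of_nat (mult f z) * (1 / z))"
   by (simp add: sum.distrib[symmetric] distrib_left)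
  hence eq: "(\<Sum>z\<in>S R. of_nat (mult f z) * (1 / (s - z) + 1 / z)) - (deriv f s / f s - deriv f 0 / f 0)
   = - (deriv h s - deriv h 0) - T"
   unfolding hs hz T_def by (simp add: algebra_simps)
  have "norm T \<le> (\<Sum>z\<in>S R. real (mult f z) * (2 * norm s / R^2))"
   unfolding T_def sum_subtractf[symmetric] right_diff_distrib[symmetric]
  proof (rule sum_norm_le)
   fix z assume z: "z \<in> S R"
   have zR: "norm z < R" using z by (simp add: S_def)
   have "norm (cnj z * s) \<le> R * (R / 4)" using zR Rs unfolding norm_mult
    by (intro mult_mono) (use R in auto)
   hence low: "norm (of_real (R^2) - cnj z * s) \<ge> R^2 / 2"
    using norm_triangle_ineq2[of "of_real (R^2)" "cnj z * s"] R
    by (simp add: power2_eq_square norm_mult) (smt (verit) mult_nonneg_nonneg)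
   hence nz: "of_real (R^2) - cnj z * s \<noteq> 0" using R by force
   have "cnj z / (of_real (R^2) - cnj z * s) - cnj z / of_real (R^2)
    = cnj z * cnj z * s / (of_real (R^2) * (of_real (R^2) - cnj z * s))"
    using nz R by (simp add: divide_simps) (simp add: algebra_simps)
   also have "norm ... = norm z * norm z * norm s / (R^2 * norm (of_real (R^2) - cnj z * s))"
    by (simp add: norm_mult norm_divide norm_power)
   also have "... \<le> R * R * norm s / (R^2 * (R^2 / 2))"
    using zR R low by (intro frac_le mult_mono mult_nonneg_nonneg) auto
   also have "... = 2 * norm s / R^2" using R by (simp add: power2_eq_square)
   finally show "norm (of_nat (mult f z) * (cnj z / (of_real (R^2) - cnj z * s) - cnj z / of_real (R^2)))
    \<le> real (mult f z) * (2 * norm s / R^2)"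
    unfolding norm_mult norm_of_nat by (rule mult_left_mono) auto
  qed
  also have "... = (\<Sum>z\<in>S R. real (mult f z)) * (2 * norm s / R^2)" by (rule sum_distrib_right[symmetric])
  also have "... \<le> (B (3 * R) - c) * (2 * norm s / R^2)"
   by (rule mult_right_mono[OF cnt[OF R1]]) auto
  finally have 2: "norm T \<le> (B (3 * R) - c) * (2 * norm s / R^2)" .
  show ?thesis unfolding eq E_def
   using norm_triangle_ineq4[of "- (deriv h s - deriv h 0)" T] 1 2
   by (simp add: norm_minus_commute mult.commute mult.left_commute)
 qed
 have lim3: "((\<lambda>R. B (3 * R) / R^2) \<longlongrightarrow> 0) at_top"
 proof -
  have "filterlim (\<lambda>R::real. 3 * R) at_top at_top"
   by (rule filterlim_tendsto_pos_mult_at_top[OF tendsto_const]) (auto intro: filterlim_ident)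
  from filterlim_compose[OF lim this] have "((\<lambda>R. B (3 * R) / (3 * R)^2) \<longlongrightarrow> 0) at_top" .
  from tendsto_mult[OF this tendsto_const[of 9]] show ?thesis by (simp add: power2_eq_square)
 qed
 have limc: "((\<lambda>R::real. k / R^2) \<longlongrightarrow> 0) at_top" for k :: real by real_asymp
 have "((\<lambda>R::real. 64 * (B R / R^2 + (1 - c) / R^2) * norm s + 2 * norm s * (B (3 * R) / R^2 - c / R^2)) \<longlongrightarrow>
   64 * (0 + 0) * norm s + 2 * norm s * (0 - 0)) at_top"
  by (intro tendsto_intros lim lim3 limc)
 moreover have "E = (\<lambda>R::real. 64 * (B R / R^2 + (1 - c) / R^2) * norm s + 2 * norm s * (B (3 * R) / R^2 - c / R^2))"
  by (rule ext) (simp add: E_def diff_divide_distrib add_divide_distrib algebra_simps)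
 ultimately have E0: "(E \<longlongrightarrow> 0) at_top" by simp
 have "((\<lambda>R. (\<Sum>z\<in>S R. of_nat (mult f z) * (1 / (s - z) + 1 / z)) - (deriv f s / f s - deriv f 0 / f 0)) \<longlongrightarrow> 0) at_top"
  by (rule Lim_null_comparison[OF _ E0])
   (use main in \<open>auto intro!: eventually_at_top_linorderI[of "max 1 (4 * norm s)"]\<close>)
 thus ?thesis unfolding S_def by (subst (asm) LIM_zero_iff)
qed

section \<open>The sum over the zeros of an L-function\<close>

text \<open>The real part of \<open>1 / (u + ig)\<close> is \<open>pker u g\<close>. For a primitive character, \<open>zero_side\<close> is the sum of
 \<open>pker (s - 1/2)\<close> over the ordinates of its zeros.\<close>

abbreviation pker :: "real \<Rightarrow> real \<Rightarrow> real" where "pker u g \<equiv> u / (u^2 + g^2)"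
abbreviation qker :: "real \<Rightarrow> real \<Rightarrow> real" where "qker u g \<equiv> 1 / (u^2 + g^2)"
abbreviation msum :: "(nat \<Rightarrow> real) \<Rightarrow> real \<Rightarrow> real" where "msum f s \<equiv> \<Sum>n. mangoldt n * f n * real n powr (- s)"
abbreviation zero_side :: "nat \<Rightarrow> nat \<Rightarrow> (nat \<Rightarrow> real) \<Rightarrow> real \<Rightarrow> real" where
 "zero_side m a f s \<equiv> ln (m / pi) / 2 + Digamma ((s + a) / 2) / 2 - msum f s"

text \<open>For nonnegative terms, convergence along one exhaustion by finite sets already gives
  unconditional summability, which frees the zeros from their order by modulus.\<close>

lemma has_sum_exhaustion:
 fixes f :: "'a \<Rightarrow> real" and AR :: "real \<Rightarrow> 'a set"
 assumes nonneg: "\<And>x. x \<in> A ==> f x \<ge> 0"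
  and fin: "\<And>R::real. finite (AR R)" and mono: "\<And>R R'. R \<le> R' ==> AR R \<subseteq> AR R'"
  and un: "A = (\<Union>R. AR R)" and lim: "((\<lambda>R. \<Sum>x\<in>AR R. f x) \<longlongrightarrow> L) at_top"
 shows "(f has_sum L) A"
proof -
 have ex: "\<exists>R. F \<subseteq> AR R" if "finite F" "F \<subseteq> A" for F
  using that
 proof (induction F rule: finite_induct)
  case (insert x F)
  then obtain R R' where "F \<subseteq> AR R" "x \<in> AR R'" using un by auto
  hence "insert x F \<subseteq> AR (max R R')" using mono[of R "max R R'"] mono[of R' "max R R'"] by auto
  thus ?case by blast
 qed simp
 have sub: "AR R \<subseteq> A" for R using un by blast
 have le: "(\<Sum>x\<in>AR R. f x) \<le> L" for R
 proof (rule tendsto_lowerbound[OF lim])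
  show "\<forall>\<^sub>F R' in at_top. (\<Sum>x\<in>AR R. f x) \<le> (\<Sum>x\<in>AR R'. f x)"
   using eventually_ge_at_top[of R]
  proof eventually_elim
   case (elim R')
   show ?case by (rule sum_mono2[OF fin mono[OF elim]]) (use nonneg sub in blast)
  qed
 qed simp
 have "f summable_on A"
 proof (rule nonneg_bdd_above_summable_on[OF nonneg])
  show "bdd_above (sum f ` {F. F \<subseteq> A \<and> finite F})"
  proof (rule bdd_aboveI2)
   fix F assume "F \<in> {F. F \<subseteq> A \<and> finite F}"
   then obtain R where "F \<subseteq> AR R" using ex by blast
   hence "sum f F \<le> sum f (AR R)" by (intro sum_mono2 fin) (use nonneg sub in blast)+
   thus "sum f F \<le> L" using le[of R] by linarith
  qed
 qed
 then obtain S where S: "(f has_sum S) A" by (auto simp: summable_on_def)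
 have "filterlim AR (finite_subsets_at_top A) at_top"
  unfolding filterlim_finite_subsets_at_top
 proof safe
  fix F assume F: "finite F" "F \<subseteq> A"
  then obtain R where R: "F \<subseteq> AR R" using ex by blast
  show "\<forall>\<^sub>F R in at_top. finite (AR R) \<and> F \<subseteq> AR R \<and> AR R \<subseteq> A"
   using eventually_ge_at_top[of R]
  proof eventually_elim
   case (elim R')
   thus ?case using fin R mono[OF elim] sub by blast
  qed
 qed
 with S have "((\<lambda>R. sum f (AR R)) \<longlongrightarrow> S) at_top"
  unfolding has_sum_def by (rule filterlim_compose)
 with lim have "S = L" using tendsto_unique trivial_limit_at_top_linorder by blast
 thus ?thesis using S by simp
qed

text \<open>The enumeration is fixed before \<open>f\<close>, so a single family of ordinates serves
  every \<open>s\<close>. Indices outside \<open>I\<close> are padded with 0, since \<open>A\<close>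
  may be finite.\<close>

lemma countable_has_sum_nat_family:
 assumes "countable A"
 obtains g :: "nat \<Rightarrow> 'a" and I :: "nat set" where
  "\<And>i. i \<in> I ==> g i \<in> A"
  "\<And>(f :: 'a \<Rightarrow> real) L. (f has_sum L) A ==> (\<lambda>i. if i \<in> I then f (g i) else 0) sums L"
proof (rule that[of "to_nat_on A ` A" "from_nat_into A"])
 have inj: "inj_on (to_nat_on A) A" by (rule inj_on_to_nat_on[OF assms])
 show "from_nat_into A i \<in> A" if "i \<in> to_nat_on A ` A" for i using that assms by auto
 fix f :: "'a \<Rightarrow> real" and L assume f: "(f has_sum L) A"
 have "((\<lambda>i. f (from_nat_into A i)) has_sum L) (to_nat_on A ` A)"
  by (subst has_sum_reindex[OF inj], rule has_sum_cong[THEN iffD1, OF _ f]) (use assms in auto)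
 hence "((\<lambda>i. if i \<in> to_nat_on A ` A then f (from_nat_into A i) else 0) has_sum L) UNIV"
  by (rule has_sum_cong_neutral[THEN iffD2, rotated 3]) auto
 thus "(\<lambda>i. if i \<in> to_nat_on A ` A then f (from_nat_into A i) else 0) sums L" by (rule has_sum_imp_sums)
qed

context real_primitive_character
begin

text \<open>The completed L-function, that is
  \<open>(m / pi) powr ((s + a) / 2) * Gamma ((s + a) / 2)\<close> times the L-function; the
  argument of \<open>xi0\<close> centres it at \<open>1/2\<close>.\<close>

definition XI :: "complex \<Rightarrow> complex" where "XI s = xi0 ((s - 1/2) / 2)"

text \<open>Dividing by the gamma factor means multiplying by \<open>rGamma\<close>, which is
  entire, so the continuation needs no discussion of poles.\<close>

definition L_ext :: "complex \<Rightarrow> complex" where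
 "L_ext s = exp (- ((s + of_nat a) / 2 * of_real (ln (m / pi)))) * rGamma ((s + of_nat a) / 2) * XI s"

abbreviation "psic \<equiv> (\<lambda>n. complex_of_real (psi n))"

lemma XI_holomorphic: "XI holomorphic_on A"
 unfolding XI_def
 by (rule holomorphic_on_compose_gen[OF _ xi0_holomorphic, unfolded o_def]) (auto intro!: holomorphic_intros)

lemma XI_functional_equation: "XI (1 - s) = of_real kappa * XI s"
proof -
 have "(1 - s - 1/2) / 2 = - ((s - 1/2) / 2)" by (simp add: field_simps)
 thus ?thesis unfolding XI_def by (simp only: xi0_symmetric)
qed

lemma L_ext_holomorphic: "L_ext holomorphic_on A"
 unfolding L_ext_def by (intro holomorphic_intros XI_holomorphic) auto

lemma norm_psic: "norm (psic n) \<le> 1" using abs_chi_le by simp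
lemma psic_mult: "psic (k * n) = psic k * psic n" by (simp add: chi_mult)
lemma psic_one: "psic 1 = 1" using chi_1 by simp

lemma dirichlet_series_real:
 assumes "s > 1"
 shows "dirichlet_series psic (of_real s) = of_real (\<Sum>n. psi n * real n powr (- s))"
proof -
 have "(\<lambda>n. psi n * real n powr (- s)) sums (\<Sum>n. psi n * real n powr (- s))"
  using Mellin_theta(2)[OF assms] by (intro summable_sums) (rule summable_rabs_cancel)
 hence "(\<lambda>n. complex_of_real (psi n * real n powr (- s))) sums of_real (\<Sum>n. psi n * real n powr (- s))"
  by (rule sums_of_real)
 moreover have "complex_of_real (psi n * real n powr (- s)) = psic n * of_nat n powr (- of_real s)" for n
  using powr_of_real[of "real n" "- s"] by simp
 ultimately show ?thesis unfolding dirichlet_series_def by (simp only: sums_iff)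
qed

lemma mangoldt_series_real:
 assumes "s > 1"
 shows "mangoldt_series psic (of_real s) = of_real (msum psi s)"
  "summable (\<lambda>n. mangoldt n * psi n * real n powr (- s))"
proof -
 have eq: "complex_of_real (mangoldt n * psi n * real n powr (- s)) = mangoldt n * psic n * of_nat n powr (- of_real s)" for n
  using powr_of_real[of "real n" "- s"] by simp
 have "summable (\<lambda>n. norm (mangoldt n * psic n * of_nat n powr (- of_real s)))"
  by (rule summable_dirichlet(2)[of psic, OF norm_psic]) (use assms in simp)
 hence "summable (\<lambda>n. norm (complex_of_real (mangoldt n * psi n * real n powr (- s))))" by (simp only: eq)
 hence "summable (\<lambda>n. norm (mangoldt n * psi n * real n powr (- s)))" by (simp only: norm_of_real real_norm_def)
 thus summ: "summable (\<lambda>n. mangoldt n * psi n * real n powr (- s))" by (rule summable_norm_cancel)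
 hence "(\<lambda>n. complex_of_real (mangoldt n * psi n * real n powr (- s))) sums of_real (msum psi s)"
  by (intro sums_of_real summable_sums)
 thus "mangoldt_series psic (of_real s) = of_real (msum psi s)"
  unfolding mangoldt_series_def eq by (simp add: sums_iff)
qed

lemma L_ext_real:
 assumes s: "s > 1"
 shows "L_ext (of_real s) = dirichlet_series psic (of_real s)"
proof -
 define sig where "sig = (s + real a) / 2"
 define S where "S = (\<Sum>n. psi n * real n powr (- s))"
 have sig: "sig > 0" using s by (simp add: sig_def)
 have "XI (of_real s) = xi0 (of_real ((s - 1/2) / 2))" by (simp add: XI_def)
 also have "... = of_real ((m / pi) powr sig * Gamma sig * S)"
  unfolding xi0_real Mellin_theta(1)[OF s] by (simp add: sig_def S_def)
 finally have 1: "XI (of_real s) = of_real ((m / pi) powr sig * Gamma sig * S)" .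
 have 2: "(of_real s + of_nat a) / 2 = complex_of_real sig" by (simp add: sig_def)
 have "L_ext (of_real s) = of_real (exp (- (sig * ln (m / pi))) * rGamma sig * ((m / pi) powr sig * Gamma sig * S))"
  unfolding L_ext_def 1 2 by (simp only: rGamma_complex_of_real of_real_mult exp_of_real[symmetric] of_real_minus)
 also have "exp (- (sig * ln (m / pi))) * rGamma sig * ((m / pi) powr sig * Gamma sig * S) = S"
 proof -
  have "(m / pi) powr sig = exp (sig * ln (m / pi))" using m_pos by (simp add: powr_def)
  hence "exp (- (sig * ln (m / pi))) * rGamma sig * ((m / pi) powr sig * Gamma sig * S) =
   (exp (- (sig * ln (m / pi))) * exp (sig * ln (m / pi))) * (rGamma sig * Gamma sig) * S" by (simp only: mult_ac)
  moreover have "rGamma sig * Gamma sig = 1"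
   unfolding rGamma_inverse_Gamma by (rule left_inverse) (use Gamma_real_pos[OF sig] in linarith)
  ultimately show ?thesis by (simp add: exp_add[symmetric])
 qed
 finally show ?thesis unfolding dirichlet_series_real[OF s] S_def .
qed

lemma L_ext_eq:
 assumes s: "Re s > 1"
 shows "L_ext s = dirichlet_series psic s"
proof -
 define H where "H = {s. Re s > 1}"
 have H: "open H" "connected H" unfolding H_def by (auto intro: open_halfspace_Re_gt convex_connected convex_halfspace_Re_gt)
 have "L_ext s - dirichlet_series psic s = 0"
 proof (rule analytic_continuation[where f = "\<lambda>s. L_ext s - dirichlet_series psic s" and w = s and S = H and U = "complex_of_real ` {1<..}" and \<xi> = 2])
  show "(\<lambda>s. L_ext s - dirichlet_series psic s) holomorphic_on H"
   unfolding H_def by (intro holomorphic_intros L_ext_holomorphic dirichlet_series_holomorphic norm_psic)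
  show "(2::complex) islimpt complex_of_real ` {1<..}"
   unfolding islimpt_approachable
  proof (intro allI impI)
   fix e :: real assume e: "e > 0"
   show "\<exists>x'\<in>complex_of_real ` {1<..}. x' \<noteq> 2 \<and> dist x' 2 < e"
   proof (intro bexI[of _ "of_real (2 + e/2)"] conjI)
    show "complex_of_real (2 + e / 2) \<noteq> 2" using e by (simp add: complex_eq_iff)
    have "dist (complex_of_real (2 + e / 2)) 2 = norm (complex_of_real (e / 2))" by (simp add: dist_norm)
    thus "dist (complex_of_real (2 + e / 2)) 2 < e" using e by (simp only: norm_of_real)
    show "complex_of_real (2 + e / 2) \<in> complex_of_real ` {1<..}" using e by (intro imageI) simp
   qed
  qed
 qed (use H s L_ext_real in \<open>auto simp: H_def\<close>)
 thus ?thesis by simp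
qed

lemma L_ext_one: "L_ext 1 \<noteq> 0"
proof -
 interpret cms: completely_multiplicative_sign psi
  by unfold_locales (use chi_mult chi_sign chi_1 in auto)
 show ?thesis by (rule cms.L_one_nonzero[OF L_ext_holomorphic L_ext_eq])
qed

text \<open>The factors in \<open>L_ext\<close> can only add zeros to those of \<open>XI\<close>, so
  nonvanishing of the L-function for \<open>Re s \<ge> 1\<close> passes to \<open>XI\<close>; on the
  line it comes from Landau's argument at 1 and from the 3-4-1 inequality elsewhere. The functional
  equation then excludes \<open>Re s \<le> 0\<close>.\<close>

lemma XI_zero_strip:
 assumes "XI s = 0"
 shows "0 < Re s" "Re s < 1" "L_ext s = 0"
proof -
 have L0: "L_ext s = 0" if "XI s = 0" for s using that by (simp add: L_ext_def)
 have *: "Re s < 1" if zero: "XI s = 0" for s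
 proof (rule ccontr)
  assume "\<not> Re s < 1"
  hence "Re s > 1 \<or> Re s = 1" by linarith
  then consider "Re s > 1" | "Re s = 1" "Im s \<noteq> 0" | "s = 1" using complex_eq_iff[of s 1] by auto
  thus False
  proof cases
   case 1
   thus False using L0[OF zero] L_ext_eq[OF 1] dirichlet_series_nonzero[of psic s, OF norm_psic psic_mult psic_one 1] by simp
  next
   case 2
   have "L_ext (Complex 1 (Im s)) \<noteq> 0"
   proof (rule nonvanishing_line_one[where f = psic])
    show "psic n = 0 \<or> psic n = 1 \<or> psic n = - 1" for n using chi_sign[of n] by (cases "psi n = 0") auto
   qed (use 2 psic_mult chi_1 L_ext_holomorphic L_ext_eq in auto)
   thus False using L0[OF zero] 2 by (metis complex_surj)
  next
   case 3
   thus False using L0[OF zero] L_ext_one by simp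
  qed
 qed
 show "Re s < 1" by (rule *[OF assms])
 have "XI (1 - s) = 0" using assms by (simp add: XI_functional_equation)
 from *[OF this] show "0 < Re s" by simp
 show "L_ext s = 0" by (rule L0[OF assms])
qed

lemma XI_log_deriv:
 fixes s :: real
 assumes s: "s > 1"
 shows "deriv XI (of_real s) / XI (of_real s) = of_real (ln (m / pi) / 2 + Digamma ((s + a) / 2) / 2
  - (msum psi s))"
proof -
 define S where "S = complex_of_real s"
 define w where "w = (\<lambda>z. (z + of_nat a) / (2 :: complex))"
 define l where "l = complex_of_real (ln (m / pi))"
 define D where "D = dirichlet_series psic"
 have ReS: "Re S > 1" using s by (simp add: S_def)
 have wpos: "Re (w z) > 0" if "Re z > 1" for z using that by (simp add: w_def)
 have wnot: "w z \<notin> \<int>\<^sub>\<le>\<^sub>0" if "Re z > 1" for z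
 proof
  assume "w z \<in> \<int>\<^sub>\<le>\<^sub>0"
  then obtain k where "w z = of_int k" "k \<le> 0" by (rule nonpos_Ints_cases)
  thus False using wpos[OF that] by simp
 qed
 have XIeq: "XI z = exp (w z * l) * Gamma (w z) * D z" if "Re z > 1" for z
 proof -
  have "D z = exp (- (w z * l)) * rGamma (w z) * XI z"
   using L_ext_eq[OF that] by (simp add: L_ext_def D_def w_def l_def)
  hence "exp (w z * l) * Gamma (w z) * D z = (exp (w z * l) * exp (- (w z * l))) * (Gamma (w z) * rGamma (w z)) * XI z" by (simp only: mult_ac)
  also have "exp (w z * l) * exp (- (w z * l)) = 1" by (simp add: exp_add[symmetric])
  also have "Gamma (w z) * rGamma (w z) = 1" using wnot[OF that] by (simp add: rGamma_inverse_Gamma Gamma_eq_zero_iff)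
  finally show ?thesis by simp
 qed
 have D0: "D S \<noteq> 0" unfolding D_def by (rule dirichlet_series_nonzero[OF norm_psic psic_mult psic_one ReS])
 have dw: "(w has_field_derivative 1/2) (at S)" unfolding w_def by (auto intro!: derivative_eq_intros)
 have de: "((\<lambda>z. exp (w z * l)) has_field_derivative exp (w S * l) * (1/2 * l)) (at S)"
  by (rule DERIV_chain2[OF DERIV_exp]) (auto intro!: derivative_eq_intros dw)
 have dg: "((\<lambda>z. Gamma (w z)) has_field_derivative Gamma (w S) * Digamma (w S) * (1/2)) (at S)"
  by (rule DERIV_chain2[OF has_field_derivative_Gamma[OF wnot[OF ReS]] dw])
 have dD: "(D has_field_derivative deriv D S) (at S)" unfolding D_def by (rule dirichlet_series_derivative(2)[OF norm_psic ReS])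
 define E where "E = exp (w S * l)"
 define G where "G = Gamma (w S)"
 have nz: "E \<noteq> 0" "G \<noteq> 0" using wnot[OF ReS] by (auto simp: E_def G_def Gamma_eq_zero_iff)
 have "((\<lambda>z. exp (w z * l) * Gamma (w z) * D z) has_field_derivative
   ((E * (1/2 * l)) * G + (G * Digamma (w S) * (1/2)) * E) * D S + deriv D S * (E * G)) (at S)"
  unfolding E_def G_def by (rule DERIV_mult[OF DERIV_mult[OF de dg] dD])
 hence "(XI has_field_derivative ((E * (1/2 * l)) * G + (G * Digamma (w S) * (1/2)) * E) * D S + deriv D S * (E * G)) (at S)"
  by (rule has_field_derivative_transform_within_open[OF _ open_halfspace_Re_gt[of 1]]) (use ReS XIeq in auto)
 hence "deriv XI S = ((E * (1/2 * l)) * G + (G * Digamma (w S) * (1/2)) * E) * D S + deriv D S * (E * G)" by (rule DERIV_imp_deriv)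
 moreover have "XI S = E * G * D S" using XIeq[OF ReS] by (simp add: E_def G_def)
 ultimately have "deriv XI S / XI S = l / 2 + Digamma (w S) / 2 + deriv D S / D S"
  using nz D0 by (simp add: field_simps)
 also have "deriv D S / D S = - mangoldt_series psic S"
  unfolding D_def by (rule dirichlet_series_log_deriv[OF norm_psic psic_mult psic_one ReS])
 also have "mangoldt_series psic S = of_real (msum psi s)"
  unfolding S_def by (rule mangoldt_series_real(1)[OF s])
 also have "Digamma (w S) = of_real (Digamma ((s + a) / 2))"
 proof -
  have "w S = of_real ((s + a) / 2)" by (simp add: w_def S_def)
  moreover have "(s + a) / 2 \<noteq> 0" using s by simp
  ultimately show ?thesis using Polygamma_of_real[of "(s + a) / 2" 0] by metis
 qed
 finally show ?thesis unfolding S_def l_def by simp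
qed

text \<open>The partial fractions are taken between the mirror points \<open>1 - s\<close> and
  \<open>s\<close>. Measured from \<open>1 - s\<close>, a zero is \<open>z = u + ig\<close> and
  \<open>2 * u - z\<close> is its conjugate, so each term is
  \<open>2 * Re (1 / z) = 2 * pker u g\<close>, real and nonnegative. The functional equation makes
  the two logarithmic derivatives opposite.\<close>

lemma zero_sum_limit:
 fixes s :: real
 assumes rh: "\<And>s. 0 < Re s ==> Re s < 1 ==> L_ext s = 0 ==> Re s = 1/2" and s: "s > 1"
 defines "u \<equiv> s - 1/2"
 shows "((\<lambda>g. mult XI (Complex (1/2) g) * (pker u g)) has_sum
  (zero_side m a psi s))
  {g. XI (Complex (1/2) g) = 0}"
proof -
 define T where "T = zero_side m a psi s"
 define A where "A = {g. XI (Complex (1/2) g) = 0}"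
 define AR where "AR = (\<lambda>R::real. {g \<in> A. norm (Complex u g) < R})"
 define c where "c = 1 - complex_of_real s"
 define F where "F = (\<lambda>w. XI (c + w))"
 have u: "u > 1/2" using s by (simp add: u_def)
 have XIs: "XI (of_real s) \<noteq> 0" using XI_zero_strip(2)[of "of_real s"] s by auto
 have XIc: "XI c \<noteq> 0" using XIs kappa(2) by (auto simp: c_def XI_functional_equation)
 have holF: "F holomorphic_on UNIV"
  unfolding F_def by (rule holomorphic_on_compose_gen[OF _ XI_holomorphic[of UNIV], unfolded o_def]) (auto intro!: holomorphic_intros)
 have zeroF: "F z = 0 \<longleftrightarrow> (\<exists>g\<in>A. z = Complex u g)" for z
 proof
  assume "F z = 0"
  hence z: "XI (c + z) = 0" by (simp add: F_def)
  from XI_zero_strip[OF z] have re: "Re (c + z) = 1/2" by (intro rh)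
  hence "c + z = Complex (1/2) (Im z)" by (simp add: complex_eq_iff c_def)
  moreover have "z = Complex u (Im z)" using re by (simp add: complex_eq_iff c_def u_def)
  ultimately show "\<exists>g\<in>A. z = Complex u g" using z by (intro bexI[of _ "Im z"]) (auto simp: A_def)
 next
  assume "\<exists>g\<in>A. z = Complex u g"
  then obtain g where g: "XI (Complex (1/2) g) = 0" "z = Complex u g" by (auto simp: A_def)
  have "c + z = Complex (1/2) g" by (simp add: g(2) complex_eq_iff c_def u_def)
  thus "F z = 0" using g by (simp add: F_def)
 qed
 have multF: "mult F (Complex u g) = mult XI (Complex (1/2) g)" for g
 proof -
  have "zorder F (Complex u g) = zorder (\<lambda>w. F (w + Complex u g)) 0" by (rule zorder_shift)
  also have "(\<lambda>w. F (w + Complex u g)) = (\<lambda>w. XI (w + Complex (1/2) g))"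
  proof (rule ext)
   fix w
   have "c + (w + Complex u g) = w + Complex (1/2) g" by (simp add: complex_eq_iff c_def u_def)
   thus "F (w + Complex u g) = XI (w + Complex (1/2) g)" by (simp only: F_def)
  qed
  also have "zorder (\<lambda>w. XI (w + Complex (1/2) g)) 0 = zorder XI (Complex (1/2) g)" by (rule zorder_shift[symmetric])
  finally show ?thesis by (simp add: mult_def)
 qed
 obtain K where K: "K > 0" "\<And>R z. R \<ge> 1 ==> norm z \<le> R ==> norm (xi0 z) \<le> K * exp ((2 * R + 2) * ln ((2 * R + 2) / (pi / m)))"
  using xi0_growth by blast
 define q where "q = norm c + 1"
 define B where "B = (\<lambda>R. ln K + (2 * (R + q) + 2) * ln ((2 * (R + q) + 2) * (real m / pi)))"
 have "((\<lambda>R. \<Sum>z | norm z < R \<and> F z = 0. of_nat (mult F z) * (1 / (of_real (2 * u) - z) + 1 / z)) \<longlongrightarrow>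
  deriv F (of_real (2 * u)) / F (of_real (2 * u)) - deriv F 0 / F 0) at_top"
 proof (rule partial_fraction_limit[OF holF, where B = B])
  show "F 0 \<noteq> 0" using XIc by (simp add: F_def)
  show "F (of_real (2 * u)) \<noteq> 0" using XIs by (simp add: F_def c_def u_def)
  show "norm (F w) \<le> exp (B R)" if R: "R \<ge> 1" "norm w \<le> R" for R w
  proof -
   have "norm (c + w - 1/2) \<le> norm c + norm w + 1/2"
    using norm_triangle_ineq4[of "c + w" "1/2"] norm_triangle_ineq[of c w] by simp
   moreover have "norm ((c + w - 1/2) / 2) = norm (c + w - 1/2) / 2" by (simp add: norm_divide)
   ultimately have "norm ((c + w - 1/2) / 2) \<le> R + q" using R norm_ge_zero[of c] unfolding q_def by linarith
   hence "norm (F w) \<le> K * exp ((2 * (R + q) + 2) * ln ((2 * (R + q) + 2) / (pi / m)))"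
    unfolding F_def XI_def using R by (intro K(2)) (auto simp: q_def intro: order_trans[of _ "1 + 0"])
   also have "... = exp (B R)" using K(1) by (simp add: B_def exp_add mult.commute)
   finally show ?thesis .
  qed
  have "real m / pi > 0" "q > 0" using m_pos by (auto simp: q_def intro: add_nonneg_pos)
  thus "((\<lambda>R. B R / R^2) \<longlongrightarrow> 0) at_top" unfolding B_def by real_asymp
 qed
 moreover have "(\<Sum>z | norm z < R \<and> F z = 0. of_nat (mult F z) * (1 / (of_real (2 * u) - z) + 1 / z))
   = of_real (2 * (\<Sum>g\<in>AR R. mult XI (Complex (1/2) g) * (pker u g)))" for R
 proof -
  have set: "{z. norm z < R \<and> F z = 0} = Complex u ` AR R" by (auto simp: zeroF AR_def)
  have inj: "inj_on (Complex u) (AR R)" by (auto simp: inj_on_def)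
  have "(\<Sum>z | norm z < R \<and> F z = 0. of_nat (mult F z) * (1 / (of_real (2 * u) - z) + 1 / z)) =
   (\<Sum>g\<in>AR R. of_nat (mult XI (Complex (1/2) g)) * (1 / (of_real (2 * u) - Complex u g) + 1 / Complex u g))"
   unfolding set by (subst sum.reindex[OF inj]) (simp add: multF)
  also have "... = (\<Sum>g\<in>AR R. of_real (2 * (mult XI (Complex (1/2) g) * (pker u g))))"
  proof (rule sum.cong[OF refl])
   fix g
   have c1: "of_real (2 * u) - Complex u g = cnj (Complex u g)" by (simp add: complex_eq_iff)
   have "Complex u g \<noteq> 0" using u by (simp add: complex_eq_iff)
   hence "1 / cnj (Complex u g) + 1 / Complex u g = (Complex u g + cnj (Complex u g)) / (Complex u g * cnj (Complex u g))"
    by (simp add: field_simps)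
   also have "Complex u g + cnj (Complex u g) = of_real (2 * u)" by (simp add: complex_eq_iff)
   also have "Complex u g * cnj (Complex u g) = of_real (u^2 + g^2)" by (simp add: complex_eq_iff power2_eq_square)
   finally have "1 / (of_real (2 * u) - Complex u g) + 1 / Complex u g = of_real (2 * (pker u g))" unfolding c1 by simp
   thus "of_nat (mult XI (Complex (1/2) g)) * (1 / (of_real (2 * u) - Complex u g) + 1 / Complex u g)
    = of_real (2 * (mult XI (Complex (1/2) g) * (pker u g)))" by simp
  qed
  finally show ?thesis by (simp add: sum_distrib_left)
 qed
 moreover have "deriv F (of_real (2 * u)) / F (of_real (2 * u)) - deriv F 0 / F 0 = of_real (2 * T)"
 proof -
  have dXI: "(XI has_field_derivative deriv XI z) (at z)" for z
   by (rule holomorphic_derivI[OF XI_holomorphic[of UNIV]]) auto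
  have "(F has_field_derivative deriv XI (c + z) * 1) (at z)" for z
   unfolding F_def by (rule DERIV_chain2[OF dXI]) (auto intro!: derivative_eq_intros)
  hence dF: "deriv F z = deriv XI (c + z)" for z by (simp add: DERIV_imp_deriv)
  have 1: "c + of_real (2 * u) = of_real s" by (simp add: c_def u_def)
  have "((\<lambda>z. XI (1 - z)) has_field_derivative deriv XI (1 - of_real s) * (- 1)) (at (of_real s))"
   by (rule DERIV_chain2[OF dXI]) (auto intro!: derivative_eq_intros)
  moreover have "((\<lambda>z. XI (1 - z)) has_field_derivative of_real kappa * deriv XI (of_real s)) (at (of_real s))"
   unfolding XI_functional_equation by (intro DERIV_cmult dXI)
  ultimately have "deriv XI c = - of_real kappa * deriv XI (of_real s)"
   using DERIV_unique unfolding c_def by fastforce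
  moreover have "XI c = of_real kappa * XI (of_real s)" by (simp add: c_def XI_functional_equation)
  moreover have "deriv F 0 = deriv XI c" "F 0 = XI c" using dF[of 0] by (auto simp: F_def)
  ultimately have "deriv F 0 / F 0 = - (deriv XI (of_real s) / XI (of_real s))"
   using kappa(2) by auto
  moreover have "deriv F (of_real (2 * u)) / F (of_real (2 * u)) = deriv XI (of_real s) / XI (of_real s)"
  proof -
   have "deriv F (of_real (2 * u)) = deriv XI (of_real s)" "F (of_real (2 * u)) = XI (of_real s)"
    using dF[of "of_real (2 * u)"] 1 by (auto simp: F_def)
   thus ?thesis by simp
  qed
  moreover have "deriv XI (of_real s) / XI (of_real s) = of_real T" unfolding T_def by (rule XI_log_deriv[OF s])
  ultimately show ?thesis by simp
 qed
 ultimately have "((\<lambda>R. complex_of_real (2 * (\<Sum>g\<in>AR R. mult XI (Complex (1/2) g) * (pker u g)))) \<longlongrightarrow> of_real (2 * T)) at_top"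
  by simp
 hence "((\<lambda>R. 2 * (\<Sum>g\<in>AR R. mult XI (Complex (1/2) g) * (pker u g))) \<longlongrightarrow> 2 * T) at_top"
  by (simp only: tendsto_of_real_iff)
 from tendsto_mult[OF tendsto_const[of "1/2"] this]
 have lim: "((\<lambda>R. \<Sum>g\<in>AR R. mult XI (Complex (1/2) g) * (pker u g)) \<longlongrightarrow> T) at_top" by simp
 show ?thesis
  unfolding T_def[symmetric] A_def[symmetric]
 proof (rule has_sum_exhaustion[OF _ _ _ _ lim])
  show "0 \<le> mult XI (Complex (1/2) g) * (pker u g)" for g using u by simp
  show "finite (AR R)" for R
  proof -
   have "finite {z \<in> cball 0 R. F z = 0}"
   proof (cases "\<exists>z. F z = 0")
    case True
    have "\<not> F constant_on UNIV"
    proof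
     assume "F constant_on UNIV"
     then obtain k where "\<And>z. F z = k" by (auto simp: constant_on_def)
     with True have "F 0 = 0" by metis
     thus False using XIc by (simp add: F_def)
    qed
    thus ?thesis by (intro holomorphic_compact_finite_zeros[OF holF]) auto
   qed auto
   hence "finite (Im ` {z \<in> cball 0 R. F z = 0})" by (rule finite_imageI)
   moreover have "AR R \<subseteq> Im ` {z \<in> cball 0 R. F z = 0}"
   proof
    fix g assume "g \<in> AR R"
    thus "g \<in> Im ` {z \<in> cball 0 R. F z = 0}"
     using zeroF[of "Complex u g"] by (intro image_eqI[of _ _ "Complex u g"]) (auto simp: AR_def)
   qed
   ultimately show ?thesis by (rule finite_subset[rotated])
  qed
  show "R \<le> R' ==> AR R \<subseteq> AR R'" for R R' by (auto simp: AR_def)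
  show "A = (\<Union>R. AR R)"
  proof (intro equalityI subsetI)
   fix g assume "g \<in> A"
   hence "g \<in> AR (norm (Complex u g) + 1)" by (simp add: AR_def)
   thus "g \<in> (\<Union>R. AR R)" by blast
  qed (auto simp: AR_def)
 qed
qed

text \<open>\<open>w\<close> holds multiplicities, with 0 on padding indices. The gap between 0 and
  1 lets a weighted sum bound a number of zeros later.\<close>

theorem zero_family:
 assumes rh: "\<And>s. 0 < Re s ==> Re s < 1 ==> L_ext s = 0 ==> Re s = 1/2"
 obtains w gamma :: "nat \<Rightarrow> real" where "\<And>i. w i = 0 \<or> w i \<ge> 1"
  "\<And>s::real. s > 1 ==> (\<lambda>i. w i * (pker (s - 1/2) (gamma i))) sums
   (zero_side m a psi s)"
proof -
 define A where "A = {g. XI (Complex (1/2) g) = 0}"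
 define W where "W = (\<lambda>g. real (mult XI (Complex (1/2) g)))"
 have XI2: "XI 2 \<noteq> 0" using XI_zero_strip(2)[of 2] by auto
 have mult: "XI z = 0 \<longleftrightarrow> mult XI z > 0" for z
  by (rule entire_zero_factor[OF XI_holomorphic XI2, of z])
 have W1: "W g \<ge> 1" if "g \<in> A" for g
  using mult[of "Complex (1/2) g"] that by (auto simp: W_def A_def)
 have "A \<subseteq> (\<Union>n::nat. Im ` {z \<in> cball 0 (real n). XI z = 0})"
 proof
  fix g assume g: "g \<in> A"
  obtain n :: nat where "norm (Complex (1/2) g) \<le> real n" using real_arch_simple by blast
  hence "g \<in> Im ` {z \<in> cball 0 (real n). XI z = 0}"
   using g by (intro image_eqI[of _ _ "Complex (1/2) g"]) (auto simp: A_def)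
  thus "g \<in> (\<Union>n::nat. Im ` {z \<in> cball 0 (real n). XI z = 0})" by blast
 qed
 moreover have "finite {z \<in> cball 0 (real n). XI z = 0}" for n
 proof (cases "\<exists>z. XI z = 0")
  case True
  have "\<not> XI constant_on UNIV"
  proof
   assume "XI constant_on UNIV"
   then obtain k where "\<And>z. XI z = k" by (auto simp: constant_on_def)
   with True XI2 show False by metis
  qed
  thus ?thesis by (intro holomorphic_compact_finite_zeros[OF XI_holomorphic[of UNIV]]) auto
 qed auto
 hence "finite (Im ` {z \<in> cball 0 (real n). XI z = 0})" for n by (rule finite_imageI)
 hence "countable (Im ` {z \<in> cball 0 (real n). XI z = 0})" for n by (rule countable_finite)
 hence "countable (\<Union>n::nat. Im ` {z \<in> cball 0 (real n). XI z = 0})"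
  by (rule countable_UN[OF countableI_type])
 ultimately have "countable A" by (rule countable_subset)
 then obtain g :: "nat \<Rightarrow> real" and I where gI: "\<And>i. i \<in> I ==> g i \<in> A"
  "\<And>(f :: real \<Rightarrow> real) L. (f has_sum L) A ==> (\<lambda>i. if i \<in> I then f (g i) else 0) sums L"
  by (rule countable_has_sum_nat_family) blast
 show ?thesis
 proof (rule that[of "\<lambda>i. if i \<in> I then W (g i) else 0" g])
  show "(if i \<in> I then W (g i) else 0) = 0 \<or> (if i \<in> I then W (g i) else 0) \<ge> 1" for i using W1 gI(1) by auto
  fix s :: real assume s: "s > 1"
  have "((\<lambda>g. W g * (pker (s - 1/2) g)) has_sum
   (zero_side m a psi s)) A"
   unfolding A_def W_def by (rule zero_sum_limit[OF rh s])
  from gI(2)[OF this]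
  have "(\<lambda>i. if i \<in> I then W (g i) * (pker (s - 1/2) (g i)) else 0) sums
   (zero_side m a psi s)" .
  moreover have "(\<lambda>i. if i \<in> I then W (g i) * (pker (s - 1/2) (g i)) else 0) =
   (\<lambda>i. (if i \<in> I then W (g i) else 0) * (pker (s - 1/2) (g i)))" by (rule ext) simp
  ultimately show "(\<lambda>i. (if i \<in> I then W (g i) else 0) * (pker (s - 1/2) (g i))) sums
   (zero_side m a psi s)" by (simp only:)
 qed
qed

end

section \<open>Laplace transforms and the explicit formula\<close>

text \<open>\<open>has_bochner_integral\<close> includes integrability, so no statement of this kind
  rests on the default value of a divergent integral.\<close>

definition has_laplace :: "(real \<Rightarrow> real) \<Rightarrow> real \<Rightarrow> real \<Rightarrow> bool" where
 "has_laplace f s I \<longleftrightarrow> has_bochner_integral lborel (\<lambda>y. indicator {0<..} y * (f y * exp (- (s * y)))) I"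

lemma has_laplace_add: "has_laplace f s I ==> has_laplace g s J ==> has_laplace (\<lambda>y. f y + g y) s (I + J)"
 unfolding has_laplace_def by (drule (1) has_bochner_integral_add) (simp add: algebra_simps)

lemma has_laplace_cmult: "has_laplace f s I ==> has_laplace (\<lambda>y. c * f y) s (c * I)"
 using has_bochner_integral_mult_right[of c lborel "\<lambda>y. indicator {0<..} y * (f y * exp (- (s * y)))" I]
 unfolding has_laplace_def by (simp add: algebra_simps)

lemma has_laplace_diff: "has_laplace f s I ==> has_laplace g s J ==> has_laplace (\<lambda>y. f y - g y) s (I - J)"
 using has_laplace_add[of f s I "\<lambda>y. - 1 * g y" "- 1 * J"] has_laplace_cmult[of g s J "- 1"] by simp

lemma has_laplace_cong: "has_laplace f s I ==> (\<And>y. y > 0 ==> f y = g y) ==> I = J ==> has_laplace g s J"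
 unfolding has_laplace_def by (elim has_bochner_integral_cong[THEN iffD1, rotated 3]) (auto split: split_indicator)

lemma laplace_cexp:
 assumes "Re z < s"
 shows "has_bochner_integral lborel (\<lambda>y. indicator {0<..} y *\<^sub>R exp ((z - of_real s) * of_real y)) (1 / (of_real s - z))"
proof -
 define c where "c = z - of_real s"
 have c: "Re c < 0" using assms by (simp add: c_def)
 hence c0: "c \<noteq> 0" by auto
 have norm_exp: "norm (exp (c * of_real y)) = exp (- (y * - Re c))" for y by (simp add: mult.commute)
 have int: "set_integrable lborel {0<..} (\<lambda>y. exp (c * of_real y))"
  unfolding set_integrable_def
 proof (rule Bochner_Integration.integrable_bound)
  show "integrable lborel (\<lambda>y. indicator {0<..} y *\<^sub>R exp (- (y * - Re c)))"
   using integrable_I0i_exp_mscale[of "- Re c"] c by (simp add: set_integrable_def)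
 qed (auto simp: norm_exp split: split_indicator)
 have "(LBINT y=ereal 0..\<infinity>. exp (c * of_real y)) = 0 - 1 / c"
 proof (rule interval_integral_FTC_integrable[where F = "\<lambda>y. exp (c * of_real y) / c"])
  show "((\<lambda>y. exp (c * of_real y) / c) has_vector_derivative exp (c * of_real y)) (at y)" for y
   by (rule has_vector_derivative_real_field[where f = "\<lambda>w. exp (c * w) / c"])
    (use c0 in \<open>auto intro!: derivative_eq_intros\<close>)
  show "isCont (\<lambda>y. exp (c * complex_of_real y)) y" for y by (intro continuous_intros)
  have "((\<lambda>y. exp (c * of_real y) / c) \<longlongrightarrow> exp (c * of_real 0) / c) (at_right 0)"
   by (intro tendsto_intros c0)
  thus "(((\<lambda>y. exp (c * of_real y) / c) \<circ> real_of_ereal) \<longlongrightarrow> 1 / c) (at_right (ereal 0))"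
   by (simp add: ereal_tendsto_simps)
  have "((\<lambda>y. norm (exp (c * complex_of_real y))) \<longlongrightarrow> 0) at_top"
   unfolding norm_exp using c by real_asymp
  hence "((\<lambda>y. exp (c * complex_of_real y) / c) \<longlongrightarrow> 0 / c) at_top"
   by (intro tendsto_divide tendsto_const c0) (rule tendsto_norm_zero_cancel)
  thus "(((\<lambda>y. exp (c * of_real y) / c) \<circ> real_of_ereal) \<longlongrightarrow> 0) (at_left \<infinity>)"
   by (simp add: ereal_tendsto_simps)
 qed (use int in auto)
 hence "(LBINT y:{0<..}. exp (c * of_real y)) = - (1 / c)" by (simp add: interval_integral_to_infinity_eq)
 also have "- (1 / c) = 1 / (of_real s - z)" using c0 by (simp add: c_def divide_simps)
 finally show ?thesis using int unfolding c_def set_integrable_def set_lebesgue_integral_def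
  by (simp add: has_bochner_integral_iff)
qed

lemma has_laplace_exp_at_0:
 assumes "s > 0"
 shows "has_laplace (\<lambda>_. 1) s (1 / s)"
proof -
 have "has_bochner_integral lborel (\<lambda>y. indicator {0<..} y *\<^sub>R exp ((0 - complex_of_real s) * of_real y)) (1 / (of_real s - 0))"
  by (rule laplace_cexp) (use assms in simp)
 hence "has_bochner_integral lborel (\<lambda>y. Re (indicator {0<..} y *\<^sub>R exp ((0 - complex_of_real s) * of_real y))) (Re (1 / (of_real s - 0)))"
  by (rule has_bochner_integral_bounded_linear[OF bounded_linear_Re])
 moreover have "Re (indicator {0<..} y *\<^sub>R exp ((0 - complex_of_real s) * of_real y)) = indicator {0<..} y * (1 * exp (- (s * y)))" for y
  using exp_of_real[of "- (s * y)", where ?'a = complex] by (simp add: Re_exp)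
 moreover have "Re (1 / (of_real s - 0)) = 1 / s" by (simp add: Re_divide_of_real)
 ultimately show ?thesis unfolding has_laplace_def by (simp only:)
qed

text \<open>A single domination by \<open>b j * exp (sig * y)\<close> yields all that the uniqueness
  theorem asks of a series: continuity, exponential growth and termwise transforms.\<close>

lemma has_laplace_suminf:
 fixes f :: "nat \<Rightarrow> real \<Rightarrow> real"
 assumes cont: "\<And>j. continuous_on {0..} (f j)"
  and bd': "\<forall>j. \<forall>y\<ge>0. \<bar>f j y\<bar> \<le> b j * exp (sig * y)" and summ: "summable b"
 shows "continuous_on {0..} (\<lambda>y. \<Sum>j. f j y)"
  "y \<ge> 0 ==> summable (\<lambda>j. f j y)" "y \<ge> 0 ==> \<bar>\<Sum>j. f j y\<bar> \<le> suminf b * exp (sig * y)"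
  "s > sig ==> (\<And>j. has_laplace (f j) s (F j)) ==> F sums I ==> has_laplace (\<lambda>y. \<Sum>j. f j y) s I"
proof -
 note bd = bd'[rule_format]
 have s1: "summable (\<lambda>j. norm (f j y))" if "y \<ge> 0" for y
  by (rule summable_comparison_test'[OF summable_mult2[OF summ, of "exp (sig * y)"]]) (use bd[OF that] in auto)
 show summ': "summable (\<lambda>j. f j y)" if "y \<ge> 0" for y by (rule summable_norm_cancel[OF s1[OF that]])
 show "\<bar>\<Sum>j. f j y\<bar> \<le> suminf b * exp (sig * y)" if "y \<ge> 0" for y
 proof -
  have "\<bar>\<Sum>j. f j y\<bar> \<le> (\<Sum>j. \<bar>f j y\<bar>)" by (rule summable_rabs) (use s1[OF that] in simp)
  also have "... \<le> (\<Sum>j. b j * exp (sig * y))"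
   by (rule suminf_le[OF bd[OF that]]) (use s1[OF that] summable_mult2[OF summ] in auto)
  finally show ?thesis using suminf_mult2[OF summ, of "exp (sig * y)"] by simp
 qed
 show "continuous_on {0..} (\<lambda>y. \<Sum>j. f j y)"
  unfolding continuous_on_eq_continuous_within
 proof
  fix x :: real assume x: "x \<in> {0..}"
  define E where "E = exp (\<bar>sig\<bar> * (x + 1))"
  have "uniform_limit {0..x+1} (\<lambda>n y. \<Sum>j<n. f j y) (\<lambda>y. \<Sum>j. f j y) sequentially"
  proof (rule Weierstrass_m_test[where M = "\<lambda>j. b j * E"])
   fix j y assume y: "y \<in> {0..x+1}"
   have bj: "b j \<ge> 0" using order_trans[OF abs_ge_zero bd[of 0 j]] by simp
   have "sig * y \<le> \<bar>sig\<bar> * (x + 1)"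
    using y by (intro order_trans[OF mult_right_mono[OF abs_ge_self] mult_left_mono]) auto
   hence "exp (sig * y) \<le> E" by (simp add: E_def)
   thus "norm (f j y) \<le> b j * E" using bd[of y j] y mult_left_mono[OF _ bj, of "exp (sig * y)" E] by simp
  qed (rule summable_mult2[OF summ])
  hence "continuous_on {0..x+1} (\<lambda>y. \<Sum>j. f j y)"
   by (rule uniform_limit_theorem[rotated])
    (auto intro!: always_eventually continuous_on_sum continuous_on_subset[OF cont])
  hence "continuous (at x within {0..x+1}) (\<lambda>y. \<Sum>j. f j y)"
   using x by (simp add: continuous_on_eq_continuous_within)
  moreover have "at x within {0..x+1} = at x within {0..}"
   by (rule at_within_nhd[of _ "{..<x+1}"]) auto
  ultimately show "continuous (at x within {0..}) (\<lambda>y. \<Sum>j. f j y)" by simp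
 qed
 assume s: "s > sig" and lap: "\<And>j. has_laplace (f j) s (F j)" and sums: "F sums I"
 define g where "g = (\<lambda>j y. indicator {0<..} y * (f j y * exp (- (s * y))))"
 have ig: "integrable lborel (g j)" "integral\<^sup>L lborel (g j) = F j" for j
  using lap[of j] by (simp_all add: has_laplace_def g_def has_bochner_integral_iff)
 have iD: "integrable lborel (\<lambda>y. indicator {0<..} y *\<^sub>R exp (- (y * (s - sig))))"
  using integrable_I0i_exp_mscale[of "s - sig"] s by (simp add: set_integrable_def)
 define D where "D = (LINT y|lborel. indicator {0<..} y *\<^sub>R exp (- (y * (s - sig))))"
 have normg: "(LINT y|lborel. norm (g j y)) \<le> b j * D" for j
  unfolding D_def Bochner_Integration.integral_mult_right_zero[symmetric]
 proof (rule integral_mono)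
  show "integrable lborel (\<lambda>y. norm (g j y))" using ig(1) by (rule integrable_norm)
  show "integrable lborel (\<lambda>y. b j * (indicator {0<..} y *\<^sub>R exp (- (y * (s - sig)))))"
   by (rule integrable_mult_right) (rule iD)
  fix y :: real
  show "norm (g j y) \<le> b j * (indicator {0<..} y *\<^sub>R exp (- (y * (s - sig))))"
  proof (cases "y > 0")
   case True
   have "\<bar>f j y\<bar> * exp (- (s * y)) \<le> (b j * exp (sig * y)) * exp (- (s * y))"
    using bd[of y j] True by (intro mult_right_mono) auto
   also have "... = b j * exp (- (y * (s - sig)))" by (simp add: exp_add[symmetric] algebra_simps)
   finally show ?thesis using True by (simp add: g_def abs_mult)
  qed (simp add: g_def)
 qed
 have gs: "summable (\<lambda>j. norm (g j y))" for y
 proof (cases "y > 0")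
  case True
  have "summable (\<lambda>j. norm (f j y) * exp (- (s * y)))" using s1[of y] True by (intro summable_mult2) simp
  thus ?thesis using True by (simp add: g_def abs_mult)
 qed (simp add: g_def)
 have ints: "summable (\<lambda>j. LINT y|lborel. norm (g j y))"
  by (rule summable_comparison_test'[OF summable_mult2[OF summ, of D]]) (use normg in \<open>simp add: integral_nonneg\<close>)
 have "integrable lborel (\<lambda>y. \<Sum>j. g j y)" by (rule integrable_suminf[OF ig(1) _ ints]) (use gs in simp)
 moreover have "(LINT y|lborel. (\<Sum>j. g j y)) = I"
  using integral_suminf[OF ig(1) _ ints] gs sums by (simp add: ig(2) sums_iff)
 moreover have "(\<Sum>j. g j y) = indicator {0<..} y * ((\<Sum>j. f j y) * exp (- (s * y)))" for y
 proof (cases "y > 0")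
  case True
  thus ?thesis using suminf_mult2[OF summ'[of y], of "exp (- (s * y))"] by (simp add: g_def)
 qed (simp add: g_def)
 ultimately show "has_laplace (\<lambda>y. \<Sum>j. f j y) s I" unfolding has_laplace_def has_bochner_integral_iff by simp
qed

text \<open>Lerch's argument: with \<open>u = exp (- y)\<close> the transforms at
  \<open>sig + 2 + i\<close> are the moments of a continuous function on \<open>[0, 1]\<close>. They
  vanish, so Weierstrass approximation of that function makes the integral of its square
  vanish.\<close>

lemma laplace_unique_zero:
 fixes H :: "real \<Rightarrow> real"
 assumes cont: "continuous_on {0..} H" and bd: "\<And>y. y \<ge> 0 ==> \<bar>H y\<bar> \<le> C * exp (sig * y)"
  and lap: "\<And>s. s > sig ==> has_laplace H s 0" and y0: "y0 \<ge> 0"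
 shows "H y0 = 0"
proof -
 have C: "C \<ge> 0" using order_trans[OF abs_ge_zero bd[of 0]] by simp
 \<comment> \<open>One factor \<open>exp (- y)\<close> more than boundedness requires: it makes
   \<open>G\<close> tend to 0 at \<open>u = 0\<close>, hence continuous there.\<close>
 define g where "g = (\<lambda>y. H y * exp (- ((sig + 1) * y)))"
 define G where "G = (\<lambda>u. if u \<le> 0 then 0 else g (- ln u))"
 have Gg: "G (exp (- y)) = g y" for y by (simp add: G_def)
 have gb: "\<bar>g y\<bar> \<le> C * exp (- y)" if "y \<ge> 0" for y
 proof -
  have "\<bar>g y\<bar> \<le> (C * exp (sig * y)) * exp (- ((sig + 1) * y))"
   using bd[OF that] by (simp add: g_def abs_mult)
  also have "... = C * exp (- y)" by (simp add: exp_add[symmetric] algebra_simps)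
  finally show ?thesis .
 qed
 have gC: "\<bar>g y\<bar> \<le> C" if "y \<ge> 0" for y
  using gb[OF that] C mult_left_mono[of "exp (- y)" 1 C] that by simp
 have cg: "continuous_on {0..} g" unfolding g_def by (intro continuous_intros cont)
 have contG: "continuous_on {0..1} G"
  unfolding continuous_on_eq_continuous_within
 proof
  fix u :: real assume u: "u \<in> {0..1}"
  show "continuous (at u within {0..1}) G"
  proof (cases "u = 0")
   case True
   have "(G \<longlongrightarrow> 0) (at 0 within {0..1})"
   proof (rule Lim_null_comparison)
    show "\<forall>\<^sub>F u in at 0 within {0..1}. norm (G u) \<le> C * u"
     unfolding eventually_at_topological
    proof (intro exI[of _ UNIV] conjI ballI impI)
     fix u :: real assume "u \<noteq> 0" "u \<in> {0..1}"
     thus "norm (G u) \<le> C * u" using gb[of "- ln u"] by (simp add: G_def)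
    qed auto
    show "((\<lambda>u. C * u) \<longlongrightarrow> 0) (at 0 within {0..1})" by (auto intro!: tendsto_eq_intros)
   qed
   thus ?thesis using True by (simp add: continuous_within G_def)
  next
   case False
   have "continuous_on {0<..1} (\<lambda>u. g (- ln u))"
    by (rule continuous_on_compose2[OF cg]) (auto intro!: continuous_intros)
   hence "continuous_on {0<..1} G"
    by (rule continuous_on_cong[THEN iffD1, rotated 2]) (auto simp: G_def)
   hence "continuous (at u within {0<..1}) G" using u False by (simp add: continuous_on_eq_continuous_within)
   moreover have "at u within {0<..1} = at u within {0..1}"
    by (rule at_within_nhd[of _ "{0<..}"]) (use u False in auto)
   ultimately show ?thesis by simp
  qed
 qed
 define I2 where "I2 = (LINT y|lborel. indicator {0<..} y * ((g y)^2 * exp (- y)))"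
 have mg: "(\<lambda>y. indicator {0<..} y *\<^sub>R g y) \<in> borel_measurable borel"
  by (rule borel_measurable_continuous_on_indicator) (auto intro: continuous_on_subset[OF cg])
 have ie: "integrable lborel (\<lambda>y::real. indicator {0<..} y * exp (- y))" "(LINT y|lborel. indicator {0<..} (y::real) * exp (- y)) = 1"
  using has_laplace_exp_at_0[of 1] by (simp_all add: has_laplace_def has_bochner_integral_iff)
 have int2: "integrable lborel (\<lambda>y. indicator {0<..} y * ((g y)^2 * exp (- y)))"
 proof (rule Bochner_Integration.integrable_bound)
  show "integrable lborel (\<lambda>y. C\<^sup>2 * (indicator {0<..} y * exp (- y)))" by (intro integrable_mult_right ie)
  have "(\<lambda>y. (indicator {0<..} y *\<^sub>R g y)\<^sup>2 * exp (- y)) \<in> borel_measurable lborel" using mg by measurable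
  moreover have "(indicator {0<..} y *\<^sub>R g y)^2 * exp (- y) = indicator {0<..} y * ((g y)^2 * exp (- y))" for y
   by (simp split: split_indicator)
  ultimately show "(\<lambda>y. indicator {0<..} y * ((g y)^2 * exp (- y))) \<in> borel_measurable lborel" by (simp only:)
  show "AE y in lborel. norm (indicator {0<..} y * ((g y)^2 * exp (- y))) \<le> norm (C^2 * (indicator {0<..} y * exp (- y)))"
  proof (rule AE_I2)
   fix y :: real
   have "(g y)^2 \<le> C^2" if "y > 0" using gC[of y] that C by (simp add: abs_le_square_iff[symmetric])
   thus "norm (indicator {0<..} y * ((g y)^2 * exp (- y))) \<le> norm (C^2 * (indicator {0<..} y * exp (- y)))"
    by (auto simp: abs_mult split: split_indicator)
  qed
 qed
 have "I2 \<le> C * e" if e: "e > 0" for e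
 proof -
  obtain P where P: "real_polynomial_function P" "\<And>u. u \<in> {0..1} ==> \<bar>G u - P u\<bar> < e"
   using Stone_Weierstrass_real_polynomial_function[OF compact_Icc contG e] by blast
  obtain a n where an: "P = (\<lambda>x. \<Sum>i\<le>n. a i * x ^ i)" using P(1) real_polynomial_function_iff_sum by blast
  have "has_bochner_integral lborel (\<lambda>y. \<Sum>i\<le>n. a i * (indicator {0<..} y * (H y * exp (- ((sig + 2 + real i) * y))))) (\<Sum>i\<le>n. a i * 0)"
   by (intro has_bochner_integral_sum has_bochner_integral_mult_right lap[unfolded has_laplace_def]) auto
  moreover have "(\<Sum>i\<le>n. a i * (indicator {0<..} y * (H y * exp (- ((sig + 2 + real i) * y)))))
    = indicator {0<..} y * (g y * P (exp (- y)) * exp (- y))" for y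
  proof -
   have "exp (- ((sig + 2 + real i) * y)) = exp (- ((sig + 1) * y)) * exp (- y) ^ i * exp (- y)" for i
    by (simp add: exp_of_nat_mult[symmetric] exp_add[symmetric] algebra_simps)
   thus ?thesis by (simp add: an g_def sum_distrib_left sum_distrib_right mult_ac)
  qed
  ultimately have hP: "has_bochner_integral lborel (\<lambda>y. indicator {0<..} y * (g y * P (exp (- y)) * exp (- y))) 0" by simp
  have "I2 = (LINT y|lborel. indicator {0<..} y * ((g y)^2 * exp (- y)) - indicator {0<..} y * (g y * P (exp (- y)) * exp (- y)))"
   using hP int2 by (subst Bochner_Integration.integral_diff) (auto simp: has_bochner_integral_iff I2_def)
  also have "... \<le> (LINT y|lborel. C * e * (indicator {0<..} y * exp (- y)))"
  proof (rule integral_mono)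
   show "integrable lborel (\<lambda>y. indicator {0<..} y * ((g y)^2 * exp (- y)) - indicator {0<..} y * (g y * P (exp (- y)) * exp (- y)))"
    using hP int2 by (intro Bochner_Integration.integrable_diff) (auto simp: has_bochner_integral_iff)
   show "integrable lborel (\<lambda>y. C * e * (indicator {0<..} y * exp (- y)))" by (intro integrable_mult_right ie)
   fix y :: real
   show "indicator {0<..} y * ((g y)^2 * exp (- y)) - indicator {0<..} y * (g y * P (exp (- y)) * exp (- y))
     \<le> C * e * (indicator {0<..} y * exp (- y))"
   proof (cases "y > 0")
    case True
    have "g y * (g y - P (exp (- y))) \<le> \<bar>g y\<bar> * \<bar>G (exp (- y)) - P (exp (- y))\<bar>"
     unfolding Gg abs_mult[symmetric] by (rule abs_ge_self)
    also have "... \<le> C * e" using gC[of y] P(2)[of "exp (- y)"] True C by (intro mult_mono) auto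
    finally have "g y * (g y - P (exp (- y))) * exp (- y) \<le> C * e * exp (- y)" by (intro mult_right_mono) auto
    thus ?thesis using True by (simp add: power2_eq_square algebra_simps)
   qed simp
  qed
  finally show ?thesis using ie by simp
 qed
 hence "I2 \<le> 0 + e" if "e > 0" for e
 proof -
  have "I2 \<le> C * (e / (C + 1))" using \<open>\<And>e. e > 0 ==> I2 \<le> C * e\<close>[of "e / (C + 1)"] that C by simp
  also have "C * (e / (C + 1)) \<le> e" using C that by (simp add: field_simps)
  finally show ?thesis by simp
 qed
 hence I2: "I2 \<le> 0" using field_le_epsilon by blast
 define F where "F = (\<lambda>y. (g y)\<^sup>2 * exp (- y))"
 have cF: "continuous_on {0..y0+1} F" unfolding F_def by (intro continuous_intros continuous_on_subset[OF cg]) auto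
 have iF: "set_integrable lborel {0..y0+1} F" by (rule borel_integrable_atLeastAtMost') (rule cF)
 have "(LINT y:{0..y0+1}|lborel. F y) \<le> I2"
  unfolding I2_def set_lebesgue_integral_def
 proof (rule integral_mono_AE)
  show "AE y in lborel. indicator {0..y0+1} y *\<^sub>R F y \<le> indicator {0<..} y * ((g y)^2 * exp (- y))"
   using AE_lborel_singleton[of 0] by eventually_elim (auto simp: F_def split: split_indicator)
 qed (use iF int2 in \<open>auto simp: set_integrable_def\<close>)
 hence "integral {0..y0+1} F \<le> 0" using I2 set_borel_integral_eq_integral(2)[OF iF] by simp
 moreover have "integral {0..y0+1} F \<ge> 0"
  by (rule integral_nonneg[OF integrable_continuous_interval[OF cF]]) (simp add: F_def)
 ultimately have "\<forall>y\<in>{0..y0+1}. F y = 0"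
  using integral_eq_0_iff[OF cF] y0 by (simp add: F_def)
 hence "F y0 = 0" using y0 by simp
 thus ?thesis by (simp add: F_def g_def)
qed

lemma has_laplace_one_minus_exp:
 assumes "l > 0" "s > 0"
 shows "has_laplace (\<lambda>y. 1 - exp (- (l * y))) s (l / (s * (s + l)))"
proof -
 have "has_laplace (\<lambda>y. exp (- (l * y))) s (1 / (s + l))"
  using has_laplace_exp_at_0[of "s + l"] assms
  by (simp add: has_laplace_def exp_add[symmetric] algebra_simps)
 from has_laplace_diff[OF has_laplace_exp_at_0[OF assms(2)] this]
 show ?thesis by (rule has_laplace_cong) (use assms in \<open>auto simp: field_simps\<close>)
qed

lemma has_laplace_shift:
 assumes "l > 0" "s > 0" "c \<ge> 0"
 shows "has_laplace (\<lambda>y. if y \<ge> c then 1 - exp (- (l * (y - c))) else 0) s (exp (- (s * c)) * (l / (s * (s + l))))"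
proof -
 have "has_bochner_integral lborel (\<lambda>y. indicator {0<..} y * ((1 - exp (- (l * y))) * exp (- (s * y)))) (l / (s * (s + l)))"
  using has_laplace_one_minus_exp[OF assms(1,2)] by (simp add: has_laplace_def)
 from lborel_has_bochner_integral_real_affine_iff[THEN iffD1, OF _ this, of 1 "- c"]
 have "has_bochner_integral lborel (\<lambda>y. indicator {0<..} (y - c) * ((1 - exp (- (l * (y - c)))) * exp (- (s * (y - c))))) (l / (s * (s + l)))"
  by simp
 from has_bochner_integral_mult_right[OF this, of "exp (- (s * c))"]
 show ?thesis unfolding has_laplace_def
 proof (rule has_bochner_integral_cong[THEN iffD1, rotated 3])
  fix y :: real
  have "exp (- (s * c)) * exp (- (s * (y - c))) = exp (- (s * y))" by (simp add: exp_add[symmetric] algebra_simps)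
  thus "exp (- (s * c)) * (indicator {0<..} (y - c) * ((1 - exp (- (l * (y - c)))) * exp (- (s * (y - c)))))
   = indicator {0<..} y * ((if y \<ge> c then 1 - exp (- (l * (y - c))) else 0) * exp (- (s * y)))"
   using assms(3) by (cases "y = c") (auto simp: mult_ac split: split_indicator)
 qed auto
qed

text \<open>The inverse Laplace transform of \<open>l / ((s - z) * s * (s + l))\<close>; the three
  summands come from the poles at \<open>z\<close>, 0 and \<open>- l\<close>.\<close>

definition zero_kernel :: "real \<Rightarrow> complex \<Rightarrow> real \<Rightarrow> complex" where
 "zero_kernel l z y = of_real l * exp (z * of_real y) / (z * (z + of_real l)) - 1 / z + of_real (exp (- (l * y))) / (z + of_real l)"

lemma has_laplace_zero_kernel:
 assumes "Re z < s" "s > 0" "l > 0" "z \<noteq> 0" "z \<noteq> - of_real l"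
 shows "has_laplace (\<lambda>y. Re (zero_kernel l z y)) s (Re (1 / (of_real s - z)) * (l / (s * (s + l))))"
proof -
 define u where "u = complex_of_real l"
 have nz: "z + u \<noteq> 0" using assms(5) by (simp add: u_def add_eq_0_iff2)
 have nz2: "of_real s - z \<noteq> 0" using assms(1) by auto
 have nz3: "complex_of_real s \<noteq> 0" "of_real s + u \<noteq> 0" "u \<noteq> 0"
  using assms(2,3) by (auto simp: u_def simp flip: of_real_add)
 define f where "f = (\<lambda>c y. indicator {0::real<..} y *\<^sub>R exp ((c - complex_of_real s) * of_real y))"
 have "has_bochner_integral lborel (\<lambda>y. u / (z * (z + u)) * f z y - 1 / z * f 0 y + 1 / (z + u) * f (- u) y)
  (u / (z * (z + u)) * (1 / (of_real s - z)) - 1 / z * (1 / (of_real s - 0)) + 1 / (z + u) * (1 / (of_real s - (- u))))"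
  unfolding f_def by (intro has_bochner_integral_add has_bochner_integral_diff has_bochner_integral_mult_right laplace_cexp)
   (use assms in \<open>auto simp: u_def\<close>)
 also have "u / (z * (z + u)) * (1 / (of_real s - z)) - 1 / z * (1 / (of_real s - 0)) + 1 / (z + u) * (1 / (of_real s - (- u)))
   = 1 / (of_real s - z) * (u / (of_real s * (of_real s + u)))"
  using nz nz2 nz3 assms(4) by (simp add: divide_simps) (simp add: algebra_simps)
 also have "u / (of_real s * (of_real s + u)) = of_real (l / (s * (s + l)))" by (simp add: u_def)
 finally have "has_bochner_integral lborel (\<lambda>y. Re (u / (z * (z + u)) * f z y - 1 / z * f 0 y + 1 / (z + u) * f (- u) y))
  (Re (1 / (of_real s - z) * of_real (l / (s * (s + l)))))"
  by (rule has_bochner_integral_bounded_linear[OF bounded_linear_Re])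
 moreover have "Re (u / (z * (z + u)) * f z y - 1 / z * f 0 y + 1 / (z + u) * f (- u) y)
   = indicator {0<..} y * (Re (zero_kernel l z y) * exp (- (s * y)))" for y
 proof -
  have "f c y = indicator {0<..} y *\<^sub>R (exp (c * of_real y) * of_real (exp (- (s * y))))" for c
   unfolding f_def exp_of_real[symmetric] exp_add[symmetric] by (simp add: algebra_simps)
  moreover have "exp (- u * of_real y) = of_real (exp (- (l * y)))" by (simp add: u_def exp_of_real[symmetric])
  ultimately have "u / (z * (z + u)) * f z y - 1 / z * f 0 y + 1 / (z + u) * f (- u) y
   = of_real (indicator {0<..} y * exp (- (s * y))) * zero_kernel l z y"
   by (simp add: zero_kernel_def u_def[symmetric] scaleR_conv_of_real algebra_simps)
  thus ?thesis by (simp only:) (simp add: mult_ac)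
 qed
 moreover have "Re (1 / (of_real s - z) * of_real (l / (s * (s + l)))) = Re (1 / (of_real s - z)) * (l / (s * (s + l)))"
  by (simp only: times_complex.sel Re_complex_of_real Im_complex_of_real mult_zero_right diff_0_right)
 ultimately show ?thesis unfolding has_laplace_def by (simp only:)
qed

text \<open>Summability at one abscissa passes to every positive one. This reaches
  \<open>beta < 1/2\<close>, where no closed form of the sum is at hand.\<close>

lemma summable_zero_weights:
 fixes w gamma :: "nat \<Rightarrow> real"
 assumes "summable (\<lambda>i. w i * (pker c (gamma i)))" "c > 0" "u > 0" "\<And>i. w i \<ge> 0"
 shows "summable (\<lambda>i. w i * (qker u (gamma i)))" "summable (\<lambda>i. w i * (pker u (gamma i)))"
proof -
 define M where "M = 1 / c + c / u^2"
 show 1: "summable (\<lambda>i. w i * (qker u (gamma i)))"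
 proof (rule summable_comparison_test'[OF summable_mult2[OF assms(1), of M]])
  fix i
  have p: "c^2 + (gamma i)^2 > 0" "u^2 + (gamma i)^2 > 0" using assms by (auto intro: add_pos_nonneg)
  have "c^2 + (gamma i)^2 \<le> (1 + c^2 / u^2) * (u^2 + (gamma i)^2)" using assms(2,3) by (simp add: field_simps)
  also have "1 + c^2 / u^2 = c * M" using assms(2) by (simp add: M_def field_simps power2_eq_square)
  finally have "qker u (gamma i) \<le> pker c (gamma i) * M" using p by (simp add: field_simps)
  from mult_left_mono[OF this assms(4)[of i]]
  show "norm (w i * (qker u (gamma i))) \<le> w i * (pker c (gamma i)) * M"
   using p assms(4)[of i] by (simp add: mult.assoc)
 qed
 from summable_mult[OF this, of u] show "summable (\<lambda>i. w i * (pker u (gamma i)))" by (simp add: mult_ac)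
qed

lemma Re_inverse_Complex: "Re (1 / Complex x g) = pker x g"
 by (simp add: Re_divide)

text \<open>The digamma term written as a sum over the trivial zeros
  \<open>- (2 * k + delta)\<close>, normalised at \<open>s = 1\<close> to converge.\<close>

lemma Digamma_half_difference:
 fixes s delta :: real
 assumes "s > 0" "delta > 0"
 shows "(\<lambda>k. 1 / (2 * real k + delta + s) - 1 / (2 * real k + delta + 1)) sums (Digamma ((1 + delta) / 2) / 2 - Digamma ((s + delta) / 2) / 2)"
proof -
 have D: "(\<lambda>k. inverse (of_nat (Suc k)) - inverse ((t + delta) / 2 + of_nat k)) sums (Digamma ((t + delta) / 2) + euler_mascheroni)" if "t > 0" for t :: real
  using summable_Digamma[of "(t + delta) / 2"] that assms by (simp add: Digamma_def summable_sums)
 from sums_mult[OF sums_diff[OF D[of 1] D[OF assms(1)]], of "1/2"]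
 have "(\<lambda>k. 1/2 * (inverse ((s + delta) / 2 + real k) - inverse ((1 + delta) / 2 + real k))) sums (1/2 * (Digamma ((1 + delta) / 2) - Digamma ((s + delta) / 2)))"
  by simp
 moreover have "1/2 * (inverse ((s + delta) / 2 + real k) - inverse ((1 + delta) / 2 + real k)) = 1 / (2 * real k + delta + s) - 1 / (2 * real k + delta + 1)" for k
 proof -
  have "inverse ((t + delta) / 2 + real k) = 2 / (2 * real k + delta + t)" if "t > 0" for t :: real
   using that assms by (simp add: field_simps)
  from this[of s] this[of 1] show ?thesis using assms by simp
 qed
 ultimately have "(\<lambda>k. 1 / (2 * real k + delta + s) - 1 / (2 * real k + delta + 1)) sums (1/2 * (Digamma ((1 + delta) / 2) - Digamma ((s + delta) / 2)))"
  by (simp only:)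
 thus ?thesis by (simp add: diff_divide_distrib)
qed

lemma norm_zero_term:
 assumes "beta > 0" "L > 0"
 shows "norm (of_real L * exp (Complex beta g * of_real y) / (Complex beta g * (Complex beta g + of_real L))) \<le> L * (qker beta g) * exp (beta * y)"
proof -
 define z where "z = Complex beta g"
 have z0: "z \<noteq> 0" "z + of_real L \<noteq> 0" using assms by (auto simp: z_def complex_eq_iff)
 have "norm z \<le> norm (Complex (beta + L) g)" unfolding z_def complex_norm
  using assms by (intro real_sqrt_le_mono add_right_mono power_mono) auto
 also have "Complex (beta + L) g = z + of_real L" by (simp add: z_def complex_eq_iff)
 finally have "L * exp (beta * y) / (norm z * norm (z + of_real L)) \<le> L * exp (beta * y) / (norm z * norm z)"
  using assms z0 by (intro divide_left_mono mult_left_mono mult_pos_pos) auto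
 moreover have "norm (of_real L * exp (z * of_real y) / (z * (z + of_real L))) = L * exp (beta * y) / (norm z * norm (z + of_real L))"
  using assms by (simp add: norm_mult norm_divide z_def)
 moreover have "norm z * norm z = beta^2 + g^2" by (simp add: z_def complex_norm)
 ultimately show ?thesis unfolding z_def[symmetric] by (simp add: mult_ac)
qed

text \<open>Multiplied by \<open>l / (s * (s + l))\<close>, the identity \<open>zero\<close> at
  \<open>s + alpha\<close> becomes an identity of Laplace transforms for \<open>s > 1\<close>, and
  uniqueness makes it one of functions of \<open>y\<close>. Of the exact formula only a lower bound
  is kept: \<open>1 / alpha\<close> covers the trivial zeros and 5 the constants.\<close>

theorem explicit_formula_lower_bound:
 fixes v w gamma :: "nat \<Rightarrow> real" and K alpha y :: real and a l :: nat
 defines "beta \<equiv> 1/2 - alpha"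
 assumes v0: "v 0 = 0" and vs: "\<And>s::real. s > 1 ==> summable (\<lambda>n. \<bar>v n\<bar> * real n powr (- s))"
  and w: "\<And>i. w i \<ge> 0"
  and zero: "\<And>s::real. s > 1 ==> (\<lambda>i. w i * (pker (s - 1/2) (gamma i))) sums
   (K + Digamma ((s + real a) / 2) / 2 - (\<Sum>n. v n * real n powr (- s)))"
  and alpha: "alpha > 0" "alpha \<le> 1/4" and l: "l \<ge> 1" and y: "y \<ge> 0" and K: "K \<ge> -1"
 shows "- (\<Sum>i. w i * Re (of_nat l * exp (Complex beta (gamma i) * of_real y) / (Complex beta (gamma i) * (Complex beta (gamma i) + of_nat l))))
   - (\<Sum>i. w i * (pker (beta + real l) (gamma i))) - 1 / alpha - 5
  \<le> (\<Sum>n | n > 0 \<and> ln (real n) \<le> y. v n * real n powr (- alpha) * (1 - exp (- (real l * (y - ln (real n))))))"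
proof -
 define L where "L = real l"
 define z where "z = (\<lambda>i. Complex beta (gamma i))"
 \<comment> \<open>The digamma term at \<open>s + alpha\<close> has its poles at
   \<open>s = - c k\<close>.\<close>
 define c where "c = (\<lambda>k. 2 * real k + (real a + alpha))"
 define D where "D = (\<lambda>s. L / (s * (s + L)))"
 define V where "V = (\<lambda>s. \<Sum>n. v n * real n powr (- s))"
 define kappa0 where "kappa0 = K + Digamma ((1 + (real a + alpha)) / 2) / 2"
 have L: "L \<ge> 1" using l by (simp add: L_def)
 have beta: "beta \<ge> 1/4" "beta < 1" using alpha by (auto simp: beta_def)
 have cpos: "c k > 0" for k using alpha by (simp add: c_def add_nonneg_pos)
 \<comment> \<open>\<open>0 < alpha < 1\<close> makes \<open>c k\<close> a non-integer, so no
   trivial zero meets the pole of the smoothing factor at \<open>- L\<close>, and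
   \<open>zero_kernel\<close> applies without double poles.\<close>
 have cL: "c k \<noteq> L" for k
 proof
  assume "c k = L"
  hence "alpha = of_int (int l - 2 * int k - int a)" by (simp add: c_def L_def)
  with alpha have "of_int (int l - 2 * int k - int a) > (0::real)" "of_int (int l - 2 * int k - int a) < (1::real)" by linarith+
  thus False unfolding of_int_0_less_iff of_int_less_1_iff by linarith
 qed
 have z: "z i \<noteq> 0" "z i + of_real L \<noteq> 0" "z i \<noteq> - of_real L" "Re (z i) = beta" "Re (z i + of_real L) = beta + L" for i
  using beta L by (auto simp: z_def complex_eq_iff)
 define f1 where "f1 = (\<lambda>n y. v n * real n powr (- alpha) * (if y \<ge> ln (real n) then 1 - exp (- (L * (y - ln (real n)))) else 0))"
 define f2 where "f2 = (\<lambda>i y. w i * Re (zero_kernel L (z i) y))"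
 define f3 where "f3 = (\<lambda>k y. Re (zero_kernel L (of_real (- c k)) y) - 1 / (c k + 1) * (1 - exp (- (L * y))))"
 define f4 where "f4 = (\<lambda>y. kappa0 * (1 - exp (- (L * y))))"

 \<comment> \<open>The prime side\<close>
 define b1 where "b1 = (\<lambda>n. \<bar>v n\<bar> * real n powr (- (1 + alpha)))"
 have b1: "summable b1" unfolding b1_def by (rule vs) (use alpha in simp)
 \<comment> \<open>On its support the weight is at most \<open>1 \<le> exp (y - ln n)\<close>. This
   trades growth \<open>exp y\<close> for a factor \<open>1 / n\<close>, which makes the
   coefficients summable, and it fixes \<open>s > 1\<close> as the range of comparison.\<close>
 have bd1: "\<bar>f1 n y\<bar> \<le> b1 n * exp (1 * y)" if "y \<ge> 0" for n y
 proof (cases "n > 0 \<and> y \<ge> ln (real n)")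
  case True
  have "1 - exp (- (L * (y - ln (real n)))) \<le> 1" "1 - exp (- (L * (y - ln (real n)))) \<ge> 0" using True L by auto
  hence "\<bar>1 - exp (- (L * (y - ln (real n))))\<bar> \<le> 1" by linarith
  also have "1 \<le> exp (y - ln (real n))" using True by simp
  also have "... = real n powr (- 1) * exp y" using True by (simp add: exp_diff powr_minus field_simps)
  finally have "\<bar>v n\<bar> * real n powr (- alpha) * \<bar>1 - exp (- (L * (y - ln (real n))))\<bar> \<le> \<bar>v n\<bar> * real n powr (- alpha) * (real n powr (- 1) * exp y)"
   by (intro mult_left_mono) auto
  also have "... = b1 n * exp (1 * y)"
  proof -
   have "real n powr (- (1 + alpha)) = real n powr (- alpha) * real n powr (- 1)" by (simp only: powr_add[symmetric]) (simp add: algebra_simps)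
   thus ?thesis by (simp only: b1_def mult_1 mult.assoc)
  qed
  finally show ?thesis using True by (simp add: f1_def abs_mult)
 next
  case False
  thus ?thesis using v0 by (cases "n = 0") (auto simp: f1_def b1_def)
 qed
 have cont1: "continuous_on {0..} (f1 n)" for n
 proof -
  have "f1 n = (\<lambda>y. v n * real n powr (- alpha) * max 0 (1 - exp (- (L * (y - ln (real n))))))"
  proof (rule ext)
   fix y
   have "1 - exp (- (L * (y - ln (real n)))) \<ge> 0 \<longleftrightarrow> y \<ge> ln (real n)" using L by (simp add: zero_le_mult_iff)
   thus "f1 n y = v n * real n powr (- alpha) * max 0 (1 - exp (- (L * (y - ln (real n)))))" by (auto simp: f1_def max_def)
  qed
  thus ?thesis by (simp only:) (intro continuous_intros)
 qed
 have lap1: "has_laplace (f1 n) s (v n * real n powr (- (s + alpha)) * D s)" if "s > 0" for n s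
 proof (cases "n = 0")
  case False
  have "has_laplace (f1 n) s (v n * real n powr (- alpha) * (exp (- (s * ln (real n))) * (L / (s * (s + L)))))"
   unfolding f1_def by (intro has_laplace_cmult has_laplace_shift) (use False L that in auto)
  moreover have "exp (- (s * ln (real n))) = real n powr (- s)" using False by (simp add: powr_def)
  moreover have "real n powr (- (s + alpha)) = real n powr (- alpha) * real n powr (- s)" by (simp only: powr_add[symmetric]) (simp add: algebra_simps)
  ultimately show ?thesis by (simp only: D_def mult.assoc)
 qed (use v0 has_laplace_cmult[of "\<lambda>_. 1" s "1/s" 0] has_laplace_exp_at_0[OF that] in \<open>simp add: f1_def\<close>)

 \<comment> \<open>The nontrivial zeros\<close>
 have s1: "summable (\<lambda>i. w i * (pker (2 - 1/2) (gamma i)))" using sums_summable[OF zero[of 2]] by simp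
 note sw = summable_zero_weights[OF s1 _ _ w]
 define b2 where "b2 = (\<lambda>i. L * (w i * (qker beta (gamma i))) + w i * (pker beta (gamma i)) + w i * (pker (beta + L) (gamma i)))"
 have b2: "summable b2" unfolding b2_def using beta L by (intro summable_add summable_mult sw) auto
 define M where "M = (\<lambda>i y. Re (of_real L * exp (z i * of_real y) / (z i * (z i + of_real L))))"
 have Rez: "Re (1 / z i) = pker beta (gamma i)" "Re (1 / (z i + of_real L)) = pker (beta + L) (gamma i)" for i
 proof -
  have "z i + of_real L = Complex (beta + L) (gamma i)" by (simp add: z_def complex_eq_iff)
  thus "Re (1 / z i) = pker beta (gamma i)" "Re (1 / (z i + of_real L)) = pker (beta + L) (gamma i)"
   by (simp_all only: z_def Re_inverse_Complex)
 qed
 have f2eq: "f2 i y = w i * M i y - w i * (pker beta (gamma i)) + w i * (exp (- (L * y)) * (pker (beta + L) (gamma i)))" for i y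
 proof -
  have "of_real (exp (- (L * y))) / (z i + of_real L) = of_real (exp (- (L * y))) * (1 / (z i + of_real L))" by simp
  moreover have "Re (of_real r * x) = r * Re x" for r x by simp
  ultimately have "Re (of_real (exp (- (L * y))) / (z i + of_real L)) = exp (- (L * y)) * Re (1 / (z i + of_real L))" by (simp only:)
  hence "Re (zero_kernel L (z i) y) = M i y - Re (1 / z i) + exp (- (L * y)) * Re (1 / (z i + of_real L))"
   unfolding zero_kernel_def M_def by simp
  thus ?thesis unfolding f2_def Rez by (simp only: distrib_left right_diff_distrib)
 qed
 have Mbd: "\<bar>M i y\<bar> \<le> L * (qker beta (gamma i)) * exp (beta * y)" for i y
  unfolding M_def z_def by (rule order_trans[OF abs_Re_le_cmod norm_zero_term]) (use beta L in auto)
 have bd2: "\<bar>f2 i y\<bar> \<le> b2 i * exp (1 * y)" if "y \<ge> 0" for i y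
 proof -
  define q1 q2 where "q1 = pker beta (gamma i)" and "q2 = pker (beta + L) (gamma i)"
  have q: "q1 \<ge> 0" "q2 \<ge> 0" using beta L by (auto simp: q1_def q2_def)
  have e: "exp (beta * y) \<le> exp y" "1 \<le> exp y" "exp (- (L * y)) \<le> 1" using beta that L by (auto simp: mult_left_le_one_le)
  have "\<bar>M i y\<bar> \<le> L * (qker beta (gamma i)) * exp y"
   by (rule order_trans[OF Mbd]) (use e L in \<open>intro mult_left_mono; simp\<close>)
  moreover have "q1 \<le> q1 * exp y" using mult_left_mono[OF e(2) q(1)] by simp
  moreover have "exp (- (L * y)) * q2 \<le> q2 * exp y" using mult_mono[OF order_trans[OF e(3,2)] order.refl, of q2] q by (simp add: mult.commute)
  moreover have "exp (- (L * y)) * q2 \<ge> 0" using q by simp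
  ultimately have "\<bar>M i y - q1 + exp (- (L * y)) * q2\<bar> \<le> (L * (qker beta (gamma i)) + q1 + q2) * exp y"
   using q unfolding ring_distribs by linarith
  from mult_left_mono[OF this w[of i]] show ?thesis
   unfolding f2eq b2_def q1_def[symmetric] q2_def[symmetric]
   using w[of i] abs_mult[of "w i" "M i y - q1 + exp (- (L * y)) * q2"] by (simp add: algebra_simps)
 qed
 have cont2: "continuous_on {0..} (f2 i)" for i
  unfolding f2_def zero_kernel_def using z by (intro continuous_intros) auto
 have lap2: "has_laplace (f2 i) s (w i * (pker (s - beta) (gamma i)) * D s)" if "s > 1" for i s
 proof -
  have "has_laplace (f2 i) s (w i * (Re (1 / (of_real s - z i)) * (L / (s * (s + L)))))"
   unfolding f2_def by (intro has_laplace_cmult has_laplace_zero_kernel) (use z beta L that in auto)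
  moreover have "of_real s - z i = Complex (s - beta) (- gamma i)" by (simp add: z_def complex_eq_iff)
  hence "Re (1 / (of_real s - z i)) = pker (s - beta) (gamma i)" by (simp only: Re_inverse_Complex power2_minus)
  ultimately show ?thesis by (simp add: D_def mult.assoc)
 qed

 \<comment> \<open>The trivial zeros\<close>
 define b3 where "b3 = (\<lambda>k. (1 / c k - 1 / c (Suc k)) + L / (c k * \<bar>L - c k\<bar>))"
 have tele: "(\<lambda>k. 1 / c k - 1 / c (Suc k)) sums (1 / c 0)"
 proof -
  have "(\<lambda>k. 1 / c k) \<longlonglongrightarrow> 0" unfolding c_def by real_asymp
  from telescope_sums'[OF this] show ?thesis by simp
 qed
 have b3: "summable b3" unfolding b3_def
 proof (rule summable_add[OF sums_summable[OF tele]])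
  show "summable (\<lambda>k. L / (c k * \<bar>L - c k\<bar>))"
  proof (rule summable_comparison_test_bigo)
   show "summable (\<lambda>k. norm (1 / real k ^ 2))" using inverse_power_summable[of 2, where ?'a = real] by (simp add: inverse_eq_divide)
   have "(\<lambda>k. L / ((2 * real k + (real a + alpha)) * \<bar>L - (2 * real k + (real a + alpha))\<bar>)) \<in> O(\<lambda>k. 1 / real k ^ 2)"
    by real_asymp
   thus "(\<lambda>k. L / (c k * \<bar>L - c k\<bar>)) \<in> O(\<lambda>k. 1 / real k ^ 2)" by (simp add: c_def)
  qed
 qed
 have f3eq: "f3 k y = (1 - exp (- (L * y))) * (1 / c k - 1 / (c k + 1)) - L / (c k * (L - c k)) * (exp (- (c k * y)) - exp (- (L * y)))" for k y
 proof -
  define x1 x2 where "x1 = exp (- (c k * y))" and "x2 = exp (- (L * y))"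
  have nz: "c k \<noteq> 0" "L - c k \<noteq> 0" "- c k + L \<noteq> 0" using cpos[of k] cL[of k] by auto
  have "exp (complex_of_real (- c k) * of_real y) = of_real x1" by (simp add: x1_def exp_of_real[symmetric])
  hence "zero_kernel L (of_real (- c k)) y = of_real (L * x1 / (- c k * (- c k + L)) - 1 / (- c k) + x2 / (- c k + L))"
   unfolding zero_kernel_def x2_def[symmetric] by (simp only: of_real_add of_real_diff of_real_mult of_real_divide of_real_1 of_real_minus)
  hence "Re (zero_kernel L (of_real (- c k)) y) = L * x1 / (- c k * (- c k + L)) - 1 / (- c k) + x2 / (- c k + L)" by (simp only: Re_complex_of_real)
  also have "... = (1 - x2) * (1 / c k) - L / (c k * (L - c k)) * (x1 - x2)"
   using nz by (simp add: divide_simps) (simp add: algebra_simps)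
  finally show ?thesis unfolding f3_def x1_def[symmetric] x2_def[symmetric] by (simp add: algebra_simps)
 qed
 have c_diff: "1 / c k - 1 / (c k + 1) \<ge> 0" "1 / c k - 1 / (c k + 1) \<le> 1 / c k - 1 / c (Suc k)" for k
 proof -
  have "c (Suc k) = c k + 2" by (simp add: c_def)
  thus "1 / c k - 1 / (c k + 1) \<ge> 0" "1 / c k - 1 / (c k + 1) \<le> 1 / c k - 1 / c (Suc k)"
   using cpos[of k] by (auto intro!: frac_le)
 qed
 have f3_le: "f3 k y \<le> 1 / c k - 1 / c (Suc k)" if "y \<ge> 0" for k y
 proof -
  have "L / (c k * (L - c k)) * (exp (- (c k * y)) - exp (- (L * y))) \<ge> 0"
  proof (cases "c k < L")
   case True
   have "c k * y \<le> L * y" using True that by (intro mult_right_mono) auto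
   thus ?thesis using True cpos[of k] L by (intro mult_nonneg_nonneg divide_nonneg_nonneg) auto
  next
   case False
   have "L * y \<le> c k * y" using False that by (intro mult_right_mono) auto
   thus ?thesis using False cpos[of k] L cL[of k]
    by (intro mult_nonpos_nonpos divide_nonneg_neg mult_pos_neg) auto
  qed
  moreover have "(1 - exp (- (L * y))) * (1 / c k - 1 / (c k + 1)) \<le> 1 * (1 / c k - 1 / (c k + 1))"
   by (intro mult_right_mono c_diff) auto
  moreover have "A - B \<le> D" if "0 \<le> B" "A \<le> 1 * C" "C \<le> D" for A B C D :: real using that by linarith
  ultimately show ?thesis using c_diff(2)[of k] unfolding f3eq by blast
 qed
 have bd3: "\<bar>f3 k y\<bar> \<le> b3 k * exp (1 * y)" if "y \<ge> 0" for k y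
 proof -
  have e: "0 \<le> exp (- (c k * y))" "exp (- (c k * y)) \<le> 1" "0 \<le> exp (- (L * y))" "exp (- (L * y)) \<le> 1"
   using cpos[of k] L that by auto
  have "\<bar>L / (c k * (L - c k)) * (exp (- (c k * y)) - exp (- (L * y)))\<bar> \<le> L / (c k * \<bar>L - c k\<bar>) * 1"
  proof -
   have "\<bar>exp (- (c k * y)) - exp (- (L * y))\<bar> \<le> 1" using e by linarith
   thus ?thesis unfolding abs_mult using L cpos[of k] by (intro mult_mono) (auto simp: abs_mult)
  qed
  moreover have "\<bar>(1 - exp (- (L * y))) * (1 / c k - 1 / (c k + 1))\<bar> \<le> 1 * (1 / c k - 1 / c (Suc k))"
   unfolding abs_mult using e c_diff[of k] by (intro mult_mono) auto
  moreover have "\<bar>A - B\<bar> \<le> C + D" if "\<bar>B\<bar> \<le> D * 1" "\<bar>A\<bar> \<le> 1 * C" for A B C D :: real using that by linarith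
  ultimately have 1: "\<bar>f3 k y\<bar> \<le> b3 k" unfolding f3eq b3_def by blast
  have "b3 k * 1 \<le> b3 k * exp (1 * y)" by (rule mult_left_mono) (use 1 that in auto)
  with 1 show ?thesis by simp
 qed
 have cont3: "continuous_on {0..} (f3 k)" for k
  unfolding f3eq by (intro continuous_intros)
 have lap3: "has_laplace (f3 k) s ((1 / (c k + s) - 1 / (c k + 1)) * D s)" if "s > 1" for k s
 proof -
  have "has_laplace (f3 k) s (Re (1 / (of_real s - of_real (- c k))) * (L / (s * (s + L))) - 1 / (c k + 1) * (L / (s * (s + L))))"
   unfolding f3_def
  proof (intro has_laplace_diff has_laplace_cmult has_laplace_zero_kernel has_laplace_one_minus_exp)
   show "complex_of_real (- c k) \<noteq> - of_real L" using cL[of k] by simp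
  qed (use cpos[of k] L that in auto)
  moreover have "1 / (of_real s - of_real (- c k)) = complex_of_real (1 / (c k + s))" by (simp add: add.commute)
  hence "Re (1 / (of_real s - of_real (- c k))) = 1 / (c k + s)" by (simp only: Re_complex_of_real)
  ultimately show ?thesis unfolding D_def left_diff_distrib by (simp only:)
 qed

 \<comment> \<open>Cancellation by uniqueness of Laplace transforms\<close>
 have "\<forall>j. \<forall>y\<ge>0. \<bar>f1 j y\<bar> \<le> b1 j * exp (1 * y)" "\<forall>j. \<forall>y\<ge>0. \<bar>f2 j y\<bar> \<le> b2 j * exp (1 * y)"
  "\<forall>j. \<forall>y\<ge>0. \<bar>f3 j y\<bar> \<le> b3 j * exp (1 * y)" using bd1 bd2 bd3 by blast+
 note S1 = has_laplace_suminf[OF cont1 this(1) b1] and S2 = has_laplace_suminf[OF cont2 this(2) b2] and S3 = has_laplace_suminf[OF cont3 this(3) b3]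
 define H where "H = (\<lambda>y. (\<Sum>n. f1 n y) + (\<Sum>i. f2 i y) + (\<Sum>k. f3 k y) - f4 y)"
 have "H y = 0"
 proof (rule laplace_unique_zero[OF _ _ _ y, where sig = 1 and C = "suminf b1 + suminf b2 + suminf b3 + \<bar>kappa0\<bar>"])
  show "continuous_on {0..} H" unfolding H_def f4_def
   by (intro continuous_on_add continuous_on_diff S1(1) S2(1) S3(1)) (auto intro!: continuous_intros)
  show "\<bar>H y\<bar> \<le> (suminf b1 + suminf b2 + suminf b3 + \<bar>kappa0\<bar>) * exp (1 * y)" if "y \<ge> 0" for y
  proof -
   have "\<bar>f4 y\<bar> \<le> \<bar>kappa0\<bar> * 1" unfolding f4_def abs_mult using that L by (intro mult_left_mono) auto
   also have "... \<le> \<bar>kappa0\<bar> * exp (1 * y)" using that by (intro mult_left_mono) auto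
   finally show ?thesis using S1(3)[OF that] S2(3)[OF that] S3(3)[OF that] unfolding H_def ring_distribs by linarith
  qed
  fix s :: real assume s: "s > 1"
  have "(\<lambda>n. v n * real n powr (- (s + alpha))) sums V (s + alpha)"
   unfolding V_def
  proof (rule summable_sums, rule summable_rabs_cancel)
   show "summable (\<lambda>n. \<bar>v n * real n powr (- (s + alpha))\<bar>)" using vs[of "s + alpha"] s alpha by (simp add: abs_mult)
  qed
  from sums_mult2[OF this, of "D s"] have l1: "has_laplace (\<lambda>y. \<Sum>n. f1 n y) s (V (s + alpha) * D s)"
   by (rule S1(4)[rotated 2]) (use s lap1 in auto)
  have "s + alpha - 1/2 = s - beta" by (simp add: beta_def)
  with zero[of "s + alpha"] s alpha have
   "(\<lambda>i. w i * (pker (s - beta) (gamma i))) sums (K + Digamma ((s + alpha + real a) / 2) / 2 - V (s + alpha))"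
   by (simp add: V_def)
  from sums_mult2[OF this, of "D s"] have l2: "has_laplace (\<lambda>y. \<Sum>i. f2 i y) s ((K + Digamma ((s + alpha + real a) / 2) / 2 - V (s + alpha)) * D s)"
   by (rule S2(4)[rotated 2]) (use s lap2 in auto)
  have "(\<lambda>k. 1 / (c k + s) - 1 / (c k + 1)) sums (Digamma ((1 + (real a + alpha)) / 2) / 2 - Digamma ((s + (real a + alpha)) / 2) / 2)"
   unfolding c_def by (rule Digamma_half_difference) (use s alpha in auto)
  from sums_mult2[OF this, of "D s"] have l3: "has_laplace (\<lambda>y. \<Sum>k. f3 k y) s ((Digamma ((1 + (real a + alpha)) / 2) / 2 - Digamma ((s + (real a + alpha)) / 2) / 2) * D s)"
   by (rule S3(4)[rotated 2]) (use s lap3 in auto)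
  have l4: "has_laplace f4 s (kappa0 * D s)" unfolding f4_def D_def
   by (intro has_laplace_cmult has_laplace_one_minus_exp) (use s L in auto)
  show "has_laplace H s 0" unfolding H_def
   by (rule has_laplace_cong[OF has_laplace_diff[OF has_laplace_add[OF has_laplace_add[OF l1 l2] l3] l4] refl])
    (simp add: kappa0_def algebra_simps)
 qed
 moreover have "f4 y \<ge> - 5"
 proof -
  \<comment> \<open>\<open>K \<ge> -1\<close> and half of \<open>Digamma (1/2) \<ge> -2\<close> give
    this bound, so \<open>f4 y\<close> is at least -2; the claimed -5 leaves room.\<close>
  have "kappa0 \<ge> - 2"
  proof -
   have "Digamma (1/2) \<le> Digamma ((1 + (real a + alpha)) / 2)" by (rule Digamma_real_mono) (use alpha in auto)
   moreover have "Digamma (1/2) \<ge> (- 2 :: real)"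
    unfolding Digamma_one_half using euler_mascheroni_less_13_over_22 ln2_le_25_over_36 by simp
   ultimately show ?thesis using K unfolding kappa0_def by linarith
  qed
  have "f4 y \<ge> (- 2) * (1 - exp (- (L * y)))" unfolding f4_def using y L \<open>kappa0 \<ge> - 2\<close> by (intro mult_right_mono) auto
  thus ?thesis using exp_ge_zero[of "- (L * y)"] unfolding right_diff_distrib by linarith
 qed
 moreover have "(\<Sum>k. f3 k y) \<le> 1 / alpha"
 proof -
  have "(\<Sum>k. f3 k y) \<le> (\<Sum>k. 1 / c k - 1 / c (Suc k))"
   by (rule suminf_le[OF f3_le[OF y] S3(2)[OF y] sums_summable[OF tele]])
  also have "... = 1 / c 0" using tele by (simp add: sums_iff)
  also have "... \<le> 1 / alpha" using alpha by (intro divide_left_mono) (auto simp: c_def intro!: mult_pos_pos add_nonneg_pos)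
  finally show ?thesis .
 qed
 moreover have "(\<Sum>i. f2 i y) \<le> (\<Sum>i. w i * M i y) + (\<Sum>i. w i * (pker (beta + L) (gamma i)))"
 proof -
  have sM: "summable (\<lambda>i. w i * M i y)"
  proof (rule summable_comparison_test'[where g = "\<lambda>i. L * exp (beta * y) * (w i * (qker beta (gamma i)))"])
   show "summable (\<lambda>i. L * exp (beta * y) * (w i * (qker beta (gamma i))))"
    using beta by (intro summable_mult sw) auto
   show "norm (w i * M i y) \<le> L * exp (beta * y) * (w i * (qker beta (gamma i)))" for i
    using mult_left_mono[OF Mbd[of i y] w[of i]] w[of i] by (simp add: abs_mult mult_ac)
  qed
  have sp: "summable (\<lambda>i. w i * (pker (beta + L) (gamma i)))" using beta L by (intro sw) auto
  show ?thesis unfolding suminf_add[OF sM sp]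
  proof (rule suminf_le[OF _ S2(2)[OF y] summable_add[OF sM sp]])
   fix i
   have "exp (- (L * y)) * (pker (beta + L) (gamma i)) \<le> 1 * (pker (beta + L) (gamma i))"
    using beta L y by (intro mult_right_mono) auto
   moreover have "pker beta (gamma i) \<ge> 0" using beta by simp
   ultimately show "f2 i y \<le> w i * M i y + w i * (pker (beta + L) (gamma i))"
    unfolding f2eq using mult_left_mono[of _ _ "w i"] w[of i] by (smt (verit) mult_nonneg_nonneg mult_left_mono)
  qed
 qed
 moreover have "(\<Sum>n. f1 n y) = (\<Sum>n | n > 0 \<and> ln (real n) \<le> y. v n * real n powr (- alpha) * (1 - exp (- (L * (y - ln (real n))))))"
 proof -
  have "finite {n::nat. n > 0 \<and> ln (real n) \<le> y}"
  proof (rule finite_subset)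
   show "{n::nat. n > 0 \<and> ln (real n) \<le> y} \<subseteq> {..nat \<lfloor>exp y\<rfloor>}"
   proof safe
    fix n :: nat assume "n > 0" "ln (real n) \<le> y"
    hence "real n \<le> exp y" by (metis exp_le_cancel_iff exp_ln of_nat_0_less_iff)
    thus "n \<le> nat \<lfloor>exp y\<rfloor>" by (rule le_nat_floor)
   qed
  qed auto
  hence "(\<Sum>n. f1 n y) = (\<Sum>n | n > 0 \<and> ln (real n) \<le> y. f1 n y)"
   by (rule suminf_finite) (use v0 in \<open>auto simp: f1_def\<close>)
  thus ?thesis by (simp add: f1_def)
 qed
 ultimately have "- (\<Sum>i. w i * M i y) - (\<Sum>i. w i * (pker (beta + L) (gamma i))) - 1 / alpha - 5
  \<le> (\<Sum>n | n > 0 \<and> ln (real n) \<le> y. v n * real n powr (- alpha) * (1 - exp (- (L * (y - ln (real n))))))"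
  unfolding H_def by linarith
 moreover have "complex_of_real L = of_nat l" by (simp add: L_def)
 ultimately show ?thesis unfolding M_def z_def by (simp only: L_def[symmetric])
qed

section \<open>Real characters\<close>

lemma coprime_inverse_mod:
 assumes "q > 1" "coprime (n::nat) q"
 obtains x where "coprime x q" "[n * x = 1] (mod q)"
proof -
 obtain x where x: "[n * x = 1] (mod q)" using cong_solve_coprime_nat[OF assms(2)] by auto
 have "coprime (n * x) q" using cong_imp_coprime[OF cong_sym[OF x]] by simp
 hence "coprime x q" by simp
 thus ?thesis using that x by blast
qed

lemma coprime_add_modulus: "coprime (n + q) q \<longleftrightarrow> coprime n (q::nat)"
 by (simp only: coprime_iff_gcd_eq_1 gcd_add1)

context
 fixes q :: nat
 assumes q: "q > 1"
begin

lemma mod_in_totatives: "n mod q \<in> totatives q \<longleftrightarrow> coprime n q"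
proof
 assume "n mod q \<in> totatives q"
 thus "coprime n q" using q by (simp add: totatives_def)
next
 assume n: "coprime n q"
 have "n mod q \<noteq> 0"
 proof
  assume "n mod q = 0"
  hence "q dvd 1" using coprime_common_divisor[OF n, of q] by auto
  thus False using q by simp
 qed
 thus "n mod q \<in> totatives q" using n q by (auto simp: totatives_def less_imp_le)
qed

lemma totatives_D: "a \<in> totatives q ==> coprime a q \<and> a < q \<and> a mod q = a"
 using q totatives_less[of a q] by (auto simp: totatives_def)

lemma mod_mult_bij_totatives:
 assumes c: "coprime c q"
 shows "bij_betw (\<lambda>a. c * a mod q) (totatives q) (totatives q)"
proof -
 have inj: "inj_on (\<lambda>a. c * a mod q) (totatives q)"
 proof (rule inj_onI)
  fix a b assume ab: "a \<in> totatives q" "b \<in> totatives q" "c * a mod q = c * b mod q"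
  hence "[a = b] (mod q)" using cong_mult_lcancel_nat[OF c] by (simp add: cong_def)
  thus "a = b" using totatives_D ab by (simp add: cong_def)
 qed
 have "(\<lambda>a. c * a mod q) ` totatives q \<subseteq> totatives q"
  using c totatives_D by (auto simp: mod_in_totatives)
 hence "(\<lambda>a. c * a mod q) ` totatives q = totatives q" by (intro endo_inj_surj inj) auto
 with inj show ?thesis by (simp add: bij_betw_def)
qed

lemma quad_res_iff: "n mod q \<in> quad_res q \<longleftrightarrow> (\<exists>x. coprime x q \<and> [x ^ 2 = n] (mod q))"
proof
 assume "n mod q \<in> quad_res q"
 thus "\<exists>x. coprime x q \<and> [x ^ 2 = n] (mod q)" by (auto simp: quad_res_def totatives_def cong_def)
next
 assume "\<exists>x. coprime x q \<and> [x ^ 2 = n] (mod q)"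
 then obtain x where x: "coprime x q" "[x ^ 2 = n] (mod q)" by blast
 have "coprime n q" using cong_imp_coprime[OF x(2)] x(1) by simp
 moreover have "[(x mod q) ^ 2 = n mod q] (mod q)" using x(2) by (simp add: cong_def power_mod)
 ultimately show "n mod q \<in> quad_res q" using x(1) mod_in_totatives unfolding quad_res_def by blast
qed

text \<open>Squaring maps the units onto the squares, and each fibre is a translate of the set of
  square roots of 1 that \<open>rho\<close> counts.\<close>

lemma card_quad_res: "card (quad_res q) * rho q = totient q"
proof -
 define F where "F = (\<lambda>s. {x \<in> totatives q. x ^ 2 mod q = s})"
 have "card (F s) = rho q" if s: "s \<in> quad_res q" for s
 proof -
  obtain x where x: "x \<in> totatives q" "[x ^ 2 = s] (mod q)" using s by (auto simp: quad_res_def)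
  have sq: "s mod q = s" using s totatives_D by (simp add: quad_res_def)
  have bij: "bij_betw (\<lambda>a. x * a mod q) (totatives q) (totatives q)"
   by (rule mod_mult_bij_totatives) (use totatives_D[OF x(1)] in simp)
  have "F s = (\<lambda>a. x * a mod q) ` {a \<in> totatives q. [a ^ 2 = 1] (mod q)}"
  proof -
   have iff: "(x * a mod q) ^ 2 mod q = s \<longleftrightarrow> [a ^ 2 = 1] (mod q)" for a
   proof -
    have "(x * a mod q) ^ 2 mod q = s \<longleftrightarrow> [x ^ 2 * a ^ 2 = x ^ 2 * 1] (mod q)"
     using x(2) sq by (simp add: power_mod power_mult_distrib cong_def)
    also have "... \<longleftrightarrow> [a ^ 2 = 1] (mod q)"
     by (rule cong_mult_lcancel_nat) (use totatives_D[OF x(1)] in simp)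
    finally show ?thesis .
   qed
   have im: "(\<lambda>a. x * a mod q) ` totatives q = totatives q" using bij by (simp add: bij_betw_def)
   show ?thesis
   proof (intro equalityI subsetI)
    fix y assume y: "y \<in> F s"
    then obtain b where b: "b \<in> totatives q" "y = x * b mod q" using im by (force simp: F_def)
    with y iff[of b] have "[b ^ 2 = 1] (mod q)" by (simp add: F_def)
    with b show "y \<in> (\<lambda>a. x * a mod q) ` {a \<in> totatives q. [a ^ 2 = 1] (mod q)}" by blast
   next
    fix y assume "y \<in> (\<lambda>a. x * a mod q) ` {a \<in> totatives q. [a ^ 2 = 1] (mod q)}"
    then obtain b where b: "b \<in> totatives q" "[b ^ 2 = 1] (mod q)" "y = x * b mod q" by blast
    have "y \<in> totatives q" using im b by blast
    thus "y \<in> F s" using iff[of b] b by (simp add: F_def)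
   qed
  qed
  also have "card ... = rho q" unfolding rho_def
   by (rule card_image) (use bij in \<open>auto simp: bij_betw_def intro: inj_on_subset\<close>)
  finally show ?thesis .
 qed
 moreover have "totatives q = (\<Union>s\<in>quad_res q. F s)"
 proof (intro equalityI subsetI)
  fix x assume x: "x \<in> totatives q"
  hence "x ^ 2 mod q \<in> quad_res q" by (subst quad_res_iff) (use totatives_D in \<open>auto intro!: exI[of _ x]\<close>)
  thus "x \<in> (\<Union>s\<in>quad_res q. F s)" using x by (auto simp: F_def)
 qed (auto simp: F_def)
 moreover have "card (\<Union>s\<in>quad_res q. F s) = (\<Sum>s\<in>quad_res q. card (F s))"
  by (rule card_UN_disjoint) (auto simp: F_def quad_res_def)
 ultimately show ?thesis by (simp add: totient_def)
qed

lemma dirichlet_character_mod: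
 assumes "dirichlet_character q psi"
 shows "psi (n mod q) = psi n"
proof -
 have "psi (r + q * k) = psi r" for r k
 proof (induction k)
  case (Suc k)
  have "psi (r + q * Suc k) = psi ((r + q * k) + q)" by (simp add: algebra_simps)
  thus ?case using assms Suc by (simp add: dirichlet_character_def)
 qed simp
 from this[of "n mod q" "n div q"] show ?thesis by (simp add: mod_mult_div_eq)
qed

lemma dirichlet_character_cong: "dirichlet_character q psi ==> [n = k] (mod q) ==> psi n = psi k"
 by (metis cong_def dirichlet_character_mod)

lemma dirichlet_character_one: "dirichlet_character q psi ==> psi 1 = 1"
proof -
 assume d: "dirichlet_character q psi"
 hence "psi (1 * 1) = psi 1 * psi 1" "psi 1 \<noteq> 0" unfolding dirichlet_character_def by (blast, auto)
 thus "psi 1 = 1" by simp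
qed

lemma dirichlet_character_principal: "dirichlet_character q (principal_character q)"
 unfolding dirichlet_character_def
proof (intro conjI allI)
 show "principal_character q (n + q) = principal_character q n" for n
  by (simp only: principal_character_def coprime_add_modulus)
 show "principal_character q (k * n) = principal_character q k * principal_character q n" for k n
  by (simp add: principal_character_def)
 show "(principal_character q n \<noteq> 0) = coprime n q" for n
  by (simp add: principal_character_def)
qed

text \<open>With the principal character included this is a group, to which orthogonality applies;
  removing it gives back the quadratic characters.\<close>

definition real_characters :: "(nat \<Rightarrow> complex) set" where
 "real_characters = {psi. dirichlet_character q psi \<and> (\<lambda>n. psi n ^ 2) = principal_character q}"

lemma real_characters_eq: "real_characters = insert (principal_character q) (quadratic_characters q)"
 using dirichlet_character_principal
 by (auto simp: real_characters_def quadratic_characters_def principal_character_def)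

lemma real_character_values:
 assumes "psi \<in> real_characters"
 shows "psi n = (if coprime n q then 1 else 0) \<or> psi n = (if coprime n q then - 1 else 0)"
proof -
 have "psi n ^ 2 = principal_character q n" using assms by (auto simp: real_characters_def dest: fun_cong)
 thus ?thesis by (auto simp: principal_character_def power2_eq_1_iff)
qed

lemma real_characters_mult:
 assumes "psi \<in> real_characters" "phi \<in> real_characters"
 shows "(\<lambda>n. psi n * phi n) \<in> real_characters"
 using assms unfolding real_characters_def dirichlet_character_def
 by (auto simp: fun_eq_iff power_mult_distrib principal_character_def)

lemma finite_real_characters: "finite real_characters"
proof (rule finite_imageD)
 have "(\<lambda>psi. map psi [0..<q]) ` real_characters \<subseteq> {xs. set xs \<subseteq> {0, 1, -1} \<and> length xs = q}"
 proof (rule image_subsetI)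
  fix psi assume "psi \<in> real_characters"
  hence "psi n \<in> {0, 1, -1}" for n using real_character_values[of psi n] by (auto split: if_splits)
  thus "map psi [0..<q] \<in> {xs. set xs \<subseteq> {0, 1, -1} \<and> length xs = q}" by auto
 qed
 moreover have "finite {xs. set xs \<subseteq> {0, 1, -1 :: complex} \<and> length xs = q}" by (rule finite_lists_length_eq) simp
 ultimately show "finite ((\<lambda>psi. map psi [0..<q]) ` real_characters)" by (rule finite_subset)
 show "inj_on (\<lambda>psi. map psi [0..<q]) real_characters"
 proof (rule inj_onI, rule ext)
  fix psi phi n assume a: "psi \<in> real_characters" "phi \<in> real_characters" "map psi [0..<q] = map phi [0..<q]"
  have "psi (n mod q) = phi (n mod q)" using a(3) q by (simp add: map_eq_conv)
  thus "psi n = phi n" using a(1,2) dirichlet_character_mod[of psi n] dirichlet_character_mod[of phi n] by (simp add: real_characters_def)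
 qed
qed

text \<open>A subgroup containing all squares that is maximal among those avoiding \<open>a\<close> has index 2.\<close>

lemma exists_separating_character:
 assumes a: "coprime a q" "a mod q \<notin> quad_res q"
 shows "\<exists>psi\<in>real_characters. psi a = - 1"
proof -
 \<comment> \<open>A subgroup is encoded as a predicate on all naturals that respects congruence
   modulo \<open>q\<close>. The greatest number of its elements in \<open>totatives q\<close> stands
   for maximality by inclusion.\<close>
 define good where "good = (\<lambda>h. (\<forall>n k. [n = k] (mod q) \<longrightarrow> h n \<longrightarrow> h k) \<and> (\<forall>n. h n \<longrightarrow> coprime n q)
  \<and> (\<forall>n. coprime n q \<longrightarrow> h (n ^ 2)) \<and> (\<forall>n k. h n \<longrightarrow> h k \<longrightarrow> h (n * k)) \<and> \<not> h a)"
 have "good (\<lambda>n. n mod q \<in> quad_res q)"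
  unfolding good_def
 proof (intro conjI allI impI)
  fix n k assume "n mod q \<in> quad_res q" "k mod q \<in> quad_res q"
  then obtain x y where "coprime x q" "[x ^ 2 = n] (mod q)" "coprime y q" "[y ^ 2 = k] (mod q)" unfolding quad_res_iff by blast
  thus "n * k mod q \<in> quad_res q"
   unfolding quad_res_iff by (intro exI[of _ "x * y"]) (auto simp: power_mult_distrib intro: cong_mult)
 next
  fix n assume "n mod q \<in> quad_res q"
  hence "n mod q \<in> totatives q" by (simp add: quad_res_def)
  thus "coprime n q" by (simp add: mod_in_totatives)
 next
  fix n assume "coprime n q"
  thus "n ^ 2 mod q \<in> quad_res q" unfolding quad_res_iff by (intro exI[of _ n]) simp
 qed (use a in \<open>auto simp: cong_def\<close>)
 hence "\<exists>h. good h \<and> (\<forall>h'. good h' \<longrightarrow> card {n \<in> totatives q. h' n} \<le> card {n \<in> totatives q. h n})"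
  by (rule ex_has_greatest_nat[where f = "\<lambda>h. card {n \<in> totatives q. h n}" and b = "Suc (card (totatives q))"]) (auto simp: less_Suc_eq_le intro: card_mono)
 then obtain h where h: "good h" and max: "\<forall>h'. good h' \<longrightarrow> card {n \<in> totatives q. h' n} \<le> card {n \<in> totatives q. h n}" by blast
 note hs = h[unfolded good_def]
 have h_cong: "h n \<longleftrightarrow> h k" if "[n = k] (mod q)" for n k
  using hs[THEN conjunct1] that cong_sym[OF that] by metis
 have h_coprime: "coprime n q" if "h n" for n using hs that by simp
 have h_sq: "h (n ^ 2)" if "coprime n q" for n using hs that by simp
 have h_mult: "h (n * k)" if "h n" "h k" for n k using hs that by simp
 have ha: "\<not> h a" using hs by simp
 \<comment> \<open>Cancellation without an inverse in \<open>h\<close>: if \<open>x\<close> inverts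
   \<open>n\<close>, then \<open>x ^ 2\<close> lies in \<open>h\<close> as a square, and
   \<open>x ^ 2 * (n * (n * k))\<close> is congruent to \<open>k\<close>.\<close>
 have h_div: "h k" if hn: "h n" "h (n * k)" for n k
 proof -
  obtain x where x: "coprime x q" "[n * x = 1] (mod q)" using coprime_inverse_mod[OF q h_coprime[OF hn(1)]] by blast
  have "h (x ^ 2 * (n * (n * k)))" by (intro h_mult h_sq hn x)
  moreover have "x ^ 2 * (n * (n * k)) = (n * x) * (n * x) * k" by (simp add: power2_eq_square)
  hence "[x ^ 2 * (n * (n * k)) = 1 * 1 * k] (mod q)" using x(2) by (metis cong_mult cong_refl)
  ultimately show ?thesis using h_cong by simp
 qed
 \<comment> \<open>Adjoining \<open>b\<close> gives a strictly larger subgroup, which by maximality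
   contains \<open>a\<close>. So \<open>a\<close> is congruent to \<open>b * x\<close> with
   \<open>h x\<close>, and \<open>a * b\<close> to the element \<open>b ^ 2 * x\<close> of
   \<open>h\<close>: there are only two cosets.\<close>
 have h_coset: "h (a * b)" if b: "coprime b q" "\<not> h b" for b
 proof -
  define h' where "h' = (\<lambda>n. h n \<or> (\<exists>x. h x \<and> [n = b * x] (mod q)))"
  have "h 1" using h_sq[of 1] by simp
  hence "h' b" unfolding h'_def by (intro disjI2 exI[of _ 1]) simp
  have h'_cong: "h' k" if "[n = k] (mod q)" "h' n" for n k
   using that h_cong[of n k] unfolding h'_def by (meson cong_sym cong_trans)
  have "b mod q \<in> {n \<in> totatives q. h' n}" "b mod q \<notin> {n \<in> totatives q. h n}"
   using b \<open>h' b\<close> h'_cong[of b "b mod q"] h_cong[of "b mod q" b] mod_in_totatives by auto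
  hence "{n \<in> totatives q. h n} \<subset> {n \<in> totatives q. h' n}" by (auto simp: h'_def)
  hence "card {n \<in> totatives q. h n} < card {n \<in> totatives q. h' n}" by (intro psubset_card_mono) auto
  hence "\<not> good h'" using max by (auto simp: not_le[symmetric])
  moreover have "h' (n ^ 2)" if "coprime n q" for n using h_sq[OF that] by (simp add: h'_def)
  moreover have "coprime n q" if "h' n" for n
  proof -
   have "coprime (b * x) q" if "h x" for x using that b h_coprime by simp
   thus ?thesis using that h_coprime cong_imp_coprime[OF cong_sym] unfolding h'_def by blast
  qed
  moreover have "h' (x * y)" if "h' x" "h' y" for x y
   using that unfolding h'_def
  proof (elim disjE exE conjE)
   fix u assume "h y" "h u" "[x = b * u] (mod q)"
   hence "h (u * y)" "[x * y = b * (u * y)] (mod q)" using h_mult by (auto simp: mult.assoc[symmetric] intro: cong_mult)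
   thus "h (x * y) \<or> (\<exists>z. h z \<and> [x * y = b * z] (mod q))" by blast
  next
   fix v assume "h x" "h v" "[y = b * v] (mod q)"
   hence "h (x * v)" "[x * y = x * (b * v)] (mod q)" using h_mult by (auto intro: cong_mult)
   thus "h (x * y) \<or> (\<exists>z. h z \<and> [x * y = b * z] (mod q))" by (metis mult.left_commute)
  next
   fix u v assume uv: "h u" "h v" "[x = b * u] (mod q)" "[y = b * v] (mod q)"
   have "[x * y = b ^ 2 * (u * v)] (mod q)" using cong_mult[OF uv(3,4)] by (simp add: power2_eq_square mult_ac)
   moreover have "h (b ^ 2 * (u * v))" by (intro h_mult h_sq b uv)
   ultimately show "h (x * y) \<or> (\<exists>z. h z \<and> [x * y = b * z] (mod q))" using h_cong by blast
  qed (use h_mult in blast)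
  ultimately have "h' a" using h'_cong unfolding good_def by blast
  with ha obtain x where x: "h x" "[a = b * x] (mod q)" by (auto simp: h'_def)
  have "[a * b = b ^ 2 * x] (mod q)" using cong_mult[OF x(2) cong_refl[of b]] by (simp add: power2_eq_square mult_ac)
  moreover have "h (b ^ 2 * x)" by (rule h_mult[OF h_sq[OF b(1)] x(1)])
  ultimately show ?thesis using h_cong by blast
 qed
 define psi :: "nat \<Rightarrow> complex" where "psi = (\<lambda>n. if coprime n q then if h n then 1 else - 1 else 0)"
 have h_prod: "h (n * k) \<longleftrightarrow> (h n \<longleftrightarrow> h k)" if nk: "coprime n q" "coprime k q" for n k
 proof -
  consider "h n" "h k" | "h n" "\<not> h k" | "\<not> h n" "h k" | "\<not> h n" "\<not> h k" by blast
  thus ?thesis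
  proof cases
   case 4
   have "h ((a * n) * (a * k))" using h_mult h_coset[OF nk(1) 4(1)] h_coset[OF nk(2) 4(2)] by blast
   hence "h (a ^ 2 * (n * k))" by (simp add: power2_eq_square mult_ac)
   with h_sq[OF a(1)] have "h (n * k)" by (rule h_div)
   thus ?thesis using 4 by simp
  qed (use h_mult h_div[of n k] h_div[of k n] in \<open>auto simp: mult.commute\<close>)
 qed
 have "dirichlet_character q psi" unfolding dirichlet_character_def
 proof (intro conjI allI)
  show "psi (n + q) = psi n" for n using h_cong[of "n + q" n] by (simp add: psi_def coprime_add_modulus cong_def)
  show "psi (n * k) = psi n * psi k" for n k using h_prod[of n k] by (auto simp: psi_def)
  show "(psi n \<noteq> 0) = coprime n q" for n by (simp add: psi_def)
 qed
 hence "psi \<in> real_characters" by (auto simp: real_characters_def psi_def principal_character_def fun_eq_iff)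
 moreover have "psi a = - 1" using a(1) ha by (simp add: psi_def)
 ultimately show ?thesis by blast
qed

lemma real_characters_sum_quad_res:
 assumes "n mod q \<in> quad_res q"
 shows "(\<Sum>psi\<in>real_characters. psi n) = of_nat (card real_characters)"
proof -
 have "psi n = 1" if psi: "psi \<in> real_characters" for psi
 proof -
  obtain x where x: "coprime x q" "[x ^ 2 = n] (mod q)" using assms quad_res_iff by blast
  have "psi n = psi (x ^ 2)" using dirichlet_character_cong[OF _ x(2), of psi] psi by (simp add: real_characters_def)
  also have "... = psi x ^ 2" using psi by (simp add: real_characters_def dirichlet_character_def power2_eq_square)
  also have "... = 1" using real_character_values[OF psi, of x] x(1) by auto
  finally show ?thesis .
 qed
 hence "(\<Sum>psi\<in>real_characters. psi n) = (\<Sum>psi\<in>real_characters. 1)" by (intro sum.cong) auto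
 thus ?thesis by simp
qed

text \<open>Multiplication by a character with value -1 at \<open>n\<close> permutes the group and
  changes the sign of the sum.\<close>

lemma real_characters_sum_quad_nonres:
 assumes n: "coprime n q" "n mod q \<notin> quad_res q"
 shows "(\<Sum>psi\<in>real_characters. psi n) = 0"
proof -
 obtain phi where phi: "phi \<in> real_characters" "phi n = - 1" using exists_separating_character[OF n] by blast
 have inv: "(\<lambda>k. phi k * (phi k * psi k)) = psi" if "psi \<in> real_characters" for psi
 proof (rule ext)
  fix k show "phi k * (phi k * psi k) = psi k"
   using real_character_values[OF phi(1), of k] real_character_values[OF that, of k] by auto
 qed
 have "bij_betw (\<lambda>psi k. phi k * psi k) real_characters real_characters"
  by (rule bij_betw_byWitness[where f' = "\<lambda>psi k. phi k * psi k"])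
   (use inv real_characters_mult[OF phi(1)] in auto)
 hence "(\<Sum>psi\<in>real_characters. phi n * psi n) = (\<Sum>psi\<in>real_characters. psi n)"
  by (rule sum.reindex_bij_betw)
 hence "- (\<Sum>psi\<in>real_characters. psi n) = (\<Sum>psi\<in>real_characters. psi n)"
  by (simp add: phi(2) sum_negf)
 thus ?thesis by simp
qed

text \<open>All values of all characters at units are summed in both orders: over units first, only
  the principal character survives; over characters first, only the squares do. Comparison with
  \<open>card_quad_res\<close> gives the count without any structure theory of the unit
  group.\<close>

lemma card_real_characters: "card real_characters = rho q"
proof -
 have orth: "(\<Sum>a\<in>totatives q. psi a) = (if psi = principal_character q then of_nat (totient q) else 0)"
  if psi: "psi \<in> real_characters" for psi
 proof (cases "psi = principal_character q")
  case True
  have "(\<Sum>a\<in>totatives q. psi a) = (\<Sum>a\<in>totatives q. 1)"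
   by (rule sum.cong) (auto simp: True principal_character_def totatives_def)
  thus ?thesis using True by (simp add: totient_def)
 next
  case False
  then obtain c where "psi c \<noteq> principal_character q c" by blast
  hence c: "coprime c q" "psi c = - 1" using real_character_values[OF psi, of c] by (auto simp: principal_character_def split: if_splits)
  have "(\<Sum>a\<in>totatives q. psi (c * a mod q)) = (\<Sum>a\<in>totatives q. psi a)"
   by (rule sum.reindex_bij_betw[OF mod_mult_bij_totatives[OF c(1)]])
  moreover have "psi (c * a mod q) = - psi a" for a
   using psi c(2) dirichlet_character_mod[of psi "c * a"] by (simp add: real_characters_def dirichlet_character_def)
  ultimately have "- (\<Sum>a\<in>totatives q. psi a) = (\<Sum>a\<in>totatives q. psi a)" by (simp add: sum_negf)
  thus ?thesis using False by simp
 qed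
 have "(\<Sum>a\<in>totatives q. \<Sum>psi\<in>real_characters. psi a) = (\<Sum>psi\<in>real_characters. \<Sum>a\<in>totatives q. psi a)"
  by (rule sum.swap)
 also have "... = (\<Sum>psi\<in>real_characters. if psi = principal_character q then of_nat (totient q) else 0)"
  by (intro sum.cong orth) auto
 also have "... = of_nat (totient q)" using finite_real_characters real_characters_eq by simp
 also have "(\<Sum>a\<in>totatives q. \<Sum>psi\<in>real_characters. psi a) = (\<Sum>a\<in>totatives q. if a \<in> quad_res q then of_nat (card real_characters) else 0)"
 proof (rule sum.cong[OF refl])
  fix a assume "a \<in> totatives q"
  from totatives_D[OF this] show "(\<Sum>psi\<in>real_characters. psi a) = (if a \<in> quad_res q then of_nat (card real_characters) else 0)"
   using real_characters_sum_quad_res[of a] real_characters_sum_quad_nonres[of a] by auto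
 qed
 also have "... = (\<Sum>a\<in>quad_res q. of_nat (card real_characters))"
  by (rule sum.mono_neutral_cong_right) (auto simp: quad_res_def)
 also have "... = (of_nat (card (quad_res q) * card real_characters) :: complex)" by simp
 finally have "card (quad_res q) * card real_characters = card (quad_res q) * rho q"
  using card_quad_res by (simp only: of_nat_eq_iff)
 moreover have "card (quad_res q) > 0"
 proof -
  have "1 mod q \<in> quad_res q" by (subst quad_res_iff) (auto intro: exI[of _ 1])
  moreover have "finite (quad_res q)" by (simp add: quad_res_def)
  ultimately show ?thesis by (auto simp: card_gt_0_iff)
 qed
 ultimately show ?thesis by simp
qed

lemma principal_notin: "principal_character q \<notin> quadratic_characters q"
 by (simp add: quadratic_characters_def)

lemma finite_quadratic_characters: "finite (quadratic_characters q)"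
 using finite_real_characters real_characters_eq by simp

lemma card_quadratic_characters: "card (quadratic_characters q) + 1 = rho q"
 using card_real_characters finite_quadratic_characters principal_notin by (simp add: real_characters_eq)

lemma quadratic_characters_sum:
 assumes "coprime n q"
 shows "(\<Sum>psi\<in>quadratic_characters q. psi n) = (if n mod q \<in> quad_res q then of_nat (rho q) else 0) - 1"
proof -
 have "(\<Sum>psi\<in>real_characters. psi n) = 1 + (\<Sum>psi\<in>quadratic_characters q. psi n)"
  using finite_quadratic_characters principal_notin assms by (simp add: real_characters_eq principal_character_def)
 thus ?thesis using real_characters_sum_quad_res[of n] real_characters_sum_quad_nonres[OF assms] card_real_characters
  by (auto simp: algebra_simps split: if_splits)
qed

end

section \<open>Reduction to primitive characters\<close>

text \<open>\<open>primitive\<close> says that no proper divisor of \<open>m\<close> is an induced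
  modulus; the values on units are signs, so failing to be trivial means taking the value
  -1.\<close>

locale quadratic_primitive =
 fixes m :: nat and psi :: "nat \<Rightarrow> real"
 assumes m: "m > 1" and period: "\<And>n. psi (n + m) = psi n"
  and chi_mult: "\<And>k n. psi (k * n) = psi k * psi n"
  and chi_zero: "\<And>n. psi n = 0 \<longleftrightarrow> \<not> coprime n m"
  and chi_sign: "\<And>n. psi n \<noteq> 0 ==> psi n = 1 \<or> psi n = -1"
  and primitive: "\<And>d. d dvd m ==> d < m ==> \<exists>c. coprime c m \<and> [c = 1] (mod d) \<and> psi c = -1"
begin

definition e :: "nat \<Rightarrow> complex" where "e n = cis (2 * pi * real n / real m)"

definition G :: "nat \<Rightarrow> complex" where "G k = (\<Sum>b<m. of_real (psi b) * e (k * b))"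

lemma e_add: "e (n + k) = e n * e k"
 by (simp add: e_def cis_mult add_divide_distrib ring_distribs)

lemma e_m_mult: "e (m * k) = 1"
proof -
 have "2 * pi * real (m * k) / real m = 2 * pi * real k" using m by simp
 hence "e (m * k) = cis (2 * pi * real k)" unfolding e_def by (simp only:)
 thus ?thesis by (simp only: cis_multiple_2pi Ints_of_nat)
qed

lemma e_cong: "[n = k] (mod m) ==> e n = e k"
proof -
 have "e n = e (n mod m)" for n
 proof -
  have "e n = e (m * (n div m) + n mod m)" by simp
  thus ?thesis unfolding e_add e_m_mult by simp
 qed
 thus "[n = k] (mod m) ==> e n = e k" by (metis cong_def)
qed

lemma psi_cong: "[n = k] (mod m) ==> psi n = psi k"
proof -
 have "psi (r + m * j) = psi r" for r j
 proof (induction j)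
  case (Suc j)
  have "psi (r + m * Suc j) = psi ((r + m * j) + m)" by (simp add: algebra_simps)
  thus ?case using period Suc by simp
 qed simp
 hence "psi n = psi (n mod m)" for n by (metis mod_mult_div_eq)
 thus "[n = k] (mod m) ==> psi n = psi k" by (metis cong_def)
qed

lemma psi_one: "psi 1 = 1"
proof -
 have "psi (1 * 1) = psi 1 * psi 1" by (rule chi_mult)
 moreover have "psi 1 \<noteq> 0" by (subst chi_zero) simp
 ultimately show ?thesis by simp
qed

lemma psi_sq: "coprime n m ==> psi n * psi n = 1"
 using chi_sign[of n] chi_zero[of n] by auto

lemma bij_mult_mod:
 assumes "coprime c m"
 shows "bij_betw (\<lambda>b. c * b mod m) {..<m} {..<m}"
proof -
 have "inj_on (\<lambda>b. c * b mod m) {..<m}"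
 proof (rule inj_onI)
  fix a b assume ab: "a \<in> {..<m}" "b \<in> {..<m}" "c * a mod m = c * b mod m"
  hence "[a = b] (mod m)" using cong_mult_lcancel_nat[OF assms] by (simp add: cong_def)
  thus "a = b" using ab by (simp add: cong_def)
 qed
 moreover have "(\<lambda>b. c * b mod m) ` {..<m} \<subseteq> {..<m}" using m by auto
 ultimately show ?thesis using endo_inj_surj[of "{..<m}" "\<lambda>b. c * b mod m"] by (simp add: bij_betw_def)
qed

lemma G_mult: "coprime c m ==> G k = of_real (psi c) * G (k * c)"
proof -
 assume c: "coprime c m"
 have "G k = (\<Sum>b<m. of_real (psi (c * b mod m)) * e (k * (c * b mod m)))"
  unfolding G_def by (rule sum.reindex_bij_betw[OF bij_mult_mod[OF c], symmetric])
 also have "... = (\<Sum>b<m. of_real (psi c) * (of_real (psi b) * e (k * c * b)))"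
 proof (rule sum.cong[OF refl])
  fix b
  have "psi (c * b mod m) = psi c * psi b" using psi_cong[of "c * b mod m" "c * b"] chi_mult by (simp add: cong_def)
  moreover have "e (k * (c * b mod m)) = e (k * c * b)" by (rule e_cong) (simp add: cong_def mod_mult_right_eq mult.assoc)
  ultimately show "of_real (psi (c * b mod m)) * e (k * (c * b mod m)) = of_real (psi c) * (of_real (psi b) * e (k * c * b))" by simp
 qed
 finally show ?thesis by (simp add: G_def sum_distrib_left)
qed

text \<open>If \<open>k\<close> and \<open>m\<close> share a factor \<open>g > 1\<close>,
  primitivity for \<open>d = m div g\<close> supplies \<open>c\<close> with \<open>k * c\<close>
  congruent to \<open>k\<close> and \<open>psi c = -1\<close>; substituting \<open>c * b\<close> for
  \<open>b\<close> then gives \<open>G k = - G k\<close>.\<close>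

lemma gauss_sum: "G k = G 1 * of_real (psi k)"
proof (cases "coprime k m")
 case True
 have "G 1 = of_real (psi k) * G k" using G_mult[OF True, of 1] by simp
 hence "G 1 * of_real (psi k) = of_real (psi k * psi k) * G k" by simp
 thus ?thesis using psi_sq[OF True] by simp
next
 case False
 define g where "g = gcd k m"
 define d where "d = m div g"
 have g: "g > 1" using False m by (metis coprime_iff_gcd_eq_1 g_def gcd_pos_nat less_one linorder_neqE_nat not_less_zero)
 have md: "m = g * d" by (simp add: d_def g_def)
 moreover have "d > 0" using md m by (cases d) auto
 ultimately have "d < m" "d dvd m" using g by (auto simp: dvd_def)
 then obtain c where c: "coprime c m" "[c = 1] (mod d)" "psi c = -1" using primitive by blast
 have gc: "[g * c = g * 1] (mod m)" using c(2) unfolding md cong_def mult_mod_right[symmetric] by simp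
 have "g dvd k" by (simp add: g_def)
 then obtain j where j: "k = g * j" by (rule dvdE)
 have kc: "[k * c = k] (mod m)" using cong_mult[OF gc cong_refl[of j]] by (simp add: j mult_ac)
 have "e (k * c * b) = e (k * b)" for b by (rule e_cong[OF cong_mult[OF kc cong_refl]])
 hence "G (k * c) = G k" by (simp add: G_def)
 hence "G k = - G k" using G_mult[OF c(1), of k] c(3) by simp
 thus ?thesis using False chi_zero by simp
qed

lemma e_orthogonality:
 assumes "b < m" "b' < m"
 shows "(\<Sum>k<m. e (k * b) * cnj (e (k * b'))) = (if b = b' then of_nat m else 0)"
proof -
 define x where "x = e b * cnj (e b')"
 have pow: "e (k * b) = e b ^ k" for k b by (induction k) (simp add: e_def, simp only: mult_Suc e_add power_Suc)
 have "e b * cnj (e b) = 1" for b unfolding e_def by (simp add: cis_cnj cis_mult)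
 note unit = this
 have 1: "(\<Sum>k<m. e (k * b) * cnj (e (k * b'))) = (\<Sum>k<m. x ^ k)" by (simp add: pow x_def power_mult_distrib)
 have xm: "x ^ m = 1" unfolding x_def power_mult_distrib complex_cnj_power[symmetric] pow[symmetric] by (simp add: e_m_mult)
 show ?thesis
 proof (cases "b = b'")
  case True
  thus ?thesis unfolding 1 by (simp add: x_def unit)
 next
  case False
  have "x \<noteq> 1"
  proof
   assume "x = 1"
   hence "e b' * x = e b'" by simp
   hence "e b = e b'" using unit[of b'] unfolding x_def by (metis mult.left_commute mult.right_neutral)
   hence "exp (2 * of_real pi * \<i> * of_nat b / of_nat m) = exp (2 * of_real pi * \<i> * of_nat b' / of_nat m)"
    by (simp add: e_def cis_conv_exp mult_ac)
   hence "b mod m = b' mod m" using complex_root_unity_eq[of m b b'] m by (simp add: cong_def)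
   thus False using assms False by simp
  qed
  hence "(\<Sum>k<m. x ^ k) = 0" using xm by (simp add: geometric_sum)
  thus ?thesis unfolding 1 using False by simp
 qed
qed

text \<open>Parseval: the sum over \<open>k\<close> of the squared norms of \<open>G k\<close> is
  \<open>m * S\<close> by orthogonality, and the squared norm of \<open>G 1\<close> times
  \<open>S\<close> by \<open>gauss_sum\<close>, with \<open>S > 0\<close>.\<close>

lemma norm_gauss_sum: "norm (G 1) = sqrt (real m)"
proof -
 define S where "S = (\<Sum>b<m. psi b * psi b)"
 have "1 * 1 \<le> S"
  unfolding S_def using member_le_sum[of 1 "{..<m}" "\<lambda>b. psi b * psi b"] m psi_one by simp
 hence S: "S > 0" by simp
 have "(\<Sum>k<m. G k * cnj (G k)) = (\<Sum>k<m. \<Sum>b<m. \<Sum>b'<m. (of_real (psi b) * e (k * b)) * cnj (of_real (psi b') * e (k * b')))"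
  unfolding G_def cnj_sum sum_product ..
 also have "... = (\<Sum>b<m. \<Sum>k<m. \<Sum>b'<m. (of_real (psi b) * e (k * b)) * cnj (of_real (psi b') * e (k * b')))"
  by (rule sum.swap)
 also have "... = (\<Sum>b<m. \<Sum>b'<m. \<Sum>k<m. (of_real (psi b) * e (k * b)) * cnj (of_real (psi b') * e (k * b')))"
  by (intro sum.cong[OF refl] sum.swap)
 also have "... = (\<Sum>b<m. \<Sum>b'<m. of_real (psi b * psi b') * (if b = b' then of_nat m else 0))"
 proof (intro sum.cong[OF refl])
  fix b b' assume "b \<in> {..<m}" "b' \<in> {..<m}"
  hence "(\<Sum>k<m. e (k * b) * cnj (e (k * b'))) = (if b = b' then of_nat m else 0)" by (intro e_orthogonality) auto
  moreover have "(\<Sum>k<m. (of_real (psi b) * e (k * b)) * cnj (of_real (psi b') * e (k * b'))) = of_real (psi b * psi b') * (\<Sum>k<m. e (k * b) * cnj (e (k * b')))"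
   by (simp add: sum_distrib_left mult_ac)
  ultimately show "(\<Sum>k<m. (of_real (psi b) * e (k * b)) * cnj (of_real (psi b') * e (k * b'))) = of_real (psi b * psi b') * (if b = b' then of_nat m else 0)"
   by (simp only:)
 qed
 also have "... = (\<Sum>b<m. of_real (psi b * psi b) * of_nat m)"
 proof (rule sum.cong[OF refl])
  fix b assume "b \<in> {..<m}"
  hence "(\<Sum>b'<m. if b = b' then of_real (psi b * psi b') * of_nat m else 0) = (of_real (psi b * psi b) * of_nat m :: complex)"
   by (subst sum.delta') auto
  moreover have "of_real (psi b * psi b') * (if b = b' then of_nat m else 0) = (if b = b' then of_real (psi b * psi b') * of_nat m else (0::complex))" for b' by simp
  ultimately show "(\<Sum>b'<m. of_real (psi b * psi b') * (if b = b' then of_nat m else 0)) = (of_real (psi b * psi b) * of_nat m :: complex)"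
   by (simp only:)
 qed
 also have "... = of_real (S * real m)" by (simp add: S_def sum_distrib_right)
 finally have "(\<Sum>k<m. G k * cnj (G k)) = of_real (S * real m)" .
 moreover have "(\<Sum>k<m. G k * cnj (G k)) = of_real ((norm (G 1))^2 * S)"
 proof -
  have "G k * cnj (G k) = of_real ((norm (G 1))^2 * (psi k * psi k))" for k
  proof -
   have "G k * cnj (G k) = (G 1 * cnj (G 1)) * of_real (psi k * psi k)" by (simp add: gauss_sum[of k])
   also have "G 1 * cnj (G 1) = of_real ((norm (G 1))^2)" by (rule complex_norm_square[symmetric])
   finally show ?thesis by simp
  qed
  thus ?thesis by (simp add: S_def sum_distrib_left)
 qed
 ultimately have "(norm (G 1))^2 * S = S * real m" by (simp only: of_real_eq_iff)
 hence "(norm (G 1))^2 = real m" using S by simp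
 thus ?thesis by (metis norm_ge_zero real_sqrt_unique)
qed

lemma real_primitive_character: "real_primitive_character m psi (if psi (m - 1) = 1 then 0 else 1) (G 1)"
proof
 show "psi (m - n) = (-1) ^ (if psi (m - 1) = 1 then 0 else 1) * psi n" if n: "n \<le> m" for n
 proof -
  have "[m - n = (m - 1) * n] (mod m)"
  proof -
   have "(m - n) + n * m = (m - 1) * n + m" using n m by (simp add: algebra_simps diff_mult_distrib)
   thus ?thesis by (metis cong_def mod_add_self2 mod_mult_self1)
  qed
  hence "psi (m - n) = psi (m - 1) * psi n" using psi_cong chi_mult by metis
  moreover have "coprime (m - 1) m" by (rule coprime_diff_one_left_nat) (use m in simp)
  hence "psi (m - 1) = 1 \<or> psi (m - 1) = - 1" using chi_sign chi_zero by blast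
  ultimately show ?thesis by auto
 qed
 show "(\<Sum>b<m. of_real (psi b) * cis (2 * pi * real k * real b / real m)) = G 1 * of_real (psi k)" for k
  unfolding gauss_sum[of k, symmetric] by (simp add: G_def e_def mult.assoc)
qed (use m period chi_mult chi_zero chi_sign norm_gauss_sum in auto)

end

lemma not_coprime_prime_divisor:
 assumes "\<not> coprime n (q::nat)"
 obtains p where "prime p" "p dvd n" "p dvd q"
proof -
 have "gcd n q \<noteq> 1" using assms by (simp only: coprime_iff_gcd_eq_1 simp_thms)
 then obtain p where "prime p" "p dvd gcd n q" using prime_factor_nat by blast
 thus ?thesis using that by simp
qed

lemma rad_dvd: "n > 0 ==> rad n dvd n"
proof -
 assume n: "n > 0"
 have "(\<Prod>p\<in>prime_factors n. p) dvd (\<Prod>p\<in>prime_factors n. p ^ multiplicity p n)"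
 proof (rule prod_dvd_prod)
  fix p assume "p \<in> prime_factors n"
  hence "multiplicity p n > 0" by (simp add: prime_factors_multiplicity)
  thus "p dvd p ^ multiplicity p n" by (simp add: dvd_power)
 qed
 thus ?thesis using prime_factorization_nat[OF n] by (simp add: rad_def)
qed

lemma dvd_rad_power: "n > 0 ==> n dvd rad n ^ n"
proof -
 assume n: "n > 0"
 have "(\<Prod>p\<in>prime_factors n. p ^ multiplicity p n) dvd (\<Prod>p\<in>prime_factors n. p ^ n)"
 proof (rule prod_dvd_prod)
  fix p assume p: "p \<in> prime_factors n"
  hence "p \<ge> 2" by (simp add: prime_ge_2_nat in_prime_factors_iff)
  hence "multiplicity p n < p ^ multiplicity p n" by (metis less_exp n_less_m_mult_n power_gt_expt numeral_2_eq_2 Suc_le_lessD)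
  also have "... \<le> n" using n by (intro dvd_imp_le multiplicity_dvd)
  finally show "p ^ multiplicity p n dvd p ^ n" by (intro le_imp_power_dvd) simp
 qed
 thus ?thesis using prime_factorization_nat[OF n] by (simp add: rad_def prod_power_distrib)
qed

text \<open>Each further \<open>R\<close>-th power gains one factor \<open>R\<close>: in
  \<open>d ^ R - 1 = (d - 1) * (\<Sum>i<R. d ^ i)\<close> the second factor is a sum of
  \<open>R\<close> terms congruent to 1 modulo \<open>R\<close>.\<close>

lemma cong_one_power:
 fixes c R :: nat
 assumes "[c = 1] (mod R)" "R > 0"
 shows "[c ^ (R ^ k) = 1] (mod (R ^ Suc k))"
proof (induction k)
 case 0 thus ?case using assms by simp
next
 case (Suc k)
 define d where "d = int (c ^ (R ^ k))"
 have "int (R ^ Suc k) dvd d - 1" using Suc unfolding d_def by (metis cong_int_iff cong_iff_dvd_diff of_nat_1)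
 moreover have "int R dvd (\<Sum>i<R. d ^ i)"
 proof -
  have "int R dvd d - 1" using calculation by (rule dvd_trans[rotated]) simp
  hence "[d = 1] (mod (int R))" by (simp add: cong_iff_dvd_diff)
  hence "[(\<Sum>i<R. d ^ i) = (\<Sum>i<R. 1 ^ i)] (mod (int R))" by (intro cong_sum cong_pow)
  thus ?thesis by (simp add: cong_def dvd_eq_mod_eq_0)
 qed
 ultimately have "int (R ^ Suc k) * int R dvd (d - 1) * (\<Sum>i<R. d ^ i)" by (rule mult_dvd_mono)
 also have "(d - 1) * (\<Sum>i<R. d ^ i) = d ^ R - 1" by (rule power_diff_1_eq[symmetric])
 finally have "int (R ^ Suc (Suc k)) dvd int (c ^ (R ^ Suc k)) - 1" by (simp add: d_def power_mult[symmetric] mult_ac)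
 thus ?case by (metis cong_int_iff cong_iff_dvd_diff of_nat_1)
qed

text \<open>Hensel lifting at 2. Where \<open>x\<close> fails modulo the next power,
  \<open>x + 2 ^ (k + 2)\<close> works, because it changes the square by an odd multiple of
  \<open>2 ^ (k + 3)\<close>.\<close>

lemma square_root_mod_two_power:
 fixes c :: nat
 assumes "[c = 1] (mod 8)"
 shows "\<exists>x. odd x \<and> [x ^ 2 = c] (mod (2 ^ (k + 3)))"
proof (induction k)
 case 0
 show ?case using assms by (intro exI[of _ 1]) (simp add: cong_sym)
next
 case (Suc k)
 then obtain x where x: "odd x" "[x ^ 2 = c] (mod (2 ^ (k + 3)))" by blast
 define M :: int where "M = 2 ^ (k + 3)"
 have M2: "int (2 ^ (Suc k + 3)) = 2 * M" by (simp add: M_def power_add)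
 have "M dvd int x ^ 2 - int c" using x(2) unfolding M_def
  by (metis cong_int_iff cong_iff_dvd_diff of_nat_numeral of_nat_power)
 then obtain j where j: "int x ^ 2 - int c = M * j" by (auto elim: dvdE)
 have new: "(int x + 2 ^ (k + 2)) ^ 2 - int c = 2 * M * (2 ^ k) + M * (j + int x)"
 proof -
  have "(int x + 2 ^ (k + 2)) ^ 2 = int x ^ 2 + M * int x + 2 * M * 2 ^ k"
   by (simp add: power2_eq_square M_def algebra_simps power_add)
  thus ?thesis using j by (simp add: algebra_simps)
 qed
 show ?case
 proof (cases "even j")
  case True
  hence "2 * M dvd int x ^ 2 - int c" unfolding j by (auto elim!: evenE)
  hence "[x ^ 2 = c] (mod (2 ^ (Suc k + 3)))" unfolding cong_int_iff[symmetric] cong_iff_dvd_diff M2 by simp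
  thus ?thesis using x(1) by blast
 next
  case False
  hence "even (j + int x)" using x(1) by simp
  then obtain l where "j + int x = 2 * l" by (rule evenE)
  hence "2 * M dvd (int x + 2 ^ (k + 2)) ^ 2 - int c" unfolding new by (intro dvd_add) auto
  hence "[(x + 2 ^ (k + 2)) ^ 2 = c] (mod (2 ^ (Suc k + 3)))" unfolding cong_int_iff[symmetric] cong_iff_dvd_diff M2 by simp
  moreover have "odd (x + 2 ^ (k + 2))" using x(1) by simp
  ultimately show ?thesis by blast
 qed
qed

text \<open>For \<open>c\<close> congruent to 1 modulo \<open>g\<close>, an odd power
  \<open>c ^ N\<close> is 1 modulo the odd part of \<open>q\<close>, and it is 1 or at least a
  square modulo the power of 2 in \<open>q\<close>. Hence \<open>psi c = psi (c ^ N) = 1\<close>.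
  This is where \<open>rad q\<close> takes the place of \<open>q\<close>.\<close>

lemma real_character_kernel:
 assumes q: "q > 1" and psi: "psi \<in> real_characters q"
 obtains g where "g dvd q" "g \<le> 8 * rad q" "\<And>c. coprime c q ==> [c = 1] (mod g) ==> psi c = 1"
proof -
 have char: "dirichlet_character q psi" using psi by (simp add: real_characters_def[OF q])
 hence mult: "psi (n * k) = psi n * psi k" for n k by (simp add: dirichlet_character_def)
 define e where "e = multiplicity 2 q"
 obtain q' where q': "q = 2 ^ e * q'" "odd q'"
  using multiplicity_decompose'[of q 2] q unfolding e_def by auto
 have q'pos: "q' > 0" using q'(2) by (rule odd_pos)
 define R where "R = rad q'"
 have Rq: "R dvd q'" unfolding R_def by (rule rad_dvd[OF q'pos])
 have oddR: "odd R" using Rq q'(2) dvd_trans by blast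
 hence Rpos: "R > 0" by (rule odd_pos)
 have cop: "coprime (2 ^ j) q'" for j using q'(2) by simp
 show ?thesis
 proof (rule that[of "2 ^ min e 3 * R"])
  show "2 ^ min e 3 * R dvd q" unfolding q'(1) by (intro mult_dvd_mono le_imp_power_dvd Rq) simp
  have "prime_factors q' \<subseteq> prime_factors q" using q q'pos q'(1) by (intro dvd_prime_factors) auto
  hence "R dvd rad q" unfolding R_def rad_def by (intro prod_dvd_prod_subset) auto
  moreover have "rad q > 0" unfolding rad_def by (intro prod_pos) (auto simp: in_prime_factors_iff prime_gt_0_nat)
  ultimately have "R \<le> rad q" by (rule dvd_imp_le)
  moreover have "(2::nat) ^ min e 3 \<le> 2 ^ 3" by (intro power_increasing) auto
  ultimately have "2 ^ min e 3 * R \<le> 2 ^ 3 * rad q" by (intro mult_mono) auto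
  thus "2 ^ min e 3 * R \<le> 8 * rad q" by simp
  fix c assume c: "coprime c q" "[c = 1] (mod (2 ^ min e 3 * R))"
  define N where "N = R ^ (q' - 1)"
  have c2: "[c ^ N = 1] (mod (2 ^ min e 3))" using cong_pow[OF cong_dvd_modulus_nat[OF c(2)], of "2 ^ min e 3" N] by simp
  have "[c = 1] (mod R)" by (rule cong_dvd_modulus_nat[OF c(2)]) simp
  hence "[c ^ N = 1] (mod (R ^ Suc (q' - 1)))" unfolding N_def using Rpos by (rule cong_one_power)
  hence c3: "[c ^ N = 1] (mod q')"
   by (rule cong_dvd_modulus_nat) (use dvd_rad_power[OF q'pos] q'pos in \<open>simp add: R_def\<close>)
  have "psi (c ^ N) = 1"
  proof (cases "e \<le> 3")
   case True
   hence "[c ^ N = 1] (mod q)" using coprime_cong_mult_nat[OF _ c3 cop, of e] c2 q'(1) by (simp add: min_def)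
   thus ?thesis using dirichlet_character_cong[OF q char] dirichlet_character_one[OF q char] by metis
  next
   case False
   hence "[c ^ N = 1] (mod 8)" using c2 by (simp add: min_def)
   then obtain x where x: "[x ^ 2 = c ^ N] (mod (2 ^ (e - 3 + 3)))" using square_root_mod_two_power[of "c ^ N" "e - 3"] by blast
   hence x: "[x ^ 2 = c ^ N] (mod (2 ^ e))" using False by simp
   obtain y where y: "[y = x] (mod (2 ^ e))" "[y = 1] (mod q')" using binary_chinese_remainder_nat[OF cop[of e], of x 1] by blast
   have "[y ^ 2 = c ^ N] (mod (2 ^ e))" using cong_trans[OF cong_pow[OF y(1)] x] .
   moreover have "[y ^ 2 = c ^ N] (mod q')" using cong_trans[OF cong_pow[OF y(2)] cong_sym, of "c ^ N" 2] c3 by simp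
   ultimately have y2: "[y ^ 2 = c ^ N] (mod q)" unfolding q'(1) using cop by (rule coprime_cong_mult_nat)
   have "coprime (c ^ N) q" using c(1) by simp
   hence "coprime (y ^ 2) q" using cong_imp_coprime[OF cong_sym[OF y2]] by blast
   hence "coprime y q" by simp
   have "psi (c ^ N) = psi (y * y)" using dirichlet_character_cong[OF q char y2] by (simp add: power2_eq_square)
   also have "... = 1" unfolding mult using real_character_values[OF q psi, of y] \<open>coprime y q\<close> by auto
   finally show ?thesis .
  qed
  moreover have "psi (c ^ N) = psi c"
  proof -
   have pow: "psi (c ^ N) = psi c ^ N" for N by (induction N) (use mult dirichlet_character_one[OF q char] in auto)
   have "odd N" using oddR by (simp add: N_def)
   thus ?thesis unfolding pow using real_character_values[OF q psi, of c] c(1) by auto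
  qed
  ultimately show "psi c = 1" by simp
 qed
qed

text \<open>Chinese remaindering against those primes of \<open>q\<close> that do not divide
  \<open>m\<close>.\<close>

lemma exists_coprime_lift:
 fixes m n q :: nat
 assumes "m dvd q" "q > 0" "coprime n m"
 shows "\<exists>k. [k = n] (mod m) \<and> coprime k q"
proof -
 define d where "d = \<Prod>{p \<in> prime_factors q. \<not> p dvd m}"
 have "coprime m d" unfolding d_def
 proof (rule prod_coprime_right)
  fix p assume "p \<in> {p \<in> prime_factors q. \<not> p dvd m}"
  hence "coprime p m" by (intro prime_imp_coprime) auto
  thus "coprime m p" by (simp add: coprime_commute)
 qed
 then obtain k where k: "[k = n] (mod m)" "[k = 1] (mod d)" using binary_chinese_remainder_nat[of m d n 1] by blast
 have "coprime k q"
 proof (rule ccontr)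
  assume "\<not> coprime k q"
  then obtain p where p: "prime p" "p dvd k" "p dvd q" by (rule not_coprime_prime_divisor)
  show False
  proof (cases "p dvd m")
   case True
   hence "[k = n] (mod p)" by (rule cong_dvd_modulus_nat[OF k(1)])
   hence "p dvd n" using p(2) cong_dvd_iff by blast
   thus False using assms(3) True p(1) coprime_common_divisor_nat[of n m p] by auto
  next
   case False
   hence "p dvd d" unfolding d_def using p assms(2) by (intro dvd_prodI) (auto simp: in_prime_factors_iff)
   hence "[k = 1] (mod p)" by (rule cong_dvd_modulus_nat[OF k(2)])
   hence "p dvd 1" using p(2) cong_dvd_iff by blast
   thus False using p(1) by simp
  qed
 qed
 thus ?thesis using k by blast
qed

text \<open>\<open>m\<close> is the least divisor of \<open>q\<close> such that \<open>f\<close> is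
  trivial on the units congruent to 1 modulo it, and leastness is primitivity. \<open>psi\<close>
  evaluates \<open>f\<close> at a lift prime to \<open>q\<close>; triviality makes the value
  independent of the lift.\<close>

theorem primitive_reduction:
 assumes q: "q > 1" and \<chi>: "f \<in> quadratic_characters q"
 obtains m psi where "quadratic_primitive m psi" "m \<le> 8 * rad q" "m dvd q" "\<And>n. coprime n q ==> f n = complex_of_real (psi n)"
proof -
 have f: "f \<in> real_characters q" using \<chi> by (simp add: real_characters_eq[OF q])
 have char: "dirichlet_character q f" using \<chi> by (simp add: quadratic_characters_def)
 hence mult: "f (n * k) = f n * f k" for n k by (simp add: dirichlet_character_def)
 note val = real_character_values[OF q f]
 define P where "P = (\<lambda>d. d dvd q \<and> (\<forall>c. coprime c q \<longrightarrow> [c = 1] (mod d) \<longrightarrow> f c = 1))"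
 obtain g where g: "g \<le> 8 * rad q" "P g" using real_character_kernel[OF q f] unfolding P_def by metis
 define m where "m = (LEAST d. P d)"
 have Pm: "P m" unfolding m_def by (rule LeastI[of P, OF g(2)])
 have least: "\<not> P d" if "d < m" for d using that not_less_Least unfolding m_def by blast
 have m8: "m \<le> 8 * rad q" using Least_le[of P, OF g(2)] g(1) by (simp add: m_def)
 have mq: "m dvd q" using Pm by (simp add: P_def)
 have m0: "m > 0" using mq q by (intro gr0I) auto
 have m1: "m \<noteq> 1"
 proof
  assume "m = 1"
  hence "f c = 1" if "coprime c q" for c using Pm that by (simp add: P_def)
  hence "f n = principal_character q n" for n using val[of n] by (cases "coprime n q") (auto simp: principal_character_def)
  hence "f = principal_character q" by (rule ext)
  thus False using \<chi> by (simp add: quadratic_characters_def)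
 qed
 have same: "f n = f k" if nk: "coprime n q" "coprime k q" "[n = k] (mod m)" for n k
 proof -
  obtain x where x: "coprime x q" "[k * x = 1] (mod q)" using coprime_inverse_mod[OF q nk(2)] by blast
  have "[n * x = k * x] (mod m)" using nk(3) by (rule cong_mult) simp
  also have "[k * x = 1] (mod m)" by (rule cong_dvd_modulus_nat[OF x(2) mq])
  finally have "f (n * x) = 1" using Pm nk x by (simp add: P_def)
  moreover have "f (k * x) = 1" using dirichlet_character_cong[OF q char x(2)] dirichlet_character_one[OF q char] by simp
  moreover have "f x \<noteq> 0" using val[of x] x(1) by auto
  ultimately show ?thesis by (simp add: mult) (metis mult_right_cancel)
 qed
 define lift where "lift = (\<lambda>n. SOME k. [k = n] (mod m) \<and> coprime k q)"
 have lift: "[lift n = n] (mod m)" "coprime (lift n) q" if "coprime n m" for n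
  using someI_ex[OF exists_coprime_lift[OF mq _ that]] q unfolding lift_def by auto
 define psi where "psi = (\<lambda>n. if coprime n m then Re (f (lift n)) else 0)"
 have cop: "coprime n m" if "coprime n q" for n using that mq by (metis coprime_divisors dvd_refl)
 have psi: "psi n = Re (f k)" if "coprime n m" "coprime k q" "[k = n] (mod m)" for n k
  using same[OF lift(2)[OF that(1)] that(2) cong_trans[OF lift(1)[OF that(1)] cong_sym[OF that(3)]]] that(1) by (simp add: psi_def)
 have Re_im: "f k = of_real (Re (f k))" "Re (f k) = 1 \<or> Re (f k) = -1" if "coprime k q" for k using val[of k] that by auto
 have "quadratic_primitive m psi"
 proof
  show "m > 1" using m0 m1 by simp
  show "psi (n + m) = psi n" for n
  proof (cases "coprime n m")
   case True
   thus ?thesis using lift[OF True] by (intro psi[of "n + m" "lift n", THEN trans]) (auto simp: psi_def coprime_add_modulus cong_def)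
  qed (simp add: psi_def coprime_add_modulus)
  show "psi (k * n) = psi k * psi n" for k n
  proof (cases "coprime k m \<and> coprime n m")
   case True
   hence c: "coprime k m" "coprime n m" by auto
   have "psi (k * n) = Re (f (lift k * lift n))"
    by (rule psi) (use c lift in \<open>auto intro: cong_mult\<close>)
   also have "... = Re (f (lift k)) * Re (f (lift n))"
    using Re_im(1)[OF lift(2)[OF c(1)]] Re_im(1)[OF lift(2)[OF c(2)]] by (metis Re_complex_of_real mult of_real_mult)
   finally show ?thesis using c by (simp add: psi_def)
  qed (auto simp: psi_def)
  show "psi n = 0 \<longleftrightarrow> \<not> coprime n m" for n using Re_im(2)[OF lift(2)] by (fastforce simp: psi_def)
  show "psi n = 1 \<or> psi n = -1" if "psi n \<noteq> 0" for n using that Re_im(2)[OF lift(2)] by (auto simp: psi_def split: if_splits)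
  fix d assume d: "d dvd m" "d < m"
  have "d dvd q" using d mq dvd_trans by blast
  with least[OF d(2)] obtain c where c: "coprime c q" "[c = 1] (mod d)" "f c \<noteq> 1" by (auto simp: P_def)
  have "psi c = Re (f c)" by (rule psi) (use cop c in auto)
  also have "... = -1" using Re_im[OF c(1)] c(3) by auto
  finally show "\<exists>c. coprime c m \<and> [c = 1] (mod d) \<and> psi c = -1" using c cop by blast
 qed
 moreover have "f n = of_real (psi n)" if "coprime n q" for n
  using psi[OF cop[OF that] that cong_refl] Re_im(1)[OF that] by simp
 ultimately show ?thesis using that m8 mq by blast
qed

lemma dirichlet_series_remove_prime:
 assumes f1: "\<And>n. norm (f n) \<le> 1" and mult: "\<And>k. f (p * k) = f p * f k" and p: "p > 0" and s: "Re s > 1"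
 shows "dirichlet_series (\<lambda>n. if p dvd n then 0 else f n) s = (1 - f p * of_nat p powr (- s)) * dirichlet_series f s"
proof -
 define g where "g = (\<lambda>n. f n * of_nat n powr (- s))"
 have "summable (\<lambda>n. norm (g n))" unfolding g_def by (rule summable_dirichlet(1)[OF f1 s])
 hence "(g has_sum (\<Sum>n. g n)) UNIV"
  using norm_summable_imp_has_sum[OF _ summable_sums[OF summable_norm_cancel]] by blast
 hence hs: "(g has_sum dirichlet_series f s) UNIV" by (simp add: dirichlet_series_def g_def)
 have "((\<lambda>n. (f p * of_nat p powr (- s)) * g n) has_sum (f p * of_nat p powr (- s)) * dirichlet_series f s) UNIV"
  by (rule has_sum_cmult_right[OF hs])
 moreover have "(f p * of_nat p powr (- s)) * g n = g (p * n)" for n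
 proof -
  have "complex_of_nat (p * n) powr (- s) = of_nat p powr (- s) * of_nat n powr (- s)"
   using powr_times_real_left[of "of_nat p" "of_nat n" "- s"] by simp
  thus ?thesis unfolding g_def mult by (simp only: mult_ac)
 qed
 ultimately have "(g has_sum (f p * of_nat p powr (- s)) * dirichlet_series f s) (range (\<lambda>n. p * n))"
  using p by (subst has_sum_reindex) (auto simp: inj_on_def o_def)
 hence "((\<lambda>n. if p dvd n then g n else 0) has_sum (f p * of_nat p powr (- s)) * dirichlet_series f s) UNIV"
  by (rule has_sum_cong_neutral[THEN iffD1, rotated 3]) (auto elim: dvdE)
 from has_sum_add[OF hs has_sum_cmult_right[OF this, of "- 1"]]
 have "((\<lambda>n. g n + - 1 * (if p dvd n then g n else 0)) has_sum (1 - f p * of_nat p powr (- s)) * dirichlet_series f s) UNIV"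
  by (simp add: algebra_simps)
 moreover have "g n + - 1 * (if p dvd n then g n else 0) = (if p dvd n then 0 else f n) * of_nat n powr (- s)" for n by (simp add: g_def)
 ultimately have "((\<lambda>n. (if p dvd n then 0 else f n) * of_nat n powr (- s)) has_sum (1 - f p * of_nat p powr (- s)) * dirichlet_series f s) UNIV" by (simp only:)
 from has_sum_imp_sums[OF this] show ?thesis by (simp add: dirichlet_series_def sums_iff)
qed

lemma dirichlet_series_remove_primes:
 assumes f1: "\<And>n. norm (f n) \<le> 1" and mult: "\<And>k n. f (k * n) = f k * f n" and s: "Re s > 1"
  and P: "finite P" "\<And>p. p \<in> P ==> prime p"
 shows "dirichlet_series (\<lambda>n. if \<exists>p\<in>P. p dvd n then 0 else f n) s = (\<Prod>p\<in>P. 1 - f p * of_nat p powr (- s)) * dirichlet_series f s"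
 using P
proof (induction P rule: finite_induct)
 case (insert p P)
 define h where "h = (\<lambda>n. if \<exists>p\<in>P. p dvd n then 0 else f n)"
 have pr: "prime p" using insert by auto
 have no: "\<not> p' dvd p" if "p' \<in> P" for p' using insert that primes_dvd_imp_eq by blast
 have hp: "h p = f p" using no by (auto simp: h_def)
 have hm: "h (p * k) = h p * h k" for k
 proof -
  have "(\<exists>p'\<in>P. p' dvd p * k) \<longleftrightarrow> (\<exists>p'\<in>P. p' dvd k)" using no insert.prems by (auto simp: prime_dvd_mult_iff)
  thus ?thesis using hp by (simp add: h_def mult)
 qed
 have "(\<lambda>n. if \<exists>p'\<in>insert p P. p' dvd n then 0 else f n) = (\<lambda>n. if p dvd n then 0 else h n)" by (auto simp: h_def)
 moreover have "dirichlet_series (\<lambda>n. if p dvd n then 0 else h n) s = (1 - h p * of_nat p powr (- s)) * dirichlet_series h s"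
  by (rule dirichlet_series_remove_prime) (use f1 hm pr s in \<open>auto simp: h_def prime_gt_0_nat\<close>)
 ultimately show ?case using insert by (simp add: hp) (simp add: h_def)
qed simp

context real_primitive_character
begin

text \<open>\<open>GRH_mod\<close> speaks of the imprimitive \<open>L_function f\<close>, which
  \<open>SOME\<close> determines off the point 1. There it equals \<open>L_ext\<close> times
  finitely many Euler factors, by the identity theorem on the connected punctured plane, so zeros of
  \<open>L_ext\<close> in the strip are among its zeros.\<close>

lemma L_ext_zero_critical_line:
 assumes q: "q > 1" and mq: "m dvd q" and f: "dirichlet_character q f" "\<And>n. coprime n q ==> f n = of_real (psi n)"
  and grh: "GRH_mod q" and s: "0 < Re s" "Re s < 1" "L_ext s = 0"
 shows "Re s = 1/2"
proof -
 define g where "g = (\<lambda>s. (\<Prod>p\<in>prime_factors q. 1 - psic p * of_nat p powr (- s)) * L_ext s)"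
 have g_hol: "g holomorphic_on A" for A unfolding g_def
  by (intro holomorphic_intros L_ext_holomorphic) (auto simp: in_prime_factors_iff)
 have f_eq: "f n = (if \<exists>p\<in>prime_factors q. p dvd n then 0 else psic n)" for n
 proof (cases "coprime n q")
  case True
  hence "\<not> p dvd n" if "p \<in> prime_factors q" for p
   using that coprime_common_divisor_nat[of n q p] by (auto simp: in_prime_factors_iff)
  thus ?thesis using f(2)[OF True] by auto
 next
  case False
  then obtain p where "prime p" "p dvd n" "p dvd q" by (rule not_coprime_prime_divisor)
  moreover have "f n = 0" using f(1) False by (auto simp: dirichlet_character_def)
  ultimately show ?thesis using q by (auto simp: in_prime_factors_iff)
 qed
 have norm_f: "norm (f n) \<le> 1" for n using norm_psic[of n] by (auto simp: f_eq)
 have g_sums: "(\<lambda>n. f (Suc n) / of_nat (Suc n) powr s) sums g s" if s: "Re s > 1" for s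
 proof -
  have "dirichlet_series f s = (\<Prod>p\<in>prime_factors q. 1 - psic p * of_nat p powr (- s)) * dirichlet_series psic s"
   unfolding f_eq by (rule dirichlet_series_remove_primes[OF norm_psic psic_mult s]) (auto simp: in_prime_factors_iff)
  hence "dirichlet_series f s = g s" by (simp add: g_def L_ext_eq[OF s])
  moreover have "summable (\<lambda>n. f n * of_nat n powr (- s))"
   by (rule summable_norm_cancel[OF summable_dirichlet(1)[OF norm_f s]])
  ultimately have "(\<lambda>n. f n * of_nat n powr (- s)) sums g s" by (simp add: dirichlet_series_def sums_iff)
  moreover have "\<not> coprime 0 q" using q by simp
  hence "f 0 = 0" using f(1) unfolding dirichlet_character_def by blast
  ultimately have "(\<lambda>n. f (Suc n) * of_nat (Suc n) powr (- s)) sums g s" by (subst sums_Suc_iff) simp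
  thus ?thesis by (simp add: powr_minus divide_inverse)
 qed
 define L where "L = L_function f"
 have "\<exists>F. F holomorphic_on (- {1}) \<and> (\<forall>s. Re s > 1 \<longrightarrow> (\<lambda>n. f (Suc n) / of_nat (Suc n) powr s) sums F s)"
  using g_hol g_sums by blast
 from someI_ex[OF this] have L: "L holomorphic_on (- {1})" "\<And>s. Re s > 1 ==> (\<lambda>n. f (Suc n) / of_nat (Suc n) powr s) sums L s"
  unfolding L_def L_function_def by auto
 have "L s - g s = 0"
 proof (rule analytic_continuation_open[where s = "{s. Re s > 1}" and s' = "- {1}" and f = "\<lambda>s. L s - g s" and g = "\<lambda>_. 0"])
  show "connected (- {1 :: complex})" by (rule connected_punctured_universe) simp
  show "{s. Re s > 1} \<noteq> {}" by (auto intro: exI[of _ 2])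
  show "L s - g s = 0" if "s \<in> {s. Re s > 1}" for s using sums_unique2[OF L(2) g_sums] that by simp
  show "(\<lambda>s. L s - g s) holomorphic_on - {1}" by (intro holomorphic_intros L(1) g_hol)
  show "s \<in> - {1}" using s by auto
 qed (auto intro: open_halfspace_Re_gt)
 hence "L s = 0" using s(3) by (simp add: g_def)
 thus ?thesis using grh f(1) s unfolding GRH_mod_def nontrivial_zeros_def L_def by blast
qed

end

section \<open>Sums over primes\<close>

lemma summable_mangoldt_powr:
 fixes s :: real
 assumes "s > 1"
 shows "summable (\<lambda>n. mangoldt n * real n powr (- s))"
proof (rule summable_comparison_test'[OF summable_ln_powr[OF assms]])
 fix n
 show "norm (mangoldt n * real n powr (- s)) \<le> ln (real n) * real n powr (- s)"
  using mangoldt_le_ln[of n] mangoldt_nonneg[of n] by (cases "n = 0") (auto simp: abs_mult intro!: mult_right_mono)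
qed

text \<open>The remainder is the logarithmic derivative of \<open>zeta_reg\<close>, continuous on
  the segment from 1 to 2 because \<open>zeta_reg\<close> has no zero there.\<close>

lemma mangoldt_sum_near_one:
 obtains C :: real where "C \<ge> 0" "\<And>e. 0 < e ==> e \<le> 1 ==> (\<Sum>n. mangoldt n * real n powr (- (1 + e))) \<le> 1 / e + C"
proof -
 define S where "S = complex_of_real ` {1..2}"
 define h where "h = (\<lambda>s. deriv zeta_reg s / zeta_reg s)"
 have op: "open {s. Re s > 0}" by (rule open_halfspace_Re_gt)
 have nz: "zeta_reg s \<noteq> 0" if "s \<in> S" for s
 proof (cases "s = 1")
  case False
  hence "Re s > 1" using that by (auto simp: S_def)
  thus ?thesis by (rule mangoldt_series_one(2))
 qed (simp add: zeta_reg_one)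
 have sub: "S \<subseteq> {s. Re s > 0}" by (auto simp: S_def)
 have "continuous_on {s. Re s > 0} zeta_reg" "continuous_on {s. Re s > 0} (deriv zeta_reg)"
  using holomorphic_on_imp_continuous_on[OF zeta_reg_holomorphic]
   holomorphic_on_imp_continuous_on[OF holomorphic_deriv[OF zeta_reg_holomorphic op]] by auto
 hence "continuous_on S h" unfolding h_def
  by (intro continuous_on_divide) (use nz sub in \<open>auto intro: continuous_on_subset\<close>)
 moreover have "compact S" unfolding S_def by (intro compact_continuous_image continuous_intros) auto
 ultimately have "bounded (h ` S)" by (intro compact_imp_bounded compact_continuous_image)
 then obtain C where C: "\<And>s. s \<in> S ==> norm (h s) \<le> C" unfolding bounded_iff by auto
 have "1 \<in> S" unfolding S_def by (rule image_eqI[of _ _ 1]) auto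
 hence C0: "C \<ge> 0" using C[of 1] norm_ge_zero[of "h 1"] by linarith
 show ?thesis
 proof (rule that[OF C0])
  fix e :: real assume e: "0 < e" "e \<le> 1"
  define s where "s = complex_of_real (1 + e)"
  have eq: "complex_of_real (mangoldt n * real n powr (- (1 + e))) = mangoldt n * 1 * of_nat n powr (- s)" for n
   using powr_of_real[of "real n" "- (1 + e)"] by (simp add: s_def)
  have "(\<lambda>n. complex_of_real (mangoldt n * real n powr (- (1 + e)))) sums of_real (\<Sum>n. mangoldt n * real n powr (- (1 + e)))"
   by (intro sums_of_real summable_sums summable_mangoldt_powr) (use e in simp)
  hence "complex_of_real (\<Sum>n. mangoldt n * real n powr (- (1 + e))) = mangoldt_series (\<lambda>_. 1) s"
   unfolding mangoldt_series_def eq by (simp add: sums_iff)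
  also have "... = 1 / (s - 1) - h s" unfolding h_def by (rule mangoldt_series_one(1)) (use e in \<open>simp add: s_def\<close>)
  also have "s - 1 = of_real e" by (simp add: s_def)
  finally have "(\<Sum>n. mangoldt n * real n powr (- (1 + e))) = Re (1 / of_real e - h s)" by (metis Re_complex_of_real)
  also have "... = 1 / e - Re (h s)" by (simp add: Re_divide_of_real)
  also have "... \<le> 1 / e + norm (h s)" using abs_Re_le_cmod[of "h s"] by linarith
  also have "norm (h s) \<le> C" by (rule C) (use e in \<open>auto simp: s_def S_def intro!: image_eqI[of _ _ "1 + e"]\<close>)
  finally show "(\<Sum>n. mangoldt n * real n powr (- (1 + e))) \<le> 1 / e + C" by simp
 qed
qed

text \<open>Primes up to \<open>r\<close> are compared with the prime number sum at \<open>1 + 1 / ln r\<close>; larger ones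
 divide \<open>q\<close> and have total logarithmic weight at most \<open>r\<close>.\<close>

lemma sum_primes_dividing:
 obtains C :: real where "C \<ge> 0" "\<And>P (r::nat). finite P ==> (\<And>p. p \<in> P ==> prime p) ==> r \<ge> 3 ==>
  (\<Sum>p\<in>P. ln (real p)) \<le> real r ==> (\<Sum>p\<in>P. ln (real p) / (real p - 1)) \<le> 6 * ln (real r) + C"
proof -
 obtain C where C: "C \<ge> 0" "\<And>e. 0 < e ==> e \<le> 1 ==> (\<Sum>n. mangoldt n * real n powr (- (1 + e))) \<le> 1 / e + C"
  using mangoldt_sum_near_one by blast
 show ?thesis
 proof (rule that[of "6 * C + 2"])
  fix P :: "nat set" and r :: nat assume P: "finite P" "\<And>p. p \<in> P ==> prime p" and r: "r \<ge> 3" and le: "(\<Sum>p\<in>P. ln (real p)) \<le> real r"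
  define A where "A = {p \<in> P. p \<le> r}"
  define e where "e = 1 / ln (real r)"
  have lnr: "ln (real r) \<ge> 1"
   using r exp_le order_trans[of "exp 1" 3 "real r"] by (subst ln_ge_iff) auto
  have e: "0 < e" "e \<le> 1" using lnr by (auto simp: e_def)
  have p2: "real p \<ge> 2" if "p \<in> P" for p using P(2)[OF that] prime_ge_2_nat[of p] by simp
  \<comment> \<open>The 6 is 2 from \<open>1 / (p - 1) \<le> 2 / p\<close> times 3 from
    \<open>p powr e \<le> exp 1 \<le> 3\<close>; the latter uses \<open>p \<le> r\<close> and
    \<open>e = 1 / ln r\<close>.\<close>
  have "(\<Sum>p\<in>A. ln (real p) / (real p - 1)) \<le> (\<Sum>p\<in>A. 6 * (mangoldt p * real p powr (- (1 + e))))"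
  proof (rule sum_mono)
   fix p assume p: "p \<in> A"
   hence pP: "p \<in> P" "p \<le> r" by (auto simp: A_def)
   have "real p powr e = exp (e * ln (real p))" using p2[OF pP(1)] by (simp add: powr_def)
   also have "... \<le> exp 1" using pP p2[OF pP(1)] lnr by (simp add: e_def divide_le_eq)
   also have "... \<le> 3" by (rule exp_le)
   finally have pe: "real p powr e \<le> 3" .
   have "1 / (real p - 1) \<le> 2 / real p" using p2[OF pP(1)] by (simp add: field_simps)
   also have "... \<le> 2 / real p * (3 / real p powr e)"
   proof -
    have "1 \<le> 3 / real p powr e" using pe p2[OF pP(1)] by (simp add: le_divide_eq)
    from mult_left_mono[OF this, of "2 / real p"] show ?thesis by simp
   qed
   also have "... = 6 * real p powr (- (1 + e))" unfolding powr_minus powr_add using p2[OF pP(1)] by (simp add: divide_inverse)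
   finally have "ln (real p) * (1 / (real p - 1)) \<le> ln (real p) * (6 * real p powr (- (1 + e)))"
    using p2[OF pP(1)] by (intro mult_left_mono) auto
   thus "ln (real p) / (real p - 1) \<le> 6 * (mangoldt p * real p powr (- (1 + e)))" using P(2)[OF pP(1)] by (simp add: mult_ac)
  qed
  also have "... = 6 * (\<Sum>p\<in>A. mangoldt p * real p powr (- (1 + e)))" by (simp add: sum_distrib_left)
  also have "(\<Sum>p\<in>A. mangoldt p * real p powr (- (1 + e))) \<le> (\<Sum>n. mangoldt n * real n powr (- (1 + e)))"
   by (rule sum_le_suminf[OF summable_mangoldt_powr]) (use e P in \<open>auto simp: A_def mangoldt_nonneg\<close>)
  also have "... \<le> ln (real r) + C" using C(2)[OF e] lnr by (simp add: e_def)
  finally have 1: "(\<Sum>p\<in>A. ln (real p) / (real p - 1)) \<le> 6 * (ln (real r) + C)" by simp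
  have "(\<Sum>p\<in>P-A. ln (real p) / (real p - 1)) \<le> (\<Sum>p\<in>P-A. 2 / real r * ln (real p))"
  proof (rule sum_mono)
   fix p assume "p \<in> P - A"
   hence pP: "p \<in> P" "p > r" by (auto simp: A_def)
   have "1 / (real p - 1) \<le> 2 / real r" using pP r by (simp add: field_simps)
   from mult_left_mono[OF this, of "ln (real p)"] show "ln (real p) / (real p - 1) \<le> 2 / real r * ln (real p)"
    using p2[OF pP(1)] by (simp add: mult_ac)
  qed
  also have "... = 2 / real r * (\<Sum>p\<in>P-A. ln (real p))" by (simp add: sum_distrib_left)
  also have "2 / real r * (\<Sum>p\<in>P-A. ln (real p)) \<le> 2 / real r * real r"
  proof (rule mult_left_mono[OF order_trans[OF _ le]])
   show "(\<Sum>p\<in>P-A. ln (real p)) \<le> (\<Sum>p\<in>P. ln (real p))"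
  proof (rule sum_mono2)
   show "ln (real p) \<ge> 0" if "p \<in> P - (P - A)" for p using p2[of p] that by simp
   qed (use P in auto)
  qed simp
  also have "... = 2" using r by simp
  finally have "(\<Sum>p\<in>P-A. ln (real p) / (real p - 1)) \<le> 2" .
  moreover have "(\<Sum>p\<in>P. ln (real p) / (real p - 1)) = (\<Sum>p\<in>P-A. ln (real p) / (real p - 1)) + (\<Sum>p\<in>A. ln (real p) / (real p - 1))"
   by (rule sum.subset_diff) (use P in \<open>auto simp: A_def\<close>)
  ultimately show "(\<Sum>p\<in>P. ln (real p) / (real p - 1)) \<le> 6 * ln (real r) + (6 * C + 2)" using 1 by simp
 qed (use C in simp)
qed

lemma prod_primes_dvd:
 fixes N :: nat
 assumes "finite P" "\<And>p. p \<in> P ==> prime p \<and> p dvd N"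
 shows "\<Prod>P dvd N"
 using assms
proof (induction P rule: finite_induct)
 case (insert p P)
 have "coprime p (\<Prod>P)"
  by (rule prod_coprime_right) (use insert in \<open>auto intro!: primes_coprime\<close>)
 thus ?case using insert by (simp add: divides_mult)
qed simp

text \<open>Chebyshev's argument: the primes above \<open>m\<close> and up to \<open>2 * m\<close>
  divide the central binomial coefficient, which is at most \<open>2 ^ (2 * m)\<close>. For odd
  \<open>n\<close> the number \<open>n\<close> itself is left over and paid for by
  \<open>ln n \<le> n\<close>.\<close>

lemma sum_ln_primes_dyadic:
 fixes n :: nat
 shows "(\<Sum>p | prime p \<and> n div 2 < p \<and> p \<le> n. ln (real p)) \<le> 2 * real n"
proof -
 define m where "m = n div 2"
 define P where "P = {p. prime p \<and> m < p \<and> p \<le> 2 * m}"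
 have finP: "finite P" by (rule finite_subset[of _ "{..2*m}"]) (auto simp: P_def)
 have "\<Prod>P dvd (2 * m choose m)"
 proof (rule prod_primes_dvd[OF finP])
  fix p assume p: "p \<in> P"
  have "fact (2 * m) = fact m * fact m * ((2 * m choose m) :: nat)"
   using binomial_fact_lemma[of m "2 * m"] by (simp add: mult_2)
  moreover have "p dvd (fact (2 * m) :: nat)" using p by (simp add: P_def prime_dvd_fact_iff)
  moreover have "\<not> p dvd (fact m :: nat)" using p by (simp add: P_def prime_dvd_fact_iff)
  ultimately show "prime p \<and> p dvd (2 * m choose m)" using p by (simp add: P_def prime_dvd_mult_iff)
 qed
 hence "\<Prod>P \<le> (2 * m choose m)" by (rule dvd_imp_le) simp
 also have "... \<le> 2 ^ (2 * m)" by (rule binomial_le_pow2)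
 finally have "real (\<Prod>P) \<le> 2 ^ (2 * m)" by (metis of_nat_le_iff of_nat_numeral of_nat_power)
 moreover have pos: "0 < real (\<Prod>P)" by (auto simp: P_def prime_gt_0_nat intro!: prod_pos)
 ultimately have "ln (real (\<Prod>P)) \<le> ln (2 ^ (2 * m))" by (subst ln_le_cancel_iff) auto
 also have "... = real (2 * m) * ln 2" by (simp add: ln_realpow)
 also have "... \<le> real (2 * m) * 1" using ln2_le_25_over_36 by (intro mult_left_mono) auto
 also have "ln (real (\<Prod>P)) = (\<Sum>p\<in>P. ln (real p))"
  using ln_prod[OF finP, of real] by (force simp: P_def prime_gt_0_nat)
 finally have 1: "(\<Sum>p\<in>P. ln (real p)) \<le> real (2 * m)" by simp
 have "(\<Sum>p | prime p \<and> n div 2 < p \<and> p \<le> n. ln (real p)) \<le> (\<Sum>p\<in>P \<union> {n}. \<bar>ln (real p)\<bar>)"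
  using finP by (intro order_trans[OF sum_mono[OF abs_ge_self] sum_mono2]) (auto simp: P_def m_def)
 also have "... \<le> (\<Sum>p\<in>P. \<bar>ln (real p)\<bar>) + \<bar>ln (real n)\<bar>" using finP by (simp add: sum.insert_if)
 also have "(\<Sum>p\<in>P. \<bar>ln (real p)\<bar>) = (\<Sum>p\<in>P. ln (real p))" by (rule sum.cong) (auto simp: P_def prime_gt_0_nat Suc_leI)
 also have "\<bar>ln (real n)\<bar> \<le> real n" using ln_le_minus_one[of "real n"] by (cases "n = 0") auto
 finally show ?thesis using 1 by (simp add: m_def)
qed

text \<open>The range is halved. The constant closes the induction through
  \<open>6 * (6/10) + 2 * (12/10) = 6\<close>, where the fractions bound
  \<open>(1/2) powr (1 - 2 * alpha)\<close> and \<open>(1/2) powr (- (2 * alpha))\<close>.\<close>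

lemma sum_ln_primes_powr:
 fixes n :: nat and alpha :: real
 assumes alpha: "0 \<le> alpha" "alpha \<le> 1/12"
 shows "(\<Sum>p | prime p \<and> p \<le> n. ln (real p) * real p powr (- (2 * alpha))) \<le> 6 * real n powr (1 - 2 * alpha)"
proof (induction n rule: less_induct)
 case (less n)
 show ?case
 proof (cases "n = 0")
  case False
  define m where "m = n div 2"
  have half: "(1/2::real) powr (1 - 2 * alpha) \<le> 6/10"
  proof -
   have "(1/2::real) powr (1 - 2 * alpha) \<le> (1/2) powr (3/4)" by (rule powr_mono') (use alpha in auto)
   also have "... \<le> 6/10"
   proof (rule power_le_imp_le_base[where n = 3])
    have "((1/2::real) powr (3/4)) ^ Suc 3 = (1/2) powr (real (Suc 3) * (3/4))" by (rule powr_power) simp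
    also have "... = (1/2) powr 3" by simp
    also have "... = (1/2) ^ 3" by (rule powr_numeral) simp
    finally have "((1/2::real) powr (3/4)) ^ Suc 3 = (1/2) ^ 3" .
    thus "((1/2::real) powr (3/4)) ^ Suc 3 \<le> (6/10) ^ Suc 3" by (simp only:) (simp add: power_divide)
   qed simp
   finally show ?thesis .
  qed
  have two: "(1/2::real) powr (- (2 * alpha)) \<le> 12/10"
  proof -
   have "(1/2::real) powr (- (2 * alpha)) \<le> (1/2) powr (- (1/4))" by (rule powr_mono') (use alpha in auto)
   also have "... \<le> 12/10"
   proof (rule power_le_imp_le_base[where n = 3])
    have "((1/2::real) powr (- (1/4))) ^ Suc 3 = (1/2) powr (real (Suc 3) * (- (1/4)))" by (rule powr_power) simp
    also have "... = (1/2) powr (- 1)" by simp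
    also have "... = 2" by (simp add: powr_minus)
    finally have "((1/2::real) powr (- (1/4))) ^ Suc 3 = 2" .
    thus "((1/2::real) powr (- (1/4))) ^ Suc 3 \<le> (12/10) ^ Suc 3" by (simp only:) (simp add: power_divide)
   qed simp
   finally show ?thesis .
  qed
  have fin: "finite {p. prime p \<and> p \<le> n}" for n :: nat by (rule finite_subset[of _ "{..n}"]) auto
  have split: "{p. prime p \<and> p \<le> n} = {p. prime p \<and> p \<le> m} \<union> {p. prime p \<and> m < p \<and> p \<le> n}" by (auto simp: m_def)
  have "(\<Sum>p | prime p \<and> p \<le> n. ln (real p) * real p powr (- (2 * alpha)))
   = (\<Sum>p | prime p \<and> p \<le> m. ln (real p) * real p powr (- (2 * alpha))) + (\<Sum>p | prime p \<and> m < p \<and> p \<le> n. ln (real p) * real p powr (- (2 * alpha)))"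
   unfolding split by (rule sum.union_disjoint) (use fin[of n] in \<open>auto simp: split\<close>)
  also have "(\<Sum>p | prime p \<and> p \<le> m. ln (real p) * real p powr (- (2 * alpha))) \<le> 6 * real m powr (1 - 2 * alpha)"
   by (rule less.IH) (use False in \<open>simp add: m_def\<close>)
  also have "real m powr (1 - 2 * alpha) \<le> (real n * (1/2)) powr (1 - 2 * alpha)" by (rule powr_mono2) (use alpha in \<open>auto simp: m_def\<close>)
  also have "(real n * (1/2)) powr (1 - 2 * alpha) = real n powr (1 - 2 * alpha) * (1/2) powr (1 - 2 * alpha)" by (rule powr_mult)
  also have "6 * (real n powr (1 - 2 * alpha) * (1/2) powr (1 - 2 * alpha)) \<le> 6 * (real n powr (1 - 2 * alpha) * (6/10))"
   by (intro mult_left_mono half) auto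
  also have "(\<Sum>p | prime p \<and> m < p \<and> p \<le> n. ln (real p) * real p powr (- (2 * alpha)))
   \<le> (\<Sum>p | prime p \<and> m < p \<and> p \<le> n. ln (real p) * (real n * (1/2)) powr (- (2 * alpha)))"
  proof (intro sum_mono mult_left_mono)
   fix p assume "p \<in> {p. prime p \<and> m < p \<and> p \<le> n}"
   hence "2 * p \<ge> n" "prime p" by (auto simp: m_def)
   hence "real n * (1/2) \<le> real p" "real n > 0" "ln (real p) \<ge> 0" using False prime_gt_0_nat[of p] by (auto simp: Suc_leI)
   thus "real p powr (- (2 * alpha)) \<le> (real n * (1/2)) powr (- (2 * alpha))" "ln (real p) \<ge> 0" using alpha by (auto intro!: powr_mono2')
  qed
  also have "... = (\<Sum>p | prime p \<and> m < p \<and> p \<le> n. ln (real p)) * (real n * (1/2)) powr (- (2 * alpha))" by (rule sum_distrib_right[symmetric])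
  also have "... \<le> 2 * real n * (real n * (1/2)) powr (- (2 * alpha))"
   using sum_ln_primes_dyadic[of n] by (intro mult_right_mono) (auto simp: m_def)
  also have "... = 2 * (real n * real n powr (- (2 * alpha))) * (1/2) powr (- (2 * alpha))" unfolding powr_mult by (simp only: mult_ac)
  also have "real n * real n powr (- (2 * alpha)) = real n powr (1 - 2 * alpha)" using False by (simp add: powr_mult_base)
  also have "2 * real n powr (1 - 2 * alpha) * (1/2) powr (- (2 * alpha)) \<le> 2 * real n powr (1 - 2 * alpha) * (12/10)" by (intro mult_left_mono two) auto
  finally show ?thesis by simp
 qed simp
qed

text \<open>This contains the biased part. Squares give 6 by the preceding bound at
  \<open>sqrt x\<close>. For each of at most \<open>x powr (1/3)\<close> primes the higher powers
  add up to at most \<open>ln x \<le> 12 * x powr (1/12)\<close>, and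
  \<open>1/3 + 1/12 = 5/12 \<le> 1/2 - alpha\<close>. No logarithm is lost, so a gain of order
  \<open>ln r\<close> can outweigh it.\<close>

lemma sum_mangoldt_prime_powers:
 fixes x :: real
 assumes alpha: "0 \<le> alpha" "alpha \<le> 1/12" and x: "x \<ge> 1"
 shows "(\<Sum>n | real n \<le> x \<and> \<not> prime n. mangoldt n * real n powr (- alpha)) \<le> 18 * x powr (1/2 - alpha)"
proof -
 define A2 where "A2 = {p::nat. prime p \<and> real p ^ 2 \<le> x}"
 define A3 where "A3 = {p::nat. prime p \<and> real p ^ 3 \<le> x}"
 define E where "E = (\<lambda>p::nat. {k::nat. 3 \<le> k \<and> real p ^ k \<le> x})"
 define F where "F = (\<lambda>n::nat. mangoldt n * real n powr (- alpha))"
 have F0: "F n \<ge> 0" for n by (simp add: F_def mangoldt_nonneg)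
 have finx: "finite {n::nat. real n \<le> x}" by (rule finite_subset[of _ "{..nat \<lfloor>x\<rfloor>}"]) (auto simp: le_nat_floor)
 have finA: "finite A2" "finite A3"
 proof -
  have le: "real p \<le> x" if "prime p" "real p ^ k \<le> x" "k > 0" for p k :: nat
   using that prime_ge_1_nat[of p] self_le_power[of "real p" k] by linarith
  have "A2 \<subseteq> {n::nat. real n \<le> x}" unfolding A2_def using le[of _ 2] by auto
  thus "finite A2" using finx by (rule finite_subset)
  have "A3 \<subseteq> {n::nat. real n \<le> x}" unfolding A3_def using le[of _ 3] by auto
  thus "finite A3" using finx by (rule finite_subset)
 qed
 have finE: "finite (E p)" and lnE: "real (card (E p)) * ln (real p) \<le> ln x" if p: "p \<in> A3" for p
 proof -
  have p2: "real p \<ge> 2" using p prime_ge_2_nat[of p] by (simp add: A3_def)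
  hence lp: "ln (real p) > 0" by simp
  define K where "K = nat \<lfloor>ln x / ln (real p)\<rfloor>"
  have sub: "E p \<subseteq> {1..K}"
  proof
   fix k assume "k \<in> E p"
   hence k: "k \<ge> 3" "real p ^ k \<le> x" by (auto simp: E_def)
   hence "ln (real p ^ k) \<le> ln x" using p2 x by (subst ln_le_cancel_iff) auto
   hence "real k \<le> ln x / ln (real p)" using lp p2 by (simp add: ln_realpow le_divide_eq)
   thus "k \<in> {1..K}" using k by (simp add: K_def le_nat_floor)
  qed
  thus "finite (E p)" by (rule finite_subset) simp
  have "card (E p) \<le> K" using card_mono[OF _ sub] by simp
  hence "real (card (E p)) \<le> real K" by simp
  also have "... \<le> ln x / ln (real p)" unfolding K_def using lp x by (intro of_nat_floor) auto
  finally show "real (card (E p)) * ln (real p) \<le> ln x" using lp by (simp add: le_divide_eq)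
 qed
 have sub: "{n. real n \<le> x \<and> \<not> prime n \<and> primepow n} \<subseteq> (\<lambda>p. p ^ 2) ` A2 \<union> (\<lambda>(p, k). p ^ k) ` Sigma A3 E"
 proof
  fix n assume "n \<in> {n. real n \<le> x \<and> \<not> prime n \<and> primepow n}"
  then obtain p k where n: "real n \<le> x" "\<not> prime n" "prime p" "k > 0" "n = p ^ k" by (auto simp: primepow_def)
  have "k \<noteq> 1" using n by auto
  with n(4) consider "k = 2" | "k \<ge> 3" by linarith
  thus "n \<in> (\<lambda>p. p ^ 2) ` A2 \<union> (\<lambda>(p, k). p ^ k) ` Sigma A3 E"
  proof cases
   case 1
   thus ?thesis using n by (auto simp: A2_def)
  next
   case 2
   have "real p ^ 3 \<le> real p ^ k" using 2 prime_ge_1_nat[OF n(3)] by (intro power_increasing) auto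
   hence "(p, k) \<in> Sigma A3 E" using n 2 by (auto simp: A3_def E_def)
   thus ?thesis using n(5) by force
  qed
 qed
 have "(\<Sum>n | real n \<le> x \<and> \<not> prime n. F n) = (\<Sum>n | real n \<le> x \<and> \<not> prime n \<and> primepow n. F n)"
  using finx by (intro sum.mono_neutral_right) (auto simp: F_def mangoldt_def)
 also have "... \<le> (\<Sum>n\<in>(\<lambda>p. p ^ 2) ` A2 \<union> (\<lambda>(p, k). p ^ k) ` Sigma A3 E. F n)"
  by (rule sum_mono2[OF _ sub]) (use finA finE F0 in auto)
 also have "... \<le> (\<Sum>n\<in>(\<lambda>p. p ^ 2) ` A2. F n) + (\<Sum>n\<in>(\<lambda>(p, k). p ^ k) ` Sigma A3 E. F n)"
  using finA finE F0 by (subst sum.union_inter[symmetric]) (auto intro!: sum_nonneg)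
 also have "... \<le> (\<Sum>p\<in>A2. F (p ^ 2)) + (\<Sum>(p, k)\<in>Sigma A3 E. F (p ^ k))"
 proof (rule add_mono)
  show "(\<Sum>n\<in>(\<lambda>p. p ^ 2) ` A2. F n) \<le> (\<Sum>p\<in>A2. F (p ^ 2))"
   using sum_image_le[of A2 F "\<lambda>p. p ^ 2"] finA F0 by (simp add: o_def)
  show "(\<Sum>n\<in>(\<lambda>(p, k). p ^ k) ` Sigma A3 E. F n) \<le> (\<Sum>(p, k)\<in>Sigma A3 E. F (p ^ k))"
   using sum_image_le[of "Sigma A3 E" F "\<lambda>(p, k). p ^ k"] finA finE F0 by (simp add: o_def case_prod_unfold)
 qed
 also have "(\<Sum>p\<in>A2. F (p ^ 2)) \<le> 6 * x powr (1/2 - alpha)"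
 proof -
  define n where "n = nat \<lfloor>sqrt x\<rfloor>"
  have nx: "real n \<le> sqrt x" using x by (simp add: n_def of_nat_floor)
  have "(\<Sum>p\<in>A2. F (p ^ 2)) = (\<Sum>p\<in>A2. ln (real p) * real p powr (- (2 * alpha)))"
  proof (rule sum.cong[OF refl])
   fix p assume p: "p \<in> A2"
   hence pp: "prime p" by (simp add: A2_def)
   have "real (p ^ 2) = real p powr 2" using prime_gt_0_nat[OF pp] by simp
   hence "real (p ^ 2) powr (- alpha) = real p powr (- (2 * alpha))" by (simp only: powr_powr) simp
   moreover have "mangoldt (p ^ 2) = ln (real p)" using pp by (subst mangoldt_primepow') auto
   ultimately show "F (p ^ 2) = ln (real p) * real p powr (- (2 * alpha))" by (simp only: F_def)
  qed
  also have "... \<le> (\<Sum>p | prime p \<and> p \<le> n. ln (real p) * real p powr (- (2 * alpha)))"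
  proof (rule sum_mono2)
   show "finite {p. prime p \<and> p \<le> n}" by (rule finite_subset[of _ "{..n}"]) auto
   show "A2 \<subseteq> {p. prime p \<and> p \<le> n}"
   proof safe
    fix p assume p: "p \<in> A2"
    show "prime p" using p by (simp add: A2_def)
    have "real p \<le> sqrt x" using p by (intro real_le_rsqrt) (simp add: A2_def)
    thus "p \<le> n" by (simp add: n_def le_nat_floor)
   qed
   show "ln (real p) * real p powr (- (2 * alpha)) \<ge> 0" if "p \<in> {p. prime p \<and> p \<le> n} - A2" for p
    using that prime_ge_1_nat[of p] by auto
  qed
  also have "... \<le> 6 * real n powr (1 - 2 * alpha)" by (rule sum_ln_primes_powr[OF alpha])
  also have "... \<le> 6 * sqrt x powr (1 - 2 * alpha)" using nx alpha by (intro mult_left_mono powr_mono2) auto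
  also have "sqrt x powr (1 - 2 * alpha) = x powr (1/2 - alpha)" using x by (simp add: powr_half_sqrt[symmetric] powr_powr field_simps)
  finally show ?thesis .
 qed
 also have "(\<Sum>(p, k)\<in>Sigma A3 E. F (p ^ k)) \<le> 12 * x powr (1/2 - alpha)"
 proof -
  have "(\<Sum>(p, k)\<in>Sigma A3 E. F (p ^ k)) = (\<Sum>p\<in>A3. \<Sum>k\<in>E p. F (p ^ k))"
   using finA finE by (intro sum.Sigma[symmetric]) auto
  also have "... \<le> (\<Sum>p\<in>A3. \<Sum>k\<in>E p. ln (real p))"
  proof (intro sum_mono)
   fix p k assume pk: "p \<in> A3" "k \<in> E p"
   hence pp: "prime p" "k > 0" by (auto simp: A3_def E_def)
   have "real (p ^ k) powr (- alpha) \<le> real (p ^ k) powr 0"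
    using alpha prime_gt_0_nat[OF pp(1)] by (intro powr_mono) auto
   hence "real (p ^ k) powr (- alpha) \<le> 1" using prime_gt_0_nat[OF pp(1)] by simp
   hence "ln (real p) * real (p ^ k) powr (- alpha) \<le> ln (real p) * 1"
    using prime_ge_1_nat[OF pp(1)] by (intro mult_left_mono) auto
   moreover have "mangoldt (p ^ k) = ln (real p)" using pp by (subst mangoldt_primepow') auto
   ultimately show "F (p ^ k) \<le> ln (real p)" by (simp only: F_def)
  qed
  also have "... \<le> (\<Sum>p\<in>A3. ln x)" using lnE by (intro sum_mono) simp
  also have "... = real (card A3) * ln x" by simp
  also have "... \<le> x powr (1/3) * (12 * x powr (1/12))"
  proof (rule mult_mono)
   have "A3 \<subseteq> {1..nat \<lfloor>x powr (1/3)\<rfloor>}"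
   proof
    fix p assume p: "p \<in> A3"
    hence "(real p ^ 3) powr (1/3) \<le> x powr (1/3)" by (intro powr_mono2) (auto simp: A3_def)
    moreover have "(real p ^ 3) powr (1/3) = real p"
    proof -
     have "real p ^ 3 = real p powr 3" using p prime_gt_0_nat[of p] by (simp add: A3_def)
     thus ?thesis by (simp only: powr_powr) simp
    qed
    ultimately show "p \<in> {1..nat \<lfloor>x powr (1/3)\<rfloor>}" using p prime_gt_0_nat[of p] by (auto simp: A3_def le_nat_floor Suc_leI)
   qed
   from card_mono[OF _ this] have "card A3 \<le> nat \<lfloor>x powr (1/3)\<rfloor>" by simp
   hence "real (card A3) \<le> real (nat \<lfloor>x powr (1/3)\<rfloor>)" by (rule of_nat_mono)
   also have "... \<le> x powr (1/3)" by (rule of_nat_floor) simp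
   finally show "real (card A3) \<le> x powr (1/3)" .
   show "ln x \<le> 12 * x powr (1/12)" using ln_powr_bound[of x "1/12"] x by simp
  qed (use x in auto)
  also have "... = 12 * x powr (5/12)" using x by (simp add: powr_add[symmetric])
  also have "... \<le> 12 * x powr (1/2 - alpha)" using x alpha by (intro mult_left_mono powr_mono) auto
  finally show ?thesis .
 qed
 finally show ?thesis by (simp add: F_def)
qed

text \<open>Abel summation beyond \<open>n0\<close>, where the partial sums are nonpositive and
  \<open>f\<close> decreases; the boundary term at \<open>n0\<close> and the terms up to it are
  estimated trivially.\<close>

lemma partial_summation_nonpos:
 fixes b f :: "nat \<Rightarrow> real"
 assumes A: "\<And>n. n0 \<le> n ==> n \<le> N ==> (\<Sum>k\<le>n. b k) \<le> 0"
  and f: "\<And>n. n0 \<le> n ==> n < N ==> f (Suc n) \<le> f n" "\<And>n. n \<le> N ==> 0 \<le> f n"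
  and n0: "n0 \<le> N" and b: "\<And>k. k \<le> n0 ==> \<bar>b k\<bar> \<le> R" "\<And>k. k \<le> n0 ==> f k \<le> M" and R: "R \<ge> 0"
 shows "(\<Sum>k\<le>N. b k * f k) \<le> 2 * (real n0 + 1) * R * M"
proof -
 define S where "S = (\<lambda>n. \<Sum>k\<le>n. b k)"
 have "(\<Sum>k\<in>{n0<..n}. b k * f k) \<le> S n * f n - S n0 * f n0" if "n0 \<le> n" "n \<le> N" for n
  using that
 proof (induction n rule: dec_induct)
  case (step n)
  have "S n * f n \<le> S n * f (Suc n)" using step f(1)[of n] A[of n] by (intro mult_left_mono_neg) (auto simp: S_def)
  moreover have "{n0<..Suc n} = insert (Suc n) {n0<..n}" using step by auto
  moreover have "S (Suc n) = S n + b (Suc n)" by (simp add: S_def)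
  ultimately show ?case using step by (simp add: algebra_simps)
 qed simp
 from this[OF n0 order.refl] have "(\<Sum>k\<in>{n0<..N}. b k * f k) \<le> S N * f N - S n0 * f n0" .
 moreover have "S N * f N \<le> 0" using A[OF n0 order.refl] f(2)[of N] by (simp add: S_def mult_nonpos_nonneg)
 moreover have "- S n0 * f n0 \<le> ((real n0 + 1) * R) * M"
 proof -
  have "- S n0 \<le> (\<Sum>k\<le>n0. \<bar>b k\<bar>)" unfolding S_def using sum_abs[of b "{..n0}"] by linarith
  also have "... \<le> (\<Sum>k\<le>n0. R)" by (intro sum_mono b) auto
  finally have "- S n0 \<le> (real n0 + 1) * R" by (simp add: add.commute)
  thus ?thesis using f(2)[OF n0] b(2)[of n0] R by (intro mult_mono) auto
 qed
 moreover have "(\<Sum>k\<le>n0. b k * f k) \<le> (\<Sum>k\<le>n0. R * M)"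
 proof (rule sum_mono)
  fix k assume k: "k \<in> {..n0}"
  have "b k * f k \<le> \<bar>b k\<bar> * f k" using f(2)[of k] k n0 by (intro mult_right_mono) auto
  also have "... \<le> R * M" using b(1)[of k] b(2)[of k] f(2)[of k] k n0 R by (intro mult_mono) auto
  finally show "b k * f k \<le> R * M" .
 qed
 moreover have "{..N} = {..n0} \<union> {n0<..N}" using n0 by auto
 hence "(\<Sum>k\<le>N. b k * f k) = (\<Sum>k\<le>n0. b k * f k) + (\<Sum>k\<in>{n0<..N}. b k * f k)"
  by (simp only:) (rule sum.union_disjoint, auto)
 ultimately show ?thesis by (simp add: algebra_simps)
qed

text \<open>The function \<open>v * exp (- (alpha * v))\<close> peaks at
  \<open>v = 1 / alpha\<close>. With \<open>v = ln n\<close> this makes the weight of a prime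
  monotone once \<open>n \<ge> exp (1 / alpha)\<close>.\<close>

lemma mult_exp_decreasing:
 fixes alpha :: real
 assumes "alpha > 0" "alpha * u \<ge> 1" "u \<le> v"
 shows "v * exp (- (alpha * v)) \<le> u * exp (- (alpha * u))"
proof -
 have u: "u > 0" using assms by (metis mult_less_cancel_left_pos mult_zero_right less_le_trans zero_less_one)
 have "v = u * (1 + (v - u) / u)" using u by (simp add: field_simps)
 also have "... \<le> u * (1 + alpha * (v - u))"
 proof (intro mult_left_mono add_left_mono)
  have "(v - u) * 1 \<le> (v - u) * (alpha * u)" using assms by (intro mult_left_mono) auto
  thus "(v - u) / u \<le> alpha * (v - u)" using u by (simp add: field_simps)
 qed (use u in simp)
 also have "... \<le> u * exp (alpha * (v - u))" using u by (intro mult_left_mono exp_ge_add_one_self) auto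
 finally have "v * exp (- (alpha * v)) \<le> u * exp (alpha * (v - u)) * exp (- (alpha * v))" by (intro mult_right_mono) auto
 also have "... = u * exp (- (alpha * u))" by (simp add: mult.assoc exp_add[symmetric] algebra_simps)
 finally show ?thesis .
qed

section \<open>Lower bound for a single character\<close>

text \<open>A bound for \<open>V s\<close> at every \<open>s \<ge> 2\<close>, common to all
  characters, so that the later thresholds are absolute.\<close>

definition mangoldt_two :: real where "mangoldt_two = (\<Sum>n. mangoldt n * real n powr (- 2))"

lemma mangoldt_two_nonneg: "mangoldt_two \<ge> 0"
 unfolding mangoldt_two_def by (intro suminf_nonneg summable_mangoldt_powr) (auto simp: mangoldt_nonneg)

lemma harm_le_ln: "n > 0 ==> harm n \<le> ln (real n) + 1"
proof -
 assume "n > 0"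
 then obtain k where k: "n = Suc k" by (cases n) auto
 have "harm (Suc k) - ln (real (Suc k)) \<le> harm (Suc 0) - ln (real (Suc 0))"
  by (rule decseqD[OF decseq_harm_diff_ln]) simp
 thus ?thesis by (simp add: k harm_expand)
qed

lemma Digamma_le_ln: "x > 0 ==> n > 0 ==> x \<le> real n + 1 ==> Digamma x \<le> ln (real n) + 1"
proof -
 assume a: "x > 0" "n > 0" "x \<le> real n + 1"
 have "Digamma x \<le> Digamma (real (Suc n))" using a by (intro Digamma_real_mono) auto
 also have "... = harm n - euler_mascheroni" by (rule Digamma_of_nat)
 also have "... \<le> ln (real n) + 1" using harm_le_ln[OF a(2)] euler_mascheroni_pos by linarith
 finally show ?thesis .
qed

lemma Digamma_ge_ln: "n > 0 ==> real n \<le> x ==> Digamma x \<ge> ln (real n) - 1"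
proof -
 assume a: "n > 0" "real n \<le> x"
 then obtain k where k: "n = Suc k" by (cases n) auto
 have "ln (real n) - 1 \<le> harm k - euler_mascheroni"
  using ln_le_harm[of k] euler_mascheroni_less_13_over_22 by (simp add: k add.commute)
 also have "... = Digamma (real n)" unfolding k by (rule Digamma_of_nat[symmetric])
 also have "... \<le> Digamma x" using a by (intro Digamma_real_mono) auto
 finally show ?thesis .
qed

text \<open>What the lower bound takes from a primitive character: bounded values and the closed
  form for the sum over its zeros.\<close>

locale zero_data =
 fixes m a :: nat and psi w gamma :: "nat \<Rightarrow> real"
 assumes m: "m > 1" and a: "a \<le> 1" and psi0: "psi 0 = 0" and psi1: "\<And>n. \<bar>psi n\<bar> \<le> 1"
  and w01: "\<And>i. w i = 0 \<or> w i \<ge> 1"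
  and zero: "\<And>s::real. s > 1 ==> (\<lambda>i. w i * (pker (s - 1/2) (gamma i))) sums
   (zero_side m a psi s)"
begin

text \<open>Minus the logarithmic derivative of the L-function at \<open>s\<close>.\<close>

definition V :: "real \<Rightarrow> real" where "V s = (msum psi s)"

definition p :: "real \<Rightarrow> real" where "p u = (\<Sum>i. w i * (pker u (gamma i)))"

definition S :: "real \<Rightarrow> nat \<Rightarrow> real \<Rightarrow> real" where
 "S alpha l y = (\<Sum>n | n > 0 \<and> ln (real n) \<le> y. mangoldt n * psi n * real n powr (- alpha) * (1 - exp (- (real l * (y - ln (real n))))))"

lemma w: "w i \<ge> 0" using w01[of i] by auto

lemma summable_w: "u > 0 ==> summable (\<lambda>i. w i * (qker u (gamma i)))" "u > 0 ==> summable (\<lambda>i. w i * (pker u (gamma i)))"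
proof -
 have s1: "summable (\<lambda>i. w i * (pker (2 - 1/2) (gamma i)))" using sums_summable[OF zero[of 2]] by simp
 show "u > 0 ==> summable (\<lambda>i. w i * (qker u (gamma i)))" "u > 0 ==> summable (\<lambda>i. w i * (pker u (gamma i)))"
  using summable_zero_weights[OF s1 _ _ w, of u] by auto
qed

lemma p_eq: "u > 1/2 ==> p u = ln (m / pi) / 2 + Digamma ((u + 1/2 + a) / 2) / 2 - V (u + 1/2)"
 using zero[of "u + 1/2"] by (simp add: p_def V_def sums_iff)

lemma summable_V: "s > 1 ==> summable (\<lambda>n. \<bar>mangoldt n * psi n\<bar> * real n powr (- s))"
proof (rule summable_comparison_test'[OF summable_mangoldt_powr])
 fix n
 have "\<bar>mangoldt n * psi n\<bar> \<le> mangoldt n * 1" unfolding abs_mult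
  using psi1[of n] mangoldt_nonneg[of n] by (intro mult_mono) auto
 hence "\<bar>mangoldt n * psi n\<bar> * real n powr (- s) \<le> mangoldt n * real n powr (- s)" by (intro mult_right_mono) auto
 thus "norm (\<bar>mangoldt n * psi n\<bar> * real n powr (- s)) \<le> mangoldt n * real n powr (- s)" by (simp add: abs_mult)
qed

lemma V_bound: "s \<ge> 2 ==> \<bar>V s\<bar> \<le> mangoldt_two"
proof -
 assume s: "s \<ge> 2"
 have s1: "summable (\<lambda>n. \<bar>mangoldt n * psi n * real n powr (- s)\<bar>)" using summable_V[of s] s by (simp add: abs_mult)
 have "\<bar>V s\<bar> \<le> (\<Sum>n. \<bar>mangoldt n * psi n * real n powr (- s)\<bar>)" unfolding V_def by (rule summable_rabs[OF s1])
 also have "... \<le> mangoldt_two" unfolding mangoldt_two_def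
 proof (rule suminf_le[OF _ s1 summable_mangoldt_powr])
  fix n
  show "\<bar>mangoldt n * psi n * real n powr (- s)\<bar> \<le> mangoldt n * real n powr (- 2)"
  proof (cases "n = 0")
   case False
   have "mangoldt n * \<bar>psi n\<bar> * real n powr (- s) \<le> mangoldt n * 1 * real n powr (- 2)"
    using s psi1[of n] mangoldt_nonneg[of n] False by (intro mult_mono powr_mono) auto
   thus ?thesis by (simp add: abs_mult mangoldt_nonneg)
  qed simp
 qed simp
 finally show ?thesis .
qed

lemma p_nonneg: "u > 0 ==> p u \<ge> 0"
 unfolding p_def by (intro suminf_nonneg summable_w) (auto simp: w)

text \<open>\<open>u * pker u g\<close> increases with \<open>u\<close>. The closed form
  \<open>p_eq\<close> is stated for \<open>u > 1/2\<close>; this comparison is the way from there to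
  \<open>1/2 - alpha\<close>.\<close>

lemma p_mono: "0 < u ==> u \<le> v ==> p u \<le> v / u * p v"
proof -
 assume u: "0 < u" "u \<le> v"
 have "p u \<le> (\<Sum>i. v / u * (w i * (pker v (gamma i))))" unfolding p_def
 proof (rule suminf_le[OF _ summable_w(2) summable_mult[OF summable_w(2)]])
  fix i
  have pos: "u^2 + (gamma i)^2 > 0" "v^2 + (gamma i)^2 > 0" using u by (auto intro: add_pos_nonneg)
  have "u^2 * (gamma i)^2 \<le> v^2 * (gamma i)^2" using u by (intro mult_right_mono power_mono) auto
  hence "u * u * (v^2 + (gamma i)^2) \<le> v * v * (u^2 + (gamma i)^2)" by (simp add: algebra_simps power2_eq_square)
  hence "(u * u * (v^2 + (gamma i)^2)) / (u * (v^2 + (gamma i)^2)) \<le> (v * v * (u^2 + (gamma i)^2)) / (u * (v^2 + (gamma i)^2))"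
   using u by (intro divide_right_mono) auto
  hence "u \<le> v / u * (pker v (gamma i)) * (u^2 + (gamma i)^2)" using pos u by (simp add: mult_ac)
  hence "pker u (gamma i) \<le> v / u * (pker v (gamma i))" using pos by (simp only: pos_divide_le_eq)
  from mult_left_mono[OF this w[of i]] show "w i * (pker u (gamma i)) \<le> v / u * (w i * (pker v (gamma i)))"
   by (simp only: mult.left_commute)
 qed (use u in auto)
 thus ?thesis using suminf_mult[OF summable_w(2)[of v], of "v / u"] u by (simp add: p_def)
qed

lemma ln_m_pi: "ln (m / pi) \<le> ln m" "ln (m / pi) \<ge> - 1"
proof -
 show "ln (m / pi) \<le> ln m" using m pi_gt3 by (subst ln_le_cancel_iff) (auto simp: field_simps)
 have "ln (1 / 2) \<le> ln (m / pi)" using m pi_less_4 by (subst ln_le_cancel_iff) (auto simp: field_simps)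
 moreover have "ln (1 / 2 :: real) = - ln 2" by (simp add: ln_div)
 ultimately show "ln (m / pi) \<ge> - 1" using ln2_le_25_over_36 by linarith
qed

lemma p_upper:
 assumes "u \<ge> 3/2" "u \<le> real k"
 shows "p u \<le> ln m / 2 + ln (real k) / 2 + 1 / 2 + mangoldt_two"
proof -
 have "Digamma ((u + 1/2 + a) / 2) \<le> ln (real k) + 1" by (rule Digamma_le_ln) (use assms a in auto)
 moreover have "\<bar>V (u + 1/2)\<bar> \<le> mangoldt_two" by (rule V_bound) (use assms in simp)
 moreover have "p u = ln (m / pi) / 2 + Digamma ((u + 1/2 + a) / 2) / 2 - V (u + 1/2)" by (rule p_eq) (use assms in simp)
 ultimately show ?thesis using ln_m_pi(1) by linarith
qed

lemma p_three_halves: "p (3/2) \<le> ln m / 2 + 1 + mangoldt_two"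
 using p_upper[of "3/2" 2] ln2_le_25_over_36 by simp

text \<open>The pole of \<open>p\<close> at the zeros moves the logarithm of \<open>l\<close> into the difference, while the
 conductor cancels.\<close>

lemma p_gain:
 assumes alpha: "0 < alpha" "alpha \<le> 1/12" "alpha * ln m \<le> 1" and l: "l \<ge> 2"
 shows "p (1/2 - alpha + real l) - p (1/2 - alpha) \<ge> ln (real l) / 2 + V (1 + alpha) - (14 + 3 * mangoldt_two)"
proof -
 define beta where "beta = 1/2 - alpha"
 have beta: "beta \<ge> 5/12" "beta < 1/2" using alpha by (auto simp: beta_def)
 have "p (beta + real l) = ln (m / pi) / 2 + Digamma ((beta + real l + 1/2 + a) / 2) / 2 - V (beta + real l + 1/2)"
  by (rule p_eq) (use beta l in auto)
 moreover have "\<bar>V (beta + real l + 1/2)\<bar> \<le> mangoldt_two" by (rule V_bound) (use beta l in auto)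
 moreover have "Digamma ((beta + real l + 1/2 + a) / 2) \<ge> ln (real l) - 3"
 proof -
  define k where "k = l div 2"
  have "l \<le> 3 * k" using l unfolding k_def by presburger
  hence k: "k > 0" "real k \<ge> real l / 3" "real k \<le> real l / 2" using l by (auto simp: k_def)
  have "ln (real l / 3) \<le> ln (real k)" using k l by (subst ln_le_cancel_iff) auto
  moreover have "ln (real l / 3) = ln (real l) - ln 3" using l by (simp add: ln_div)
  moreover have "ln (3::real) \<le> 2" using ln_le_minus_one[of 3] by simp
  moreover have "Digamma ((beta + real l + 1/2 + a) / 2) \<ge> ln (real k) - 1" by (rule Digamma_ge_ln) (use k beta in auto)
  ultimately show ?thesis by linarith
 qed
 ultimately have 1: "p (beta + real l) \<ge> ln (m / pi) / 2 + ln (real l) / 2 - 3/2 - mangoldt_two" by linarith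
 have "p (1/2 + alpha) = ln (m / pi) / 2 + Digamma ((1/2 + alpha + 1/2 + a) / 2) / 2 - V (1/2 + alpha + 1/2)"
  by (rule p_eq) (use alpha in auto)
 moreover have "1/2 + alpha + 1/2 = 1 + alpha" by simp
 moreover have "Digamma ((1/2 + alpha + 1/2 + a) / 2) \<le> ln (real 1) + 1" by (rule Digamma_le_ln) (use alpha a in auto)
 ultimately have 2: "p (1/2 + alpha) \<le> ln (m / pi) / 2 + 1/2 - V (1 + alpha)" by simp
 have "p beta \<le> (1/2 + alpha) / beta * p (1/2 + alpha)" by (rule p_mono) (use beta alpha in \<open>auto simp: beta_def\<close>)
 \<comment> \<open>The excess \<open>5 * alpha * p (1/2 + alpha)\<close> stays bounded:
   \<open>p (1/2 + alpha)\<close> is at most \<open>3 * p (3/2)\<close>, of size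
   \<open>ln m\<close>, and \<open>alpha * ln m \<le> 1\<close>.\<close>
 also have "... \<le> (1 + 5 * alpha) * p (1/2 + alpha)"
 proof (intro mult_right_mono p_nonneg)
  have "alpha * alpha \<le> alpha * (1/12)" using alpha by (intro mult_left_mono) auto
  thus "(1/2 + alpha) / beta \<le> 1 + 5 * alpha" using beta by (simp add: pos_divide_le_eq beta_def algebra_simps)
 qed (use alpha in auto)
 also have "... = p (1/2 + alpha) + 5 * (alpha * p (1/2 + alpha))" by (simp add: algebra_simps)
 also have "alpha * p (1/2 + alpha) \<le> alpha * (3 * p (3/2))"
 proof (intro mult_left_mono)
  have "p (1/2 + alpha) \<le> (3/2) / (1/2 + alpha) * p (3/2)" by (rule p_mono) (use alpha in auto)
  also have "... \<le> 3 * p (3/2)" using alpha by (intro mult_right_mono p_nonneg) (auto simp: divide_le_eq)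
  finally show "p (1/2 + alpha) \<le> 3 * p (3/2)" .
 qed (use alpha in auto)
 also have "alpha * (3 * p (3/2)) \<le> alpha * (3 * (ln m / 2 + 1 + mangoldt_two))"
  using alpha p_three_halves by (intro mult_left_mono) auto
 also have "... = 3/2 * (alpha * ln m) + 3 * (alpha * (1 + mangoldt_two))" by (simp add: algebra_simps)
 also have "alpha * (1 + mangoldt_two) \<le> 1/12 * (1 + mangoldt_two)" using alpha mangoldt_two_nonneg by (intro mult_right_mono) auto
 finally have pbeta: "p beta \<le> p (1/2 + alpha) + 5 * (3/2 * (alpha * ln m) + 3 * (1/12 * (1 + mangoldt_two)))" by simp
 have "p beta \<le> p (1/2 + alpha) + 10 + 5/4 * mangoldt_two"
 proof -
  have "5 * (3/2 * x + 3 * (1/12 * (1 + t))) = 15/2 * x + 5/4 + 5/4 * t" for x t :: real by (simp add: algebra_simps add_divide_distrib)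
  with pbeta
  have "p beta \<le> p (1/2 + alpha) + (15/2 * (alpha * ln m) + 5/4 + 5/4 * mangoldt_two)" by (simp only:)
  thus ?thesis using alpha(3) by linarith
 qed
 thus ?thesis using 1 2 mangoldt_two_nonneg unfolding beta_def[symmetric] by linarith
qed

text \<open>Each zero up to height \<open>T\<close> contributes at least
  \<open>(3/2) / (9/4 + T^2)\<close> to \<open>p (3/2)\<close>. The quadratic dependence on
  \<open>T\<close> is wasteful but affects only the power of \<open>r\<close> in the final
  bound.\<close>

lemma zero_count:
 assumes T: "T \<ge> (0::real)"
 shows "finite {i. w i \<noteq> 0 \<and> \<bar>gamma i\<bar> \<le> T}"
  "real (card {i. w i \<noteq> 0 \<and> \<bar>gamma i\<bar> \<le> T}) \<le> (9/4 + T^2) * (2/3 * p (3/2))"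
proof -
 define I where "I = {i. w i \<noteq> 0 \<and> \<bar>gamma i\<bar> \<le> T}"
 have bd: "real (card G) \<le> (9/4 + T^2) * (2/3 * p (3/2))" if G: "G \<subseteq> I" "finite G" for G
 proof -
  have pos: "9/4 + T^2 > 0" by (rule add_pos_nonneg) auto
  have "real (card G) * ((3/2) / (9/4 + T^2)) = (\<Sum>i\<in>G. (3/2) / (9/4 + T^2))" by simp
  also have "... \<le> (\<Sum>i\<in>G. w i * (pker (3/2) (gamma i)))"
  proof (rule sum_mono)
   fix i assume "i \<in> G"
   hence i: "w i \<ge> 1" "\<bar>gamma i\<bar> \<le> T" using G w01[of i] by (auto simp: I_def)
   have g: "(gamma i)^2 \<le> T^2" using power_mono[OF i(2), of 2] by simp
   have "(3/2) / (9/4 + T^2) \<le> pker (3/2) (gamma i)"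
    using g by (intro divide_left_mono) (auto simp: power2_eq_square intro!: mult_pos_pos add_pos_nonneg)
   also have "... \<le> w i * (pker (3/2) (gamma i))" using mult_right_mono[OF i(1), of "pker (3/2) (gamma i)"] by simp
   finally show "(3/2) / (9/4 + T^2) \<le> w i * (pker (3/2) (gamma i))" .
  qed
  also have "... \<le> p (3/2)" unfolding p_def by (rule sum_le_suminf[OF summable_w(2)]) (use G w in auto)
  finally show ?thesis using pos by (simp add: field_simps)
 qed
 have "finite I \<and> card I \<le> nat \<lfloor>(9/4 + T^2) * (2/3 * p (3/2))\<rfloor>"
  by (rule finite_if_finite_subsets_card_bdd) (use bd in \<open>auto intro: le_nat_floor\<close>)
 thus "finite {i. w i \<noteq> 0 \<and> \<bar>gamma i\<bar> \<le> T}" unfolding I_def by blast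
 with bd[of I] show "real (card {i. w i \<noteq> 0 \<and> \<bar>gamma i\<bar> \<le> T}) \<le> (9/4 + T^2) * (2/3 * p (3/2))" by (simp add: I_def)
qed

text \<open>If all phases were 1, a zero would give \<open>exp (beta * y)\<close> times
  \<open>pker\<close> at \<open>beta + l\<close> minus \<open>pker\<close> at \<open>beta\<close>,
  and the sum would be exact. The error is at most \<open>eta * l * qker beta\<close> for a zero up
  to \<open>T\<close> and \<open>4 * l * qker T\<close> beyond; these sum to the two correction
  terms.\<close>

lemma S_lower_aux:
 assumes alpha: "0 < alpha" "alpha \<le> 1/12" and l: "l \<ge> 1" and y: "y \<ge> 0" and T: "T > 0" and eta: "eta \<ge> 0"
  and approx: "\<And>i. w i \<noteq> 0 ==> \<bar>gamma i\<bar> \<le> T ==> norm (cis (gamma i * y) - 1) \<le> eta"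
 defines "beta \<equiv> 1/2 - alpha"
 shows "S alpha l y \<ge> exp (beta * y) * (p (beta + real l) - p beta - eta * real l * p beta / beta - 4 * real l / T * p T) - p (beta + real l) - 1 / alpha - 5"
proof -
 define L where "L = real l"
 define z where "z = (\<lambda>i. Complex beta (gamma i))"
 define R where "R = (\<lambda>i. Re (of_nat l * exp (z i * of_real y) / (z i * (z i + of_nat l))))"
 have beta: "beta \<ge> 5/12" "beta < 1/2" using alpha by (auto simp: beta_def)
 have L: "L \<ge> 1" using l by (simp add: L_def)
 have z: "z i \<noteq> 0" "z i + of_real L \<noteq> 0" for i using beta L by (auto simp: z_def complex_eq_iff)
 have R_le: "w i * R i \<le> exp (beta * y) * ((w i * (pker beta (gamma i)) - w i * (pker (beta + L) (gamma i)))
  + (eta * L * (w i * (qker beta (gamma i))) + 4 * L * (w i * (qker T (gamma i)))))" for i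
 proof (cases "w i = 0")
  case False
  define Q where "Q = complex_of_real L / (z i * (z i + of_real L))"
  have "exp (z i * of_real y) = of_real (exp (beta * y)) * cis (gamma i * y)"
   by (simp add: z_def exp_eq_polar)
  hence "of_nat l * exp (z i * of_real y) / (z i * (z i + of_nat l)) = of_real (exp (beta * y)) * (Q + (cis (gamma i * y) - 1) * Q)"
  proof -
   assume "exp (z i * of_real y) = of_real (exp (beta * y)) * cis (gamma i * y)"
   hence "of_nat l * exp (z i * of_real y) / (z i * (z i + of_nat l)) = (of_real (exp (beta * y)) * cis (gamma i * y)) * Q"
    by (simp add: Q_def L_def mult_ac)
   moreover have "x * (Q + (c - 1) * Q) = (x * c) * Q" for x c by (simp add: algebra_simps)
   ultimately show ?thesis by (simp only:)
  qed
  hence "R i = exp (beta * y) * (Re Q + Re ((cis (gamma i * y) - 1) * Q))" by (simp add: R_def)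
  also have "... \<le> exp (beta * y) * (Re Q + norm (cis (gamma i * y) - 1) * norm Q)"
   using complex_Re_le_cmod[of "(cis (gamma i * y) - 1) * Q"] by (intro mult_left_mono add_left_mono) (auto simp: norm_mult)
  also have "Re Q = pker beta (gamma i) - pker (beta + L) (gamma i)"
  proof -
   have "Q = 1 / z i - 1 / (z i + of_real L)" using z[of i] by (simp add: Q_def field_simps)
   also have "z i + of_real L = Complex (beta + L) (gamma i)" by (simp add: z_def complex_eq_iff)
   finally show ?thesis by (simp only: z_def minus_complex.sel Re_inverse_Complex)
  qed
  also have "norm (cis (gamma i * y) - 1) * norm Q \<le> eta * L * (qker beta (gamma i)) + 4 * L * (qker T (gamma i))"
  proof -
   have nQ: "norm Q \<le> L * (qker beta (gamma i))"
    using norm_zero_term[of beta L "gamma i" 0] beta L by (simp add: Q_def z_def)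
   show ?thesis
   proof (cases "\<bar>gamma i\<bar> \<le> T")
    case True
    have "norm (cis (gamma i * y) - 1) * norm Q \<le> eta * (L * (qker beta (gamma i)))"
     using approx[OF False True] nQ eta by (intro mult_mono) auto
    moreover have "4 * L * (qker T (gamma i)) \<ge> 0" using L by simp
    ultimately show ?thesis by (simp only: mult.assoc)
   next
    case F: False
    have g: "(gamma i)^2 \<ge> T^2" using F T power_mono[of T "\<bar>gamma i\<bar>" 2] by simp
    have T2: "T^2 > 0" using T by simp
    \<comment> \<open>Beyond \<open>T\<close> the kernel at \<open>beta\<close> is at most twice the
      one at \<open>T\<close>. With \<open>norm (cis x - 1) \<le> 2\<close> this is the factor 4,
      and \<open>qker T\<close> is chosen because its sum is again accessible, as
      \<open>p T / T\<close>.\<close>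
    have "qker beta (gamma i) \<le> 1 / ((T^2 + (gamma i)^2) / 2)"
    proof (intro divide_left_mono mult_pos_pos)
     show "(T^2 + (gamma i)^2) / 2 \<le> beta^2 + (gamma i)^2" using g by (simp add: add_increasing2)
     show "0 < beta^2 + (gamma i)^2" using g T2 zero_le_power2[of beta] by linarith
     have "0 < T^2 + (gamma i)^2" using g T2 by linarith
     thus "0 < (T^2 + (gamma i)^2) / 2" by simp
    qed simp
    hence i: "qker beta (gamma i) \<le> 2 * (qker T (gamma i))" by simp
    have "norm (cis (gamma i * y) - 1) \<le> norm (cis (gamma i * y)) + norm (1::complex)" by (rule norm_triangle_ineq4)
    hence "norm (cis (gamma i * y) - 1) * norm Q \<le> 2 * (L * (2 * (qker T (gamma i))))"
     using order_trans[OF nQ mult_left_mono[OF i]] L by (intro mult_mono) auto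
    moreover have "eta * L * (qker beta (gamma i)) \<ge> 0" using L eta by simp
    ultimately show ?thesis by simp
   qed
  qed
  finally have "R i \<le> exp (beta * y) * (pker beta (gamma i) - pker (beta + L) (gamma i) + (eta * L * (qker beta (gamma i)) + 4 * L * (qker T (gamma i))))"
   by simp
  from mult_left_mono[OF this w[of i]] show ?thesis
   by (rule order_trans) (simp only: ring_distribs mult.left_commute mult.assoc order.refl)
 qed simp
 define X where "X = exp (beta * y)"
 have sm: "(\<lambda>i. X * ((w i * (pker beta (gamma i)) - w i * (pker (beta + L) (gamma i)))
  + (eta * L * (w i * (qker beta (gamma i))) + 4 * L * (w i * (qker T (gamma i)))))) sums
  (X * ((p beta - p (beta + L)) + (eta * L * (p beta / beta) + 4 * L * (p T / T))))"
 proof -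
  have ps: "(\<lambda>i. w i * (pker u (gamma i))) sums p u" if "u > 0" for u unfolding p_def by (rule summable_sums[OF summable_w(2)[OF that]])
  have ps1: "(\<lambda>i. w i * (qker u (gamma i))) sums (p u / u)" if "u > 0" for u
   using sums_divide[OF ps[OF that], of u] that by (simp add: mult_ac)
  show ?thesis by (intro sums_mult sums_add sums_diff ps ps1) (use beta L T in auto)
 qed
 have sR: "summable (\<lambda>i. w i * R i)"
 proof (rule summable_comparison_test'[OF summable_mult[OF summable_w(1)[of beta], of "L * exp (beta * y)"]])
  fix i
  have "\<bar>R i\<bar> \<le> L * (qker beta (gamma i)) * exp (beta * y)"
   unfolding R_def z_def L_def using norm_zero_term[of beta "real l" "gamma i" y] beta l
   by (intro order_trans[OF abs_Re_le_cmod]) simp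
  from mult_left_mono[OF this w[of i]] show "norm (w i * R i) \<le> L * exp (beta * y) * (w i * (qker beta (gamma i)))"
   using w[of i] by (simp add: abs_mult mult_ac)
 qed (use beta in simp)
 have "(\<Sum>i. w i * R i) \<le> X * ((p beta - p (beta + L)) + (eta * L * (p beta / beta) + 4 * L * (p T / T)))"
  using suminf_le[OF R_le[folded X_def] sR sums_summable[OF sm]] sm by (simp add: sums_iff)
 also have "... = - (X * (p (beta + L) - p beta - eta * L * p beta / beta - 4 * L / T * p T))" by (simp add: algebra_simps)
 finally have 1: "(\<Sum>i. w i * R i) \<le> - (X * (p (beta + L) - p beta - eta * L * p beta / beta - 4 * L / T * p T))" .
 have "- (\<Sum>i. w i * R i) - p (beta + L) - 1 / alpha - 5 \<le> S alpha l y"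
  unfolding R_def z_def p_def S_def beta_def L_def
 proof (rule explicit_formula_lower_bound[where K = "ln (m / pi) / 2" and a = a])
  show "ln (m / pi) / 2 \<ge> - 1" using ln_m_pi(2) by linarith
  show "mangoldt 0 * psi 0 = 0" by simp
  show "(\<lambda>i. w i * (pker (s - 1/2) (gamma i))) sums
   (ln (m / pi) / 2 + Digamma ((s + real a) / 2) / 2 - (msum psi s))" if "s > 1" for s :: real
   by (rule zero[OF that])
 qed (use summable_V w alpha l y in auto)
 thus ?thesis using 1 unfolding X_def L_def by linarith
qed

text \<open>Every term is made explicit in \<open>D\<close>, a common bound for \<open>ln m\<close>
  over all characters, with \<open>alpha = 1 / D\<close>. The values of \<open>p\<close> at
  \<open>T\<close> and \<open>beta + l\<close> are bounded by \<open>p_upper\<close>, the one at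
  \<open>beta\<close> by \<open>p_mono\<close> from \<open>3/2\<close>.\<close>

lemma S_lower:
 assumes D: "D \<ge> 12" "ln m \<le> D" and l: "l \<ge> 2" and y: "y \<ge> 0" and T: "T \<ge> (2::nat)" and eta: "eta \<ge> 0"
  and approx: "\<And>i. w i \<noteq> 0 ==> \<bar>gamma i\<bar> \<le> real T ==> norm (cis (gamma i * y) - 1) \<le> eta"
 shows "S (1 / D) l y \<ge> exp ((1/2 - 1/D) * y) * (ln (real l) / 2 + V (1 + 1/D) - (14 + 3 * mangoldt_two)
   - 9 * eta * real l * (D + 1 + mangoldt_two) - 4 * real l / real T * (D + ln (real T) + 1 + mangoldt_two))
   - (3 * D + ln (real l + 1) + 6 + mangoldt_two)"
proof -
 define alpha where "alpha = 1 / D"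
 define beta where "beta = 1/2 - alpha"
 have alpha: "0 < alpha" "alpha \<le> 1/12" "1 / alpha = D" using D by (auto simp: alpha_def field_simps)
 have "alpha * ln m \<le> 1" using D by (simp add: alpha_def divide_le_eq)
 note gain = p_gain[OF alpha(1,2) this l, folded beta_def]
 have beta: "beta \<ge> 5/12" "beta < 1/2" using alpha by (auto simp: beta_def)
 have p32: "p (3/2) \<le> D / 2 + 1 + mangoldt_two" using p_three_halves D by linarith
 have "p beta \<le> (3/2) / beta * p (3/2)" by (rule p_mono) (use beta in auto)
 hence "p beta / beta \<le> ((3/2) / beta * p (3/2)) / beta" using beta by (intro divide_right_mono) auto
 also have "... = (3/2) / (beta * beta) * p (3/2)" by simp
 also have "... \<le> 9 * (D + 1 + mangoldt_two)"
 proof (rule mult_mono)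
  \<comment> \<open>\<open>(3/2) / (5/12)^2\<close> is 8.64, rounded up to 9.\<close>
  have "5/12 * (5/12) \<le> beta * beta" using beta by (intro mult_mono) auto
  thus "(3/2) / (beta * beta) \<le> 9" using beta by (simp add: divide_le_eq)
 qed (use p32 p_nonneg[of "3/2"] D in auto)
 finally have "eta * real l * (p beta / beta) \<le> eta * real l * (9 * (D + 1 + mangoldt_two))" using eta by (intro mult_left_mono) auto
 hence e1: "eta * real l * p beta / beta \<le> 9 * eta * real l * (D + 1 + mangoldt_two)" by (simp add: mult_ac)
 have lnT: "ln (real T) \<ge> 0" using T by simp
 have "p (real T) \<le> ln m / 2 + ln (real T) / 2 + 1/2 + mangoldt_two" by (rule p_upper) (use T in auto)
 hence "p (real T) \<le> D + ln (real T) + 1 + mangoldt_two" using D lnT by linarith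
 hence e2: "4 * real l / real T * p (real T) \<le> 4 * real l / real T * (D + ln (real T) + 1 + mangoldt_two)" by (intro mult_left_mono) auto
 have "p (beta + real l) \<le> ln m / 2 + ln (real (l + 1)) / 2 + 1/2 + mangoldt_two" by (rule p_upper) (use beta l in auto)
 moreover have "ln (real l + 1) \<ge> 0" by simp
 ultimately have e3: "p (beta + real l) \<le> D + ln (real l + 1) + 1 + mangoldt_two" using D by (simp only: of_nat_add of_nat_1)
 have "S alpha l y \<ge> exp (beta * y) * (p (beta + real l) - p beta - eta * real l * p beta / beta - 4 * real l / real T * p (real T)) - p (beta + real l) - 1 / alpha - 5"
  unfolding beta_def by (rule S_lower_aux[OF alpha(1,2) _ y _ eta approx]) (use l T in auto)
 moreover have "exp (beta * y) * (ln (real l) / 2 + V (1 + alpha) - (14 + 3 * mangoldt_two)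
   - 9 * eta * real l * (D + 1 + mangoldt_two) - 4 * real l / real T * (D + ln (real T) + 1 + mangoldt_two))
  \<le> exp (beta * y) * (p (beta + real l) - p beta - eta * real l * p beta / beta - 4 * real l / real T * p (real T))"
  by (rule mult_left_mono[OF _ exp_ge_zero]) (use gain e1 e2 in linarith)
 ultimately show ?thesis using e3 alpha(3) D unfolding beta_def alpha_def by linarith
qed

end

section \<open>The race\<close>

lemma character_zero_data:
 assumes q: "q \<ge> 3" and f: "f \<in> quadratic_characters q" and grh: "GRH_mod q"
 obtains m a psi w gamma where "zero_data m a psi w gamma" "m \<le> 8 * rad q" "\<And>n. coprime n q ==> f n = complex_of_real (psi n)"
proof -
 have q1: "q > 1" using q by simp
 obtain m psi where m: "quadratic_primitive m psi" "m \<le> 8 * rad q" "m dvd q" "\<And>n. coprime n q ==> f n = complex_of_real (psi n)"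
  using primitive_reduction[OF q1 f] by blast
 interpret P: quadratic_primitive m psi by (rule m(1))
 define a :: nat where "a = (if psi (m - 1) = 1 then 0 else 1)"
 interpret R: real_primitive_character m psi a "P.G 1" unfolding a_def by (rule P.real_primitive_character)
 have "Re s = 1/2" if "0 < Re s" "Re s < 1" "R.L_ext s = 0" for s
  by (rule R.L_ext_zero_critical_line[OF q1 m(3) _ m(4) grh that]) (use f in \<open>simp_all add: quadratic_characters_def\<close>)
 then obtain w gamma where w: "\<And>i. w i = 0 \<or> w i \<ge> 1"
  "\<And>s::real. s > 1 ==> (\<lambda>i. w i * (pker (s - 1/2) (gamma i))) sums
   (zero_side m a psi s)"
  using R.zero_family by blast
 have "zero_data m a psi w gamma"
  by unfold_locales (use R.m R.chi_0 R.abs_chi_le w in \<open>auto simp: a_def\<close>)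
 thus ?thesis using that m by blast
qed

lemma geometric_sum_inverse:
 fixes p :: real
 assumes "p > 1"
 shows "(\<Sum>k=1..N. 1 / p ^ k) \<le> 1 / (p - 1)"
proof -
 have "(p - 1) * (\<Sum>k=1..N. 1 / p ^ k) = 1 - 1 / p ^ N"
 proof (induction N)
  case (Suc N)
  have "(p - 1) * (\<Sum>k=1..Suc N. 1 / p ^ k) = (p - 1) * (\<Sum>k=1..N. 1 / p ^ k) + (p - 1) * (1 / p ^ Suc N)"
   by (simp add: distrib_left)
  also have "... = 1 - 1 / p ^ N + (p - 1) * (1 / p ^ Suc N)" by (simp only: Suc)
  also have "... = 1 - 1 / p ^ Suc N" using assms by (simp add: field_simps)
  finally show ?case .
 qed simp
 hence "(\<Sum>k=1..N. 1 / p ^ k) = (1 - 1 / p ^ N) / (p - 1)" using assms by (simp add: field_simps)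
 also have "... \<le> 1 / (p - 1)" using assms by (intro divide_right_mono) auto
 finally show ?thesis .
qed

text \<open>Each prime dividing \<open>q\<close> contributes at most \<open>ln p\<close> times the
  geometric series in \<open>1 / p\<close>. These are the arguments where a primitive character may
  be nonzero although the character modulo \<open>q\<close> vanishes.\<close>

lemma sum_mangoldt_noncoprime:
 assumes q: "q > 0" and s: "s \<ge> 1"
 shows "(\<Sum>n<N. if coprime n q then 0 else mangoldt n * real n powr (- s)) \<le> (\<Sum>p\<in>prime_factors q. ln (real p) / (real p - 1))"
proof -
 define F where "F = (\<lambda>n. mangoldt n * real n powr (- s))"
 define Y where "Y = {n. n < N \<and> \<not> coprime n q \<and> primepow n}"
 have F0: "F n \<ge> 0" for n by (simp add: F_def mangoldt_nonneg)
 have "(\<Sum>n<N. if coprime n q then 0 else F n) = (\<Sum>n\<in>Y. F n)"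
  by (rule sum.mono_neutral_cong_right) (auto simp: Y_def F_def mangoldt_def)
 also have "... \<le> (\<Sum>n\<in>(\<lambda>(p, k). p ^ k) ` (prime_factors q \<times> {1..N}). F n)"
 proof (rule sum_mono2)
  show "Y \<subseteq> (\<lambda>(p, k). p ^ k) ` (prime_factors q \<times> {1..N})"
  proof
   fix n assume n: "n \<in> Y"
   then obtain p k where pk: "prime p" "k > 0" "n = p ^ k" by (auto simp: Y_def primepow_def)
   have "\<not> coprime p q" using n pk by (simp add: Y_def)
   hence pq: "p dvd q" using pk(1) prime_imp_coprime by blast
   have "2 ^ k \<le> p ^ k" using prime_ge_2_nat[OF pk(1)] by (intro power_mono) auto
   moreover have "p ^ k < N" using n pk(3) by (simp add: Y_def)
   moreover have "k < 2 ^ k" by (rule less_exp)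
   ultimately have "k \<le> N" by linarith
   hence "(p, k) \<in> prime_factors q \<times> {1..N}" using pk pq q by (auto simp: in_prime_factors_iff)
   thus "n \<in> (\<lambda>(p, k). p ^ k) ` (prime_factors q \<times> {1..N})" using pk(3) by force
  qed
 qed (use F0 in auto)
 also have "... \<le> (\<Sum>(p, k)\<in>prime_factors q \<times> {1..N}. F (p ^ k))"
  using sum_image_le[of "prime_factors q \<times> {1..N}" F "\<lambda>(p, k). p ^ k"] F0 by (simp add: o_def case_prod_unfold)
 also have "... = (\<Sum>p\<in>prime_factors q. \<Sum>k=1..N. F (p ^ k))" by (rule sum.cartesian_product[symmetric])
 also have "... \<le> (\<Sum>p\<in>prime_factors q. ln (real p) / (real p - 1))"
 proof (rule sum_mono)
  fix p assume "p \<in> prime_factors q"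
  hence p: "prime p" "real p \<ge> 2" using prime_ge_2_nat[of p] by (auto simp: in_prime_factors_iff)
  have "(\<Sum>k=1..N. F (p ^ k)) \<le> (\<Sum>k=1..N. ln (real p) * (1 / real p ^ k))"
  proof (rule sum_mono)
   fix k assume k: "k \<in> {1..N}"
   have p1: "real (p ^ k) \<ge> 1" using p by simp
   have "real (p ^ k) powr (- s) \<le> real (p ^ k) powr (- 1)" using s p1 by (intro powr_mono) auto
   also have "... = 1 / real p ^ k" using p1 by (simp add: powr_minus_divide)
   finally have "ln (real p) * real (p ^ k) powr (- s) \<le> ln (real p) * (1 / real p ^ k)" using p by (intro mult_left_mono) auto
   moreover have "mangoldt (p ^ k) = ln (real p)" using p k by (subst mangoldt_primepow') auto
   ultimately show "F (p ^ k) \<le> ln (real p) * (1 / real p ^ k)" by (simp only: F_def)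
  qed
  also have "... = ln (real p) * (\<Sum>k=1..N. 1 / real p ^ k)" by (rule sum_distrib_left[symmetric])
  also have "... \<le> ln (real p) * (1 / (real p - 1))" using p by (intro mult_left_mono geometric_sum_inverse) auto
  finally show "(\<Sum>k=1..N. F (p ^ k)) \<le> ln (real p) / (real p - 1)" by simp
 qed
 finally show ?thesis by (simp only: F_def)
qed

lemma norm_cis_minus_one: "norm (cis x - 1) \<le> \<bar>x\<bar>"
proof -
 have "norm (cis x - 1) = 2 * \<bar>sin (x / 2)\<bar>" using dist_exp_i_1[of x] by (simp add: cis_conv_exp)
 also have "... \<le> 2 * \<bar>x / 2\<bar>" by (intro mult_left_mono abs_sin_x_le_abs_x) auto
 finally show ?thesis by simp
qed

text \<open>The times are multiples of \<open>\<Delta>\<close>, so that \<open>k > 0\<close> bounds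
  them below; Dirichlet's theorem alone could return a short time, at which the main term is still
  small.\<close>

lemma simultaneous_phases:
 fixes g :: "'a \<Rightarrow> real" and M \<Delta> :: nat
 assumes Z: "finite Z" and M: "M > 0" and \<Delta>: "\<Delta> > 0"
 obtains k :: nat where "k > 0" "k \<le> M ^ card Z" "\<And>z. z \<in> Z ==> norm (cis (g z * real (k * \<Delta>)) - 1) \<le> 2 * pi / real M"
proof -
 obtain h where h: "bij_betw h {0..<card Z} Z" using ex_bij_betw_nat_finite[OF Z] by blast
 define theta where "theta = (\<lambda>j. g (h j) * real \<Delta> / (2 * pi))"
 obtain k p where kp: "0 < k" "k \<le> int (M ^ card Z)" "\<And>j. j < card Z ==> \<bar>of_int k * theta j - of_int (p j)\<bar> < 1 / M"
  using Dirichlet_approx_simult[OF M, of "card Z" theta] by blast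
 show ?thesis
 proof (rule that[of "nat k"])
  show "nat k > 0" using kp(1) by simp
  show "nat k \<le> M ^ card Z" using kp(2) by (simp only: nat_le_iff)
  fix z assume "z \<in> Z"
  then obtain j where j: "j < card Z" "z = h j" using h unfolding bij_betw_def by (metis atLeastLessThan_iff imageE)
  define x where "x = of_int k * theta j - of_int (p j)"
  have "g z * real (nat k * \<Delta>) = 2 * pi * x + 2 * pi * of_int (p j)" using kp(1) j by (simp add: x_def theta_def field_simps)
  hence "cis (g z * real (nat k * \<Delta>)) = cis (2 * pi * x)" by (simp add: cis_mult[symmetric] cis_multiple_2pi)
  hence "norm (cis (g z * real (nat k * \<Delta>)) - 1) \<le> \<bar>2 * pi * x\<bar>" using norm_cis_minus_one by simp
  also have "... = 2 * pi * \<bar>x\<bar>" by (simp add: abs_mult)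
  also have "... \<le> 2 * pi * (1 / M)" using kp(3)[OF j(1)] by (intro mult_left_mono) (auto simp: x_def)
  finally show "norm (cis (g z * real (nat k * \<Delta>)) - 1) \<le> 2 * pi / real M" by simp
 qed
qed

definition character_sum :: "nat \<Rightarrow> nat \<Rightarrow> real" where
 "character_sum q n = Re (\<Sum>f\<in>quadratic_characters q. f n)"

definition prime_race :: "nat \<Rightarrow> nat \<Rightarrow> real" where
 "prime_race q n = (\<Sum>k\<le>n. if prime k then character_sum q k else 0)"

lemma character_sum_eq:
 assumes "q > 1"
 shows "character_sum q n = (if coprime n q then (if n mod q \<in> quad_res q then real (rho q) else 0) - 1 else 0)"
proof (cases "coprime n q")
 case False
 hence "f n = 0" if "f \<in> quadratic_characters q" for f using that by (auto simp: quadratic_characters_def dirichlet_character_def)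
 hence "(\<Sum>f\<in>quadratic_characters q. f n) = 0" by (intro sum.neutral) blast
 thus ?thesis using False by (simp only: character_sum_def) simp
next
 case True
 have "(\<Sum>f\<in>quadratic_characters q. f n) = of_real ((if n mod q \<in> quad_res q then real (rho q) else 0) - 1)"
  using quadratic_characters_sum[OF assms True] by simp
 thus ?thesis using True unfolding character_sum_def by (simp only: Re_complex_of_real if_True)
qed

lemma rho_pos: "q > 1 ==> rho q \<ge> 1"
 using card_quadratic_characters[of q] by simp

lemma abs_character_sum_le: "q > 1 ==> \<bar>character_sum q n\<bar> \<le> real (rho q)"
 using rho_pos[of q] by (auto simp: character_sum_eq)

lemma sum_primes_count:
 assumes q: "q > 1" and A: "A \<subseteq> totatives q"
 shows "(\<Sum>a\<in>A. real (primes_count (real n) q a)) = (\<Sum>k\<le>n. if prime k \<and> k mod q \<in> A then 1 else 0)"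
proof -
 have finA: "finite A" using A by (rule finite_subset) simp
 have "(\<Sum>a\<in>A. real (primes_count (real n) q a)) = (\<Sum>a\<in>A. \<Sum>k\<le>n. if prime k \<and> k mod q = a then 1 else 0)"
 proof (rule sum.cong[OF refl])
  fix a assume "a \<in> A"
  hence "a mod q = a" using A totatives_D[OF q] by auto
  hence "{p. prime p \<and> real p \<le> real n \<and> [p = a] (mod q)} = {..n} \<inter> {k. prime k \<and> k mod q = a}" by (auto simp: cong_def)
  hence "real (primes_count (real n) q a) = (\<Sum>k\<in>{..n} \<inter> {k. prime k \<and> k mod q = a}. 1)" by (simp add: primes_count_def)
  also have "... = (\<Sum>k\<le>n. if prime k \<and> k mod q = a then 1 else 0)" by (subst sum.inter_restrict) auto
  finally show "real (primes_count (real n) q a) = (\<Sum>k\<le>n. if prime k \<and> k mod q = a then 1 else 0)" .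
 qed
 also have "... = (\<Sum>k\<le>n. \<Sum>a\<in>A. if prime k \<and> k mod q = a then 1 else 0)" by (rule sum.swap)
 also have "... = (\<Sum>k\<le>n. if prime k \<and> k mod q \<in> A then 1 else 0)"
 proof (rule sum.cong[OF refl])
  fix k
  show "(\<Sum>a\<in>A. if prime k \<and> k mod q = a then 1 else 0) = (if prime k \<and> k mod q \<in> A then 1 else (0::real))"
   using finA by (cases "prime k") (simp_all add: sum.delta')
 qed
 finally show ?thesis .
qed

text \<open>There are \<open>rho q - 1\<close> times as many nonresidues as residues, so
  \<open>prime_race\<close> is the difference of the two averages multiplied by the number of
  nonresidues.\<close>

lemma x_first_le:
 assumes q: "q > 1" and rho: "rho q \<ge> 2" and n: "n \<ge> 2" and pos: "prime_race q n > 0"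
 shows "x_first q \<le> ereal (real n)"
proof -
 define R where "R = (\<Sum>a\<in>quad_res q. real (primes_count (real n) q a))"
 define NR where "NR = (\<Sum>a\<in>quad_nonres q. real (primes_count (real n) q a))"
 have subs: "quad_res q \<subseteq> totatives q" "quad_nonres q \<subseteq> totatives q" by (auto simp: quad_res_def quad_nonres_def)
 have "prime_race q n = (\<Sum>k\<le>n. (real (rho q) - 1) * (if prime k \<and> k mod q \<in> quad_res q then 1 else 0) - (if prime k \<and> k mod q \<in> quad_nonres q then 1 else 0))"
  unfolding prime_race_def
 proof (rule sum.cong[OF refl])
  fix k
  show "(if prime k then character_sum q k else 0) = (real (rho q) - 1) * (if prime k \<and> k mod q \<in> quad_res q then 1 else 0) - (if prime k \<and> k mod q \<in> quad_nonres q then 1 else 0)"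
   using character_sum_eq[OF q, of k] mod_in_totatives[OF q, of k] subs by (auto simp: quad_nonres_def)
 qed
 also have "... = (real (rho q) - 1) * R - NR"
  unfolding R_def NR_def sum_primes_count[OF q subs(1)] sum_primes_count[OF q subs(2)] sum_subtractf sum_distrib_left ..
 finally have main: "NR < (real (rho q) - 1) * R" using pos by simp
 define c where "c = card (quad_res q)"
 have cr: "c * rho q = card (totatives q)" using card_quad_res[OF q] by (simp add: c_def totient_def)
 have "card (totatives q) > 0" using q by (simp add: totient_def[symmetric])
 hence c0: "c > 0" using cr by (intro gr0I) auto
 have "card (quad_nonres q) = card (totatives q) - c"
  unfolding quad_nonres_def c_def by (rule card_Diff_subset) (use subs in \<open>auto intro: finite_subset\<close>)
 hence nr: "real (card (quad_nonres q)) = real c * (real (rho q) - 1)"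
  using cr[symmetric] rho c0 by (simp add: of_nat_diff algebra_simps)
 have "NR / (real c * (real (rho q) - 1)) < ((real (rho q) - 1) * R) / (real c * (real (rho q) - 1))"
  using main c0 rho by (intro divide_strict_right_mono) auto
 also have "... = R / real c" using rho by simp
 finally have "1 / real (card (quad_res q)) * R > 1 / real (card (quad_nonres q)) * NR" unfolding nr c_def[symmetric] by simp
 thus ?thesis unfolding x_first_def R_def NR_def using n by (intro Inf_lower) auto
qed

text \<open>After \<open>r \<ge> 8\<close> the conditions concern, in order: phase error, zeros
  beyond \<open>T\<close>, net gain, secondary terms against the main exponential, number of zeros,
  size of \<open>y\<close>. The net gain is positive for large \<open>r\<close> because 20 exceeds
  6.\<close>

lemma eventually_race_inequalities:
 fixes C1 C2 C3 C4 :: real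
 shows "\<forall>\<^sub>F r in at_top. (r::real) \<ge> 8 \<and> 9 * (r + 1 + C1) / r ^ 3 \<le> 1 \<and> 4 * (r + 44 * ln r + 1 + C1) / r ^ 4 \<le> 1
  \<and> (r - 1) * (20 * ln r - C2) - (r + C3) - r * (6 * ln r + C4) - 18 * r \<ge> 1
  \<and> 18 * r * exp (2 * r) + r * r + r * (3 * r + 41 * ln r + 6 + C1) < exp (5/12 * r ^ 2)
  \<and> r * ((9/4 + r ^ 88) * (2/3 * (r / 2 + 1 + C1))) \<le> r ^ 91
  \<and> 2 * ln r + r ^ 91 * (44 * ln r) \<le> r ^ 92"
proof (intro eventually_conj)
 show "\<forall>\<^sub>F r in at_top. (r::real) \<ge> 8" by real_asymp
 show "\<forall>\<^sub>F r in at_top. 9 * (r + 1 + C1) / r ^ 3 \<le> (1::real)" by real_asymp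
 show "\<forall>\<^sub>F r in at_top. 4 * (r + 44 * ln r + 1 + C1) / r ^ 4 \<le> (1::real)" by real_asymp
 show "\<forall>\<^sub>F r in at_top. (r - 1) * (20 * ln r - C2) - (r + C3) - r * (6 * ln r + C4) - 18 * r \<ge> (1::real)" by real_asymp
 show "\<forall>\<^sub>F r in at_top. 18 * r * exp (2 * r) + r * r + r * (3 * r + 41 * ln r + 6 + C1) < exp (5/12 * (r::real) ^ 2)" by real_asymp
 show "\<forall>\<^sub>F r in at_top. r * ((9/4 + r ^ 88) * (2/3 * (r / 2 + 1 + C1))) \<le> (r::real) ^ 91" by real_asymp
 show "\<forall>\<^sub>F r in at_top. 2 * ln r + r ^ 91 * (44 * ln r) \<le> (r::real) ^ 92" by real_asymp
qed

text \<open>The data of all quadratic characters modulo \<open>q\<close>, given as functions of the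
  character so that their lower bounds can be added.\<close>

locale character_family =
 fixes q :: nat and X :: "(nat \<Rightarrow> complex) set" and m a :: "(nat \<Rightarrow> complex) \<Rightarrow> nat"
  and psi w gamma :: "(nat \<Rightarrow> complex) \<Rightarrow> nat \<Rightarrow> real"
 assumes q: "q \<ge> 3" and X_def: "X = quadratic_characters q"
  and data: "\<And>f. f \<in> X ==> zero_data (m f) (a f) (psi f) (w f) (gamma f)"
  and conductor: "\<And>f. f \<in> X ==> m f \<le> 8 * rad q"
  and lift: "\<And>f n. f \<in> X ==> coprime n q ==> f n = complex_of_real (psi f n)"
begin

lemma q1: "q > 1" using q by simp

lemma finX: "finite X" unfolding X_def by (rule finite_quadratic_characters[OF q1])

lemma cardX: "real (card X) = real (rho q) - 1"
 using card_quadratic_characters[OF q1] by (simp add: X_def)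

lemma abs_sum_psi: "\<bar>\<Sum>f\<in>X. psi f n\<bar> \<le> real (rho q)"
proof -
 have "\<bar>\<Sum>f\<in>X. psi f n\<bar> \<le> (\<Sum>f\<in>X. 1)"
  by (intro order_trans[OF sum_abs sum_mono] zero_data.psi1[OF data])
 thus ?thesis using cardX by simp
qed

lemma sum_psi_coprime: "coprime n q ==> (\<Sum>f\<in>X. psi f n) = character_sum q n"
proof -
 assume n: "coprime n q"
 have "(\<Sum>f\<in>X. f n) = of_real (\<Sum>f\<in>X. psi f n)" using lift[OF _ n] by simp
 thus ?thesis by (simp only: character_sum_def X_def Re_complex_of_real)
qed

lemma prime_factors_D: "p \<in> prime_factors q ==> prime p \<and> real p \<ge> 2"
 using prime_ge_2_nat[of p] by (auto simp: in_prime_factors_iff)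

lemma sum_ln_prime_factors: "(\<Sum>p\<in>prime_factors q. ln (real p)) = ln (real (rad q))"
 using ln_prod[of "prime_factors q" real] prime_factors_D by (fastforce simp: rad_def)

lemma rad_pos: "rad q > 0" unfolding rad_def using prime_factors_D by (intro prod_pos) fastforce

text \<open>Adding separate bounds for each \<open>V\<close> would lose the whole series once per
  character. Summed over characters first, the coefficient at a unit is at least -1, so the series
  is lost only once. Elsewhere the coefficient may reach \<open>- rho q\<close>, but there only
  powers of primes dividing \<open>q\<close> count.\<close>

lemma sum_V_lower:
 assumes e: "0 < e" "e \<le> 1"
 shows "(\<Sum>f\<in>X. zero_data.V (psi f) (1 + e)) \<ge> - (\<Sum>n. mangoldt n * real n powr (- (1 + e)))
   - real (rho q) * (\<Sum>p\<in>prime_factors q. ln (real p) / (real p - 1))"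
proof -
 define s where "s = 1 + e"
 have s: "s > 1" using e by (simp add: s_def)
 define Q where "Q = (\<Sum>p\<in>prime_factors q. ln (real p) / (real p - 1))"
 define G where "G = (\<lambda>n. mangoldt n * real n powr (- s))"
 define NC where "NC = (\<lambda>n. if coprime n q then 0 else mangoldt n * real n powr (- s))"
 have G0: "G n \<ge> 0" for n by (simp add: G_def mangoldt_nonneg)
 have sG: "summable G" unfolding G_def by (rule summable_mangoldt_powr[OF s])
 have sNC: "summable NC" by (rule summable_comparison_test'[OF sG]) (auto simp: NC_def G_def mangoldt_nonneg)
 have NC_le: "suminf NC \<le> Q" unfolding Q_def NC_def
  by (rule suminf_le_const[OF sNC[unfolded NC_def] sum_mangoldt_noncoprime]) (use s q in auto)
 have sV: "summable (\<lambda>n. mangoldt n * psi f n * real n powr (- s))" if "f \<in> X" for f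
  by (rule summable_rabs_cancel) (use zero_data.summable_V[OF data[OF that] s] in \<open>simp add: abs_mult\<close>)
 have "(\<Sum>f\<in>X. zero_data.V (psi f) s) = (\<Sum>f\<in>X. \<Sum>n. mangoldt n * psi f n * real n powr (- s))"
  by (rule sum.cong[OF refl]) (rule zero_data.V_def[OF data])
 also have "... = (\<Sum>n. \<Sum>f\<in>X. mangoldt n * psi f n * real n powr (- s))"
  by (rule suminf_sum[symmetric]) (rule sV)
 also have "... \<ge> (\<Sum>n. - G n - real (rho q) * NC n)"
 proof (rule suminf_le)
  show "summable (\<lambda>n. - G n - real (rho q) * NC n)" by (intro summable_diff summable_minus summable_mult sG sNC)
  show "summable (\<lambda>n. \<Sum>f\<in>X. mangoldt n * psi f n * real n powr (- s))" by (intro summable_sum sV)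
  fix n
  have eq: "(\<Sum>f\<in>X. mangoldt n * psi f n * real n powr (- s)) = G n * (\<Sum>f\<in>X. psi f n)"
   by (simp add: G_def sum_distrib_left mult_ac)
  show "- G n - real (rho q) * NC n \<le> (\<Sum>f\<in>X. mangoldt n * psi f n * real n powr (- s))"
  proof (cases "coprime n q")
   case True
   have "(\<Sum>f\<in>X. psi f n) \<ge> - 1" using True by (simp add: sum_psi_coprime character_sum_eq[OF q1])
   from mult_left_mono[OF this G0[of n]] show ?thesis unfolding eq using True by (simp add: NC_def)
  next
   case False
   have "(\<Sum>f\<in>X. psi f n) \<ge> - real (rho q)" using abs_sum_psi[of n] by linarith
   from mult_left_mono[OF this G0[of n]] show ?thesis unfolding eq using False G0[of n] by (simp add: NC_def G_def mult_ac)
  qed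
 qed
 also have "(\<Sum>n. - G n - real (rho q) * NC n) = - suminf G - real (rho q) * suminf NC"
  using suminf_diff[OF summable_minus[OF sG] summable_mult[OF sNC, of "real (rho q)"]] suminf_minus[OF sG] suminf_mult[OF sNC, of "real (rho q)"] by simp
 finally have "(\<Sum>f\<in>X. zero_data.V (psi f) s) \<ge> - suminf G - real (rho q) * suminf NC" .
 moreover have "real (rho q) * suminf NC \<le> real (rho q) * Q" using NC_le by (intro mult_left_mono) auto
 ultimately show ?thesis unfolding s_def[symmetric] G_def Q_def by linarith
qed

text \<open>Primes not dividing \<open>q\<close> reproduce the race with weight \<open>F\<close>;
  primes dividing \<open>q\<close> cost at most \<open>ln (rad q)\<close> per character, and proper
  prime powers the 18 of \<open>sum_mangoldt_prime_powers\<close>.\<close>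

lemma sum_S_upper:
 fixes alpha y :: real and l :: nat
 assumes alpha: "0 < alpha" "alpha \<le> 1/12" and y: "y \<ge> 0"
 defines "N \<equiv> nat \<lfloor>exp y\<rfloor>"
 defines "F \<equiv> \<lambda>k. ln (real k) * exp (- (alpha * ln (real k))) * (1 - exp (- (real l * (y - ln (real k)))))"
 shows "(\<Sum>f\<in>X. zero_data.S (psi f) alpha l y) \<le> (\<Sum>k\<le>N. (if prime k then character_sum q k else 0) * F k)
  + real (rho q) * ln (real (rad q)) + 18 * real (rho q) * exp ((1/2 - alpha) * y)"
proof -
 define J where "J = {n::nat. n > 0 \<and> ln (real n) \<le> y}"
 define r where "r = real (rho q)"
 have J_iff: "n \<in> J \<longleftrightarrow> n > 0 \<and> real n \<le> exp y" for n
  unfolding J_def using ln_le_cancel_iff[of "real n" "exp y"] by auto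
 have J: "J = {1..N}" unfolding set_eq_iff J_iff N_def by (auto simp: le_nat_floor Suc_le_eq le_floor_iff nat_le_iff le_nat_iff)
 have finJ: "finite J" by (simp add: J)
 define g where "g = (\<lambda>n. real n powr (- alpha) * (1 - exp (- (real l * (y - ln (real n))))))"
 have g: "0 \<le> g n" "g n \<le> real n powr (- alpha)" "g n \<le> 1" if "n \<in> J" for n
 proof -
  have n: "n > 0" "ln (real n) \<le> y" using that by (auto simp: J_def)
  have "0 \<le> real l * (y - ln (real n))" using n by simp
  hence h: "0 \<le> 1 - exp (- (real l * (y - ln (real n))))" "1 - exp (- (real l * (y - ln (real n)))) \<le> 1" by auto
  show "0 \<le> g n" unfolding g_def by (intro mult_nonneg_nonneg h) auto
  show "g n \<le> real n powr (- alpha)" unfolding g_def using mult_left_mono[OF h(2), of "real n powr (- alpha)"] by simp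
  also have "real n powr (- alpha) \<le> real n powr 0" using n alpha by (intro powr_mono) auto
  finally show "g n \<le> 1" using n by simp
 qed
 have "(\<Sum>f\<in>X. zero_data.S (psi f) alpha l y) = (\<Sum>f\<in>X. \<Sum>n\<in>J. mangoldt n * psi f n * real n powr (- alpha) * (1 - exp (- (real l * (y - ln (real n))))))"
  unfolding J_def by (rule sum.cong[OF refl]) (rule zero_data.S_def[OF data])
 also have "... = (\<Sum>n\<in>J. \<Sum>f\<in>X. mangoldt n * psi f n * real n powr (- alpha) * (1 - exp (- (real l * (y - ln (real n))))))" by (rule sum.swap)
 also have "... = (\<Sum>n\<in>J. mangoldt n * g n * (\<Sum>f\<in>X. psi f n))"
  unfolding sum_distrib_left by (intro sum.cong[OF refl]) (simp add: g_def mult_ac)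
 also have "... \<le> (\<Sum>n\<in>J. (if prime n then character_sum q n else 0) * F n + (if n \<in> prime_factors q then r * ln (real n) else 0)
   + (if \<not> prime n then r * (mangoldt n * real n powr (- alpha)) else 0))"
 proof (rule sum_mono)
  fix n assume n: "n \<in> J"
  have abs: "mangoldt n * g n * (\<Sum>f\<in>X. psi f n) \<le> mangoldt n * g n * r"
   using abs_sum_psi[of n] g(1)[OF n] mangoldt_nonneg[of n] by (intro mult_left_mono) (auto simp: r_def)
  show "mangoldt n * g n * (\<Sum>f\<in>X. psi f n) \<le> (if prime n then character_sum q n else 0) * F n + (if n \<in> prime_factors q then r * ln (real n) else 0)
   + (if \<not> prime n then r * (mangoldt n * real n powr (- alpha)) else 0)"
  proof (cases "prime n")
   case True
   show ?thesis
   proof (cases "n dvd q")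
    case dvd: True
    hence nc: "\<not> coprime n q" using True by (metis coprime_absorb_left not_prime_unit)
    have pf: "n \<in> prime_factors q" using True dvd q by (simp add: in_prime_factors_iff)
    have "ln (real n) * g n * r \<le> ln (real n) * 1 * r"
     using g[OF n] True prime_ge_1_nat[of n] by (intro mult_right_mono mult_left_mono) (auto simp: r_def)
    thus ?thesis using abs True nc pf by (simp add: character_sum_eq[OF q1] mult_ac)
   next
    case False
    hence c: "coprime n q" using True by (simp add: prime_imp_coprime)
    have "real n powr (- alpha) = exp (- (alpha * ln (real n)))" using n by (simp add: J_def powr_def)
    hence "ln (real n) * g n = F n" by (simp add: F_def g_def mult.assoc)
    thus ?thesis using True False by (simp add: sum_psi_coprime[OF c] in_prime_factors_iff mult.commute)
   qed
  next
   case False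
   have "mangoldt n * g n * r \<le> mangoldt n * real n powr (- alpha) * r"
    using g(2)[OF n] mangoldt_nonneg[of n] by (intro mult_right_mono mult_left_mono) (auto simp: r_def)
   thus ?thesis using abs False by (simp add: in_prime_factors_iff mult_ac)
  qed
 qed
 also have "... = (\<Sum>n\<in>J. (if prime n then character_sum q n else 0) * F n) + (\<Sum>n\<in>J. if n \<in> prime_factors q then r * ln (real n) else 0)
   + (\<Sum>n\<in>J. if \<not> prime n then r * (mangoldt n * real n powr (- alpha)) else 0)" by (simp add: sum.distrib)
 also have "(\<Sum>n\<in>J. (if prime n then character_sum q n else 0) * F n) = (\<Sum>k\<le>N. (if prime k then character_sum q k else 0) * F k)"
  unfolding J by (rule sum.mono_neutral_left) (auto simp: not_le)
 also have "(\<Sum>n\<in>J. if n \<in> prime_factors q then r * ln (real n) else 0) \<le> r * ln (real (rad q))"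
 proof -
  have "(\<Sum>n\<in>J. if n \<in> prime_factors q then r * ln (real n) else 0) = (\<Sum>n\<in>J \<inter> prime_factors q. r * ln (real n))"
   using finJ by (simp add: sum.inter_restrict)
  also have "... \<le> (\<Sum>n\<in>prime_factors q. r * ln (real n))"
  proof (rule sum_mono2)
   show "r * ln (real p) \<ge> 0" if "p \<in> prime_factors q - J \<inter> prime_factors q" for p
    using prime_factors_D[of p] that by (auto simp: r_def)
  qed auto
  also have "... = r * ln (real (rad q))" by (simp add: sum_distrib_left[symmetric] sum_ln_prime_factors)
  finally show ?thesis .
 qed
 also have "(\<Sum>n\<in>J. if \<not> prime n then r * (mangoldt n * real n powr (- alpha)) else 0) \<le> 18 * r * exp ((1/2 - alpha) * y)"
 proof -
  have "(\<Sum>n\<in>J. if \<not> prime n then r * (mangoldt n * real n powr (- alpha)) else 0) = (\<Sum>n\<in>{n\<in>J. \<not> prime n}. r * (mangoldt n * real n powr (- alpha)))"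
   using finJ by (simp add: sum.inter_filter)
  also have "... = r * (\<Sum>n\<in>{n\<in>J. \<not> prime n}. mangoldt n * real n powr (- alpha))" by (rule sum_distrib_left[symmetric])
  finally have eq: "(\<Sum>n\<in>J. if \<not> prime n then r * (mangoldt n * real n powr (- alpha)) else 0) = r * (\<Sum>n\<in>{n\<in>J. \<not> prime n}. mangoldt n * real n powr (- alpha))" .
  have "(\<Sum>n\<in>{n\<in>J. \<not> prime n}. mangoldt n * real n powr (- alpha)) \<le> (\<Sum>n | real n \<le> exp y \<and> \<not> prime n. mangoldt n * real n powr (- alpha))"
  proof (rule sum_mono2)
   show "finite {n. real n \<le> exp y \<and> \<not> prime n}" by (rule finite_subset[of _ "{..N}"]) (auto simp: N_def le_nat_floor)
  qed (auto simp: J_iff mangoldt_nonneg)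
  also have "... \<le> 18 * exp y powr (1/2 - alpha)" by (rule sum_mangoldt_prime_powers) (use alpha y in auto)
  also have "exp y powr (1/2 - alpha) = exp ((1/2 - alpha) * y)" by (simp add: powr_def)
  finally have "r * (\<Sum>n\<in>{n\<in>J. \<not> prime n}. mangoldt n * real n powr (- alpha)) \<le> r * (18 * exp ((1/2 - alpha) * y))"
   by (rule mult_left_mono) (simp add: r_def)
  thus ?thesis unfolding eq by (simp only: mult.assoc mult.left_commute)
 qed
 finally show ?thesis by (simp add: r_def)
qed

text \<open>With \<open>E = exp ((1/2 - alpha) * y)\<close>, a race that is never positive up to
  \<open>exp y\<close> bounds the sum of all \<open>S\<close> above by \<open>18 * r * E\<close>,
  whereas the zeros force at least \<open>(18 * r + 1) * E\<close>, both up to terms of lower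
  order.\<close>

lemma exists_positive_race:
 fixes Ca Cb :: real
 defines "r \<equiv> real (rho q)"
 assumes Ca: "\<And>e. 0 < e ==> e \<le> 1 ==> (\<Sum>n. mangoldt n * real n powr (- (1 + e))) \<le> 1 / e + Ca"
  and Cb: "(\<Sum>p\<in>prime_factors q. ln (real p) / (real p - 1)) \<le> 6 * ln r + Cb"
  and D: "ln (8 * real (rad q)) + 12 \<le> r"
  and r8: "r \<ge> 8" and r1: "9 * (r + 1 + mangoldt_two) / r ^ 3 \<le> 1" and r2: "4 * (r + 44 * ln r + 1 + mangoldt_two) / r ^ 4 \<le> 1"
  and r3: "(r - 1) * (20 * ln r - (16 + 3 * mangoldt_two)) - (r + Ca) - r * (6 * ln r + Cb) - 18 * r \<ge> 1"
  and r4: "18 * r * exp (2 * r) + r * r + r * (3 * r + 41 * ln r + 6 + mangoldt_two) < exp (5/12 * r ^ 2)"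
  and r5: "r * ((9/4 + r ^ 88) * (2/3 * (r / 2 + 1 + mangoldt_two))) \<le> r ^ 91"
  and r6: "2 * ln r + r ^ 91 * (44 * ln r) \<le> r ^ 92"
 shows "\<exists>n\<ge>2. prime_race q n > 0 \<and> real n \<le> exp (exp (exp (92 * ln r)))"
proof -

 \<comment> \<open>Parameters\<close>
 define Q where "Q = ln (8 * real (rad q)) + 12"
 \<comment> \<open>\<open>Q\<close> bounds \<open>ln m\<close> for all characters, and its summand
   12 ensures \<open>alpha \<le> 1/12\<close>.\<close>
 define alpha where "alpha = 1 / Q"
 \<comment> \<open>\<open>ln l / 2 = 20 * ln r\<close> has to exceed the \<open>6 * ln r\<close>
   lost at primes dividing \<open>q\<close>. Then \<open>T = l * r ^ 4\<close> makes the cost of the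
   zeros beyond \<open>T\<close> of order \<open>1 / r ^ 3\<close>.\<close>
 define l where "l = rho q ^ 40"
 define T where "T = rho q ^ 44"
 define eta where "eta = 2 * pi / r ^ 44"
 have rn: "real l = r ^ 40" "real T = r ^ 44" by (simp_all add: l_def T_def r_def)
 have rho8: "rho q \<ge> 8" using r8 by (simp add: r_def)
 have lnr: "ln r \<ge> 0" using r8 by simp
 have Q: "Q \<ge> 12" "Q \<le> r" using D rad_pos by (auto simp: Q_def)
 have alpha: "0 < alpha" "alpha \<le> 1/12" using Q by (auto simp: alpha_def field_simps)
 have lnm: "ln (m f) \<le> Q" if "f \<in> X" for f
 proof -
  have "real (m f) \<le> 8 * real (rad q)" using conductor[OF that] by (metis of_nat_le_iff of_nat_mult of_nat_numeral)
  moreover have "m f > 0" using zero_data.m[OF data[OF that]] by simp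
  ultimately have "ln (m f) \<le> ln (8 * real (rad q))" by (subst ln_le_cancel_iff) auto
  thus ?thesis by (simp add: Q_def)
 qed
 have eta: "eta \<ge> 0" "eta \<le> r / r ^ 44" using r8 pi_less_4 by (auto simp: eta_def intro!: divide_right_mono)

 \<comment> \<open>Zeros up to height \<open>T\<close> and the choice of \<open>y\<close>\<close>
 define Zf where "Zf = (\<lambda>f. {i. w f i \<noteq> 0 \<and> \<bar>gamma f i\<bar> \<le> real T})"
 define Z where "Z = Sigma X Zf"
 have finZf: "finite (Zf f)" if "f \<in> X" for f unfolding Zf_def by (rule zero_data.zero_count(1)[OF data[OF that]]) simp
 have finZ: "finite Z" unfolding Z_def using finX finZf by blast
 \<comment> \<open>Up to constants there are at most \<open>T^2 = r ^ 88\<close> times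
   \<open>r\<close> zeros for each of fewer than \<open>r\<close> characters; 91 leaves one power to
   spare.\<close>
 have cardZ: "real (card Z) \<le> r ^ 91"
 proof -
  have "real (card Z) = (\<Sum>f\<in>X. real (card (Zf f)))" unfolding Z_def using finX finZf by (simp add: card_SigmaI)
  also have "... \<le> (\<Sum>f\<in>X. (9/4 + r ^ 88) * (2/3 * (r / 2 + 1 + mangoldt_two)))"
  proof (rule sum_mono)
   fix f assume f: "f \<in> X"
   have "real (card (Zf f)) \<le> (9/4 + (real T)^2) * (2/3 * zero_data.p (w f) (gamma f) (3/2))"
    unfolding Zf_def by (rule zero_data.zero_count(2)[OF data[OF f]]) simp
   also have "(real T)^2 = r ^ 88" by (simp add: rn power_mult[symmetric])
   also have "(9/4 + r ^ 88) * (2/3 * zero_data.p (w f) (gamma f) (3/2)) \<le> (9/4 + r ^ 88) * (2/3 * (r / 2 + 1 + mangoldt_two))"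
    using zero_data.p_three_halves[OF data[OF f]] lnm[OF f] Q r8 by (intro mult_left_mono) auto
   finally show "real (card (Zf f)) \<le> (9/4 + r ^ 88) * (2/3 * (r / 2 + 1 + mangoldt_two))" .
  qed
  also have "... = (r - 1) * ((9/4 + r ^ 88) * (2/3 * (r / 2 + 1 + mangoldt_two)))" using cardX by (simp add: r_def)
  also have "... \<le> r * ((9/4 + r ^ 88) * (2/3 * (r / 2 + 1 + mangoldt_two)))"
   using r8 mangoldt_two_nonneg by (intro mult_right_mono mult_nonneg_nonneg) auto
  finally show ?thesis using r5 by linarith
 qed
 \<comment> \<open>Multiples of \<open>rho q ^ 2\<close> give \<open>y \<ge> r ^ 2\<close>, so that
   the main exponential exceeds the \<open>exp (2 * r)\<close> from the initial segment of the
   partial summation.\<close>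
 have "T > 0" "rho q ^ 2 > 0" using rho8 by (auto simp: T_def)
 from simultaneous_phases[OF finZ this, of "\<lambda>(f, i). gamma f i"]
 obtain k where k: "k > 0" "k \<le> T ^ card Z"
  "\<And>z. z \<in> Z ==> norm (cis ((case z of (f, i) \<Rightarrow> gamma f i) * real (k * rho q ^ 2)) - 1) \<le> 2 * pi / real T" by blast
 define y where "y = real (k * rho q ^ 2)"
 have approx: "norm (cis (gamma f i * y) - 1) \<le> eta" if "f \<in> X" "w f i \<noteq> 0" "\<bar>gamma f i\<bar> \<le> real T" for f i
  using k(3)[of "(f, i)"] that by (simp add: Z_def Zf_def y_def eta_def rn)
 have y_ge: "y \<ge> r ^ 2"
 proof -
  have "1 * rho q ^ 2 \<le> k * rho q ^ 2" using k(1) by (intro mult_right_mono) auto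
  hence "real (1 * rho q ^ 2) \<le> real (k * rho q ^ 2)" by (rule of_nat_mono)
  thus ?thesis by (simp add: y_def r_def)
 qed
 have "r * 1 \<le> r * r" using r8 by (intro mult_left_mono) auto
 hence yr: "y \<ge> r" using y_ge by (simp add: power2_eq_square)
 have "8 * r \<le> r * r" using r8 by (intro mult_right_mono) auto
 hence "r + 1 \<le> r ^ 2" using r8 unfolding power2_eq_square by linarith
 hence y1: "y \<ge> r + 1" using y_ge by linarith
 have y0: "y > 0" using yr r8 by simp
 have y_le: "y \<le> exp (exp (92 * ln r))"
 proof -
  have "real k \<le> real (T ^ card Z)" using k(2) by (rule of_nat_mono)
  hence "y \<le> (r ^ 44) ^ card Z * r ^ 2" unfolding y_def by (simp add: rn r_def mult_right_mono)
  hence "ln y \<le> ln ((r ^ 44) ^ card Z * r ^ 2)" using y0 by (subst ln_le_cancel_iff) auto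
  also have "... = real (card Z) * (44 * ln r) + 2 * ln r"
   using r8 by (simp add: ln_mult ln_realpow)
  also have "... \<le> r ^ 91 * (44 * ln r) + 2 * ln r" using cardZ lnr by (intro add_right_mono mult_right_mono) auto
  also have "... \<le> r ^ 92" using r6 by linarith
  also have "r ^ 92 = exp (92 * ln r)" using r8 by (simp add: exp_of_nat_mult[of 92 "ln r", simplified])
  finally show ?thesis using y0 by (metis exp_le_cancel_iff exp_ln)
 qed

 \<comment> \<open>The prime side under a nonpositive race\<close>
 define N where "N = nat \<lfloor>exp y\<rfloor>"
 have N_le: "real N \<le> exp y" unfolding N_def by (rule of_nat_floor) simp
 define E where "E = exp ((1/2 - alpha) * y)"
 have E: "E \<ge> exp (5/12 * r ^ 2)"
  unfolding E_def using alpha y_ge y0 by (intro exp_le_cancel_iff[THEN iffD2] mult_mono) auto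

 have "\<exists>n. 2 \<le> n \<and> n \<le> N \<and> prime_race q n > 0"
 proof (rule ccontr)
  assume "\<nexists>n. 2 \<le> n \<and> n \<le> N \<and> prime_race q n > 0"
  hence neg: "prime_race q n \<le> 0" if "2 \<le> n" "n \<le> N" for n using that by (meson not_le)
  define F where "F = (\<lambda>k. ln (real k) * exp (- (alpha * ln (real k))) * (1 - exp (- (real l * (y - ln (real k))))))"
  \<comment> \<open>Since \<open>exp Q = exp (1 / alpha)\<close>, the weight \<open>F\<close>
    decreases from here on; as \<open>Q \<le> r\<close>, the initial segment costs at most
    \<open>18 * r * exp (2 * r)\<close>.\<close>
  define n0 where "n0 = nat \<lceil>exp Q\<rceil>"
  have eQ: "exp Q \<ge> 2" using exp_ge_add_one_self[of Q] Q by linarith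
  have n0_ge: "real n0 \<ge> exp Q" unfolding n0_def by linarith
  have n0_le: "real n0 \<le> exp Q + 1" unfolding n0_def using eQ by linarith
  have n0N: "n0 \<le> N"
  proof -
   have "exp Q * 2 \<le> exp Q * exp 1" using exp_ge_add_one_self[of 1] by (intro mult_left_mono) auto
   hence "exp Q + 1 \<le> exp Q * exp 1" using eQ by linarith
   also have "... = exp (Q + 1)" by (simp add: exp_add)
   also have "... \<le> exp y" using y1 Q by simp
   finally show ?thesis using n0_le unfolding N_def by (intro le_nat_floor) linarith
  qed
  have n02: "n0 \<ge> 2" using n0_ge eQ by linarith
  have ln_le_y: "ln (real n) \<le> y" if "n \<le> N" for n
  proof (cases "n = 0")
   case False
   have "real n \<le> exp y" using that N_le by linarith
   thus ?thesis using False by (metis exp_le_cancel_iff exp_ln of_nat_0_less_iff neq0_conv)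
  qed (use y0 in simp)
  have frac: "0 \<le> 1 - exp (- (real l * (y - ln (real n))))" "1 - exp (- (real l * (y - ln (real n)))) \<le> 1" if "n \<le> N" for n
   using ln_le_y[OF that] by auto
  have "(\<Sum>k\<le>N. (if prime k then character_sum q k else 0) * F k) \<le> 2 * (real n0 + 1) * r * real n0"
  proof (rule partial_summation_nonpos)
   show "(\<Sum>k\<le>n. if prime k then character_sum q k else 0) \<le> 0" if "n0 \<le> n" "n \<le> N" for n
    using neg[of n] that n02 by (simp add: prime_race_def)
   show "0 \<le> F n" if "n \<le> N" for n
    using frac[OF that] unfolding F_def by (cases "n = 0") auto
   show "F (Suc n) \<le> F n" if n: "n0 \<le> n" "n < N" for n
   proof -
    have npos: "n > 0" using n n02 by simp
    have "exp Q \<le> real n" using n0_ge n by linarith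
    hence "ln (exp Q) \<le> ln (real n)" using npos by (subst ln_le_cancel_iff) auto
    hence "alpha * ln (real n) \<ge> 1" using Q by (simp add: alpha_def le_divide_eq)
    moreover have lnn: "ln (real n) \<le> ln (real (Suc n))" using npos by simp
    ultimately have "ln (real (Suc n)) * exp (- (alpha * ln (real (Suc n)))) \<le> ln (real n) * exp (- (alpha * ln (real n)))"
     using alpha(1) by (intro mult_exp_decreasing)
    moreover have "1 - exp (- (real l * (y - ln (real (Suc n))))) \<le> 1 - exp (- (real l * (y - ln (real n))))"
    proof -
     have "real l * (y - ln (real (Suc n))) \<le> real l * (y - ln (real n))" using lnn by (intro mult_left_mono) auto
     thus ?thesis by simp
    qed
    ultimately show ?thesis unfolding F_def
     by (rule mult_mono[OF _ _ _ frac(1)]) (use n npos in auto)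
   qed
   show "\<bar>if prime k then character_sum q k else 0\<bar> \<le> r" for k using abs_character_sum_le[OF q1, of k] by (simp add: r_def)
   show "F k \<le> real n0" if k: "k \<le> n0" for k
   proof (cases "k = 0")
    case False
    hence lk: "ln (real k) \<ge> 0" by simp
    have "F k \<le> ln (real k) * 1 * 1" unfolding F_def
     using lk alpha frac[of k] k n0N by (intro mult_mono) auto
    also have "... \<le> real k" using ln_le_minus_one[of "real k"] False by simp
    finally show ?thesis using k by simp
   qed (simp add: F_def)
  qed (use n0N r8 in auto)
  also have "... \<le> 18 * r * exp (2 * r)"
  proof -
   have "real n0 + 1 \<le> 3 * exp r" "real n0 \<le> 3 * exp r" using n0_le eQ exp_le_cancel_iff[of Q r] Q by linarith+
   hence "(real n0 + 1) * real n0 \<le> (3 * exp r) * (3 * exp r)" by (intro mult_mono) auto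
   also have "... = 9 * exp (2 * r)" by (simp add: exp_add[symmetric])
   finally have "2 * r * ((real n0 + 1) * real n0) \<le> 2 * r * (9 * exp (2 * r))" using r8 by (intro mult_left_mono) auto
   thus ?thesis by (simp add: mult_ac)
  qed
  finally have P: "(\<Sum>k\<le>N. (if prime k then character_sum q k else 0) * F k) \<le> 18 * r * exp (2 * r)" .
  have "(\<Sum>f\<in>X. zero_data.S (psi f) alpha l y) \<le> (\<Sum>k\<le>N. (if prime k then character_sum q k else 0) * F k) + r * ln (real (rad q)) + 18 * r * E"
   unfolding r_def N_def F_def E_def by (rule sum_S_upper[OF alpha]) (use y0 in simp)
  moreover have "r * ln (real (rad q)) \<le> r * r"
  proof (intro mult_left_mono)
   have "ln (8 * real (rad q)) = ln 8 + ln (real (rad q))" using rad_pos by (simp add: ln_mult)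
   moreover have "ln (8::real) \<ge> 0" by simp
   ultimately show "ln (real (rad q)) \<le> r" using D by linarith
  qed (use r8 in simp)
  ultimately have upper: "(\<Sum>f\<in>X. zero_data.S (psi f) alpha l y) \<le> 18 * r * exp (2 * r) + r * r + 18 * r * E" using P by linarith

  \<comment> \<open>The zero side and the contradiction\<close>
  define B where "B = 3 * r + 41 * ln r + 6 + mangoldt_two"
  have B: "B \<ge> 0" using r8 lnr mangoldt_two_nonneg by (simp add: B_def)
  have each: "zero_data.S (psi f) alpha l y \<ge> E * ((20 * ln r - (16 + 3 * mangoldt_two)) + zero_data.V (psi f) (1 + alpha)) - B" if f: "f \<in> X" for f
  proof -
   have l2: "l \<ge> 2" "T \<ge> 2"
   proof -
    have "rho q \<le> rho q ^ 40" "rho q \<le> rho q ^ 44" using rho8 by (intro self_le_power; simp)+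
    hence "2 \<le> rho q ^ 40" "2 \<le> rho q ^ 44" using rho8 by linarith+
    thus "l \<ge> 2" "T \<ge> 2" by (simp_all add: l_def T_def)
   qed
   have "zero_data.S (psi f) (1 / Q) l y \<ge> exp ((1/2 - 1/Q) * y) * (ln (real l) / 2 + zero_data.V (psi f) (1 + 1/Q) - (14 + 3 * mangoldt_two)
    - 9 * eta * real l * (Q + 1 + mangoldt_two) - 4 * real l / real T * (Q + ln (real T) + 1 + mangoldt_two))
    - (3 * Q + ln (real l + 1) + 6 + mangoldt_two)"
    by (rule zero_data.S_lower[OF data[OF f] Q(1) lnm[OF f] l2(1) _ l2(2) eta(1) approx[OF f]]) (use y0 in auto)
   moreover have "9 * eta * real l * (Q + 1 + mangoldt_two) \<le> 1"
   proof -
    have "9 * eta * real l * (Q + 1 + mangoldt_two) \<le> 9 * (r / r ^ 44) * r ^ 40 * (r + 1 + mangoldt_two)"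
     unfolding rn using eta Q r8 mangoldt_two_nonneg by (intro mult_mono) auto
    also have "r ^ 44 = r ^ (1 + 40 + 3)" by simp
    also have "... = r * r ^ 40 * r ^ 3" by (simp only: power_add power_one_right)
    also have "9 * (r / (r * r ^ 40 * r ^ 3)) * r ^ 40 * (r + 1 + mangoldt_two) = 9 * (r + 1 + mangoldt_two) / r ^ 3"
    proof -
     have cancel: "9 * (x / (x * u * v)) * u * S = 9 * S / v" if "x \<noteq> 0" "u \<noteq> 0" for x u v S :: real using that by simp
     show ?thesis by (rule cancel) (use r8 in auto)
    qed
    finally show ?thesis using r1 by linarith
   qed
   moreover have "4 * real l / real T * (Q + ln (real T) + 1 + mangoldt_two) \<le> 1"
   proof -
    have "4 * real l / real T * (Q + ln (real T) + 1 + mangoldt_two) \<le> 4 * real l / real T * (r + 44 * ln r + 1 + mangoldt_two)"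
     using Q r8 by (intro mult_left_mono) (auto simp: rn ln_realpow)
    also have "... = 4 * (r + 44 * ln r + 1 + mangoldt_two) / r ^ 4"
    proof -
     have cancel: "4 * u / (u * v) * S = 4 * S / v" if "u \<noteq> 0" for u v S :: real using that by simp
     have "real T = r ^ 40 * r ^ 4" by (simp only: rn power_add[symmetric]) simp
     thus ?thesis unfolding rn(1) by (simp only:) (rule cancel, use r8 in auto)
    qed
    finally show ?thesis using r2 by linarith
   qed
   moreover have "3 * Q + ln (real l + 1) + 6 + mangoldt_two \<le> B"
   proof -
    have "r ^ 40 * 1 \<le> r ^ 40 * (r - 1)" using r8 by (intro mult_left_mono) auto
    moreover have "1 \<le> r ^ 40" using r8 by (intro one_le_power) auto
    moreover have "r ^ 40 * (r - 1) = r ^ 41 - r ^ 40" by (simp add: right_diff_distrib power_Suc2[symmetric] del: power_Suc)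
    ultimately have "r ^ 40 + 1 \<le> r ^ 41" by linarith
    hence "ln (real l + 1) \<le> ln (r ^ 41)" unfolding rn using r8 by (subst ln_le_cancel_iff) (auto intro: add_nonneg_pos)
    hence "ln (real l + 1) \<le> 41 * ln r" using r8 by (simp add: ln_realpow)
    thus ?thesis using Q by (simp add: B_def)
   qed
   moreover have "ln (real l) / 2 = 20 * ln r" unfolding rn using r8 by (simp add: ln_realpow)
   moreover have "E * ((20 * ln r - (16 + 3 * mangoldt_two)) + zero_data.V (psi f) (1 + alpha)) \<le> E * (ln (real l) / 2 + zero_data.V (psi f) (1 + 1/Q) - (14 + 3 * mangoldt_two)
    - 9 * eta * real l * (Q + 1 + mangoldt_two) - 4 * real l / real T * (Q + ln (real T) + 1 + mangoldt_two))"
    using calculation(2,3,5) by (intro mult_left_mono) (auto simp: alpha_def E_def)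
   ultimately show ?thesis unfolding E_def alpha_def by linarith
  qed
  have "(\<Sum>f\<in>X. zero_data.S (psi f) alpha l y) \<ge> (\<Sum>f\<in>X. E * ((20 * ln r - (16 + 3 * mangoldt_two)) + zero_data.V (psi f) (1 + alpha)) - B)"
   by (rule sum_mono) (rule each)
  moreover have "(\<Sum>f\<in>X. E * ((20 * ln r - (16 + 3 * mangoldt_two)) + zero_data.V (psi f) (1 + alpha)) - B)
    = E * ((r - 1) * (20 * ln r - (16 + 3 * mangoldt_two)) + (\<Sum>f\<in>X. zero_data.V (psi f) (1 + alpha))) - (r - 1) * B"
   by (simp add: sum_subtractf sum_distrib_left[symmetric] sum.distrib cardX r_def)
  moreover have "(r - 1) * B \<le> r * B" using B by (intro mult_right_mono) auto
  moreover have "E * ((r - 1) * (20 * ln r - (16 + 3 * mangoldt_two)) + (\<Sum>f\<in>X. zero_data.V (psi f) (1 + alpha)))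
   \<ge> E * ((r - 1) * (20 * ln r - (16 + 3 * mangoldt_two)) - (r + Ca) - r * (6 * ln r + Cb))"
  proof (intro mult_left_mono)
   have "(\<Sum>n. mangoldt n * real n powr (- (1 + alpha))) \<le> 1 / alpha + Ca" using alpha by (intro Ca) auto
   also have "1 / alpha = Q" by (simp add: alpha_def)
   finally have "(\<Sum>n. mangoldt n * real n powr (- (1 + alpha))) \<le> r + Ca" using Q by linarith
   moreover have "r * (\<Sum>p\<in>prime_factors q. ln (real p) / (real p - 1)) \<le> r * (6 * ln r + Cb)" using Cb r8 by (intro mult_left_mono) auto
   moreover have "(\<Sum>f\<in>X. zero_data.V (psi f) (1 + alpha)) \<ge> - (\<Sum>n. mangoldt n * real n powr (- (1 + alpha))) - r * (\<Sum>p\<in>prime_factors q. ln (real p) / (real p - 1))"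
    unfolding r_def by (rule sum_V_lower) (use alpha in auto)
   ultimately show "(r - 1) * (20 * ln r - (16 + 3 * mangoldt_two)) - (r + Ca) - r * (6 * ln r + Cb)
    \<le> (r - 1) * (20 * ln r - (16 + 3 * mangoldt_two)) + (\<Sum>f\<in>X. zero_data.V (psi f) (1 + alpha))" by linarith
  qed (simp add: E_def)
  ultimately have "E * ((r - 1) * (20 * ln r - (16 + 3 * mangoldt_two)) - (r + Ca) - r * (6 * ln r + Cb)) - 18 * r * E \<le> 18 * r * exp (2 * r) + r * r + r * B"
   using upper by linarith
  \<comment> \<open>Net of all losses the main terms leave at least \<open>E\<close>, and this
    exceeds the secondary terms because \<open>E \<ge> exp (5/12 * r ^ 2)\<close>.\<close>
  moreover have "E * 1 \<le> E * ((r - 1) * (20 * ln r - (16 + 3 * mangoldt_two)) - (r + Ca) - r * (6 * ln r + Cb) - 18 * r)"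
   using r3 by (intro mult_left_mono) (auto simp: E_def)
  ultimately have "E \<le> 18 * r * exp (2 * r) + r * r + r * B" by (simp add: algebra_simps)
  thus False using E r4 unfolding B_def by linarith
 qed
 then obtain n where n: "2 \<le> n" "n \<le> N" "prime_race q n > 0" by blast
 have "real n \<le> exp y" using n(2) N_le by linarith
 also have "... \<le> exp (exp (exp (92 * ln r)))" using y_le by simp
 finally show ?thesis using n by blast
qed

end

lemma exists_character_family:
 assumes q: "q \<ge> 3" and grh: "GRH_mod q"
 obtains m a psi w gamma where "character_family q (quadratic_characters q) m a psi w gamma"
proof -
 have "\<forall>f\<in>quadratic_characters q. \<exists>m a psi w gamma. zero_data m a psi w gamma \<and> m \<le> 8 * rad q
   \<and> (\<forall>n. coprime n q \<longrightarrow> f n = complex_of_real (psi n))"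
  using character_zero_data[OF q _ grh] by metis
 then obtain m a psi w gamma where "\<forall>f\<in>quadratic_characters q. zero_data (m f) (a f) (psi f) (w f) (gamma f) \<and> m f \<le> 8 * rad q
   \<and> (\<forall>n. coprime n q \<longrightarrow> f n = complex_of_real (psi f n))"
  unfolding bchoice_iff by blast
 hence "character_family q (quadratic_characters q) m a psi w gamma" using q by (intro character_family.intro) auto
 thus ?thesis by (rule that)
qed

text \<open>Uniform in \<open>q\<close>: the threshold depends only on the absolute constants from
  the sums over primes. The condition on \<open>ln (8 * rad q) + 12\<close> is the form in which the
  divergence of \<open>rho q / ln (rad q)\<close> will enter.\<close>

theorem x_first_bound:
 "\<exists>R0::real. \<forall>q. q \<ge> 3 \<longrightarrow> GRH_mod q \<longrightarrow> real (rho q) \<ge> R0 \<longrightarrow> ln (8 * real (rad q)) + 12 \<le> real (rho q) \<longrightarrow>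
  x_first q \<le> ereal (exp (exp (exp (92 * ln (real (rho q))))))"
proof -
 obtain Ca :: real where Ca: "\<And>e. 0 < e ==> e \<le> 1 ==> (\<Sum>n. mangoldt n * real n powr (- (1 + e))) \<le> 1 / e + Ca"
  using mangoldt_sum_near_one by blast
 obtain Cb :: real where Cb: "\<And>P (r::nat). finite P ==> (\<And>p. p \<in> P ==> prime p) ==> r \<ge> 3 ==>
  (\<Sum>p\<in>P. ln (real p)) \<le> real r ==> (\<Sum>p\<in>P. ln (real p) / (real p - 1)) \<le> 6 * ln (real r) + Cb"
  using sum_primes_dividing by blast
 from eventually_race_inequalities[of mangoldt_two "16 + 3 * mangoldt_two" Ca Cb, unfolded eventually_at_top_linorder]
 obtain R0 where R0: "\<And>r::real. r \<ge> R0 ==> r \<ge> 8 \<and> 9 * (r + 1 + mangoldt_two) / r ^ 3 \<le> 1 \<and> 4 * (r + 44 * ln r + 1 + mangoldt_two) / r ^ 4 \<le> 1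
  \<and> (r - 1) * (20 * ln r - (16 + 3 * mangoldt_two)) - (r + Ca) - r * (6 * ln r + Cb) - 18 * r \<ge> 1
  \<and> 18 * r * exp (2 * r) + r * r + r * (3 * r + 41 * ln r + 6 + mangoldt_two) < exp (5/12 * r ^ 2)
  \<and> r * ((9/4 + r ^ 88) * (2/3 * (r / 2 + 1 + mangoldt_two))) \<le> r ^ 91
  \<and> 2 * ln r + r ^ 91 * (44 * ln r) \<le> r ^ 92" by blast
 show ?thesis
 proof (intro exI[of _ R0] allI impI)
  fix q assume q: "q \<ge> 3" "GRH_mod q" and rho: "real (rho q) \<ge> R0" and D: "ln (8 * real (rad q)) + 12 \<le> real (rho q)"
  obtain m a psi w gamma where "character_family q (quadratic_characters q) m a psi w gamma" using exists_character_family[OF q] by blast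
  then interpret character_family q "quadratic_characters q" m a psi w gamma .
  note r = R0[OF rho]
  have "ln (8 * real (rad q)) = ln 8 + ln (real (rad q))" using rad_pos by (simp add: ln_mult)
  moreover have "ln (8::real) \<ge> 0" by simp
  ultimately have lr: "ln (real (rad q)) \<le> real (rho q)" using D by linarith
  have r8: "rho q \<ge> 8" using r by simp
  have "(\<Sum>p\<in>prime_factors q. ln (real p) / (real p - 1)) \<le> 6 * ln (real (rho q)) + Cb"
   by (rule Cb) (use prime_factors_D lr r8 in \<open>auto simp: sum_ln_prime_factors\<close>)
  then obtain n where n: "n \<ge> 2" "prime_race q n > 0" "real n \<le> exp (exp (exp (92 * ln (real (rho q)))))"
   using exists_positive_race[OF Ca _ D] r by blast
  have "x_first q \<le> ereal (real n)" by (rule x_first_le[OF q1 _ n(1,2)]) (use r8 in simp)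
  also have "... \<le> ereal (exp (exp (exp (92 * ln (real (rho q))))))" using n(3) by simp
  finally show "x_first q \<le> ereal (exp (exp (exp (92 * ln (real (rho q))))))" .
 qed
qed

lemma rad_ge_two: "q \<ge> 2 ==> rad q \<ge> 2"
proof -
 assume q: "q \<ge> 2"
 then obtain p where p: "prime p" "p dvd q" using prime_factor_nat[of q] by auto
 have "p dvd rad q" unfolding rad_def using p q by (intro dvd_prodI) (auto simp: in_prime_factors_iff)
 moreover have "rad q > 0" unfolding rad_def by (intro prod_pos) (auto simp: in_prime_factors_iff prime_gt_0_nat)
 ultimately have "p \<le> rad q" by (rule dvd_imp_le)
 thus ?thesis using prime_ge_2_nat[OF p(1)] by simp
qed

theorem theorem1p6:
  fixes A :: real
  assumes "A > 1"
  shows "\<exists>K>0. \<forall>c T0 :: real. \<forall>q :: nat \<Rightarrow> nat.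
    c > 0 \<longrightarrow>
    (\<forall>n. q n \<ge> 3) \<longrightarrow>
    filterlim (\<lambda>n. real (rho (q n)) / ln (real (rad (q n)))) at_top sequentially \<longrightarrow>
    (\<forall>n. GRH_mod (q n)) \<longrightarrow>
    (\<forall>n. ELI A c T0 (quadratic_characters (q n))) \<longrightarrow>
    (\<forall>\<^sub>F n in sequentially.
       x_first (q n) \<le> ereal (exp (exp (exp
         (K * (real (rho (q n)) / ln (real (rad (q n))) + ln (real (rho (q n)))))))))"
proof -
 obtain R0 :: real where R0: "\<And>q. q \<ge> 3 ==> GRH_mod q ==> real (rho q) \<ge> R0 ==> ln (8 * real (rad q)) + 12 \<le> real (rho q) ==>
  x_first q \<le> ereal (exp (exp (exp (92 * ln (real (rho q))))))" using x_first_bound by blast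
 show ?thesis
 proof (intro exI[of _ 92] conjI allI impI)
  fix c T0 :: real and q :: "nat \<Rightarrow> nat"
  assume q: "\<forall>n. q n \<ge> 3" and lim: "filterlim (\<lambda>n. real (rho (q n)) / ln (real (rad (q n)))) at_top sequentially"
   and grh: "\<forall>n. GRH_mod (q n)"
  have "\<forall>\<^sub>F n in sequentially. real (rho (q n)) / ln (real (rad (q n))) \<ge> max 32 (2 * R0)"
   using lim unfolding filterlim_at_top by (rule spec)
  thus "\<forall>\<^sub>F n in sequentially. x_first (q n) \<le> ereal (exp (exp (exp
    (92 * (real (rho (q n)) / ln (real (rad (q n))) + ln (real (rho (q n))))))))"
  proof eventually_elim
   case (elim n)
   define L where "L = ln (real (rad (q n)))"
   define r where "r = real (rho (q n))"
   have rad2: "rad (q n) \<ge> 2" using q rad_ge_two[of "q n"] by (metis One_nat_def Suc_1 Suc_leD numeral_3_eq_3)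
   have "ln (2::real) \<le> L" unfolding L_def using rad2 by (subst ln_le_cancel_iff) auto
   moreover have "ln (2::real) \<ge> 1/2" using ln_2_less_1 ln2_ge_two_thirds by linarith
   ultimately have L: "L \<ge> 1/2" by linarith
   \<comment> \<open>Since \<open>L \<ge> 1/2\<close>, a ratio of 32 covers
     \<open>L + 3 * ln 2 + 12\<close>, and a ratio of \<open>2 * R0\<close> lifts \<open>r\<close>
     above \<open>R0\<close>.\<close>
   have "32 \<le> r / L" "2 * R0 \<le> r / L" using elim by (auto simp: r_def L_def)
   hence r: "32 * L \<le> r" "2 * R0 * L \<le> r" using L by (simp_all add: pos_le_divide_eq)
   have "R0 \<le> r"
   proof (cases "R0 \<ge> 0")
    case True
    have "R0 * 1 \<le> R0 * (2 * L)" using L True by (intro mult_left_mono) auto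
    thus ?thesis using r(2) by simp
   qed (simp add: r_def)
   moreover have "ln (8 * real (rad (q n))) + 12 \<le> r"
   proof -
    have "ln (8 * real (rad (q n))) = ln 8 + L" using rad2 by (simp add: ln_mult L_def)
    moreover have "ln (8::real) = 3 * ln 2" using ln_realpow[of 2 3] by simp
    ultimately show ?thesis using r(1) L ln2_le_25_over_36 by linarith
   qed
   ultimately have 1: "x_first (q n) \<le> ereal (exp (exp (exp (92 * ln r))))"
    using R0[of "q n"] q grh by (simp add: r_def)
   have "0 \<le> r / L" using L by (simp add: r_def)
   hence "exp (exp (exp (92 * ln r))) \<le> exp (exp (exp (92 * (r / L + ln r))))" by simp
   hence "ereal (exp (exp (exp (92 * ln r)))) \<le> ereal (exp (exp (exp (92 * (r / L + ln r)))))" by simp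
   from order_trans[OF 1 this] show ?case by (simp only: r_def L_def)
  qed
 qed simp
qed

end
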